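(* Let $(G,c)$ be an infinite connected locally finite network. If $(G,c)$ is a transient quasi-transitive network, or $(G,c)$ is a non-amenable network with $\inf_{x\in\mathsf V(G)}\pi(x)>0$, then $\mathsf{WSF}$-a.s. every tree has only one end.
   Context: A network $(G,c)$ is a graph $G=(\mathsf V,\mathsf E)$ with a function $c:\mathsf E\to(0,\infty)$ (edge conductances). For a set $F$ of edges, $|F|_c:=\sum_{e\in F}c(e)$. For $K\subset\mathsf V$, $\partial_{\mathsf E}K$ is the set of edges with exactly one endpoint in $K$, and $\pi(K)$ is the sum of $c(e)$ over all oriented edges $e$ whose tail is in $K$ (each edge of $G$ gives two oriented edges); $\pi(x):=\pi(\{x\})$. Define $$\kappa(G,t):=\inf\{|\partial_{\mathsf E}K|_c : K\subset\mathsf V \text{ finite and connected},\ t\le\pi(K)\},$$ with $\inf\emptyset=\infty$. The network is non-amenable if $\inf_{t>0}\kappa(G,t)/t>0$. It is quasi-transitive if the action of its automorphism group (graph automorphisms preserving $c$) on $\mathsf V$ has only finitely many orbits. It is transient if the network random walk (transition probabilities proportional to $c$) is transient. For a finite connected network, the uniform spanning tree is the random spanning tree $T$ chosen with probability proportional to $\prod_{e\in T}c(e)$. Let an infinite connected network $G$ be exhausted by finite connected subnetworks $G_0\subset G_1\subset\cdots$ with $\bigcup_n G_n=G$, and let $G_n^*$ be obtained from $G$ by identifying all vertices outside $G_n$ to a single vertex and dropping loops (multiple edges are kept). The wired uniform spanning forest $\mathsf{WSF}$ on $G$ is the weak limit, as $n\to\infty$, of the laws of the uniform spanning trees of $G_n^*$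 (as random sets of edges); it exists and does not depend on the exhaustion, and is supported on spanning forests of $G$ all of whose trees are infinite. The ends of a tree are the equivalence classes of infinite simple paths in it, two paths being equivalent if their symmetric difference is finite. *)

theory Defs
  imports "HOL-Probability.Probability"
begin

section \<open>Networks\<close>

text \<open>
  Graphs are multigraphs in which loops are allowed. An edge is stored with its two endpoints in
  an arbitrary order; no notion below depends on that order.
\<close>

record ('v, 'e) network =
  verts :: "'v set"
  edges :: "'e set"
  src :: "'e \<Rightarrow> 'v"
  dst :: "'e \<Rightarrow> 'v"
  cond :: "'e \<Rightarrow> real"

definition is_network :: "('v, 'e) network \<Rightarrow> bool" where
  "is_network G \<longleftrightarrow> (\<forall>e\<in>edges G. src G e \<in> verts G \<and> dst G e \<in> verts G \<and> 0 < cond G e)"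

definition ends :: "('v, 'e) network \<Rightarrow> 'e \<Rightarrow> 'v set" where
  "ends G e = {src G e, dst G e}"

text \<open>Each edge, loops included, gives two oriented edges.\<close>

definition oriented_edges :: "('v, 'e) network \<Rightarrow> ('e \<times> bool) set" where
  "oriented_edges G = edges G \<times> UNIV"

definition tail :: "('v, 'e) network \<Rightarrow> 'e \<times> bool \<Rightarrow> 'v" where
  "tail G a = (if snd a then src G (fst a) else dst G (fst a))"

definition head :: "('v, 'e) network \<Rightarrow> 'e \<times> bool \<Rightarrow> 'v" where
  "head G a = (if snd a then dst G (fst a) else src G (fst a))"

definition locally_finite :: "('v, 'e) network \<Rightarrow> bool" where
  "locally_finite G \<longleftrightarrow> (\<forall>x\<in>verts G. finite {e \<in> edges G. x \<in> ends G e})"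

definition adjacency :: "('v, 'e) network \<Rightarrow> ('v \<times> 'v) set" where
  "adjacency G = {(x, y). \<exists>e\<in>edges G. ends G e = {x, y}}"

definition net_connected :: "('v, 'e) network \<Rightarrow> bool" where
  "net_connected G \<longleftrightarrow>
     verts G \<noteq> {} \<and> (\<forall>x\<in>verts G. \<forall>y\<in>verts G. (x, y) \<in> (adjacency G)\<^sup>*)"

definition induced :: "('v, 'e) network \<Rightarrow> 'v set \<Rightarrow> ('v, 'e) network" where
  "induced G K = G\<lparr>verts := K, edges := {e \<in> edges G. ends G e \<subseteq> K}\<rparr>"

definition net_components :: "('v, 'e) network \<Rightarrow> ('v, 'e) network set" where
  "net_components G = (\<lambda>x. induced G {y \<in> verts G. (x, y) \<in> (adjacency G)\<^sup>*}) ` verts G"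

definition subnetwork :: "('v, 'e) network \<Rightarrow> ('v, 'e) network \<Rightarrow> bool" where
  "subnetwork H G \<longleftrightarrow> verts H \<subseteq> verts G \<and> edges H \<subseteq> edges G \<and>
     (\<forall>e\<in>edges H. src H e = src G e \<and> dst H e = dst G e \<and> cond H e = cond G e)"


section \<open>Non-amenability, quasi-transitivity, transience\<close>

definition edge_boundary :: "('v, 'e) network \<Rightarrow> 'v set \<Rightarrow> 'e set" where
  "edge_boundary G K = {e \<in> edges G. ends G e \<inter> K \<noteq> {} \<and> ends G e - K \<noteq> {}}"

definition net_pi :: "('v, 'e) network \<Rightarrow> 'v set \<Rightarrow> real" where
  "net_pi G K = (\<Sum>a | a \<in> oriented_edges G \<and> tail G a \<in> K. cond G (fst a))"

definition kappa :: "('v, 'e) network \<Rightarrow> real \<Rightarrow> ereal" where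
  "kappa G t = Inf {ereal (\<Sum>e\<in>edge_boundary G K. cond G e) | K.
     K \<subseteq> verts G \<and> finite K \<and> net_connected (induced G K) \<and> t \<le> net_pi G K}"

definition non_amenable :: "('v, 'e) network \<Rightarrow> bool" where
  "non_amenable G \<longleftrightarrow> 0 < (INF t\<in>{0<..}. kappa G t / ereal t)"

text \<open>
  As multiple edges are allowed, an automorphism consists of a vertex map and an edge map.
\<close>

definition automorphism :: "('v, 'e) network \<Rightarrow> ('v \<Rightarrow> 'v) \<Rightarrow> ('e \<Rightarrow> 'e) \<Rightarrow> bool" where
  "automorphism G \<phi> \<psi> \<longleftrightarrow>
     bij_betw \<phi> (verts G) (verts G) \<and> bij_betw \<psi> (edges G) (edges G) \<and>
     (\<forall>e\<in>edges G. ends G (\<psi> e) = \<phi> ` ends G e \<and> cond G (\<psi> e) = cond G e)"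

definition quasi_transitive :: "('v, 'e) network \<Rightarrow> bool" where
  "quasi_transitive G \<longleftrightarrow>
     finite ((\<lambda>x. {\<phi> x | \<phi>. \<exists>\<psi>. automorphism G \<phi> \<psi>}) ` verts G)"

definition trans_prob :: "('v, 'e) network \<Rightarrow> 'v \<Rightarrow> 'v \<Rightarrow> real" where
  "trans_prob G x y =
     (\<Sum>a | a \<in> oriented_edges G \<and> tail G a = x \<and> head G a = y. cond G (fst a)) / net_pi G {x}"

text \<open>\<open>M\<close> is the law, on vertex sequences, of the network random walk started at \<open>x\<close>.\<close>

definition walk_law :: "('v, 'e) network \<Rightarrow> 'v \<Rightarrow> (nat \<Rightarrow> 'v) measure \<Rightarrow> bool" where
  "walk_law G x M \<longleftrightarrow> prob_space M \<and>
     sets M = sets (PiM (UNIV :: nat set) (\<lambda>_. count_space (verts G))) \<and>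
     (\<forall>y n. (\<forall>i. y i \<in> verts G) \<longrightarrow>
        measure M {\<omega> \<in> space M. \<forall>i\<le>n. \<omega> i = y i} =
          (if y 0 = x then \<Prod>i<n. trans_prob G (y i) (y (Suc i)) else 0))"

text \<open>
  On the networks considered here (connected, locally finite and infinite, so that \<open>verts G\<close> is
  countable and the transition probabilities sum to 1) the law of the walk exists and is unique.
\<close>

definition transient :: "('v, 'e) network \<Rightarrow> bool" where
  "transient G \<longleftrightarrow> (\<forall>x\<in>verts G. \<exists>M. walk_law G x M \<and>
     measure M {\<omega> \<in> space M. \<exists>n\<ge>1. \<omega> n = x} < 1)"


section \<open>Trees and their ends\<close>

text \<open>A loop is a cycle of length 1, and two parallel edges form a cycle of length 2.\<close>

definition cycle :: "('v, 'e) network \<Rightarrow> 'v list \<Rightarrow> 'e list \<Rightarrow> bool" where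
  "cycle G xs es \<longleftrightarrow> xs \<noteq> [] \<and> length es = length xs \<and> distinct xs \<and> distinct es \<and>
     set xs \<subseteq> verts G \<and> set es \<subseteq> edges G \<and>
     (\<forall>i<length xs. ends G (es ! i) = {xs ! i, xs ! (Suc i mod length xs)})"

definition is_tree :: "('v, 'e) network \<Rightarrow> bool" where
  "is_tree G \<longleftrightarrow> net_connected G \<and> (\<nexists>xs es. cycle G xs es)"

text \<open>Infinite simple paths, as pairs of a vertex sequence and an edge sequence.\<close>

definition rays :: "('v, 'e) network \<Rightarrow> ((nat \<Rightarrow> 'v) \<times> (nat \<Rightarrow> 'e)) set" where
  "rays T = {(p, q). inj p \<and> range p \<subseteq> verts T \<and> range q \<subseteq> edges T \<and>
     (\<forall>n. ends T (q n) = {p n, p (Suc n)})}"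

definition tree_ends :: "('v, 'e) network \<Rightarrow> ((nat \<Rightarrow> 'v) \<times> (nat \<Rightarrow> 'e)) set set" where
  "tree_ends T = rays T //
     {(r, s). r \<in> rays T \<and> s \<in> rays T \<and> finite (sym_diff (range (snd r)) (range (snd s)))}"


section \<open>The uniform spanning tree and the wired uniform spanning forest\<close>

definition spanning_trees :: "('v, 'e) network \<Rightarrow> 'e set set" where
  "spanning_trees G = {F. F \<subseteq> edges G \<and> is_tree (G\<lparr>edges := F\<rparr>)}"

definition UST :: "('v, 'e) network \<Rightarrow> 'e set pmf" where
  "UST G = embed_pmf (\<lambda>F. if F \<in> spanning_trees G
     then (\<Prod>e\<in>F. cond G e) / (\<Sum>F'\<in>spanning_trees G. \<Prod>e\<in>F'. cond G e) else 0)"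

text \<open>
  Identify all vertices outside \<open>W\<close> to the single vertex \<open>None\<close> and drop the loops. Edges keep
  their names, so that a set of edges of the quotient is a set of edges of \<open>G\<close>.
\<close>

definition wired_proj :: "'v set \<Rightarrow> 'v \<Rightarrow> 'v option" where
  "wired_proj W x = (if x \<in> W then Some x else None)"

definition wired :: "('v, 'e) network \<Rightarrow> 'v set \<Rightarrow> ('v option, 'e) network" where
  "wired G W =
     \<lparr>verts = wired_proj W ` verts G,
      edges = {e \<in> edges G. wired_proj W (src G e) \<noteq> wired_proj W (dst G e)},
      src = wired_proj W \<circ> src G,
      dst = wired_proj W \<circ> dst G,
      cond = cond G\<rparr>"

definition exhaustion :: "('v, 'e) network \<Rightarrow> (nat \<Rightarrow> ('v, 'e) network) \<Rightarrow> bool" where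
  "exhaustion G H \<longleftrightarrow>
     (\<forall>n. is_network (H n) \<and> finite (verts (H n)) \<and> finite (edges (H n)) \<and>
          net_connected (H n) \<and> subnetwork (H n) G \<and> subnetwork (H n) (H (Suc n))) \<and>
     (\<Union>n. verts (H n)) = verts G \<and> (\<Union>n. edges (H n)) = edges G"

text \<open>
  Subsets of \<open>E\<close> are identified with their indicator functions, elements of the product
  \<open>{0, 1}\<close>-space over \<open>E\<close>, and carry the product topology and the product sigma-algebra.
\<close>

definition config_topology :: "'e set \<Rightarrow> 'e set topology" where
  "config_topology E = pullback_topology (Pow E) (\<lambda>F. \<lambda>e\<in>E. e \<in> F)
     (product_topology (\<lambda>_. discrete_topology (UNIV :: bool set)) E)"

definition config_space :: "'e set \<Rightarrow> 'e set measure" where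
  "config_space E = vimage_algebra (Pow E) (\<lambda>F. \<lambda>e\<in>E. e \<in> F)
     (PiM E (\<lambda>_. count_space (UNIV :: bool set)))"

text \<open>
  The limit does not depend on the exhaustion, so being the limit along some exhaustion is the
  same as being the limit along all of them. Continuous functions are automatically bounded, the
  configuration space being compact.
\<close>

definition is_WSF :: "('v, 'e) network \<Rightarrow> 'e set measure \<Rightarrow> bool" where
  "is_WSF G \<mu> \<longleftrightarrow> prob_space \<mu> \<and> sets \<mu> = sets (config_space (edges G)) \<and>
     (\<exists>H. exhaustion G H \<and>
        (\<forall>f. continuous_map (config_topology (edges G)) euclideanreal f \<longrightarrow>
           (\<lambda>n. measure_pmf.expectation (UST (wired G (verts (H n)))) f)
             \<longlonglongrightarrow> (\<integral>F. f F \<partial>\<mu>)))"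

end

theory Submission
  imports Defs
begin

text \<open>
  In a spanning tree of a finite network with a root \<open>r\<close>, every vertex \<open>x \<noteq> r\<close> has an exit arc, the
  first arc of its path to \<open>r\<close>, and the \<^emph>\<open>past\<close> of \<open>x\<close> consists of the vertices whose paths to \<open>r\<close> run
  through \<open>x\<close>. The root of a wired network is the vertex that stands for infinity. If both sides of
  an edge of the wired forest were infinite, then so would be the past of one of its endpoints, so the
  theorem reduces to the statement that long pasts are unlikely, uniformly in the wired finite
  networks (\<open>thin_pasts\<close>, \<open>one_end_of_thin_pasts\<close>). The deterministic part of that reduction is
  \<open>one_end\<close>, the passage to the limit is \<open>WSF_event_bound\<close>.

  Long pasts are made unlikely by a dynamics under which the uniform spanning tree is stationary. The
  root performs a random walk; when it moves along the arc \<open>a\<close> from \<open>x\<close> to \<open>y\<close>, the tree gains \<open>a\<close>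
  and loses the exit arc of \<open>y\<close> (\<open>stationary\<close>). Let the walk make \<open>M\<close> excursions from \<open>r\<close>. A vertex
  \<open>v\<close> that the excursions have missed has as its new past a part of its old one: a path into \<open>v\<close>
  survives exactly if the walk has missed all of it, and every path into \<open>v\<close> in the new tree is such a
  survivor. The old tree is independent of the walk, and one excursion hits a set \<open>A\<close> with probability
  \<open>cap A / \<pi> r\<close>. Hence (\<open>thinning\<close>), for paths into \<open>v\<close>,
  \<open>P (some \<gamma> \<in> \<Gamma> is in the tree) \<le> M cap {v} / \<pi> r + (\<Sum>\<gamma>\<in>\<Gamma>. P (\<gamma> is in the tree) (1 - cap \<gamma> / \<pi> r) ^ M)\<close>.
  Taking \<open>M\<close> to be \<open>s \<pi> r\<close>, the right-hand side is about \<open>s \<pi> v + (\<Sum>\<gamma>\<in>\<Gamma>. P \<gamma> exp (- s cap \<gamma>))\<close>. For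
  small \<open>s\<close> it remains to see that the capacities of long paths beat the expected number of the paths.

  The number of paths is controlled by reversal. For a path \<open>\<gamma>\<close> from \<open>u\<close> to \<open>v\<close>, the probability that
  the tree contains \<open>\<gamma>\<close> directed to \<open>v\<close> is a weight that depends only on the edges of \<open>\<gamma>\<close>, times the
  conductance for escaping from \<open>\<gamma>\<close> at \<open>v\<close> (\<open>tree_prob_path\<close>). Reversing \<open>\<gamma>\<close> exchanges the two ends,
  and the probabilities of all paths of a given length that leave \<open>v\<close> add up to at most 1.

  In a non-amenable network, Cheeger's inequality gives \<open>cap A \<ge> \<kappa> |A|\<close> (\<open>cheeger\<close>). Along a long path
  into \<open>v\<close> there is then a late vertex \<open>u\<close> at which the escape conductance from the part of the path
  between \<open>u\<close> and \<open>v\<close> is at least \<open>\<kappa> / 2\<close>, because these conductances add up to at least the capacity.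
  By reversal the expected number of such paths of length \<open>j\<close> is at most \<open>2 \<pi> v / \<kappa>\<close>, whereas each
  survives with probability at most \<open>exp (- s \<kappa> j)\<close> (\<open>thin_pasts_of_linear_capacity\<close>).

  A quasi-transitive network that is not non-amenable has finite sets \<open>K\<close> which are hardly enlarged by
  adding all points at distance at most \<open>n\<close>. The expected number of vertices in generation \<open>n\<close> of the
  past is, in the limit of large wired networks, invariant under automorphisms (\<open>past_mass_aut\<close>).
  Counting pairs of a vertex in \<open>K\<close> and one in its past therefore bounds this number independently of
  \<open>n\<close>, since every vertex has only one ancestor \<open>n\<close> generations ahead (\<open>past_mass_bounded\<close>). On the
  other hand, transience and quasi-transitivity make Green's function decay uniformly, so that the
  capacity of a set of \<open>n\<close> vertices tends to infinity with \<open>n\<close> (\<open>capacity_unbounded\<close>). A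
  quasi-transitive network that is non-amenable falls under the previous case.
\<close>

section \<open>Rooted spanning forests of a finite network\<close>

definition out_arcs :: "('v, 'e) network \<Rightarrow> 'v \<Rightarrow> ('e \<times> bool) set" where
  "out_arcs G x = {a \<in> oriented_edges G. tail G a = x}"

definition rev_arc :: "'e \<times> bool \<Rightarrow> 'e \<times> bool" where
  "rev_arc a = (fst a, \<not> snd a)"

lemma fst_rev_arc [simp]: "fst (rev_arc a) = fst a"
  and rev_rev_arc [simp]: "rev_arc (rev_arc a) = a"
  and tail_rev_arc [simp]: "tail G (rev_arc a) = head G a"
  and head_rev_arc [simp]: "head G (rev_arc a) = tail G a"
  and rev_arc_mem [simp]: "rev_arc a \<in> oriented_edges G \<longleftrightarrow> a \<in> oriented_edges G"
  by (cases a; auto simp: rev_arc_def tail_def head_def oriented_edges_def)+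

lemma out_arcsD: "a \<in> out_arcs G x \<Longrightarrow> tail G a = x" "a \<in> out_arcs G x \<Longrightarrow> a \<in> oriented_edges G"
  "a \<in> out_arcs G x \<Longrightarrow> fst a \<in> edges G"
  by (auto simp: out_arcs_def oriented_edges_def)

lemma net_pi_single: "net_pi G {x} = (\<Sum>a\<in>out_arcs G x. cond G (fst a))"
  by (simp add: net_pi_def out_arcs_def)

lemma ends_fst: "ends G (fst a) = {tail G a, head G a}"
  by (auto simp: ends_def tail_def head_def)

lemma adjacency_iff_arc: "(x, y) \<in> adjacency G \<longleftrightarrow> (\<exists>a\<in>out_arcs G x. head G a = y)"
proof
  assume "(x, y) \<in> adjacency G"
  then obtain e where e: "e \<in> edges G" "ends G e = {x, y}" by (auto simp: adjacency_def)
  then consider "src G e = x" "dst G e = y" | "src G e = y" "dst G e = x"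
    by (auto simp: ends_def doubleton_eq_iff)
  then show "\<exists>a\<in>out_arcs G x. head G a = y"
  proof cases
    case 1 then show ?thesis using e by (intro bexI[of _ "(e, True)"]) (auto simp: out_arcs_def oriented_edges_def tail_def head_def)
  next
    case 2 then show ?thesis using e by (intro bexI[of _ "(e, False)"]) (auto simp: out_arcs_def oriented_edges_def tail_def head_def)
  qed
next
  assume "\<exists>a\<in>out_arcs G x. head G a = y"
  then show "(x, y) \<in> adjacency G"
    using ends_fst[of G] by (fastforce simp: adjacency_def out_arcs_def oriented_edges_def)
qed

lemma closed_set_is_everything:
  assumes "net_connected G" "S \<subseteq> verts G" "S \<noteq> {}"
    and cl: "\<And>x a. x \<in> S \<Longrightarrow> a \<in> out_arcs G x \<Longrightarrow> head G a \<in> S"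
  shows "S = verts G"
proof -
  obtain x where x: "x \<in> S" using assms(3) by blast
  have "y \<in> S" if "(x, y) \<in> (adjacency G)\<^sup>*" for y
    using that x by induction (auto simp: adjacency_iff_arc intro: cl)
  moreover have "(x, y) \<in> (adjacency G)\<^sup>*" if "y \<in> verts G" for y
    using assms(1,2) x that by (auto simp: net_connected_def)
  ultimately show ?thesis using assms(2) by blast
qed

text \<open>
  \<open>t\<close> assigns to each vertex outside \<open>R\<close> an arc that leaves it. Being inductive, the predicate also
  says that following these arcs does reach \<open>R\<close>; so a forest is acyclic by requiring it for \<open>Q = R\<close>.
\<close>

inductive leads_to :: "('v, 'e) network \<Rightarrow> 'v set \<Rightarrow> 'v set \<Rightarrow> ('v \<Rightarrow> 'e \<times> bool) \<Rightarrow> 'v \<Rightarrow> bool"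
  for G R Q t where
  leads_to_root: "x \<in> R \<Longrightarrow> x \<in> Q \<Longrightarrow> leads_to G R Q t x"
| leads_to_step: "x \<notin> R \<Longrightarrow> leads_to G R Q t (head G (t x)) \<Longrightarrow> leads_to G R Q t x"

lemma leads_to_at_root [simp]: "x \<in> R \<Longrightarrow> leads_to G R Q t x \<longleftrightarrow> x \<in> Q"
  by (auto elim: leads_to.cases intro: leads_to_root)

lemma leads_to_off_root: "x \<notin> R \<Longrightarrow> leads_to G R Q t x \<longleftrightarrow> leads_to G R Q t (head G (t x))"
  by (meson leads_to.cases leads_to_step)

lemma leads_to_stepD: "leads_to G R Q t x \<Longrightarrow> x \<notin> R \<Longrightarrow> leads_to G R Q t (head G (t x))"
  by (auto elim: leads_to.cases)

lemma leads_to_mono: "leads_to G R Q t x \<Longrightarrow> Q \<inter> R \<subseteq> Q' \<Longrightarrow> leads_to G R Q' t x"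
  by (induction rule: leads_to.induct) (blast intro: leads_to_root, meson leads_to_step)

lemma leads_to_Int: "leads_to G R Q t x \<Longrightarrow> leads_to G R Q' t x \<Longrightarrow> leads_to G R (Q \<inter> Q') t x"
  by (induction rule: leads_to.induct) (simp, meson leads_to_step leads_to_stepD)

lemma leads_to_Un: "leads_to G R Q t x \<Longrightarrow> Q \<inter> R \<subseteq> Q1 \<union> Q2 \<Longrightarrow> leads_to G R Q1 t x \<or> leads_to G R Q2 t x"
  by (induction rule: leads_to.induct) (simp, blast, meson leads_to_step)

lemma leads_to_nonempty: "leads_to G R Q t x \<Longrightarrow> Q \<inter> R \<noteq> {}"
  by (induction rule: leads_to.induct) auto

lemma leads_to_disjoint: "leads_to G R Q t x \<Longrightarrow> leads_to G R Q' t x \<Longrightarrow> Q \<inter> Q' \<inter> R \<noteq> {}"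
  by (rule leads_to_nonempty[OF leads_to_Int])

lemma leads_to_cong:
  assumes "\<And>x. x \<notin> R \<Longrightarrow> s x = t x"
  shows "leads_to G R Q s x \<longleftrightarrow> leads_to G R Q t x"
proof -
  have "leads_to G R Q t x" if "\<And>x. x \<notin> R \<Longrightarrow> s x = t x" "leads_to G R Q s x" for s t x
    using that(2)
  proof (induction rule: leads_to.induct)
    case (leads_to_root x) then show ?case by simp
  next
    case (leads_to_step x) then show ?case using that(1)[of x] by (metis leads_to.leads_to_step)
  qed
  from this[of s t] this[of t s] assms show ?thesis by metis
qed

text \<open>
  Turning the root \<open>z\<close> into an ordinary vertex with exit arc \<open>a\<close> redirects exactly the tree of \<open>z\<close>.
  All statements about adding, removing or exchanging arcs are reduced to this one.
\<close>

lemma leads_to_upd_iff: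
  assumes "z \<notin> R" "Q \<subseteq> R"
  shows "leads_to G R Q (s(z := a)) x \<longleftrightarrow>
     leads_to G (insert z R) Q s x \<or> (leads_to G (insert z R) {z} s x \<and> leads_to G (insert z R) Q s (head G a))"
    (is "?L \<longleftrightarrow> ?R")
proof
  assume ?L
  then show ?R
  proof (induction rule: leads_to.induct)
    case (leads_to_root x) then show ?case using assms by simp
  next
    case (leads_to_step x)
    show ?case
    proof (cases "x = z")
      case True
      then show ?thesis using leads_to_step by auto
    next
      case False
      then have "x \<notin> insert z R" using leads_to_step by simp
      then show ?thesis using leads_to_step.IH False by (metis fun_upd_other leads_to.leads_to_step)
    qed
  qed
next
  have g1: "leads_to G R Q (s(z := a)) x" if "leads_to G (insert z R) Q s x" for x
    using that
  proof (induction rule: leads_to.induct)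
    case (leads_to_root x) then show ?case using assms by auto
  next
    case (leads_to_step x) then show ?case by (metis (no_types, lifting) fun_upd_other leads_to.leads_to_step insertCI)
  qed
  have g2: "leads_to G (insert z R) {z} s x \<Longrightarrow> leads_to G R Q (s(z := a)) z \<Longrightarrow> leads_to G R Q (s(z := a)) x"
  proof (induction rule: leads_to.induct)
    case (leads_to_root x) then show ?case by auto
  next
    case (leads_to_step x) then show ?case by (metis (no_types, lifting) fun_upd_other leads_to.leads_to_step insertCI)
  qed
  assume ?R
  then show ?L
  proof
    assume "leads_to G (insert z R) Q s x" then show ?L by (rule g1)
  next
    assume *: "leads_to G (insert z R) {z} s x \<and> leads_to G (insert z R) Q s (head G a)"
    then have "leads_to G R Q (s(z := a)) z" using g1[of "head G a"] assms by (metis fun_upd_same leads_to.leads_to_step)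
    then show ?L using * g2 by blast
  qed
qed

text \<open>
  A spanning forest rooted at \<open>R\<close> is given by the exit arcs of the vertices outside \<open>R\<close>. It takes the
  default value on \<open>R\<close>, so that a forest is determined by its arcs.
\<close>

definition forests :: "('v, 'e) network \<Rightarrow> 'v set \<Rightarrow> ('v \<Rightarrow> 'e \<times> bool) set" where
  "forests G R = {t \<in> (\<Pi>\<^sub>E x\<in>verts G - R. out_arcs G x). \<forall>x\<in>verts G. leads_to G R R t x}"

definition forest_weight :: "('v, 'e) network \<Rightarrow> 'v set \<Rightarrow> ('v \<Rightarrow> 'e \<times> bool) \<Rightarrow> real" where
  "forest_weight G R t = (\<Prod>x\<in>verts G - R. cond G (fst (t x)))"

definition forest_sum :: "('v, 'e) network \<Rightarrow> 'v set \<Rightarrow> real" where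
  "forest_sum G R = (\<Sum>t\<in>forests G R. forest_weight G R t)"

text \<open>
  The probability that the tree of \<open>z\<close> has its root in \<open>Q\<close>, in a random forest rooted at \<open>R\<close>. It is also
  the probability that the random walk from \<open>z\<close> enters \<open>R\<close> through \<open>Q\<close>, as it solves the
  corresponding Dirichlet problem (\<open>forest_hit_harmonic\<close>).
\<close>

definition forest_hit :: "('v, 'e) network \<Rightarrow> 'v set \<Rightarrow> 'v set \<Rightarrow> 'v \<Rightarrow> real" where
  "forest_hit G R Q z = (\<Sum>t\<in>forests G R. forest_weight G R t * of_bool (leads_to G R Q t z)) / forest_sum G R"

locale fin_net =
  fixes G :: "('v, 'e) network"
  assumes network: "is_network G" and fin_verts: "finite (verts G)" and fin_edges: "finite (edges G)"
    and conn: "net_connected G" and loopless: "\<And>e. e \<in> edges G \<Longrightarrow> src G e \<noteq> dst G e"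
begin

lemma fin_arcs [simp]: "finite (oriented_edges G)"
  using fin_edges by (simp add: oriented_edges_def)

lemma fin_out [simp]: "finite (out_arcs G x)"
  using finite_subset[OF _ fin_arcs] by (auto simp: out_arcs_def)

lemma head_in: "a \<in> out_arcs G x \<Longrightarrow> head G a \<in> verts G"
  using network by (auto simp: out_arcs_def oriented_edges_def is_network_def head_def)

lemma head_neq: "a \<in> out_arcs G x \<Longrightarrow> head G a \<noteq> x"
  using loopless by (fastforce simp: out_arcs_def oriented_edges_def tail_def head_def split: if_splits)

lemma cond_pos: "a \<in> out_arcs G x \<Longrightarrow> 0 < cond G (fst a)"
  using network by (auto simp: out_arcs_def oriented_edges_def is_network_def)

lemma fin_forests [simp]: "finite (forests G R)"
proof -
  have "finite (\<Pi>\<^sub>E x\<in>verts G - R. out_arcs G x)"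
    using fin_verts by (intro finite_PiE) auto
  then show ?thesis by (rule rev_finite_subset) (auto simp: forests_def)
qed

lemma forest_out: "t \<in> forests G R \<Longrightarrow> x \<in> verts G \<Longrightarrow> x \<notin> R \<Longrightarrow> t x \<in> out_arcs G x"
  by (auto simp: forests_def)

lemma forest_leads_to: "t \<in> forests G R \<Longrightarrow> x \<in> verts G \<Longrightarrow> leads_to G R R t x"
  by (auto simp: forests_def)

lemma forest_weight_pos: "t \<in> forests G R \<Longrightarrow> 0 < forest_weight G R t"
  unfolding forest_weight_def by (intro prod_pos) (auto intro: cond_pos forest_out)

lemma forest_glue:
  assumes "z \<in> verts G" "z \<notin> R" "s \<in> forests G (insert z R)" "a \<in> out_arcs G z"
    "leads_to G (insert z R) R s (head G a)"
  shows "s(z := a) \<in> forests G R"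
proof -
  have "leads_to G R R (s(z := a)) x" if "x \<in> verts G" for x
    using leads_to_upd_iff[OF assms(2) subset_refl, of G s a x] assms(5) forest_leads_to[OF assms(3) that]
      leads_to_Un[of G "insert z R" "insert z R" s x R "{z}"] by auto
  moreover have "s(z := a) \<in> (\<Pi>\<^sub>E x\<in>verts G - R. out_arcs G x)"
    using assms by (auto simp: forests_def PiE_iff extensional_def)
  ultimately show ?thesis by (auto simp: forests_def)
qed

lemma forest_split:
  assumes "z \<in> verts G" "z \<notin> R" "t \<in> forests G R"
  shows "t(z := undefined) \<in> forests G (insert z R)" "leads_to G (insert z R) R t (head G (t z))"
proof -
  have cut: "leads_to G (insert z R) (insert z R) t x" if "leads_to G R R t x" for x
    using that
  proof (induction rule: leads_to.induct)
    case (leads_to_root x) then show ?case by auto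
  next
    case (leads_to_step x) then show ?case by (cases "x = z") (simp, metis leads_to.leads_to_step insertE)
  qed
  have "leads_to G (insert z R) (insert z R) (t(z := undefined)) x" if "x \<in> verts G" for x
    using cut[OF forest_leads_to[OF assms(3) that]] leads_to_cong[of "insert z R" "t(z := undefined)" t] by auto
  moreover have "t(z := undefined) \<in> (\<Pi>\<^sub>E x\<in>verts G - insert z R. out_arcs G x)"
    using assms by (auto simp: forests_def PiE_iff extensional_def)
  ultimately show "t(z := undefined) \<in> forests G (insert z R)" by (auto simp: forests_def)
  have "leads_to G R R t (head G (t z))"
    using forest_leads_to[OF assms(3,1)] assms(2) by (rule leads_to_stepD)
  then show "leads_to G (insert z R) R t (head G (t z))"
    using leads_to_upd_iff[OF assms(2) subset_refl, of G t "t z" "head G (t z)"] by auto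
qed

lemma forest_weight_glue:
  assumes "z \<in> verts G" "z \<notin> R"
  shows "forest_weight G R (s(z := a)) = cond G (fst a) * forest_weight G (insert z R) s"
proof -
  have "verts G - R = insert z (verts G - insert z R)" using assms by auto
  then have "forest_weight G R (s(z := a)) = (\<Prod>x\<in>insert z (verts G - insert z R). cond G (fst ((s(z := a)) x)))"
    unfolding forest_weight_def by (rule prod.cong) simp
  also have "\<dots> = cond G (fst a) * (\<Prod>x\<in>verts G - insert z R. cond G (fst ((s(z := a)) x)))"
    using fin_verts by (subst prod.insert) auto
  also have "(\<Prod>x\<in>verts G - insert z R. cond G (fst ((s(z := a)) x))) = forest_weight G (insert z R) s"
    unfolding forest_weight_def by (rule prod.cong) auto
  finally show ?thesis .
qed

text \<open>
  A forest rooted at \<open>R\<close> is a forest rooted at \<open>insert z R\<close> together with an exit arc of \<open>z\<close> whose head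
  is not in the tree of \<open>z\<close>.
\<close>

lemma sum_forests_split:
  fixes f :: "_ \<Rightarrow> real"
  assumes "z \<in> verts G" "z \<notin> R"
  shows "(\<Sum>t\<in>forests G R. forest_weight G R t * f t) =
    (\<Sum>s\<in>forests G (insert z R). forest_weight G (insert z R) s *
       (\<Sum>a\<in>out_arcs G z. cond G (fst a) * of_bool (leads_to G (insert z R) R s (head G a)) * f (s(z := a))))"
proof -
  let ?S = "SIGMA s:forests G (insert z R). {a\<in>out_arcs G z. leads_to G (insert z R) R s (head G a)}"
  have "(\<Sum>t\<in>forests G R. forest_weight G R t * f t) =
      (\<Sum>(s, a)\<in>?S. forest_weight G (insert z R) s * (cond G (fst a) * f (s(z := a))))"
  proof (rule sum.reindex_bij_witness[where i = "\<lambda>(s, a). s(z := a)" and j = "\<lambda>t. (t(z := undefined), t z)"])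
    fix p assume "p \<in> ?S"
    then show "(\<lambda>t. (t(z := undefined), t z)) ((\<lambda>(s, a). s(z := a)) p) = p"
      by (auto simp: forests_def PiE_iff extensional_def fun_eq_iff)
    show "(\<lambda>(s, a). s(z := a)) p \<in> forests G R"
      using \<open>p \<in> ?S\<close> forest_glue[OF assms] by auto
  next
    fix t assume t: "t \<in> forests G R"
    show "(\<lambda>(s, a). s(z := a)) (t(z := undefined), t z) = t" by auto
    show "(t(z := undefined), t z) \<in> ?S"
      using forest_split[OF assms t] forest_out[OF t assms]
        leads_to_cong[of "insert z R" "t(z := undefined)" t] by auto
    show "(\<lambda>(s, a). forest_weight G (insert z R) s * (cond G (fst a) * f (s(z := a)))) (t(z := undefined), t z)
       = forest_weight G R t * f t"
      using forest_weight_glue[OF assms, of "t(z := undefined)" "t z"] by simp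
  qed
  also have "\<dots> = (\<Sum>s\<in>forests G (insert z R).
      (\<Sum>a\<in>{a\<in>out_arcs G z. leads_to G (insert z R) R s (head G a)}.
         forest_weight G (insert z R) s * (cond G (fst a) * f (s(z := a)))))"
    by (subst sum.Sigma) auto
  also have "\<dots> = (\<Sum>s\<in>forests G (insert z R). forest_weight G (insert z R) s *
       (\<Sum>a\<in>out_arcs G z. cond G (fst a) * of_bool (leads_to G (insert z R) R s (head G a)) * f (s(z := a))))"
    unfolding sum_distrib_left
    by (intro sum.cong refl sum.mono_neutral_cong_left) auto
  finally show ?thesis .
qed

text \<open>
  Forests exist: by connectedness some vertex outside \<open>R\<close> has an arc into \<open>R\<close>, and attaching it there to
  a forest rooted at one vertex more gives a forest rooted at \<open>R\<close>.
\<close>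

lemma forest_sum_pos: "R \<noteq> {} \<Longrightarrow> R \<subseteq> verts G \<Longrightarrow> 0 < forest_sum G R"
proof (induction "card (verts G - R)" arbitrary: R rule: less_induct)
  case less
  show ?case
  proof (cases "R = verts G")
    case True
    then have "forests G R = {\<lambda>_. undefined}" by (auto simp: forests_def)
    then show ?thesis by (simp add: forest_sum_def forest_weight_def True)
  next
    case False
    obtain a where a: "a \<in> oriented_edges G" "tail G a \<notin> R" "head G a \<in> R"
    proof -
      have "\<exists>x a. x \<in> R \<and> a \<in> out_arcs G x \<and> head G a \<notin> R"
        using closed_set_is_everything[OF conn less.prems(2,1)] False by blast
      then obtain x a where "x \<in> R" "a \<in> out_arcs G x" "head G a \<notin> R" by blast
      then show ?thesis using that[of "rev_arc a"] by (auto simp: out_arcs_def)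
    qed
    let ?z = "tail G a"
    have z: "?z \<in> verts G" "a \<in> out_arcs G ?z"
      using a(1) head_in[of "rev_arc a"] by (auto simp: out_arcs_def)
    have pos: "0 < forest_sum G (insert ?z R)"
    proof (rule less.hyps)
      show "card (verts G - insert ?z R) < card (verts G - R)"
        using z a fin_verts by (intro psubset_card_mono) auto
    qed (use less.prems z in auto)
    have "forest_sum G R = (\<Sum>t\<in>forests G R. forest_weight G R t * 1)" by (simp add: forest_sum_def)
    also have "\<dots> = (\<Sum>s\<in>forests G (insert ?z R). forest_weight G (insert ?z R) s *
       (\<Sum>b\<in>out_arcs G ?z. cond G (fst b) * of_bool (leads_to G (insert ?z R) R s (head G b)) * 1))"
      by (rule sum_forests_split[OF z(1) a(2)])
    also have "\<dots> \<ge> (\<Sum>s\<in>forests G (insert ?z R). forest_weight G (insert ?z R) s * cond G (fst a))"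
    proof (intro sum_mono mult_left_mono)
      fix s assume s: "s \<in> forests G (insert ?z R)"
      show "0 \<le> forest_weight G (insert ?z R) s" using forest_weight_pos[OF s] by simp
      have "cond G (fst a) * of_bool (leads_to G (insert ?z R) R s (head G a)) * 1
        \<le> (\<Sum>b\<in>out_arcs G ?z. cond G (fst b) * of_bool (leads_to G (insert ?z R) R s (head G b)) * 1)"
        by (rule member_le_sum) (use z in \<open>auto intro!: mult_nonneg_nonneg less_imp_le cond_pos\<close>)
      then show "cond G (fst a) \<le> (\<Sum>b\<in>out_arcs G ?z. cond G (fst b) * of_bool (leads_to G (insert ?z R) R s (head G b)) * 1)"
        using a(3) by simp
    qed
    also have "(\<Sum>s\<in>forests G (insert ?z R). forest_weight G (insert ?z R) s * cond G (fst a)) = forest_sum G (insert ?z R) * cond G (fst a)"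
      by (simp add: forest_sum_def sum_distrib_right)
    moreover have "\<dots> > 0" using pos cond_pos[OF z(2)] by simp
    ultimately show ?thesis by linarith
  qed
qed

lemma sum_leads_to: "R \<noteq> {} \<Longrightarrow> R \<subseteq> verts G \<Longrightarrow>
    (\<Sum>t\<in>forests G R. forest_weight G R t * of_bool (leads_to G R Q t z)) = forest_sum G R * forest_hit G R Q z"
  using forest_sum_pos[of R] by (simp add: forest_hit_def)

lemma forest_hit_root: "x \<in> R \<Longrightarrow> R \<subseteq> verts G \<Longrightarrow> forest_hit G R Q x = of_bool (x \<in> Q)"
  using forest_sum_pos[of R] by (cases "R = {}") (auto simp: forest_hit_def forest_sum_def)

lemma forest_hit_nonneg: "0 \<le> forest_hit G R Q z"
  unfolding forest_hit_def forest_sum_def using forest_weight_pos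
  by (intro divide_nonneg_nonneg sum_nonneg) (auto simp: less_imp_le)

lemma forest_hit_le_1: assumes "R \<noteq> {}" "R \<subseteq> verts G" shows "forest_hit G R Q z \<le> 1"
proof -
  have "(\<Sum>t\<in>forests G R. forest_weight G R t * of_bool (leads_to G R Q t z)) \<le> forest_sum G R"
    unfolding forest_sum_def using forest_weight_pos by (intro sum_mono) (auto simp: less_imp_le)
  then show ?thesis using forest_sum_pos[OF assms] by (simp add: forest_hit_def)
qed

lemma forest_hit_compl:
  assumes "R \<noteq> {}" "R \<subseteq> verts G" "Q \<subseteq> R" "z \<in> verts G"
  shows "forest_hit G R (R - Q) z = 1 - forest_hit G R Q z"
proof -
  have "of_bool (leads_to G R (R - Q) t z) = 1 - (of_bool (leads_to G R Q t z) :: real)" if "t \<in> forests G R" for t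
    using leads_to_Un[OF forest_leads_to[OF that assms(4)], of Q "R - Q"] leads_to_disjoint[of G R Q t z "R - Q"] assms by auto
  then have "(\<Sum>t\<in>forests G R. forest_weight G R t * of_bool (leads_to G R (R - Q) t z)) =
      (\<Sum>t\<in>forests G R. forest_weight G R t * 1 - forest_weight G R t * of_bool (leads_to G R Q t z))"
    by (intro sum.cong refl) (simp add: right_diff_distrib)
  also have "\<dots> = forest_sum G R - (\<Sum>t\<in>forests G R. forest_weight G R t * of_bool (leads_to G R Q t z))"
    by (simp add: sum_subtractf forest_sum_def)
  finally show ?thesis using forest_sum_pos[OF assms(1,2)] by (simp add: forest_hit_def diff_divide_distrib)
qed

text \<open>
  Fix the forest off the exit arc of \<open>z\<close>, and let \<open>\<alpha>\<close> and \<open>\<beta>\<close> be the total conductances from \<open>z\<close> to the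
  trees rooted in \<open>Q\<close> and in \<open>R - Q\<close>. The tree of \<open>z\<close> goes to \<open>Q\<close> and a second arc of \<open>z\<close> points to
  \<open>R - Q\<close> with weight \<open>\<alpha> \<beta>\<close>; with the roles exchanged the weight is the same.
\<close>

lemma forest_hit_harmonic:
  assumes z: "z \<in> verts G" "z \<notin> R" and R: "R \<noteq> {}" "R \<subseteq> verts G" and Q: "Q \<subseteq> R"
  shows "(\<Sum>b\<in>out_arcs G z. cond G (fst b) * (forest_hit G R Q z - forest_hit G R Q (head G b))) = 0"
proof -
  let ?R = "insert z R"
  let ?f = "\<lambda>t. \<Sum>b\<in>out_arcs G z. cond G (fst b) * (of_bool (leads_to G R Q t z) - of_bool (leads_to G R Q t (head G b)))"
  have key: "(\<Sum>a\<in>out_arcs G z. cond G (fst a) * of_bool (leads_to G ?R R s (head G a)) * ?f (s(z := a))) = 0"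
    if s: "s \<in> forests G ?R" for s
  proof -
    define q where "q a = (of_bool (leads_to G ?R Q s (head G a)) :: real)" for a
    define n where "n a = (of_bool (leads_to G ?R (R - Q) s (head G a)) :: real)" for a
    (* The exit arc \<open>a\<close> and the second arc \<open>b\<close> of \<open>z\<close>; the two products are exchanged by swapping them. *)
    have term_eq: "cond G (fst a) * of_bool (leads_to G ?R R s (head G a)) *
        (cond G (fst b) * (of_bool (leads_to G R Q (s(z := a)) z) - of_bool (leads_to G R Q (s(z := a)) (head G b))))
      = (cond G (fst a) * q a) * (cond G (fst b) * n b) - (cond G (fst a) * n a) * (cond G (fst b) * q b)"
      if a: "a \<in> out_arcs G z" and b: "b \<in> out_arcs G z" for a b
    proof -
      have zz: "leads_to G R Q (s(z := a)) z \<longleftrightarrow> leads_to G ?R Q s (head G a)"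
        using leads_to_upd_iff[OF z(2) Q, of G s a z] z Q by auto
      have part: "(leads_to G ?R Q s y \<and> \<not> leads_to G ?R (R - Q) s y \<and> \<not> leads_to G ?R {z} s y \<and> leads_to G ?R R s y) \<or>
          (\<not> leads_to G ?R Q s y \<and> leads_to G ?R (R - Q) s y \<and> \<not> leads_to G ?R {z} s y \<and> leads_to G ?R R s y) \<or>
          (\<not> leads_to G ?R Q s y \<and> \<not> leads_to G ?R (R - Q) s y \<and> leads_to G ?R {z} s y \<and> \<not> leads_to G ?R R s y)"
        if "y \<in> verts G" for y
      proof -
        have 1: "leads_to G ?R ?R s y" by (rule forest_leads_to[OF s that])
        have 2: "leads_to G ?R Q s y \<or> leads_to G ?R (R - Q) s y \<or> leads_to G ?R {z} s y"
          using leads_to_Un[OF 1, of Q "insert z (R - Q)"] leads_to_Un[of G ?R "insert z (R-Q)" s y "R - Q" "{z}"] Q by auto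
        have 3: "leads_to G ?R Q s y \<Longrightarrow> leads_to G ?R R s y" "leads_to G ?R (R - Q) s y \<Longrightarrow> leads_to G ?R R s y"
          using Q by (auto elim!: leads_to_mono)
        show ?thesis using 2 3 leads_to_disjoint[of G ?R Q s y "R - Q"] leads_to_disjoint[of G ?R "{z}" s y "R"] z Q by auto
      qed
      have "leads_to G R Q (s(z := a)) (head G b) \<longleftrightarrow>
          leads_to G ?R Q s (head G b) \<or> (leads_to G ?R {z} s (head G b) \<and> leads_to G ?R Q s (head G a))"
        by (rule leads_to_upd_iff[OF z(2) Q])
      then show ?thesis unfolding zz
        using part[OF head_in[OF a]] part[OF head_in[OF b]] by (auto simp: q_def n_def)
    qed
    have "(\<Sum>a\<in>out_arcs G z. cond G (fst a) * of_bool (leads_to G ?R R s (head G a)) * ?f (s(z := a))) =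
       (\<Sum>a\<in>out_arcs G z. \<Sum>b\<in>out_arcs G z. (cond G (fst a) * q a) * (cond G (fst b) * n b) - (cond G (fst a) * n a) * (cond G (fst b) * q b))"
      unfolding sum_distrib_left by (intro sum.cong refl term_eq)
    also have "\<dots> = 0"
      by (simp add: sum_subtractf flip: sum_product)
    finally show ?thesis .
  qed
  have "forest_sum G R * (\<Sum>b\<in>out_arcs G z. cond G (fst b) * (forest_hit G R Q z - forest_hit G R Q (head G b))) =
     (\<Sum>b\<in>out_arcs G z. cond G (fst b) * (forest_sum G R * forest_hit G R Q z - forest_sum G R * forest_hit G R Q (head G b)))"
    by (simp add: sum_distrib_left algebra_simps)
  also have "\<dots> = (\<Sum>b\<in>out_arcs G z. \<Sum>t\<in>forests G R. forest_weight G R t * (cond G (fst b) * (of_bool (leads_to G R Q t z) - of_bool (leads_to G R Q t (head G b)))))"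
    unfolding sum_leads_to[OF R, symmetric] sum_subtractf[symmetric] sum_distrib_left
    by (intro sum.cong refl) (simp add: algebra_simps)
  also have "\<dots> = (\<Sum>t\<in>forests G R. forest_weight G R t * ?f t)"
    by (subst sum.swap) (simp add: sum_distrib_left)
  also have "\<dots> = 0"
    by (subst sum_forests_split[OF z]) (simp add: key)
  finally show ?thesis using forest_sum_pos[OF R] by simp
qed

lemma max_principle:
  fixes u :: "'v \<Rightarrow> real"
  assumes R: "R \<noteq> {}" "R \<subseteq> verts G"
    and sub: "\<And>z. z \<in> verts G \<Longrightarrow> z \<notin> R \<Longrightarrow> (\<Sum>b\<in>out_arcs G z. cond G (fst b) * (u z - u (head G b))) \<le> 0"
    and bd: "\<And>z. z \<in> R \<Longrightarrow> u z \<le> 0" and z: "z \<in> verts G"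
  shows "u z \<le> 0"
proof (rule ccontr)
  assume neg: "\<not> u z \<le> 0"
  define m where "m = Max (u ` verts G)"
  have m: "u x \<le> m" if "x \<in> verts G" for x using that fin_verts by (simp add: m_def)
  have "m \<in> u ` verts G" unfolding m_def using fin_verts z by (intro Max_in) auto
  then have "{x \<in> verts G. u x = m} \<noteq> {}" by auto
  moreover have "head G a \<in> {x \<in> verts G. u x = m}" if x: "x \<in> {x \<in> verts G. u x = m}" and a: "a \<in> out_arcs G x" for x a
  proof -
    have xR: "x \<notin> R" using bd[of x] x m[OF z] neg by auto
    have nn: "\<And>b. b \<in> out_arcs G x \<Longrightarrow> 0 \<le> cond G (fst b) * (u x - u (head G b))"
      using x m[OF head_in] less_imp_le[OF cond_pos] by (intro mult_nonneg_nonneg) auto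
    have "cond G (fst a) * (u x - u (head G a)) \<le> (\<Sum>b\<in>out_arcs G x. cond G (fst b) * (u x - u (head G b)))"
      by (rule member_le_sum) (use a nn in auto)
    also have "\<dots> \<le> 0" using sub x xR by auto
    finally have "u x - u (head G a) \<le> 0" using cond_pos[OF a] by (simp add: mult_le_0_iff)
    then show ?thesis using m[OF head_in[OF a]] x head_in[OF a] by auto
  qed
  ultimately have "{x \<in> verts G. u x = m} = verts G"
    by (intro closed_set_is_everything[OF conn]) auto
  moreover obtain y where "y \<in> R" using R by blast
  ultimately have "u y = m" "u y \<le> 0" using R bd by auto
  then show False using m[OF z] neg by simp
qed

end

section \<open>Paths in the random tree and the tree-valued random walk\<close>

fun walk :: "('v, 'e) network \<Rightarrow> 'v \<Rightarrow> ('e \<times> bool) list \<Rightarrow> 'v \<Rightarrow> bool" where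
  "walk G x [] y \<longleftrightarrow> x = y"
| "walk G x (a # as) y \<longleftrightarrow> a \<in> out_arcs G x \<and> walk G (head G a) as y"

definition self_avoiding :: "('v, 'e) network \<Rightarrow> 'v \<Rightarrow> ('e \<times> bool) list \<Rightarrow> 'v \<Rightarrow> bool" where
  "self_avoiding G x bs y \<longleftrightarrow> walk G x bs y \<and> distinct (map (tail G) bs @ [y])"

definition path_verts :: "('v, 'e) network \<Rightarrow> ('e \<times> bool) list \<Rightarrow> 'v \<Rightarrow> 'v set" where
  "path_verts G bs y = insert y (tail G ` set bs)"

text \<open>
  The path \<open>bs\<close> is traversed in the direction of the exit arcs, that is, towards the root.
\<close>

definition follows :: "('v, 'e) network \<Rightarrow> ('v \<Rightarrow> 'e \<times> bool) \<Rightarrow> ('e \<times> bool) list \<Rightarrow> bool" where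
  "follows G t bs \<longleftrightarrow> (\<forall>a\<in>set bs. t (tail G a) = a)"

definition path_cond :: "('v, 'e) network \<Rightarrow> ('e \<times> bool) list \<Rightarrow> real" where
  "path_cond G bs = (\<Prod>a\<leftarrow>bs. cond G (fst a))"

definition tree_prob :: "('v, 'e) network \<Rightarrow> 'v \<Rightarrow> (('v \<Rightarrow> 'e \<times> bool) \<Rightarrow> bool) \<Rightarrow> real" where
  "tree_prob G r P = (\<Sum>t\<in>forests G {r}. forest_weight G {r} t * of_bool (P t)) / forest_sum G {r}"

text \<open>
  The conductance from \<open>y\<close> to the root that is not intercepted by \<open>A\<close>: the probability that the walk from
  \<open>y\<close> reaches \<open>r\<close> before it enters \<open>A\<close> again, times \<open>\<pi> y\<close>.
\<close>

definition escape :: "('v, 'e) network \<Rightarrow> 'v \<Rightarrow> 'v set \<Rightarrow> 'v \<Rightarrow> real" where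
  "escape G r A y = (\<Sum>a\<in>out_arcs G y. cond G (fst a) * forest_hit G (insert r A) {r} (head G a))"

text \<open>
  The effective conductance between \<open>r\<close> and \<open>A\<close>, read off at the root: the probability that an excursion
  from \<open>r\<close> hits \<open>A\<close>, times \<open>\<pi> r\<close>.
\<close>

definition capacity :: "('v, 'e) network \<Rightarrow> 'v \<Rightarrow> 'v set \<Rightarrow> real" where
  "capacity G r A = (\<Sum>a\<in>out_arcs G r. cond G (fst a) * forest_hit G (insert r A) A (head G a))"

text \<open>
  The root moves along \<open>a\<close>; its new position loses its exit arc.
\<close>

definition move :: "('v, 'e) network \<Rightarrow> ('v \<Rightarrow> 'e \<times> bool) \<Rightarrow> 'e \<times> bool \<Rightarrow> ('v \<Rightarrow> 'e \<times> bool)" where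
  "move G t a = (t(tail G a := a))(head G a := undefined)"

context fin_net
begin

text \<open>
  The vertices of the path are made into roots one after the other.
\<close>

lemma sum_along_path:
  assumes "walk G x bs y" "distinct (map (tail G) bs @ [y])" "(tail G ` set bs \<union> {y}) \<inter> R = {}"
    "Q \<subseteq> R" "x \<in> verts G"
  shows "(\<Sum>t\<in>forests G R. forest_weight G R t * of_bool (follows G t bs \<and> leads_to G R Q t x)) =
     path_cond G bs * (\<Sum>t\<in>forests G (tail G ` set bs \<union> R). forest_weight G (tail G ` set bs \<union> R) t *
        of_bool (leads_to G (tail G ` set bs \<union> R) Q t y))"
  using assms
proof (induction bs arbitrary: x R)
  case Nil
  then show ?case by (simp add: follows_def path_cond_def)
next
  case (Cons b bs)
  from Cons.prems have b: "b \<in> out_arcs G x" "tail G b = x" and w: "walk G (head G b) bs y"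
    by (auto simp: out_arcs_def)
  have xR: "x \<notin> R" and xb: "x \<notin> tail G ` set bs" using Cons.prems b by auto
  let ?R = "insert x R"
  have "(\<Sum>t\<in>forests G R. forest_weight G R t * of_bool (follows G t (b # bs) \<and> leads_to G R Q t x)) =
     (\<Sum>s\<in>forests G ?R. forest_weight G ?R s * (\<Sum>a\<in>out_arcs G x. cond G (fst a) * of_bool (leads_to G ?R R s (head G a)) *
        of_bool (follows G (s(x := a)) (b # bs) \<and> leads_to G R Q (s(x := a)) x)))"
    by (rule sum_forests_split) (use Cons.prems xR in auto)
  also have "\<dots> = (\<Sum>s\<in>forests G ?R. forest_weight G ?R s * (cond G (fst b) *
        of_bool (follows G s bs \<and> leads_to G ?R Q s (head G b))))"
  proof (intro sum.cong refl arg_cong2[where f = "(*)"])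
    fix s
    have *: "of_bool (leads_to G ?R R s (head G a)) * of_bool (follows G (s(x := a)) (b # bs) \<and> leads_to G R Q (s(x := a)) x)
       = (if a = b then of_bool (follows G s bs \<and> leads_to G ?R Q s (head G b)) else (0::real))" for a
    proof (cases "a = b")
      case False
      then show ?thesis using b by (auto simp: follows_def)
    next
      case True
      have "tail G a \<noteq> x" if "a \<in> set bs" for a using xb that by auto
      then have "follows G (s(x := b)) (b # bs) \<longleftrightarrow> follows G s bs"
        unfolding follows_def using b(2) by simp
      moreover have "leads_to G R Q (s(x := b)) x \<longleftrightarrow> leads_to G ?R Q s (head G b)"
        using leads_to_upd_iff[OF xR Cons.prems(4), of G s b x] xR Cons.prems(4) by auto
      moreover have "leads_to G ?R Q s (head G b) \<Longrightarrow> leads_to G ?R R s (head G b)"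
        using Cons.prems(4) by (auto elim: leads_to_mono)
      ultimately show ?thesis using True by auto
    qed
    have "(\<Sum>a\<in>out_arcs G x. cond G (fst a) * of_bool (leads_to G ?R R s (head G a)) *
        of_bool (follows G (s(x := a)) (b # bs) \<and> leads_to G R Q (s(x := a)) x))
      = (\<Sum>a\<in>out_arcs G x. if a = b then cond G (fst b) * of_bool (follows G s bs \<and> leads_to G ?R Q s (head G b)) else 0)"
      unfolding mult.assoc * by (intro sum.cong) auto
    then show "(\<Sum>a\<in>out_arcs G x. cond G (fst a) * of_bool (leads_to G ?R R s (head G a)) *
        of_bool (follows G (s(x := a)) (b # bs) \<and> leads_to G R Q (s(x := a)) x))
      = cond G (fst b) * of_bool (follows G s bs \<and> leads_to G ?R Q s (head G b))"
      using b by simp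
  qed
  also have "\<dots> = cond G (fst b) * (\<Sum>s\<in>forests G ?R. forest_weight G ?R s * of_bool (follows G s bs \<and> leads_to G ?R Q s (head G b)))"
    by (simp only: sum_distrib_left ac_simps)
  also have "\<dots> = cond G (fst b) * (path_cond G bs * (\<Sum>t\<in>forests G (tail G ` set bs \<union> ?R). forest_weight G (tail G ` set bs \<union> ?R) t *
        of_bool (leads_to G (tail G ` set bs \<union> ?R) Q t y)))"
    using Cons.prems b xb w head_in[OF b(1)] by (subst Cons.IH) auto
  also have "tail G ` set bs \<union> ?R = tail G ` set (b # bs) \<union> R" using b by auto
  finally show ?case by (simp add: path_cond_def)
qed

lemma walk_end_in: "walk G x bs y \<Longrightarrow> x \<in> verts G \<Longrightarrow> y \<in> verts G"
  by (induction bs arbitrary: x) (auto intro: head_in)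

lemma walk_tails_in: "walk G x bs y \<Longrightarrow> x \<in> verts G \<Longrightarrow> tail G ` set bs \<subseteq> verts G"
proof (induction bs arbitrary: x)
  case (Cons a bs)
  then have "tail G ` set bs \<subseteq> verts G" by (intro Cons.IH[of "head G a"]) (auto intro: head_in)
  with Cons.prems show ?case by (auto simp: out_arcs_def)
qed simp

lemma sum_leads_to_nonroot:
  assumes "z \<in> verts G" "z \<notin> R" "R \<subseteq> verts G" "Q \<subseteq> R"
  shows "(\<Sum>t\<in>forests G R. forest_weight G R t * of_bool (leads_to G R Q t z)) =
     forest_sum G (insert z R) * (\<Sum>a\<in>out_arcs G z. cond G (fst a) * forest_hit G (insert z R) Q (head G a))"
proof -
  have *: "of_bool (leads_to G (insert z R) R s (head G a)) * of_bool (leads_to G R Q (s(z := a)) z) =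
       (of_bool (leads_to G (insert z R) Q s (head G a)) :: real)" for s a
  proof -
    have "leads_to G R Q (s(z := a)) z \<longleftrightarrow> leads_to G (insert z R) Q s (head G a)"
        using leads_to_upd_iff[OF assms(2,4), of G s a z] assms by auto
    moreover have "leads_to G (insert z R) Q s (head G a) \<Longrightarrow> leads_to G (insert z R) R s (head G a)"
      using assms(4) by (auto elim: leads_to_mono)
    ultimately show ?thesis by auto
  qed
  have "(\<Sum>t\<in>forests G R. forest_weight G R t * of_bool (leads_to G R Q t z)) =
    (\<Sum>s\<in>forests G (insert z R). \<Sum>a\<in>out_arcs G z. cond G (fst a) * (forest_weight G (insert z R) s * of_bool (leads_to G (insert z R) Q s (head G a))))"
    by (subst sum_forests_split[OF assms(1,2)]) (simp only: * mult.assoc sum_distrib_left mult.left_commute)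
  also have "\<dots> = (\<Sum>a\<in>out_arcs G z. cond G (fst a) * (forest_sum G (insert z R) * forest_hit G (insert z R) Q (head G a)))"
    using assms by (subst sum.swap, subst sum_leads_to[symmetric]) (simp_all only: sum_distrib_left, auto)
  finally show ?thesis by (simp add: sum_distrib_left algebra_simps)
qed

text \<open>
  All factors but the last are unchanged when the path is reversed.
\<close>

lemma tree_prob_path:
  assumes "self_avoiding G x bs y" "r \<notin> path_verts G bs y" "r \<in> verts G" "x \<in> verts G"
  shows "tree_prob G r (\<lambda>t. follows G t bs) =
     path_cond G bs * forest_sum G (insert r (path_verts G bs y)) / forest_sum G {r} * escape G r (path_verts G bs y) y"
proof -
  let ?R = "tail G ` set bs \<union> {r}"
  have w: "walk G x bs y" "distinct (map (tail G) bs @ [y])" using assms by (auto simp: self_avoiding_def)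
  have y: "y \<in> verts G" "y \<notin> ?R" "?R \<subseteq> verts G"
    using walk_end_in[OF w(1) assms(4)] walk_tails_in[OF w(1) assms(4)] w assms by (auto simp: path_verts_def)
  have ins: "insert y ?R = insert r (path_verts G bs y)" by (auto simp: path_verts_def)
  have "(\<Sum>t\<in>forests G {r}. forest_weight G {r} t * of_bool (follows G t bs)) =
    (\<Sum>t\<in>forests G {r}. forest_weight G {r} t * of_bool (follows G t bs \<and> leads_to G {r} {r} t x))"
    using forest_leads_to[OF _ assms(4)] by (intro sum.cong) auto
  also have "\<dots> = path_cond G bs * (\<Sum>t\<in>forests G ?R. forest_weight G ?R t * of_bool (leads_to G ?R {r} t y))"
    using w assms by (intro sum_along_path) (auto simp: path_verts_def)
  also have "\<dots> = path_cond G bs * (forest_sum G (insert r (path_verts G bs y)) * escape G r (path_verts G bs y) y)"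
    by (subst sum_leads_to_nonroot[OF y]) (simp_all only: ins escape_def, auto)
  finally show ?thesis by (simp add: tree_prob_def)
qed

lemma forest_sum_split:
  assumes "z \<in> verts G" "z \<notin> R" "R \<subseteq> verts G"
  shows "forest_sum G R = forest_sum G (insert z R) * (\<Sum>a\<in>out_arcs G z. cond G (fst a) * forest_hit G (insert z R) R (head G a))"
proof -
  have "forest_sum G R = (\<Sum>t\<in>forests G R. forest_weight G R t * of_bool (leads_to G R R t z))"
    unfolding forest_sum_def using forest_leads_to[OF _ assms(1)] by (intro sum.cong) auto
  then show ?thesis using sum_leads_to_nonroot[OF assms subset_refl] by simp
qed

text \<open>
  The last vertex before the root on the path from \<open>z\<close>.
\<close>

lemma unique_child:
  assumes t: "t \<in> forests G {y}" and z: "z \<in> verts G" "z \<noteq> y"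
  shows "\<exists>!x. x \<in> verts G - {y} \<and> head G (t x) = y \<and> leads_to G (insert x {y}) {x} t z"
proof -
  have ex: "\<exists>x. x \<in> verts G - {y} \<and> head G (t x) = y \<and> leads_to G (insert x {y}) {x} t z"
    using forest_leads_to[OF t z(1)] z
  proof (induction rule: leads_to.induct)
    case (leads_to_root x) then show ?case by simp
  next
    case (leads_to_step z)
    show ?case
    proof (cases "head G (t z) = y")
      case True then show ?thesis using leads_to_step by (intro exI[of _ z]) auto
    next
      case False
      moreover have "head G (t z) \<in> verts G" using head_in[OF forest_out[OF t]] leads_to_step.prems by auto
      ultimately obtain x where x: "x \<in> verts G - {y}" "head G (t x) = y" "leads_to G (insert x {y}) {x} t (head G (t z))"
        using leads_to_step.IH by blast
      have "leads_to G (insert x {y}) {x} t z"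
        using x(3) leads_to_step.prems by (cases "z = x") (simp, metis leads_to.leads_to_step insertE singletonD)
      then show ?thesis using x by blast
    qed
  qed
  have un: "x = x'" if "leads_to G (insert x {y}) {x} t z" "leads_to G (insert x' {y}) {x'} t z"
    "head G (t x) = y" "head G (t x') = y" "x \<noteq> y" "x' \<noteq> y" for x x'
    using that
  proof (induction rule: leads_to.induct)
    case (leads_to_root z)
    show ?case
    proof (rule ccontr)
      assume ne: "x \<noteq> x'"
      with leads_to_root have "leads_to G (insert x' {y}) {x'} t (head G (t x))" by (intro leads_to_stepD) auto
      with leads_to_root show False by simp
    qed
  next
    case (leads_to_step z)
    show ?case
    proof (cases "z = x'")
      case True
      with leads_to_step.hyps leads_to_step.prems have "leads_to G (insert x {y}) {x} t y" by simp
      with leads_to_step.prems show ?thesis by simp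
    next
      case False
      with leads_to_step.prems leads_to_step.hyps have "leads_to G (insert x' {y}) {x'} t (head G (t z))" by (intro leads_to_stepD) auto
      then show ?thesis using leads_to_step by blast
    qed
  qed
  show ?thesis using ex un by blast
qed

lemma move_forest:
  assumes "t \<in> forests G {x}" "a \<in> out_arcs G x"
  shows "move G t a \<in> forests G {head G a}"
proof -
  let ?y = "head G a"
  have y: "?y \<in> verts G" "?y \<noteq> x" using head_in head_neq assms by auto
  have x: "x \<in> verts G" "tail G a = x" using assms(2) head_in[of "rev_arc a"] by (auto simp: out_arcs_def)
  have s: "t(?y := undefined) \<in> forests G (insert x {?y})"
    using forest_split(1)[OF y(1) _ assms(1)] y by (simp add: insert_commute)
  have "(t(?y := undefined))(x := a) \<in> forests G {?y}"
    by (rule forest_glue[OF x(1) _ s assms(2)]) (use y in auto)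
  also have "(t(?y := undefined))(x := a) = move G t a"
    using x y by (auto simp: move_def)
  finally show ?thesis .
qed

lemma pi_sum_pos:
  assumes "x \<in> verts G" "y \<in> verts G" "x \<noteq> y"
  shows "0 < net_pi G {x}"
proof -
  have "out_arcs G x \<noteq> {}"
  proof
    assume "out_arcs G x = {}"
    then have "{x} = verts G" by (intro closed_set_is_everything[OF conn]) (use assms in auto)
    then show False using assms by auto
  qed
  then show ?thesis unfolding net_pi_single by (intro sum_pos) (auto intro: cond_pos)
qed

text \<open>
  A tree rooted at \<open>x\<close> has stationary weight \<open>\<pi> x\<close> times the product of its conductances. A move into
  \<open>(t, y)\<close> comes from a child \<open>x\<close> of \<open>y\<close> in \<open>t\<close> and an exit arc \<open>b\<close> that \<open>y\<close> has lost; the old tree has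
  no cycle precisely if \<open>b\<close> points into the subtree of \<open>x\<close>. As each arc \<open>b\<close> of \<open>y\<close> points into the
  subtree of exactly one child, the predecessors of \<open>(t, y)\<close> correspond to the arcs \<open>b\<close> at \<open>y\<close>, and
  their weights add up to that of \<open>(t, y)\<close>.
\<close>

lemma stationary:
  fixes \<psi> :: "('v \<Rightarrow> 'e \<times> bool) \<Rightarrow> 'v \<Rightarrow> real"
  shows "(\<Sum>x\<in>verts G. \<Sum>t\<in>forests G {x}. forest_weight G {x} t *
            (\<Sum>a\<in>out_arcs G x. cond G (fst a) * \<psi> (move G t a) (head G a))) =
         (\<Sum>y\<in>verts G. \<Sum>t\<in>forests G {y}. forest_weight G {y} t * (net_pi G {y} * \<psi> t y))"
proof -
  (* The weight of all moves along \<open>a\<close> from \<open>x\<close> to \<open>y\<close>: the rest \<open>s\<close> of the tree and the lost arc \<open>b\<close>. *)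
  define T where "T x a y = cond G (fst a) * (\<Sum>s\<in>forests G {x, y}. forest_weight G {x, y} s *
     (\<Sum>b\<in>out_arcs G y. cond G (fst b) * of_bool (leads_to G {x, y} {x} s (head G b)) * \<psi> (s(x := a)) y))" for x a y
  have L: "(\<Sum>t\<in>forests G {x}. forest_weight G {x} t * (\<Sum>a\<in>out_arcs G x. cond G (fst a) * \<psi> (move G t a) (head G a)))
      = (\<Sum>a\<in>out_arcs G x. T x a (head G a))" if x: "x \<in> verts G" for x
  proof -
    have "(\<Sum>t\<in>forests G {x}. forest_weight G {x} t * \<psi> (move G t a) (head G a)) =
       (\<Sum>s\<in>forests G {x, head G a}. forest_weight G {x, head G a} s *
         (\<Sum>b\<in>out_arcs G (head G a). cond G (fst b) * of_bool (leads_to G {x, head G a} {x} s (head G b)) * \<psi> (s(x := a)) (head G a)))"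
      if a: "a \<in> out_arcs G x" for a
    proof -
      let ?y = "head G a"
      have y: "?y \<in> verts G" "?y \<notin> {x}" using head_in head_neq a by auto
      have mv: "move G (s(?y := b)) a = s(x := a)" if "s \<in> forests G {x, ?y}" for s b
        using that a y by (auto simp: move_def out_arcs_def forests_def PiE_iff extensional_def fun_eq_iff)
      show ?thesis
        by (subst sum_forests_split[OF y]) (simp add: insert_commute[of ?y x] mv cong: sum.cong)
    qed
    note * = this
    have "(\<Sum>t\<in>forests G {x}. forest_weight G {x} t * (\<Sum>a\<in>out_arcs G x. cond G (fst a) * \<psi> (move G t a) (head G a))) =
        (\<Sum>a\<in>out_arcs G x. cond G (fst a) * (\<Sum>t\<in>forests G {x}. forest_weight G {x} t * \<psi> (move G t a) (head G a)))"
      unfolding sum_distrib_left by (subst sum.swap) (simp only: ac_simps)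
    also have "\<dots> = (\<Sum>a\<in>out_arcs G x. T x a (head G a))"
      unfolding T_def by (intro sum.cong refl) (simp only: *)
    finally show ?thesis .
  qed
  have R: "(\<Sum>t\<in>forests G {y}. forest_weight G {y} t * (net_pi G {y} * \<psi> t y)) =
      (\<Sum>x\<in>verts G - {y}. \<Sum>a\<in>out_arcs G x. of_bool (head G a = y) * T x a y)" if y: "y \<in> verts G" for y
  proof -
    let ?I = "\<lambda>t x b. of_bool (head G (t x) = y) * of_bool (leads_to G (insert x {y}) {x} t (head G b)) :: real"
    have one: "(\<Sum>x\<in>verts G - {y}. ?I t x b) = 1" if t: "t \<in> forests G {y}" and b: "b \<in> out_arcs G y" for t b
    proof -
      obtain x where x: "x \<in> verts G - {y}" "head G (t x) = y" "leads_to G (insert x {y}) {x} t (head G b)"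
        and u: "\<And>x'. x' \<in> verts G - {y} \<Longrightarrow> head G (t x') = y \<Longrightarrow> leads_to G (insert x' {y}) {x'} t (head G b) \<Longrightarrow> x' = x"
        using unique_child[OF t head_in[OF b] head_neq[OF b]] by metis
      have "(\<Sum>x\<in>verts G - {y}. ?I t x b) = (\<Sum>x'\<in>verts G - {y}. if x' = x then 1 else 0)"
      proof (intro sum.cong refl)
        fix x' assume "x' \<in> verts G - {y}"
        then have "(head G (t x') = y \<and> leads_to G (insert x' {y}) {x'} t (head G b)) \<longleftrightarrow> x' = x"
          using x(2,3) u[of x'] by blast
        then show "?I t x' b = (if x' = x then 1 else 0)" unfolding of_bool_conj[symmetric] by simp
      qed
      then show ?thesis using x fin_verts by simp
    qed
    have "(\<Sum>t\<in>forests G {y}. forest_weight G {y} t * (net_pi G {y} * \<psi> t y)) =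
       (\<Sum>t\<in>forests G {y}. forest_weight G {y} t * ((\<Sum>b\<in>out_arcs G y. cond G (fst b) * (\<Sum>x\<in>verts G - {y}. ?I t x b)) * \<psi> t y))"
      unfolding net_pi_single using one by simp
    also have "\<dots> = (\<Sum>t\<in>forests G {y}. \<Sum>x\<in>verts G - {y}. forest_weight G {y} t * (\<Sum>b\<in>out_arcs G y. cond G (fst b) * ?I t x b * \<psi> t y))"
    proof (rule sum.cong[OF refl])
      fix t
      have "(\<Sum>b\<in>out_arcs G y. cond G (fst b) * (\<Sum>x\<in>verts G - {y}. ?I t x b)) * \<psi> t y =
         (\<Sum>x\<in>verts G - {y}. \<Sum>b\<in>out_arcs G y. cond G (fst b) * ?I t x b * \<psi> t y)"
        unfolding sum_distrib_left sum_distrib_right by (rule sum.swap)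
      then show "forest_weight G {y} t * ((\<Sum>b\<in>out_arcs G y. cond G (fst b) * (\<Sum>x\<in>verts G - {y}. ?I t x b)) * \<psi> t y) =
         (\<Sum>x\<in>verts G - {y}. forest_weight G {y} t * (\<Sum>b\<in>out_arcs G y. cond G (fst b) * ?I t x b * \<psi> t y))"
        unfolding sum_distrib_left[symmetric] by simp
    qed
    also have "\<dots> = (\<Sum>x\<in>verts G - {y}. \<Sum>t\<in>forests G {y}. forest_weight G {y} t * (\<Sum>b\<in>out_arcs G y. cond G (fst b) * ?I t x b * \<psi> t y))"
      by (rule sum.swap)
    also have "\<dots> = (\<Sum>x\<in>verts G - {y}. \<Sum>a\<in>out_arcs G x. of_bool (head G a = y) * T x a y)"
    proof (intro sum.cong refl)
      fix x assume x: "x \<in> verts G - {y}"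
      then have x': "x \<in> verts G" "x \<notin> {y}" by auto
      have gc: "leads_to G {x, y} Q (s(x := a)) z \<longleftrightarrow> leads_to G {x, y} Q s z" for Q s a z
        by (rule leads_to_cong) auto
      have *: "of_bool (leads_to G {x, y} {y} s (head G a)) * (\<Sum>b\<in>out_arcs G y. cond G (fst b) * (of_bool (head G ((s(x:=a)) x) = y)
          * of_bool (leads_to G {x, y} {x} (s(x := a)) (head G b))) * \<psi> (s(x := a)) y) =
        of_bool (head G a = y) * (\<Sum>b\<in>out_arcs G y. cond G (fst b) * of_bool (leads_to G {x, y} {x} s (head G b)) * \<psi> (s(x := a)) y)" for s a
        by (cases "head G a = y") (auto simp: gc)
      show "(\<Sum>t\<in>forests G {y}. forest_weight G {y} t * (\<Sum>b\<in>out_arcs G y. cond G (fst b) * ?I t x b * \<psi> t y)) =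
         (\<Sum>a\<in>out_arcs G x. of_bool (head G a = y) * T x a y)"
      proof -
        define K where "K s a = (\<Sum>b\<in>out_arcs G y. cond G (fst b) * of_bool (leads_to G {x, y} {x} s (head G b)) * \<psi> (s(x := a)) y)" for s a
        have "(\<Sum>t\<in>forests G {y}. forest_weight G {y} t * (\<Sum>b\<in>out_arcs G y. cond G (fst b) * ?I t x b * \<psi> t y)) =
           (\<Sum>s\<in>forests G {x, y}. forest_weight G {x, y} s * (\<Sum>a\<in>out_arcs G x. cond G (fst a) * (of_bool (head G a = y) * K s a)))"
          unfolding K_def *[symmetric]
          by (subst sum_forests_split[OF x']) (simp only: mult.assoc)
        also have "\<dots> = (\<Sum>a\<in>out_arcs G x. \<Sum>s\<in>forests G {x, y}. forest_weight G {x, y} s * (cond G (fst a) * (of_bool (head G a = y) * K s a)))"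
          unfolding sum_distrib_left by (rule sum.swap)
        also have "\<dots> = (\<Sum>a\<in>out_arcs G x. of_bool (head G a = y) * T x a y)"
          unfolding T_def K_def[symmetric] sum_distrib_left by (simp only: ac_simps)
        finally show ?thesis .
      qed
    qed
    finally show ?thesis .
  qed
  have "(\<Sum>y\<in>verts G. \<Sum>x\<in>verts G - {y}. \<Sum>a\<in>out_arcs G x. of_bool (head G a = y) * T x a y) =
     (\<Sum>y\<in>verts G. \<Sum>x\<in>verts G. \<Sum>a\<in>out_arcs G x. of_bool (head G a = y) * T x a y)"
  proof (rule sum.cong[OF refl], rule sum.mono_neutral_left)
    fix y show "\<forall>i\<in>verts G - (verts G - {y}). (\<Sum>a\<in>out_arcs G i. of_bool (head G a = y) * T i a y) = 0"
      using head_neq by (auto intro!: sum.neutral)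
  qed (use fin_verts in auto)
  also have "\<dots> = (\<Sum>x\<in>verts G. \<Sum>a\<in>out_arcs G x. \<Sum>y\<in>verts G. of_bool (head G a = y) * T x a y)"
    by (subst sum.swap) (intro sum.cong refl sum.swap)
  also have "\<dots> = (\<Sum>x\<in>verts G. \<Sum>a\<in>out_arcs G x. T x a (head G a))"
  proof (intro sum.cong refl)
    fix x a assume "a \<in> out_arcs G x"
    have "(\<Sum>y\<in>verts G. of_bool (head G a = y) * T x a y) = (\<Sum>y\<in>verts G. if y = head G a then T x a (head G a) else 0)"
      by (intro sum.cong) auto
    then show "(\<Sum>y\<in>verts G. of_bool (head G a = y) * T x a y) = T x a (head G a)"
      using head_in[OF \<open>a \<in> out_arcs G x\<close>] fin_verts by simp
  qed
  finally show ?thesis using L R by simp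
qed

end

section \<open>Excursions of the walk thin out the past of a vertex\<close>

text \<open>
  The expected value of \<open>\<phi>\<close> at the tree that is present when the moving root first returns to \<open>r\<close>, on
  the event that this takes at most \<open>k\<close> steps. The truncation keeps everything a finite sum.
\<close>

primrec excursion :: "('v, 'e) network \<Rightarrow> 'v \<Rightarrow> nat \<Rightarrow> (('v \<Rightarrow> 'e \<times> bool) \<Rightarrow> real) \<Rightarrow> ('v \<Rightarrow> 'e \<times> bool) \<Rightarrow> 'v \<Rightarrow> real" where
  "excursion G r 0 \<phi> t x = 0"
| "excursion G r (Suc k) \<phi> t x = (\<Sum>a\<in>out_arcs G x. cond G (fst a) *
      (if head G a = r then \<phi> (move G t a) else excursion G r k \<phi> (move G t a) (head G a))) / net_pi G {x}"

primrec return_prob :: "('v, 'e) network \<Rightarrow> 'v \<Rightarrow> nat \<Rightarrow> 'v \<Rightarrow> real" where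
  "return_prob G r 0 x = 0"
| "return_prob G r (Suc k) x = (\<Sum>a\<in>out_arcs G x. cond G (fst a) *
      (if head G a = r then 1 else return_prob G r k (head G a))) / net_pi G {x}"

locale rooted_net = fin_net G for G :: "('v, 'e) network" +
  fixes r :: 'v
  assumes root: "r \<in> verts G" and more: "verts G \<noteq> {r}"
begin

lemma pi_pos: "x \<in> verts G \<Longrightarrow> 0 < net_pi G {x}"
proof -
  assume x: "x \<in> verts G"
  obtain y where "y \<in> verts G" "y \<noteq> r" using root more by blast
  then show ?thesis using pi_sum_pos[of x y] pi_sum_pos[of x r] x root by metis
qed

lemma Zpos: "0 < forest_sum G {r}"
  using root by (intro forest_sum_pos) auto

lemma avg_const: "x \<in> verts G \<Longrightarrow> (\<Sum>a\<in>out_arcs G x. cond G (fst a) * c) / net_pi G {x} = c"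
  using pi_pos[of x] by (simp add: sum_distrib_right[symmetric] net_pi_single)

lemma avg_mono:
  assumes "x \<in> verts G" "\<And>a. a \<in> out_arcs G x \<Longrightarrow> f a \<le> g a"
  shows "(\<Sum>a\<in>out_arcs G x. cond G (fst a) * f a) / net_pi G {x} \<le> (\<Sum>a\<in>out_arcs G x. cond G (fst a) * g a) / net_pi G {x}"
  using pi_pos[OF assms(1)] assms(2) cond_pos
  by (intro divide_right_mono sum_mono mult_left_mono) (auto intro: less_imp_le)

lemma excursion_mono:
  assumes "\<And>t. t \<in> forests G {r} \<Longrightarrow> \<phi> t \<le> \<psi> t" "x \<in> verts G" "t \<in> forests G {x}"
  shows "excursion G r k \<phi> t x \<le> excursion G r k \<psi> t x"
  using assms(2,3)
proof (induction k arbitrary: t x)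
  case (Suc k)
  have "(if head G a = r then \<phi> (move G t a) else excursion G r k \<phi> (move G t a) (head G a))
     \<le> (if head G a = r then \<psi> (move G t a) else excursion G r k \<psi> (move G t a) (head G a))"
    if "a \<in> out_arcs G x" for a
    using assms(1)[of "move G t a"] Suc.IH[of "head G a" "move G t a"] move_forest[OF Suc.prems(2) that] head_in[OF that] by auto
  then show ?case unfolding excursion.simps by (intro avg_mono Suc.prems)
qed simp

lemma excursion_0: "excursion G r k (\<lambda>_. 0) t x = 0"
proof (induction k arbitrary: t x)
  case (Suc k) then show ?case unfolding excursion.simps by (simp add: if_distrib cong: if_cong)
qed simp

lemma excursion_nonneg:
  assumes "\<And>t. t \<in> forests G {r} \<Longrightarrow> 0 \<le> \<phi> t" "x \<in> verts G" "t \<in> forests G {x}"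
  shows "0 \<le> excursion G r k \<phi> t x"
  using excursion_mono[of "\<lambda>_. 0" \<phi> x t k] assms by (simp add: excursion_0)

lemma excursion_Suc_mono:
  assumes "\<And>t. t \<in> forests G {r} \<Longrightarrow> 0 \<le> \<phi> t" "x \<in> verts G" "t \<in> forests G {x}"
  shows "excursion G r k \<phi> t x \<le> excursion G r (Suc k) \<phi> t x"
  using assms(2,3)
proof (induction k arbitrary: t x)
  case 0
  then show ?case using excursion_nonneg[of \<phi> x t "Suc 0", OF assms(1)] by (simp del: excursion.simps(2))
next
  case (Suc k)
  have "(if head G a = r then \<phi> (move G t a) else excursion G r k \<phi> (move G t a) (head G a))
     \<le> (if head G a = r then \<phi> (move G t a) else excursion G r (Suc k) \<phi> (move G t a) (head G a))"
    if "a \<in> out_arcs G x" for a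
    using Suc.IH[of "head G a" "move G t a"] move_forest[OF Suc.prems(2) that] head_in[OF that] by auto
  then show ?case unfolding excursion.simps(2)[of _ _ k] excursion.simps(2)[of _ _ "Suc k"] by (intro avg_mono Suc.prems)
qed

lemma excursion_1: "excursion G r k (\<lambda>_. 1) t x = return_prob G r k x"
  by (induction k arbitrary: t x) (auto intro!: sum.cong arg_cong2[where f="(/)"])

lemma excursion_diff: "excursion G r k (\<lambda>t. \<phi> t - \<psi> t) t x = excursion G r k \<phi> t x - excursion G r k \<psi> t x"
proof (induction k arbitrary: t x)
  case (Suc k)
  show ?case unfolding excursion.simps diff_divide_distrib[symmetric] sum_subtractf[symmetric]
    by (intro arg_cong2[where f="(/)"] sum.cong refl) (simp add: Suc.IH right_diff_distrib)
qed simp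

text \<open>
  The stationary measure is preserved by a step, and a step from the trees not rooted at \<open>r\<close> only
  prolongs excursions; since truncated excursions increase with the truncation, nothing is gained.
\<close>

lemma excursion_substationary:
  assumes "\<And>t. t \<in> forests G {r} \<Longrightarrow> 0 \<le> \<phi> t"
  shows "(\<Sum>t\<in>forests G {r}. forest_weight G {r} t * excursion G r k \<phi> t r) \<le> (\<Sum>t\<in>forests G {r}. forest_weight G {r} t * \<phi> t)"
proof (cases k)
  case 0
  have "0 \<le> (\<Sum>t\<in>forests G {r}. forest_weight G {r} t * \<phi> t)"
    using assms less_imp_le[OF forest_weight_pos] by (intro sum_nonneg mult_nonneg_nonneg) auto
  then show ?thesis using 0 by simp
next
  case (Suc k')
  define \<psi> where "\<psi> t x = (if x = r then \<phi> t else excursion G r k' \<phi> t x)" for t x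
  define S where "S f x = (\<Sum>t\<in>forests G {x}. forest_weight G {x} t * (net_pi G {x} * f t x))" for f :: "_ \<Rightarrow> 'v \<Rightarrow> real" and x
  have "(\<Sum>x\<in>verts G. S (excursion G r k \<phi>) x) =
      (\<Sum>x\<in>verts G. \<Sum>t\<in>forests G {x}. forest_weight G {x} t * (\<Sum>a\<in>out_arcs G x. cond G (fst a) * \<psi> (move G t a) (head G a)))"
    unfolding S_def
  proof (intro sum.cong refl)
    fix x t assume "x \<in> verts G"
    then show "forest_weight G {x} t * (net_pi G {x} * excursion G r k \<phi> t x) =
      forest_weight G {x} t * (\<Sum>a\<in>out_arcs G x. cond G (fst a) * \<psi> (move G t a) (head G a))"
      using pi_pos[of x] by (simp add: Suc \<psi>_def)
  qed
  also have "\<dots> = (\<Sum>x\<in>verts G. S \<psi> x)" unfolding S_def by (rule stationary)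
  finally have "(\<Sum>x\<in>verts G. S (excursion G r k \<phi>) x) = (\<Sum>x\<in>verts G. S \<psi> x)" .
  moreover have "(\<Sum>x\<in>verts G. S f x) = S f r + (\<Sum>x\<in>verts G - {r}. S f x)" for f
    using root fin_verts by (simp add: sum.remove)
  moreover have "(\<Sum>x\<in>verts G - {r}. S \<psi> x) \<le> (\<Sum>x\<in>verts G - {r}. S (excursion G r k \<phi>) x)"
    unfolding S_def
  proof (intro sum_mono mult_left_mono)
    fix x t assume x: "x \<in> verts G - {r}" and t: "t \<in> forests G {x}"
    show "\<psi> t x \<le> excursion G r k \<phi> t x" using x t excursion_Suc_mono[OF assms, where k = k'] by (simp add: \<psi>_def Suc del: excursion.simps)
    show "0 \<le> net_pi G {x}" using pi_pos[of x] x by simp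
    show "0 \<le> forest_weight G {x} t" using forest_weight_pos[OF t] by simp
  qed
  ultimately have "S (excursion G r k \<phi>) r \<le> S \<psi> r" by smt
  also have "S \<psi> r = net_pi G {r} * (\<Sum>t\<in>forests G {r}. forest_weight G {r} t * \<phi> t)"
    by (simp add: S_def \<psi>_def sum_distrib_left mult.left_commute)
  also have "S (excursion G r k \<phi>) r = net_pi G {r} * (\<Sum>t\<in>forests G {r}. forest_weight G {r} t * excursion G r k \<phi> t r)"
    by (simp add: S_def sum_distrib_left mult.left_commute)
  finally show ?thesis using pi_pos[OF root] by simp
qed

lemma return_prob_props: "x \<in> verts G \<Longrightarrow> 0 \<le> return_prob G r k x \<and> return_prob G r k x \<le> 1 \<and> return_prob G r k x \<le> return_prob G r (Suc k) x"
proof -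
  assume x: "x \<in> verts G"
  have ub: "return_prob G r k x \<le> 1"
    using x
  proof (induction k arbitrary: x)
    case (Suc k)
    have "return_prob G r (Suc k) x \<le> (\<Sum>a\<in>out_arcs G x. cond G (fst a) * 1) / net_pi G {x}"
      unfolding return_prob.simps by (intro avg_mono Suc.prems) (use Suc.IH head_in in auto)
    then show ?case unfolding avg_const[OF Suc.prems] .
  qed simp
  obtain t where t: "t \<in> forests G {x}"
    using forest_sum_pos[of "{x}"] x by (auto simp: forest_sum_def elim!: sum.not_neutral_contains_not_neutral) (metis equals0I less_numeral_extra(3) sum.empty)
  show ?thesis using ub excursion_nonneg[of "\<lambda>_. 1" x t k] excursion_Suc_mono[of "\<lambda>_. 1" x t k] x t
    by (simp add: excursion_1 del: excursion.simps return_prob.simps)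
qed

text \<open>
  The limit is harmonic off \<open>r\<close>, so the maximum principle applies to its difference from 1.
\<close>

lemma return_prob_tendsto_1: "(\<lambda>k. return_prob G r k r) \<longlonglongrightarrow> 1"
proof -
  define \<rho> where "\<rho> x = lim (\<lambda>k. return_prob G r k x)" for x
  have lim: "(\<lambda>k. return_prob G r k x) \<longlonglongrightarrow> \<rho> x" if "x \<in> verts G" for x
  proof -
    have "incseq (\<lambda>k. return_prob G r k x)" using return_prob_props[OF that] by (intro incseq_SucI) auto
    moreover have "Bseq (\<lambda>k. return_prob G r k x)" using return_prob_props[OF that] by (intro BseqI'[of _ 1]) auto
    ultimately have "convergent (\<lambda>k. return_prob G r k x)" by (rule Bseq_monoseq_convergent[rotated, OF incseq_imp_monoseq])
    then show ?thesis by (simp add: \<rho>_def convergent_LIMSEQ_iff)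
  qed
  have eq: "\<rho> x = (\<Sum>a\<in>out_arcs G x. cond G (fst a) * (if head G a = r then 1 else \<rho> (head G a))) / net_pi G {x}"
    if x: "x \<in> verts G" for x
  proof (rule LIMSEQ_unique)
    show "(\<lambda>k. return_prob G r (Suc k) x) \<longlonglongrightarrow> \<rho> x" using lim[OF x] by (rule LIMSEQ_Suc)
    show "(\<lambda>k. return_prob G r (Suc k) x) \<longlonglongrightarrow> (\<Sum>a\<in>out_arcs G x. cond G (fst a) * (if head G a = r then 1 else \<rho> (head G a))) / net_pi G {x}"
      unfolding return_prob.simps using pi_pos[OF x] by (intro tendsto_divide tendsto_sum tendsto_mult tendsto_const) (auto intro: lim head_in)
  qed
  define u where "u x = (if x = r then 0 else 1 - \<rho> x)" for x
  have "u x \<le> 0" if "x \<in> verts G" for x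
  proof (rule max_principle[where R = "{r}"])
    fix z assume z: "z \<in> verts G" "z \<notin> {r}"
    have "net_pi G {z} * \<rho> z = (\<Sum>a\<in>out_arcs G z. cond G (fst a) * (if head G a = r then 1 else \<rho> (head G a)))"
      by (subst eq[OF z(1)]) (use pi_pos[OF z(1)] in simp)
    moreover have "net_pi G {z} * \<rho> z = (\<Sum>a\<in>out_arcs G z. cond G (fst a) * \<rho> z)"
      by (simp add: net_pi_single sum_distrib_right)
    ultimately have "(\<Sum>a\<in>out_arcs G z. cond G (fst a) * ((if head G a = r then 1 else \<rho> (head G a)) - \<rho> z)) = 0"
      by (simp add: right_diff_distrib sum_subtractf)
    also have "(\<Sum>a\<in>out_arcs G z. cond G (fst a) * ((if head G a = r then 1 else \<rho> (head G a)) - \<rho> z)) =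
      (\<Sum>b\<in>out_arcs G z. cond G (fst b) * (u z - u (head G b)))"
      by (intro sum.cong) (use z in \<open>auto simp: u_def\<close>)
    finally show "(\<Sum>b\<in>out_arcs G z. cond G (fst b) * (u z - u (head G b))) \<le> 0" by simp
  qed (use root that in \<open>auto simp: u_def\<close>)
  moreover have "\<rho> x \<le> 1" if "x \<in> verts G" for x
    using LIMSEQ_le_const2[OF lim[OF that]] return_prob_props[OF that] by auto
  ultimately have one: "\<rho> x = 1" if "x \<in> verts G" "x \<noteq> r" for x using that by (fastforce simp: u_def intro: antisym)
  have "\<rho> r = (\<Sum>a\<in>out_arcs G r. cond G (fst a) * 1) / net_pi G {r}"
    by (subst eq[OF root], intro arg_cong2[where f="(/)"] sum.cong) (use one head_in in auto)
  then show ?thesis using lim[OF root] avg_const[OF root, of 1] by simp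
qed

lemma forest_hit_avg:
  assumes "x \<in> verts G" "x \<notin> R" "R \<noteq> {}" "R \<subseteq> verts G" "Q \<subseteq> R"
  shows "(\<Sum>a\<in>out_arcs G x. cond G (fst a) * forest_hit G R Q (head G a)) / net_pi G {x} = forest_hit G R Q x"
proof -
  have "(\<Sum>a\<in>out_arcs G x. cond G (fst a) * forest_hit G R Q x) = (\<Sum>a\<in>out_arcs G x. cond G (fst a) * forest_hit G R Q (head G a))"
    using forest_hit_harmonic[OF assms] by (simp add: right_diff_distrib sum_subtractf)
  then show ?thesis using avg_const[OF assms(1), of "forest_hit G R Q x"] by simp
qed

text \<open>
  A move that does not enter the path can only have created the path by adding an arc along it; but
  then the head of that arc, the new root, would be on the path.
\<close>

lemma follows_move:
  assumes a: "a \<in> out_arcs G x" and t: "t \<in> forests G {x}" and w: "self_avoiding G u bs v" and "u \<in> verts G"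
    and x: "x \<noteq> v" "head G a \<notin> path_verts G bs v" and f: "follows G (move G t a) bs"
  shows "follows G t bs \<and> x \<notin> path_verts G bs v"
proof -
  have tx: "tail G a = x" using a by (auto simp: out_arcs_def)
  have fl: "t' (tail G b) = b" if "b \<in> set bs" "follows G t' bs" for b t' using that by (auto simp: follows_def)
  have heads: "head G b \<in> path_verts G bs v" if "b \<in> set bs" for b
  proof -
    have "walk G u bs v" using w by (simp add: self_avoiding_def)
    then show ?thesis using that
    proof (induction bs arbitrary: u)
      case (Cons c bs)
      have "b = c \<Longrightarrow> head G b \<in> path_verts G (c # bs) v"
        using Cons.prems by (cases bs) (auto simp: path_verts_def out_arcs_def)
      then show ?case using Cons by (auto simp: path_verts_def)
    qed simp
  qed
  have xn: "x \<notin> path_verts G bs v"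
  proof
    assume "x \<in> path_verts G bs v"
    then obtain b where b: "b \<in> set bs" "tail G b = x" using x(1) by (auto simp: path_verts_def)
    have "move G t a x = a" using tx head_neq[OF a] by (auto simp: move_def)
    then have "b = a" using fl[OF b(1) f] b(2) by simp
    then show False using heads[OF b(1)] x(2) by simp
  qed
  have "t (tail G b) = b" if b: "b \<in> set bs" for b
  proof -
    have "tail G b \<in> path_verts G bs v" using b by (auto simp: path_verts_def)
    then have "tail G b \<noteq> x" "tail G b \<noteq> head G a" using xn x(2) by auto
    then show ?thesis using fl[OF b f] tx by (simp add: move_def)
  qed
  then show ?thesis using xn by (auto simp: follows_def)
qed

text \<open>
  Off \<open>v\<close>, the right-hand side with the capacities replaced by hitting probabilities from the
  current position is harmonic, and at \<open>v\<close> it is at least 1. So it dominates the expectation of \<open>\<phi>\<close>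
  along the excursion. A path that has been entered by the walk is lost, see \<open>follows_move\<close>.
\<close>

lemma one_excursion:
  assumes v: "v \<in> verts G" "v \<noteq> r" and \<Gamma>: "finite \<Gamma>"
    "\<And>bs. bs \<in> \<Gamma> \<Longrightarrow> \<exists>u\<in>verts G. self_avoiding G u bs v" "\<And>bs. bs \<in> \<Gamma> \<Longrightarrow> r \<notin> path_verts G bs v"
    and C: "0 \<le> C" "\<And>bs. bs \<in> \<Gamma> \<Longrightarrow> 0 \<le> \<beta> bs"
    and phi: "\<And>t. t \<in> forests G {r} \<Longrightarrow> 0 \<le> \<phi> t \<and> \<phi> t \<le> 1 \<and> \<phi> t \<le> C + (\<Sum>bs\<in>\<Gamma>. of_bool (follows G t bs) * \<beta> bs)"
    and t: "t \<in> forests G {r}"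
  shows "excursion G r k \<phi> t r \<le> (C + capacity G r {v} / net_pi G {r}) +
     (\<Sum>bs\<in>\<Gamma>. of_bool (follows G t bs) * (\<beta> bs * (1 - capacity G r (path_verts G bs v) / net_pi G {r})))"
proof -
  define hv where "hv = forest_hit G (insert r {v}) {v}"
  define hA where "hA bs = forest_hit G (insert r (path_verts G bs v)) (path_verts G bs v)" for bs
  define B where "B t x = C + hv x + (\<Sum>bs\<in>\<Gamma>. of_bool (follows G t bs) * (\<beta> bs * (1 - hA bs x)))" for t x
  have sub: "insert r (path_verts G bs v) \<subseteq> verts G" if "bs \<in> \<Gamma>" for bs
    using \<Gamma>(2)[OF that] v root walk_tails_in by (auto simp: path_verts_def self_avoiding_def) blast
  have h01: "0 \<le> hv x" "0 \<le> hA bs x" "bs \<in> \<Gamma> \<Longrightarrow> hA bs x \<le> 1" for x bs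
    using forest_hit_nonneg forest_hit_le_1 sub by (auto simp: hv_def hA_def)
  have le1: "excursion G r k \<phi> t x \<le> 1" if "x \<in> verts G" "t \<in> forests G {x}" for t x k
    using excursion_mono[of \<phi> "\<lambda>_. 1" x t k] phi return_prob_props[of x k] that by (auto simp: excursion_1 simp del: excursion.simps return_prob.simps)
  have hr: "hv r = 0" "\<And>bs. bs \<in> \<Gamma> \<Longrightarrow> hA bs r = 0" "hv v = 1"
     and hA1: "\<And>bs x. bs \<in> \<Gamma> \<Longrightarrow> x \<in> path_verts G bs v \<Longrightarrow> hA bs x = 1"
    using sub v root \<Gamma>(3) by (auto simp: hv_def hA_def forest_hit_root)
  have step: "excursion G r (Suc k) \<phi> t x \<le> C + (\<Sum>a\<in>out_arcs G x. cond G (fst a) * hv (head G a)) / net_pi G {x} +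
      (\<Sum>bs\<in>\<Gamma>. of_bool (follows G t bs \<and> x \<notin> path_verts G bs v) * (\<beta> bs * (1 - (\<Sum>a\<in>out_arcs G x. cond G (fst a) * hA bs (head G a)) / net_pi G {x})))"
    if x: "x \<in> verts G" "x \<noteq> v" and t: "t \<in> forests G {x}"
      and IH: "\<And>t x. x \<in> verts G \<Longrightarrow> x \<noteq> r \<Longrightarrow> t \<in> forests G {x} \<Longrightarrow> excursion G r k \<phi> t x \<le> B t x" for x t k
  proof -
    have "(if head G a = r then \<phi> (move G t a) else excursion G r k \<phi> (move G t a) (head G a)) \<le>
        C + hv (head G a) + (\<Sum>bs\<in>\<Gamma>. of_bool (follows G t bs \<and> x \<notin> path_verts G bs v) * (\<beta> bs * (1 - hA bs (head G a))))"
      if a: "a \<in> out_arcs G x" for a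
    proof -
      have mv: "move G t a \<in> forests G {head G a}" by (rule move_forest[OF t a])
      have "(if head G a = r then \<phi> (move G t a) else excursion G r k \<phi> (move G t a) (head G a)) \<le> B (move G t a) (head G a)"
        using IH[OF head_in[OF a] _ mv] phi[of "move G t a"] mv hr by (auto simp: B_def)
      also have "\<dots> \<le> C + hv (head G a) + (\<Sum>bs\<in>\<Gamma>. of_bool (follows G t bs \<and> x \<notin> path_verts G bs v) * (\<beta> bs * (1 - hA bs (head G a))))"
        unfolding B_def
      proof (intro add_left_mono sum_mono)
        fix bs assume bs: "bs \<in> \<Gamma>"
        show "of_bool (follows G (move G t a) bs) * (\<beta> bs * (1 - hA bs (head G a))) \<le>
            of_bool (follows G t bs \<and> x \<notin> path_verts G bs v) * (\<beta> bs * (1 - hA bs (head G a)))"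
        proof (cases "follows G (move G t a) bs \<and> head G a \<notin> path_verts G bs v")
          case True
          then show ?thesis using follows_move[OF a t _ _ x(2)] \<Gamma>(2)[OF bs] by auto
        next
          case False
          moreover have "0 \<le> \<beta> bs * (1 - hA bs (head G a))" using C(2)[OF bs] h01(3)[OF bs] by simp
          ultimately show ?thesis using hA1[OF bs] by auto
        qed
      qed
      finally show ?thesis .
    qed
    then have "excursion G r (Suc k) \<phi> t x \<le> (\<Sum>a\<in>out_arcs G x. cond G (fst a) *
       (C + hv (head G a) + (\<Sum>bs\<in>\<Gamma>. of_bool (follows G t bs \<and> x \<notin> path_verts G bs v) * (\<beta> bs * (1 - hA bs (head G a)))))) / net_pi G {x}"
      unfolding excursion.simps by (intro avg_mono x(1))
    also have "\<dots> = (\<Sum>a\<in>out_arcs G x. cond G (fst a) * C) / net_pi G {x} + (\<Sum>a\<in>out_arcs G x. cond G (fst a) * hv (head G a)) / net_pi G {x} +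
      (\<Sum>a\<in>out_arcs G x. \<Sum>bs\<in>\<Gamma>. cond G (fst a) * (of_bool (follows G t bs \<and> x \<notin> path_verts G bs v) * (\<beta> bs * (1 - hA bs (head G a))))) / net_pi G {x}"
      by (simp only: distrib_left sum.distrib add_divide_distrib sum_distrib_left)
    also have "(\<Sum>a\<in>out_arcs G x. \<Sum>bs\<in>\<Gamma>. cond G (fst a) * (of_bool (follows G t bs \<and> x \<notin> path_verts G bs v) * (\<beta> bs * (1 - hA bs (head G a))))) / net_pi G {x} =
      (\<Sum>bs\<in>\<Gamma>. of_bool (follows G t bs \<and> x \<notin> path_verts G bs v) * (\<beta> bs * ((\<Sum>a\<in>out_arcs G x. cond G (fst a) * (1 - hA bs (head G a))) / net_pi G {x})))"
      by (subst sum.swap) (simp only: sum_distrib_left sum_divide_distrib ac_simps times_divide_eq_right times_divide_eq_left)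
    also have "\<dots> = (\<Sum>bs\<in>\<Gamma>. of_bool (follows G t bs \<and> x \<notin> path_verts G bs v) * (\<beta> bs * (1 - (\<Sum>a\<in>out_arcs G x. cond G (fst a) * hA bs (head G a)) / net_pi G {x})))"
      using avg_const[OF x(1), of 1] by (simp add: right_diff_distrib sum_subtractf diff_divide_distrib)
    finally show ?thesis using avg_const[OF x(1), of C] by simp
  qed
  have main: "excursion G r k \<phi> t x \<le> B t x" if "x \<in> verts G" "x \<noteq> r" "t \<in> forests G {x}" for k t x
    using that
  proof (induction k arbitrary: t x)
    case 0
    have "0 \<le> B t x" unfolding B_def using C h01 by (intro add_nonneg_nonneg sum_nonneg) auto
    then show ?case by simp
  next
    case (Suc k)
    show ?case
    proof (cases "x = v")
      case True
      have "1 \<le> B t v" unfolding B_def hr using C h01 sum_nonneg[of \<Gamma> "\<lambda>bs. of_bool (follows G t bs) * (\<beta> bs * (1 - hA bs v))"] by auto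
      then show ?thesis using le1[OF Suc.prems(1,3)] True order_trans by blast
    next
      case False
      have avv: "(\<Sum>a\<in>out_arcs G x. cond G (fst a) * hv (head G a)) / net_pi G {x} = hv x"
        unfolding hv_def by (rule forest_hit_avg) (use Suc.prems False v root in auto)
      have avA: "(\<Sum>a\<in>out_arcs G x. cond G (fst a) * hA bs (head G a)) / net_pi G {x} = hA bs x" if "bs \<in> \<Gamma>" "x \<notin> path_verts G bs v" for bs
        unfolding hA_def by (rule forest_hit_avg) (use Suc.prems sub[OF that(1)] that in auto)
      have eqA: "(\<Sum>bs\<in>\<Gamma>. of_bool (follows G t bs \<and> x \<notin> path_verts G bs v) *
            (\<beta> bs * (1 - (\<Sum>a\<in>out_arcs G x. cond G (fst a) * hA bs (head G a)) / net_pi G {x}))) =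
          (\<Sum>bs\<in>\<Gamma>. of_bool (follows G t bs \<and> x \<notin> path_verts G bs v) * (\<beta> bs * (1 - hA bs x)))"
      proof (rule sum.cong[OF refl])
        fix bs assume "bs \<in> \<Gamma>"
        then show "of_bool (follows G t bs \<and> x \<notin> path_verts G bs v) *
            (\<beta> bs * (1 - (\<Sum>a\<in>out_arcs G x. cond G (fst a) * hA bs (head G a)) / net_pi G {x})) =
            of_bool (follows G t bs \<and> x \<notin> path_verts G bs v) * (\<beta> bs * (1 - hA bs x))"
          using avA[of bs] by (cases "x \<in> path_verts G bs v") simp_all
      qed
      have "excursion G r (Suc k) \<phi> t x \<le> C + hv x +
         (\<Sum>bs\<in>\<Gamma>. of_bool (follows G t bs \<and> x \<notin> path_verts G bs v) * (\<beta> bs * (1 - hA bs x)))"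
        using step[of x t k, OF Suc.prems(1) False Suc.prems(3) Suc.IH] unfolding avv eqA by blast
      also have "\<dots> \<le> B t x" unfolding B_def
        using C h01 by (intro add_left_mono sum_mono mult_right_mono) auto
      finally show ?thesis .
    qed
  qed
  show ?thesis
  proof (cases k)
    case 0
    have "capacity G r (path_verts G bs v) \<le> net_pi G {r}" if "bs \<in> \<Gamma>" for bs
      unfolding capacity_def net_pi_single using cond_pos h01(3)[OF that]
      by (intro sum_mono) (auto simp: hA_def intro!: mult_left_le less_imp_le)
    moreover have "0 \<le> capacity G r {v}" unfolding capacity_def using cond_pos forest_hit_nonneg by (intro sum_nonneg mult_nonneg_nonneg) (auto intro: less_imp_le)
    ultimately show ?thesis using 0 C pi_pos[OF root]
      by (auto intro!: add_nonneg_nonneg sum_nonneg mult_nonneg_nonneg divide_nonneg_nonneg)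
  next
    case (Suc k')
    have "excursion G r k \<phi> t r \<le> C + (\<Sum>a\<in>out_arcs G r. cond G (fst a) * hv (head G a)) / net_pi G {r} +
      (\<Sum>bs\<in>\<Gamma>. of_bool (follows G t bs \<and> r \<notin> path_verts G bs v) * (\<beta> bs * (1 - (\<Sum>a\<in>out_arcs G r. cond G (fst a) * hA bs (head G a)) / net_pi G {r})))"
      unfolding Suc by (rule step[OF root _ t main]) (use v in auto)
    then show ?thesis using \<Gamma>(3) unfolding hv_def hA_def capacity_def by (auto cong: sum.cong)
  qed
qed

lemma capacity_le_pi: assumes "A \<subseteq> verts G" shows "0 \<le> capacity G r A" "capacity G r A \<le> net_pi G {r}"
proof -
  show "0 \<le> capacity G r A" unfolding capacity_def using cond_pos forest_hit_nonneg by (intro sum_nonneg mult_nonneg_nonneg) (auto intro: less_imp_le)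
  show "capacity G r A \<le> net_pi G {r}" unfolding capacity_def net_pi_single
    using cond_pos forest_hit_le_1[of "insert r A"] assms root
      by (intro sum_mono) (auto intro!: mult_left_le less_imp_le)
qed

text \<open>
  Iterate \<open>one_excursion\<close>, starting from the indicator of the event, and use that truncated excursions
  nearly preserve the law of the tree; then remove the truncation.
\<close>

theorem thinning:
  assumes v: "v \<in> verts G" "v \<noteq> r" and \<Gamma>: "finite \<Gamma>"
    "\<And>bs. bs \<in> \<Gamma> \<Longrightarrow> \<exists>u\<in>verts G. self_avoiding G u bs v" "\<And>bs. bs \<in> \<Gamma> \<Longrightarrow> r \<notin> path_verts G bs v"
  shows "tree_prob G r (\<lambda>t. \<exists>bs\<in>\<Gamma>. follows G t bs) \<le> real M * capacity G r {v} / net_pi G {r} +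
    (\<Sum>bs\<in>\<Gamma>. tree_prob G r (\<lambda>t. follows G t bs) * (1 - capacity G r (path_verts G bs v) / net_pi G {r}) ^ M)"
proof -
  define q where "q bs = 1 - capacity G r (path_verts G bs v) / net_pi G {r}" for bs
  have sub: "path_verts G bs v \<subseteq> verts G" if "bs \<in> \<Gamma>" for bs
    using \<Gamma>(2)[OF that] v root walk_tails_in by (auto simp: path_verts_def self_avoiding_def) blast
  have q0: "0 \<le> q bs" if "bs \<in> \<Gamma>" for bs
    using capacity_le_pi[OF sub[OF that]] pi_pos[OF root] by (simp add: q_def)
  define f where "f t = (of_bool (\<exists>bs\<in>\<Gamma>. follows G t bs) :: real)" for t
  (* The expectation of \<open>f\<close> after \<open>n\<close> truncated excursions, as a function of the initial tree. *)
  define g where "g k = rec_nat f (\<lambda>_ \<phi> t. excursion G r k \<phi> t r)" for k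
  have g_simps: "g k 0 = f" "g k (Suc n) = (\<lambda>t. excursion G r k (g k n) t r)" for k n
    by (simp_all add: g_def)
  have bd: "0 \<le> g k n t \<and> g k n t \<le> 1 \<and> g k n t \<le> real n * (capacity G r {v} / net_pi G {r}) +
     (\<Sum>bs\<in>\<Gamma>. of_bool (follows G t bs) * q bs ^ n)" if "t \<in> forests G {r}" for k n t
    using that
  proof (induction n arbitrary: t)
    case 0
    have "f t \<le> (\<Sum>bs\<in>\<Gamma>. of_bool (follows G t bs))"
    proof (cases "\<exists>bs\<in>\<Gamma>. follows G t bs")
      case True
      then obtain bs where bs: "bs \<in> \<Gamma>" "follows G t bs" by blast
      have "of_bool (follows G t bs) \<le> (\<Sum>bs\<in>\<Gamma>. of_bool (follows G t bs) :: real)"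
        by (rule member_le_sum) (use bs \<Gamma>(1) in auto)
      then show ?thesis using bs by (simp add: f_def)
    qed (auto simp: f_def sum_nonneg)
    then show ?case by (simp add: g_simps f_def[of t] del: sum_of_bool_eq)
  next
    case (Suc n)
    have "excursion G r k (g k n) t r \<le> (real n * (capacity G r {v} / net_pi G {r}) + capacity G r {v} / net_pi G {r}) +
     (\<Sum>bs\<in>\<Gamma>. of_bool (follows G t bs) * (q bs ^ n * (1 - capacity G r (path_verts G bs v) / net_pi G {r})))"
      by (rule one_excursion[OF v \<Gamma> _ _ Suc.IH Suc.prems])
         (use q0 capacity_le_pi[of "{v}"] pi_pos[OF root] v in auto)
    moreover have "0 \<le> excursion G r k (g k n) t r"
      using Suc by (intro excursion_nonneg root) auto
    moreover have "excursion G r k (g k n) t r \<le> 1"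
      using excursion_mono[of "g k n" "\<lambda>_. 1" r t k] Suc return_prob_props[OF root, of k] root by (auto simp: excursion_1 simp del: excursion.simps return_prob.simps)
    moreover have "(\<Sum>bs\<in>\<Gamma>. of_bool (follows G t bs) * (q bs ^ n * (1 - capacity G r (path_verts G bs v) / net_pi G {r}))) =
       (\<Sum>bs\<in>\<Gamma>. of_bool (follows G t bs) * q bs ^ Suc n)"
      by (intro sum.cong) (simp_all add: q_def mult.commute)
    moreover have "real n * (capacity G r {v} / net_pi G {r}) + capacity G r {v} / net_pi G {r} = real (Suc n) * (capacity G r {v} / net_pi G {r})"
      by (simp add: ring_distribs add_divide_distrib)
    ultimately show ?case unfolding g_simps by simp
  qed
  (* Substationarity is applied to \<open>1 - g k n\<close>, which turns it into a lower bound. *)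
  have step: "(\<Sum>t\<in>forests G {r}. forest_weight G {r} t * f t) \<le> (\<Sum>t\<in>forests G {r}. forest_weight G {r} t * g k n t) + real n * (1 - return_prob G r k r) * forest_sum G {r}" for k n
  proof (induction n)
    case 0 then show ?case by (simp add: g_simps)
  next
    case (Suc n)
    have "(\<Sum>t\<in>forests G {r}. forest_weight G {r} t * excursion G r k (\<lambda>t. 1 - g k n t) t r) \<le> (\<Sum>t\<in>forests G {r}. forest_weight G {r} t * (1 - g k n t))"
      using bd[of _ k n] by (intro excursion_substationary) auto
    then have "(\<Sum>t\<in>forests G {r}. forest_weight G {r} t * g k n t) \<le> (\<Sum>t\<in>forests G {r}. forest_weight G {r} t * g k (Suc n) t) + (1 - return_prob G r k r) * forest_sum G {r}"
    proof -
      assume "(\<Sum>t\<in>forests G {r}. forest_weight G {r} t * excursion G r k (\<lambda>t. 1 - g k n t) t r) \<le> (\<Sum>t\<in>forests G {r}. forest_weight G {r} t * (1 - g k n t))"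
      moreover have "(\<Sum>t\<in>forests G {r}. forest_weight G {r} t * excursion G r k (\<lambda>t. 1 - g k n t) t r) =
          return_prob G r k r * forest_sum G {r} - (\<Sum>t\<in>forests G {r}. forest_weight G {r} t * g k (Suc n) t)"
        unfolding excursion_diff excursion_1 g_simps right_diff_distrib sum_subtractf forest_sum_def sum_distrib_left by (simp only: mult.commute)
      moreover have "(\<Sum>t\<in>forests G {r}. forest_weight G {r} t * (1 - g k n t)) = forest_sum G {r} - (\<Sum>t\<in>forests G {r}. forest_weight G {r} t * g k n t)"
        unfolding right_diff_distrib sum_subtractf forest_sum_def by simp
      ultimately show ?thesis by (simp add: algebra_simps)
    qed
    then show ?case using Suc by (simp add: algebra_simps)
  qed
  define RHS where "RHS = real M * (capacity G r {v} / net_pi G {r}) + (\<Sum>bs\<in>\<Gamma>. tree_prob G r (\<lambda>t. follows G t bs) * q bs ^ M)"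
  have "tree_prob G r (\<lambda>t. \<exists>bs\<in>\<Gamma>. follows G t bs) \<le> RHS + real M * (1 - return_prob G r k r)" for k
  proof -
    have "(\<Sum>t\<in>forests G {r}. forest_weight G {r} t * g k M t) \<le>
       (\<Sum>t\<in>forests G {r}. forest_weight G {r} t * (real M * (capacity G r {v} / net_pi G {r}) + (\<Sum>bs\<in>\<Gamma>. of_bool (follows G t bs) * q bs ^ M)))"
      using bd forest_weight_pos by (intro sum_mono mult_left_mono) (auto intro: less_imp_le)
    also have "\<dots> = forest_sum G {r} * (real M * (capacity G r {v} / net_pi G {r})) + (\<Sum>bs\<in>\<Gamma>. (\<Sum>t\<in>forests G {r}. forest_weight G {r} t * of_bool (follows G t bs)) * q bs ^ M)"
      unfolding forest_sum_def distrib_left sum.distrib sum_distrib_right sum_distrib_left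
      by (subst (2) sum.swap) (simp only: ac_simps)
    also have "\<dots> = forest_sum G {r} * RHS"
      using Zpos by (simp only: RHS_def tree_prob_def distrib_left sum_distrib_left) (simp add: divide_simps)
    finally have "(\<Sum>t\<in>forests G {r}. forest_weight G {r} t * f t) \<le> forest_sum G {r} * RHS + real M * (1 - return_prob G r k r) * forest_sum G {r}"
      using step[where n = M and k = k] by simp
    then show ?thesis using Zpos unfolding tree_prob_def f_def
      by (subst pos_divide_le_eq) (auto simp: algebra_simps)
  qed
  moreover have "(\<lambda>k. RHS + real M * (1 - return_prob G r k r)) \<longlonglongrightarrow> RHS + real M * (1 - 1)"
    by (intro tendsto_intros return_prob_tendsto_1)
  ultimately have "tree_prob G r (\<lambda>t. \<exists>bs\<in>\<Gamma>. follows G t bs) \<le> RHS + real M * (1 - 1)"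
    by (intro LIMSEQ_le_const) auto
  then show ?thesis by (simp add: RHS_def q_def)
qed

end

section \<open>Self-avoiding paths and cycles\<close>

lemma heads_path_verts: "walk G u bs v \<Longrightarrow> b \<in> set bs \<Longrightarrow> head G b \<in> path_verts G bs v"
proof (induction bs arbitrary: u)
  case (Cons c bs)
  have "b = c \<Longrightarrow> head G b \<in> path_verts G (c # bs) v"
    using Cons.prems by (cases bs) (auto simp: path_verts_def out_arcs_def)
  then show ?case using Cons by (auto simp: path_verts_def)
qed simp

lemma walk_append: "walk G x (bs @ cs) z \<longleftrightarrow> (\<exists>y. walk G x bs y \<and> walk G y cs z)"
  by (induction bs arbitrary: x) auto

lemma walk_shorten:
  assumes "walk G x bs y"
  shows "\<exists>bs'. self_avoiding G x bs' y \<and> set bs' \<subseteq> set bs"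
  using assms
proof (induction bs arbitrary: x)
  case Nil
  then show ?case by (intro exI[of _ "[]"]) (auto simp: self_avoiding_def)
next
  case (Cons a bs)
  then obtain cs where cs: "self_avoiding G (head G a) cs y" "set cs \<subseteq> set bs" by auto
  have a: "a \<in> out_arcs G x" "tail G a = x" using Cons.prems by (auto simp: out_arcs_def)
  consider "x = y" | "x \<noteq> y" "x \<in> tail G ` set cs" | "x \<noteq> y" "x \<notin> tail G ` set cs" by blast
  then show ?case
  proof cases
    case 1
    then show ?thesis by (intro exI[of _ "[]"]) (auto simp: self_avoiding_def)
  next
    case 2
    then obtain b ds es where b: "cs = ds @ b # es" "tail G b = x" by (auto simp: in_set_conv_decomp)
    have "walk G x (b # es) y" using cs(1) b by (auto simp: self_avoiding_def walk_append out_arcs_def)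
    moreover have "distinct (map (tail G) (b # es) @ [y])" using cs(1) b by (auto simp: self_avoiding_def)
    ultimately show ?thesis using cs b by (intro exI[of _ "b # es"]) (auto simp: self_avoiding_def)
  next
    case 3
    then show ?thesis using cs a by (intro exI[of _ "a # cs"]) (auto simp: self_avoiding_def)
  qed
qed

lemma walk_of_rtrancl:
  assumes "(x, y) \<in> (adjacency G)\<^sup>*"
  shows "\<exists>bs. walk G x bs y"
  using assms
proof (induction rule: converse_rtrancl_induct)
  case base
  then show ?case by (intro exI[of _ "[]"]) simp
next
  case (step x z)
  then obtain a bs where "a \<in> out_arcs G x" "head G a = z" "walk G z bs y" by (auto simp: adjacency_iff_arc)
  then show ?case by (intro exI[of _ "a # bs"]) simp
qed

lemma rtrancl_of_walk: "walk G x bs y \<Longrightarrow> (x, y) \<in> (adjacency G)\<^sup>*"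
proof (induction bs arbitrary: x)
  case (Cons a bs)
  then have "(x, head G a) \<in> adjacency G" "(head G a, y) \<in> (adjacency G)\<^sup>*" by (auto simp: adjacency_iff_arc)
  then show ?case by (rule converse_rtrancl_into_rtrancl)
qed simp

lemma sym_adjacency: "sym (adjacency G)"
  by (auto simp: sym_def adjacency_def insert_commute)

lemma adjacency_rtrancl_sym: "(x, y) \<in> (adjacency G)\<^sup>* \<Longrightarrow> (y, x) \<in> (adjacency G)\<^sup>*"
  using sym_rtrancl[OF sym_adjacency] by (rule symD)

lemma self_avoiding_distinct_edges:
  assumes "self_avoiding G x bs y"
  shows "distinct (map fst bs)"
  using assms
proof (induction bs arbitrary: x)
  case (Cons b bs)
  have b: "tail G b = x" and w: "walk G (head G b) bs y" and d: "distinct (map (tail G) bs @ [y])" "x \<notin> path_verts G bs y"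
    using Cons.prems by (auto simp: self_avoiding_def out_arcs_def path_verts_def)
  have "fst c \<noteq> fst b" if c: "c \<in> set bs" for c
  proof
    assume "fst c = fst b"
    then have "tail G b \<in> {tail G c, head G c}" using ends_fst[of G b] ends_fst[of G c] by auto
    then show False using heads_path_verts[OF w c] c d b by (auto simp: path_verts_def)
  qed
  moreover have "distinct (map fst bs)" using Cons.IH[of "head G b"] w d by (simp add: self_avoiding_def)
  ultimately show ?case by auto (metis fst_conv)
qed simp

lemma walk_nth:
  "walk G x bs y \<Longrightarrow> i < length bs \<Longrightarrow>
     ends G (fst (bs ! i)) = {(map (tail G) bs @ [y]) ! i, (map (tail G) bs @ [y]) ! Suc i}"
proof (induction bs arbitrary: x i)
  case (Cons b bs)
  show ?case
  proof (cases i)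
    case 0
    have "head G b = (map (tail G) bs @ [y]) ! 0"
      using Cons.prems by (cases bs) (auto simp: out_arcs_def)
    then show ?thesis using 0 by (simp add: ends_fst)
  next
    case (Suc j)
    then show ?thesis using Cons by auto
  qed
qed simp

text \<open>
  An edge outside a self-avoiding path that joins its ends closes a cycle.
\<close>

lemma cycle_of_path:
  assumes p: "self_avoiding G x bs y" and xV: "x \<in> verts G" "is_network G" and bs: "fst ` set bs \<subseteq> edges G"
    and e: "e \<in> edges G" "e \<notin> fst ` set bs" "ends G e = {x, y}"
  shows "cycle G (map (tail G) bs @ [y]) (map fst bs @ [e])"
proof -
  have w: "walk G x bs y" using p by (simp add: self_avoiding_def)
  have x0: "(map (tail G) bs @ [y]) ! 0 = x" using w by (cases bs) (auto simp: out_arcs_def)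
  have "ends G ((map fst bs @ [e]) ! i) =
     {(map (tail G) bs @ [y]) ! i, (map (tail G) bs @ [y]) ! (Suc i mod length (map (tail G) bs @ [y]))}"
    if i: "i < length (map (tail G) bs @ [y])" for i
  proof (cases "i < length bs")
    case True
    then show ?thesis using walk_nth[OF w True] by (simp add: nth_append)
  next
    case False
    then have "i = length bs" using i by simp
    moreover have "(map fst bs @ [e]) ! length bs = e" "(map (tail G) bs @ [y]) ! length bs = y"
      by (simp_all add: nth_append)
    ultimately show ?thesis using e(3) x0 by (simp add: insert_commute)
  qed
  moreover have "set (map (tail G) bs @ [y]) \<subseteq> verts G"
  proof -
    have *: "z \<in> verts G" if "(x, z) \<in> (adjacency G)\<^sup>*" for z
      using that xV by (induction) (auto simp: adjacency_def ends_def is_network_def doubleton_eq_iff)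
    have "tail G ` set bs \<subseteq> verts G"
      using bs xV by (auto simp: is_network_def tail_def)
    then show ?thesis using *[OF rtrancl_of_walk[OF w]] by auto
  qed
  ultimately show ?thesis
    using p self_avoiding_distinct_edges[OF p] e bs unfolding cycle_def self_avoiding_def by auto
qed

section \<open>Spanning trees as rooted trees\<close>

definition tree_edges :: "('v, 'e) network \<Rightarrow> 'v \<Rightarrow> ('v \<Rightarrow> 'e \<times> bool) \<Rightarrow> 'e set" where
  "tree_edges G r t = (\<lambda>x. fst (t x)) ` (verts G - {r})"

text \<open>
  The distance to the root along the exit arcs.
\<close>

definition height :: "('v, 'e) network \<Rightarrow> 'v \<Rightarrow> ('v \<Rightarrow> 'e \<times> bool) \<Rightarrow> 'v \<Rightarrow> nat" where
  "height G r t x = (LEAST n. ((\<lambda>y. head G (t y)) ^^ n) x = r)"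

lemma height_less:
  assumes "leads_to G {r} {r} t x" "x \<noteq> r"
  shows "height G r t (head G (t x)) < height G r t x"
proof -
  have "\<exists>n. ((\<lambda>y. head G (t y)) ^^ n) x = r"
    using assms(1)
  proof (induction rule: leads_to.induct)
    case (leads_to_root x) then show ?case by (intro exI[of _ 0]) simp
  next
    case (leads_to_step x)
    then obtain n where "((\<lambda>y. head G (t y)) ^^ n) (head G (t x)) = r" by blast
    then show ?case by (intro exI[of _ "Suc n"]) (simp only: funpow_Suc_right o_apply)
  qed
  then have L: "((\<lambda>y. head G (t y)) ^^ height G r t x) x = r" unfolding height_def by (rule LeastI_ex)
  then obtain m where m: "height G r t x = Suc m" using assms(2) by (cases "height G r t x") auto
  then have "((\<lambda>y. head G (t y)) ^^ m) (head G (t x)) = r" using L by (simp only: funpow_Suc_right o_apply)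
  then have "height G r t (head G (t x)) \<le> m" unfolding height_def by (rule Least_le)
  then show ?thesis using m by simp
qed

context fin_net
begin

lemma arc_eqI: "a \<in> out_arcs G x \<Longrightarrow> b \<in> out_arcs G x \<Longrightarrow> fst a = fst b \<Longrightarrow> a = b"
  using loopless[of "fst a"] by (cases a; cases b) (auto simp: out_arcs_def oriented_edges_def tail_def split: if_splits)

lemma tree_edges_sub: "t \<in> forests G {r} \<Longrightarrow> tree_edges G r t \<subseteq> edges G"
  by (auto simp: tree_edges_def dest!: forest_out intro: out_arcsD)

lemma tree_connected:
  assumes t: "t \<in> forests G {r}" and r: "r \<in> verts G"
  shows "net_connected (G\<lparr>edges := tree_edges G r t\<rparr>)"
proof -
  let ?T = "G\<lparr>edges := tree_edges G r t\<rparr>"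
  have "(x, r) \<in> (adjacency ?T)\<^sup>*" if "x \<in> verts G" for x
    using forest_leads_to[OF t that] that
  proof (induction rule: leads_to.induct)
    case (leads_to_root x) then show ?case by auto
  next
    case (leads_to_step x)
    have o: "t x \<in> out_arcs G x" using forest_out[OF t] leads_to_step by auto
    have "(x, head G (t x)) \<in> adjacency ?T"
      using o leads_to_step ends_fst[of G "t x"]
      by (auto simp: adjacency_def tree_edges_def out_arcs_def ends_def)
    then show ?case using leads_to_step head_in[OF o] by (meson converse_rtrancl_into_rtrancl)
  qed
  then have "(x, y) \<in> (adjacency ?T)\<^sup>*" if "x \<in> verts G" "y \<in> verts G" for x y
    using that adjacency_rtrancl_sym[of y r ?T] by (meson rtrancl_trans)
  then show ?thesis using r by (auto simp: net_connected_def)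
qed

text \<open>
  Each edge of the tree is the exit arc of its higher endpoint.
\<close>

lemma tree_parent_edge:
  assumes t: "t \<in> forests G {r}" and e: "e \<in> tree_edges G r t" "ends G e = {x, y}" "x \<noteq> r \<Longrightarrow> e \<noteq> fst (t x)"
  shows "y \<in> verts G - {r} \<and> head G (t y) = x \<and> e = fst (t y) \<and> height G r t x < height G r t y"
proof -
  obtain z where z: "z \<in> verts G" "z \<noteq> r" "e = fst (t z)" using e(1) by (auto simp: tree_edges_def)
  have tz: "t z \<in> out_arcs G z" using forest_out[OF t] z by auto
  have en: "{z, head G (t z)} = {x, y}" using e(2) z(3) ends_fst[of G "t z"] tz by (simp add: out_arcs_def)
  have "z \<noteq> x" using z e(3) by auto
  then have "z = y" "head G (t z) = x" using en by (auto simp: doubleton_eq_iff)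
  then show ?thesis using z height_less[OF forest_leads_to[OF t z(1)] z(2)] by auto
qed

text \<open>
  Both edges of a cycle at a vertex of maximal height would be its exit arc.
\<close>

lemma tree_acyclic:
  assumes t: "t \<in> forests G {r}" and c: "cycle (G\<lparr>edges := tree_edges G r t\<rparr>) xs es"
  shows False
proof -
  let ?n = "length xs"
  have c': "xs \<noteq> []" "length es = ?n" "distinct xs" "distinct es" "set es \<subseteq> tree_edges G r t"
    "\<And>i. i < ?n \<Longrightarrow> ends G (es ! i) = {xs ! i, xs ! (Suc i mod ?n)}"
    using c by (auto simp: cycle_def ends_def)
  obtain x where x: "x \<in> set xs" "\<And>y. y \<in> set xs \<Longrightarrow> height G r t y \<le> height G r t x"
  proof -
    have "Max (height G r t ` set xs) \<in> height G r t ` set xs" using c'(1) by (intro Max_in) auto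
    then obtain x where "x \<in> set xs" "height G r t x = Max (height G r t ` set xs)" by auto
    then show ?thesis using that[of x] by (metis List.finite_set Max_ge finite_imageI image_eqI)
  qed
  have own: "e = fst (t x)" if e: "e \<in> set es" "ends G e = {x, y}" "y \<in> set xs" for e y
  proof (rule ccontr)
    assume "e \<noteq> fst (t x)"
    then have "height G r t x < height G r t y" using tree_parent_edge[OF t _ e(2)] e c' by blast
    then show False using x(2)[OF e(3)] by simp
  qed
  obtain i where i: "i < ?n" "xs ! i = x" using x(1) by (auto simp: in_set_conv_nth)
  (* The predecessor of \<open>i\<close> on the cycle. *)
  define j where "j = (if i = 0 then ?n - 1 else i - 1)"
  have j: "j < ?n" "Suc j mod ?n = i" using i by (auto simp: j_def)
  have 1: "es ! i = fst (t x)"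
    by (rule own[of _ "xs ! (Suc i mod ?n)"]) (use i c' in auto)
  have 2: "es ! j = fst (t x)"
    by (rule own[of _ "xs ! j"]) (use i j c' in \<open>auto simp: insert_commute\<close>)
  have ij: "i = j" using 1 2 c' i j by (metis nth_eq_iff_index_eq)
  then have "Suc i mod ?n = i" using j by simp
  then have "ends G (es ! i) = {x}" using c'(6)[OF i(1)] i by simp
  moreover have "es ! i \<in> edges G" using c'(2,5) i tree_edges_sub[OF t] nth_mem[of i es] by (metis subsetD)
  ultimately show False using loopless[of "es ! i"] by (auto simp: ends_def doubleton_eq_iff)
qed

text \<open>
  If the exit arcs of \<open>x\<close> differ in two trees with the same edges, then so do those of its parent in the
  first tree. By induction on the height this cannot happen.
\<close>

lemma tree_edges_inj: "inj_on (tree_edges G r) (forests G {r})"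
proof (rule inj_onI)
  fix t t' assume t: "t \<in> forests G {r}" "t' \<in> forests G {r}" and eq: "tree_edges G r t = tree_edges G r t'"
  have "t x = t' x" if "x \<in> verts G" "x \<noteq> r" for x
    using that
  proof (induction "height G r t x" arbitrary: x rule: less_induct)
    case less
    let ?e = "fst (t x)"
    have o: "t x \<in> out_arcs G x" "t' x \<in> out_arcs G x" using forest_out t less.prems by auto
    have e: "?e \<in> tree_edges G r t'" using less.prems unfolding eq[symmetric] by (auto simp: tree_edges_def)
    show ?case
    proof (cases "?e = fst (t' x)")
      case True
      then show ?thesis using o by (intro arc_eqI)
    next
      case False
      have "ends G ?e = {x, head G (t x)}" using ends_fst[of G "t x"] o by (simp add: out_arcs_def)
      then have z: "head G (t x) \<in> verts G - {r}" "head G (t' (head G (t x))) = x"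
        using tree_parent_edge[OF t(2) e _ False] by auto
      have l: "height G r t (head G (t x)) < height G r t x"
        using height_less forest_leads_to t less.prems by metis
      then have "t (head G (t x)) = t' (head G (t x))" using less.hyps z by auto
      then have "height G r t x < height G r t (head G (t x))"
        using height_less[OF forest_leads_to[OF t(1)], of "head G (t x)"] z by auto
      then show ?thesis using l by simp
    qed
  qed
  moreover have "t x = t' x" if "\<not> (x \<in> verts G \<and> x \<noteq> r)" for x
    using t that by (auto simp: forests_def PiE_iff extensional_def)
  ultimately show "t = t'" by blast
qed

text \<open>
  Orient a spanning tree towards \<open>r\<close> by choosing a rooted forest inside it. An edge not used by that
  forest would close a cycle.
\<close>

lemma tree_edges_image:
  assumes r: "r \<in> verts G"
  shows "tree_edges G r ` forests G {r} = spanning_trees G"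
proof
  show "tree_edges G r ` forests G {r} \<subseteq> spanning_trees G"
    using tree_connected[OF _ r] tree_acyclic subsetD[OF tree_edges_sub] by (auto simp: spanning_trees_def is_tree_def)
  show "spanning_trees G \<subseteq> tree_edges G r ` forests G {r}"
  proof
    fix F assume F: "F \<in> spanning_trees G"
    let ?F = "G\<lparr>edges := F\<rparr>"
    have F': "F \<subseteq> edges G" "net_connected ?F" "\<And>xs es. \<not> cycle ?F xs es"
      using F by (auto simp: spanning_trees_def is_tree_def)
    interpret F: fin_net ?F
      using network F' fin_verts finite_subset[OF F'(1) fin_edges] loopless
      by unfold_locales (auto simp: is_network_def)
    have "0 < forest_sum ?F {r}" using r by (intro F.forest_sum_pos) auto
    then have "forests ?F {r} \<noteq> {}" by (auto simp: forest_sum_def)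
    then obtain t where t: "t \<in> forests ?F {r}" by blast
    have oF: "out_arcs ?F x \<subseteq> out_arcs G x" for x
      using F'(1) by (auto simp: out_arcs_def oriented_edges_def tail_def)
    have hF: "head ?F = head G" by (auto simp: head_def fun_eq_iff)
    have gF: "leads_to ?F R Q t x \<Longrightarrow> leads_to G R Q t x" for R Q x
      by (induction rule: leads_to.induct) (auto simp: hF intro: leads_to.leads_to_step)
    have tG: "t \<in> forests G {r}" using t oF gF by (fastforce simp: forests_def PiE_iff)
    have sub: "tree_edges G r t \<subseteq> F" using t by (auto simp: tree_edges_def forests_def out_arcs_def oriented_edges_def PiE_iff mem_Times_iff)
    have "F \<subseteq> tree_edges G r t"
    proof
      fix e assume e: "e \<in> F"
      show "e \<in> tree_edges G r t"
      proof (rule ccontr)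
        assume ne: "e \<notin> tree_edges G r t"
        let ?T = "G\<lparr>edges := tree_edges G r t\<rparr>"
        have v: "src G e \<in> verts G" "dst G e \<in> verts G" using e F'(1) network by (auto simp: is_network_def)
        then have "(src G e, dst G e) \<in> (adjacency ?T)\<^sup>*" using tree_connected[OF tG r] by (auto simp: net_connected_def)
        then obtain bs where bs: "self_avoiding ?T (src G e) bs (dst G e)"
          using walk_of_rtrancl walk_shorten by metis
        have bse: "fst ` set bs \<subseteq> tree_edges G r t"
        proof -
          have "walk ?T u cs w \<Longrightarrow> fst ` set cs \<subseteq> tree_edges G r t" for u w cs
            by (induction cs arbitrary: u) (auto simp: out_arcs_def oriented_edges_def)
          moreover have "walk ?T (src G e) bs (dst G e)" using bs by (simp add: self_avoiding_def)
          ultimately show ?thesis by blast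
        qed
        have wF: "walk ?T u cs w \<Longrightarrow> walk ?F u cs w" for u w cs
          using sub by (induction cs arbitrary: u) (auto simp: out_arcs_def oriented_edges_def tail_def head_def)
        have "self_avoiding ?F (src G e) bs (dst G e)"
        proof -
          have "tail ?F = tail ?T" by (simp add: tail_def fun_eq_iff)
          then show ?thesis using bs wF by (simp add: self_avoiding_def)
        qed
        then have "cycle ?F (map (tail ?F) bs @ [dst G e]) (map fst bs @ [e])"
          using e v bse sub ne F.network by (intro cycle_of_path) (auto simp: ends_def)
        then show False using F'(3) by blast
      qed
    qed
    then show "F \<in> tree_edges G r ` forests G {r}" using sub tG by auto
  qed
qed

lemma prod_tree_edges:
  assumes t: "t \<in> forests G {r}"
  shows "(\<Prod>e\<in>tree_edges G r t. cond G e) = forest_weight G {r} t"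
proof -
  have "inj_on (\<lambda>x. fst (t x)) (verts G - {r})"
  proof (rule inj_onI)
    fix x y assume x: "x \<in> verts G - {r}" and y: "y \<in> verts G - {r}" and eq: "fst (t x) = fst (t y)"
    show "x = y"
    proof (rule ccontr)
      assume ne: "x \<noteq> y"
      have "t x \<in> out_arcs G x" "t y \<in> out_arcs G y" using forest_out[OF t] x y by auto
      then have "{x, head G (t x)} = {y, head G (t y)}"
        using ends_fst[of G "t x"] ends_fst[of G "t y"] eq by (simp add: out_arcs_def)
      then have "head G (t x) = y" "head G (t y) = x" using ne by (auto simp: doubleton_eq_iff)
      then show False
        using height_less[of G r t x] height_less[of G r t y] forest_leads_to[OF t] x y by force
    qed
  qed
  then show ?thesis by (simp add: tree_edges_def forest_weight_def prod.reindex)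
qed

text \<open>
  Rooted at \<open>r\<close>, the uniform spanning tree is a random rooted forest with the single root \<open>r\<close>.
\<close>

lemma UST_expectation:
  fixes f :: "'e set \<Rightarrow> real"
  assumes r: "r \<in> verts G"
  shows "measure_pmf.expectation (UST G) f =
    (\<Sum>t\<in>forests G {r}. forest_weight G {r} t * f (tree_edges G r t)) / forest_sum G {r}"
proof -
  let ?S = "spanning_trees G" and ?w = "\<lambda>F. \<Prod>e\<in>F. cond G e"
  have fin: "finite ?S" unfolding tree_edges_image[OF r, symmetric] by simp
  have re: "(\<Sum>F\<in>?S. g F) = (\<Sum>t\<in>forests G {r}. g (tree_edges G r t))" for g :: "'e set \<Rightarrow> real"
    unfolding tree_edges_image[OF r, symmetric] by (rule sum.reindex[OF tree_edges_inj, unfolded o_def])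
  have Z: "(\<Sum>F\<in>?S. ?w F) = forest_sum G {r}" unfolding re forest_sum_def by (intro sum.cong refl prod_tree_edges)
  have Zp: "0 < forest_sum G {r}" using r by (intro forest_sum_pos) auto
  define p where "p F = (if F \<in> ?S then ?w F / (\<Sum>F'\<in>?S. ?w F') else 0)" for F
  have p0: "0 \<le> p F" for F
  proof (cases "F \<in> ?S")
    case True
    then obtain t where "t \<in> forests G {r}" "F = tree_edges G r t" unfolding tree_edges_image[OF r, symmetric] by blast
    then show ?thesis using Zp forest_weight_pos[of t "{r}"] by (simp add: p_def Z prod_tree_edges less_imp_le)
  qed (simp add: p_def)
  have p1: "(\<Sum>F\<in>?S. p F) = 1"
    using Zp Z by (simp add: p_def sum_divide_distrib[symmetric])
  have "(\<integral>\<^sup>+F. ennreal (p F) \<partial>count_space UNIV) = (\<Sum>F\<in>?S. ennreal (p F))"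
    by (intro nn_integral_count_space'[OF fin]) (auto simp: p_def)
  also have "\<dots> = ennreal (\<Sum>F\<in>?S. p F)" using p0 by simp
  finally have pmf: "pmf (UST G) F = p F" for F
    unfolding UST_def p_def[symmetric] by (subst pmf_embed_pmf) (use p0 p1 in auto)
  have "measure_pmf.expectation (UST G) f = (\<Sum>F\<in>?S. f F * pmf (UST G) F)"
    by (rule integral_measure_pmf_real[OF fin]) (auto simp: set_pmf_iff pmf p_def split: if_splits)
  also have "\<dots> = (\<Sum>F\<in>?S. ?w F * f F) / forest_sum G {r}"
    unfolding sum_divide_distrib by (intro sum.cong refl) (simp add: pmf p_def Z mult.commute)
  also have "(\<Sum>F\<in>?S. ?w F * f F) = (\<Sum>t\<in>forests G {r}. forest_weight G {r} t * f (tree_edges G r t))"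
    unfolding re by (intro sum.cong refl) (simp add: prod_tree_edges)
  finally show ?thesis .
qed

section \<open>Escape conductance and capacity\<close>

lemma sum_arcs_by_tail: "(\<Sum>x\<in>verts G. \<Sum>a\<in>out_arcs G x. f a) = (\<Sum>a\<in>oriented_edges G. f a :: real)"
proof -
  have "tail G a \<in> verts G" if "a \<in> oriented_edges G" for a
    using head_in[of "rev_arc a" "head G a"] that by (simp add: out_arcs_def)
  then have "(\<Sum>a\<in>oriented_edges G. f a) = (\<Sum>a\<in>(\<Union>x\<in>verts G. out_arcs G x). f a)"
    by (intro sum.cong) (auto simp: out_arcs_def)
  also have "\<dots> = (\<Sum>x\<in>verts G. \<Sum>a\<in>out_arcs G x. f a)"
    using fin_verts by (intro sum.UNION_disjoint) (auto simp: out_arcs_def)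
  finally show ?thesis by simp
qed

lemma sum_arcs_rev: "(\<Sum>a\<in>oriented_edges G. f (rev_arc a)) = (\<Sum>a\<in>oriented_edges G. f a :: real)"
  by (rule sum.reindex_bij_witness[where i = rev_arc and j = rev_arc]) auto

text \<open>
  The terms of an arc and of its reversal cancel.
\<close>

lemma divergence_zero: "(\<Sum>x\<in>verts G. \<Sum>a\<in>out_arcs G x. cond G (fst a) * (u x - u (head G a))) = (0::real)"
proof -
  let ?f = "\<lambda>a. cond G (fst a) * (u (tail G a) - u (head G a))"
  have "(\<Sum>x\<in>verts G. \<Sum>a\<in>out_arcs G x. cond G (fst a) * (u x - u (head G a))) = (\<Sum>a\<in>oriented_edges G. ?f a)"
    unfolding sum_arcs_by_tail[symmetric] by (intro sum.cong refl) (auto simp: out_arcs_def)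
  also have "\<dots> = (\<Sum>a\<in>oriented_edges G. - ?f a)"
    unfolding sum_arcs_rev[of ?f, symmetric] by (intro sum.cong refl) (simp add: algebra_simps)
  also have "\<dots> = - (\<Sum>a\<in>oriented_edges G. ?f a)" by (rule sum_negf)
  also have "(\<Sum>a\<in>oriented_edges G. ?f a) = (\<Sum>x\<in>verts G. \<Sum>a\<in>out_arcs G x. cond G (fst a) * (u x - u (head G a)))"
    unfolding sum_arcs_by_tail[symmetric] by (intro sum.cong refl) (auto simp: out_arcs_def)
  finally show ?thesis by simp
qed

end

context rooted_net
begin

lemma escape_eq:
  assumes "A \<subseteq> verts G" "r \<notin> A"
  shows "escape G r A y = (\<Sum>a\<in>out_arcs G y. cond G (fst a) * (1 - forest_hit G (insert r A) A (head G a)))"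
proof -
  have "forest_hit G (insert r A) {r} z = 1 - forest_hit G (insert r A) A z" if "z \<in> verts G" for z
  proof -
    have "insert r A - A = {r}" using assms by auto
    then show ?thesis using forest_hit_compl[of "insert r A" A z] that assms root by auto
  qed
  then show ?thesis unfolding escape_def by (intro sum.cong refl) (simp add: head_in)
qed

text \<open>
  Flow conservation: what leaves the root enters \<open>A\<close>.
\<close>

lemma capacity_eq_escape:
  assumes A: "A \<subseteq> verts G" "r \<notin> A"
  shows "capacity G r A = (\<Sum>x\<in>A. escape G r A x)"
proof -
  let ?h = "forest_hit G (insert r A) A"
  let ?d = "\<lambda>x. \<Sum>a\<in>out_arcs G x. cond G (fst a) * (?h x - ?h (head G a))"
  have fA: "finite A" using A fin_verts finite_subset by auto
  have sub: "insert r A \<subseteq> verts G" using A root by auto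
  have "0 = (\<Sum>x\<in>verts G. ?d x)" by (simp add: divergence_zero)
  also have "\<dots> = (\<Sum>x\<in>insert r A. ?d x)"
    using sub fin_verts forest_hit_harmonic[of _ "insert r A" A] by (intro sum.mono_neutral_right) auto
  also have "\<dots> = ?d r + (\<Sum>x\<in>A. ?d x)" using fA A by simp
  also have "?d r = - capacity G r A"
    using A sub by (simp add: forest_hit_root capacity_def sum_negf)
  also have "(\<Sum>x\<in>A. ?d x) = (\<Sum>x\<in>A. escape G r A x)"
    by (intro sum.cong refl) (use A sub in \<open>simp add: forest_hit_root escape_eq\<close>)
  finally show ?thesis by simp
qed

lemma forest_hit_mono:
  assumes "A \<subseteq> A'" "A' \<subseteq> verts G" "r \<notin> A'" "z \<in> verts G"
  shows "forest_hit G (insert r A) A z \<le> forest_hit G (insert r A') A' z"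
proof -
  let ?u = "\<lambda>z. forest_hit G (insert r A) A z - forest_hit G (insert r A') A' z"
  have "?u z \<le> 0"
  proof (rule max_principle[where R = "insert r A'"])
    fix z assume z: "z \<in> verts G" "z \<notin> insert r A'"
    have "(\<Sum>b\<in>out_arcs G z. cond G (fst b) * (?u z - ?u (head G b))) =
       (\<Sum>b\<in>out_arcs G z. cond G (fst b) * (forest_hit G (insert r A) A z - forest_hit G (insert r A) A (head G b))) -
       (\<Sum>b\<in>out_arcs G z. cond G (fst b) * (forest_hit G (insert r A') A' z - forest_hit G (insert r A') A' (head G b)))"
      unfolding sum_subtractf[symmetric] by (intro sum.cong refl) (simp add: algebra_simps)
    also have "\<dots> = 0" using z assms root by (subst (1 2) forest_hit_harmonic) auto
    finally show "(\<Sum>b\<in>out_arcs G z. cond G (fst b) * (?u z - ?u (head G b))) \<le> 0" by simp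
  next
    fix z assume z: "z \<in> insert r A'"
    show "?u z \<le> 0"
    proof (cases "z = r")
      case True
      then show ?thesis using assms root by (subst (1 2) forest_hit_root) auto
    next
      case False
      then show ?thesis using assms root z forest_hit_le_1[of "insert r A" A z] by (subst (2) forest_hit_root) auto
    qed
  qed (use assms root in auto)
  then show ?thesis by simp
qed

text \<open>
  Enlarging \<open>A\<close> makes it harder to escape.
\<close>

lemma escape_mono:
  assumes "A \<subseteq> A'" "A' \<subseteq> verts G" "r \<notin> A'"
  shows "escape G r A' y \<le> escape G r A y"
proof -
  have "escape G r A' y = (\<Sum>a\<in>out_arcs G y. cond G (fst a) * (1 - forest_hit G (insert r A') A' (head G a)))"
    using assms by (intro escape_eq) auto
  also have "\<dots> \<le> (\<Sum>a\<in>out_arcs G y. cond G (fst a) * (1 - forest_hit G (insert r A) A (head G a)))"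
    using forest_hit_mono[OF assms head_in] cond_pos by (intro sum_mono mult_left_mono) (auto intro: less_imp_le)
  also have "\<dots> = escape G r A y"
    using assms by (intro escape_eq[symmetric]) auto
  finally show ?thesis .
qed

lemma capacity_mono:
  assumes "A \<subseteq> A'" "A' \<subseteq> verts G" "r \<notin> A'"
  shows "capacity G r A \<le> capacity G r A'"
  unfolding capacity_def using forest_hit_mono[OF assms head_in] cond_pos
  by (intro sum_mono mult_left_mono) (auto intro: less_imp_le)

lemma escape_nonneg: "0 \<le> escape G r A y"
  unfolding escape_def using forest_hit_nonneg cond_pos by (intro sum_nonneg mult_nonneg_nonneg) (auto intro: less_imp_le)

lemma escape_le_pi:
  assumes "A \<subseteq> verts G"
  shows "escape G r A y \<le> net_pi G {y}"
  unfolding escape_def net_pi_single using forest_hit_le_1[of "insert r A"] cond_pos assms root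
  by (intro sum_mono) (auto intro!: mult_left_le less_imp_le)

lemma tree_prob_nonneg: "0 \<le> tree_prob G r P"
  unfolding tree_prob_def using Zpos forest_weight_pos by (intro divide_nonneg_nonneg sum_nonneg) (auto intro: less_imp_le)

lemma tree_prob_mono:
  assumes "\<And>t. t \<in> forests G {r} \<Longrightarrow> P t \<Longrightarrow> Q t"
  shows "tree_prob G r P \<le> tree_prob G r Q"
  unfolding tree_prob_def using Zpos forest_weight_pos assms
  by (intro divide_right_mono sum_mono mult_left_mono) (auto intro: less_imp_le)

lemma tree_prob_disj: "tree_prob G r (\<lambda>t. P t \<or> Q t) \<le> tree_prob G r P + tree_prob G r Q"
  unfolding tree_prob_def add_divide_distrib[symmetric] sum.distrib[symmetric] distrib_left[symmetric] using Zpos forest_weight_pos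
  by (intro divide_right_mono sum_mono mult_left_mono) (auto intro: less_imp_le)

lemma tree_prob_sum_disjoint:
  assumes "finite \<Gamma>" and "\<And>t. t \<in> forests G {r} \<Longrightarrow> card {\<gamma>\<in>\<Gamma>. P \<gamma> t} \<le> 1"
  shows "(\<Sum>\<gamma>\<in>\<Gamma>. tree_prob G r (P \<gamma>)) \<le> 1"
proof -
  have "(\<Sum>\<gamma>\<in>\<Gamma>. tree_prob G r (P \<gamma>)) = (\<Sum>t\<in>forests G {r}. forest_weight G {r} t * (\<Sum>\<gamma>\<in>\<Gamma>. of_bool (P \<gamma> t))) / forest_sum G {r}"
    unfolding tree_prob_def sum_divide_distrib[symmetric] sum_distrib_left by (subst sum.swap) simp
  also have "\<dots> \<le> (\<Sum>t\<in>forests G {r}. forest_weight G {r} t * 1) / forest_sum G {r}"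
  proof (intro divide_right_mono sum_mono mult_left_mono)
    fix t assume t: "t \<in> forests G {r}"
    have "(\<Sum>\<gamma>\<in>\<Gamma>. of_bool (P \<gamma> t)) = real (card {\<gamma>\<in>\<Gamma>. P \<gamma> t})"
      using assms(1) by (simp add: Int_def)
    then show "(\<Sum>\<gamma>\<in>\<Gamma>. of_bool (P \<gamma> t)) \<le> (1::real)" using assms(2)[OF t] by simp
    show "0 \<le> forest_weight G {r} t" using forest_weight_pos[OF t] by simp
  qed (use Zpos in auto)
  also have "\<dots> = 1" using Zpos by (simp add: forest_sum_def)
  finally show ?thesis .
qed

end

section \<open>Infinite networks and their wired quotients\<close>

definition nbh :: "('v, 'e) network \<Rightarrow> 'v set \<Rightarrow> 'v set" where
  "nbh G S = S \<union> (\<Union>x\<in>S. head G ` out_arcs G x)"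

text \<open>
  All vertices at graph distance at most \<open>n\<close> from the set \<open>S\<close>.
\<close>

definition ball_set :: "('v, 'e) network \<Rightarrow> nat \<Rightarrow> 'v set \<Rightarrow> 'v set" where
  "ball_set G n S = (nbh G ^^ n) S"

definition paths_to :: "('v, 'e) network \<Rightarrow> nat \<Rightarrow> 'v \<Rightarrow> ('e \<times> bool) list set" where
  "paths_to G n x = {bs. length bs = n \<and> (\<exists>u\<in>verts G. self_avoiding G u bs x)}"

text \<open>
  The event \<open>evt\<close> depends only on the finitely many edges in \<open>D\<close>.
\<close>

definition cylinder :: "'e set \<Rightarrow> ('e set \<Rightarrow> bool) \<Rightarrow> bool" where
  "cylinder D evt \<longleftrightarrow> finite D \<and> (\<forall>F. evt F \<longleftrightarrow> evt (F \<inter> D))"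

locale inf_net =
  fixes G :: "('v, 'e) network"
  assumes network: "is_network G" and inf_verts: "infinite (verts G)"
    and conn: "net_connected G" and loc_fin: "locally_finite G"
begin

lemma fin_out [simp]: "finite (out_arcs G x)"
proof (cases "x \<in> verts G")
  case True
  then have "finite ({e \<in> edges G. x \<in> ends G e} \<times> (UNIV :: bool set))"
    using loc_fin by (simp add: locally_finite_def)
  then show ?thesis
    by (rule rev_finite_subset) (auto simp: out_arcs_def oriented_edges_def ends_def tail_def)
next
  case False
  then have "out_arcs G x = {}"
    using network by (auto simp: out_arcs_def oriented_edges_def is_network_def tail_def)
  then show ?thesis by simp
qed

lemma head_in: "a \<in> out_arcs G x \<Longrightarrow> head G a \<in> verts G"
  using network by (auto simp: out_arcs_def oriented_edges_def is_network_def head_def)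

lemma tail_in: "a \<in> oriented_edges G \<Longrightarrow> tail G a \<in> verts G"
  using network by (auto simp: oriented_edges_def is_network_def tail_def)

lemma cond_pos: "a \<in> out_arcs G x \<Longrightarrow> 0 < cond G (fst a)"
  using network by (auto simp: out_arcs_def oriented_edges_def is_network_def)

lemma pi_pos: "x \<in> verts G \<Longrightarrow> 0 < net_pi G {x}"
proof -
  assume x: "x \<in> verts G"
  have "out_arcs G x \<noteq> {}"
  proof
    assume "out_arcs G x = {}"
    then have "{x} = verts G" by (intro closed_set_is_everything[OF conn]) (use x in auto)
    then show False using inf_verts by (metis finite.emptyI finite_insert)
  qed
  then show ?thesis unfolding net_pi_single by (intro sum_pos) (auto intro: cond_pos)
qed

lemma finite_ball: "finite S \<Longrightarrow> finite (ball_set G n S)"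
  by (induction n) (auto simp: ball_set_def nbh_def)

lemma ball_in: "S \<subseteq> verts G \<Longrightarrow> ball_set G n S \<subseteq> verts G"
  by (induction n) (auto simp: ball_set_def nbh_def intro: head_in)

lemma ball_Suc_mono: "ball_set G n S \<subseteq> ball_set G (Suc n) S"
  by (auto simp: ball_set_def nbh_def)

lemma ball_mono: "m \<le> n \<Longrightarrow> ball_set G m S \<subseteq> ball_set G n S"
  using lift_Suc_mono_le[of "\<lambda>n. ball_set G n S"] ball_Suc_mono by blast

lemma ball_step: "x \<in> ball_set G n S \<Longrightarrow> a \<in> out_arcs G x \<Longrightarrow> head G a \<in> ball_set G (Suc n) S"
  by (auto simp: ball_set_def nbh_def)

lemma walk_in_ball: "walk G u bs x \<Longrightarrow> u \<in> ball_set G (length bs) {x}"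
proof (induction bs arbitrary: u)
  case (Cons a bs)
  then have h: "head G a \<in> ball_set G (length bs) {x}" "a \<in> out_arcs G u" by auto
  then have "rev_arc a \<in> out_arcs G (head G a)" "head G (rev_arc a) = u" by (auto simp: out_arcs_def)
  then show ?case using ball_step[OF h(1)] by (metis length_Cons)
qed (simp add: ball_set_def)

lemma walk_tails_in_ball: "walk G u bs x \<Longrightarrow> path_verts G bs x \<subseteq> ball_set G (length bs) {x}"
proof (induction bs arbitrary: u)
  case (Cons a bs)
  have "path_verts G bs x \<subseteq> ball_set G (length bs) {x}" using Cons.prems by (intro Cons.IH[of "head G a"]) simp
  then have "path_verts G bs x \<subseteq> ball_set G (length (a # bs)) {x}" using ball_Suc_mono by fastforce
  moreover have "tail G a \<in> ball_set G (length (a # bs)) {x}"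
    using walk_in_ball[OF Cons.prems] Cons.prems by (simp add: out_arcs_def)
  ultimately show ?case by (auto simp: path_verts_def)
qed (simp add: ball_set_def path_verts_def)

lemma finite_paths_to: "finite (paths_to G n x)"
proof -
  have "walk G u bs x \<Longrightarrow> set bs \<subseteq> (\<Union>y\<in>ball_set G (length bs) {x}. out_arcs G y)" for u bs
    using walk_tails_in_ball[of u bs x]
  proof -
    assume w: "walk G u bs x"
    have "walk G u bs x \<Longrightarrow> a \<in> set bs \<Longrightarrow> a \<in> out_arcs G (tail G a)" for a u bs
      by (induction bs arbitrary: u) (auto simp: out_arcs_def)
    then have "a \<in> out_arcs G (tail G a)" if "a \<in> set bs" for a using w that by blast
    moreover have "tail G a \<in> ball_set G (length bs) {x}" if "a \<in> set bs" for a
      using walk_tails_in_ball[OF w] that unfolding path_verts_def by blast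
    ultimately show ?thesis by blast
  qed
  then have "paths_to G n x \<subseteq> {bs. set bs \<subseteq> (\<Union>y\<in>ball_set G n {x}. out_arcs G y) \<and> length bs = n}"
    unfolding paths_to_def self_avoiding_def by blast
  moreover have "finite {bs. set bs \<subseteq> (\<Union>y\<in>ball_set G n {x}. out_arcs G y) \<and> length bs = n}"
    by (rule finite_lists_length_eq) (use finite_ball[of "{x}" n] in auto)
  ultimately show ?thesis by (rule finite_subset)
qed

lemma paths_to_in_ball: "bs \<in> paths_to G n x \<Longrightarrow> path_verts G bs x \<subseteq> ball_set G n {x}"
  using walk_tails_in_ball by (auto simp: paths_to_def self_avoiding_def)

lemma walk_in_verts: "walk G u bs x \<Longrightarrow> u \<in> verts G \<Longrightarrow> x \<in> verts G"
  by (induction bs arbitrary: u) (auto intro: head_in)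

end

locale wired_net = inf_net G for G :: "('v, 'e) network" +
  fixes W :: "'v set"
  assumes finW: "finite W" and Wsub: "W \<subseteq> verts G" and Wne: "W \<noteq> {}"
begin

abbreviation "N \<equiv> wired G W"

lemma verts_N: "verts N = insert None (Some ` W)"
proof -
  (* The vertex \<open>None\<close> is present because \<open>W\<close> misses some vertex of the infinite network. *)
  obtain y where "y \<in> verts G" "y \<notin> W" using finW inf_verts Wsub by (metis finite_subset subsetI)
  then show ?thesis using Wsub by (auto simp: wired_def wired_proj_def image_iff split: if_splits intro!: bexI[of _ y])
qed

lemma tail_N: "tail N a = wired_proj W (tail G a)" and head_N: "head N a = wired_proj W (head G a)"
  by (simp_all add: wired_def tail_def head_def)

lemma cond_N [simp]: "cond N = cond G" by (simp add: wired_def)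

lemma oriented_N: "oriented_edges N = {a \<in> oriented_edges G. tail N a \<noteq> head N a}"
  by (auto simp: oriented_edges_def wired_def tail_def head_def)

lemma ends_N: "ends N e = wired_proj W ` ends G e"
  by (auto simp: ends_def wired_def)

lemma out_N: "x \<in> W \<Longrightarrow> out_arcs N (Some x) = {a \<in> out_arcs G x. head N a \<noteq> Some x}"
  by (auto simp: out_arcs_def oriented_N tail_N wired_proj_def split: if_splits)

lemma proj_W [simp]: "x \<in> W \<Longrightarrow> wired_proj W x = Some x" by (simp add: wired_proj_def)

sublocale w: rooted_net N None
proof
  show "is_network N"
    using network by (auto simp: is_network_def wired_def)
  show "finite (verts N)" using finW by (simp add: verts_N)
  show "finite (edges N)"
  proof -
    have "finite (\<Union>x\<in>W. {e \<in> edges G. x \<in> ends G e})"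
      using finW Wsub loc_fin by (auto simp: locally_finite_def)
    moreover have "edges N \<subseteq> (\<Union>x\<in>W. {e \<in> edges G. x \<in> ends G e})"
      by (auto simp: wired_def wired_proj_def ends_def split: if_splits)
    ultimately show ?thesis by (rule finite_subset[rotated])
  qed
  have step: "(wired_proj W x, wired_proj W y) \<in> (adjacency N)\<^sup>*" if "(x, y) \<in> (adjacency G)\<^sup>*" for x y
    using that
  proof induction
    case (step y z)
    then obtain e where e: "e \<in> edges G" "ends G e = {y, z}" by (auto simp: adjacency_def)
    have "(wired_proj W y, wired_proj W z) \<in> (adjacency N)\<^sup>="
    proof (cases "wired_proj W y = wired_proj W z")
      case False
      then have "e \<in> edges N" using e by (auto simp: wired_def ends_def doubleton_eq_iff)
      moreover have "ends N e = {wired_proj W y, wired_proj W z}" using e by (simp add: ends_N)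
      ultimately show ?thesis by (auto simp: adjacency_def)
    qed simp
    then show ?case using step by (auto intro: rtrancl_into_rtrancl)
  qed simp
  show "net_connected N"
    using conn step by (auto simp: net_connected_def wired_def)
  show "src N e \<noteq> dst N e" if "e \<in> edges N" for e using that by (simp add: wired_def)
  show "None \<in> verts N" by (simp add: verts_N)
  show "verts N \<noteq> {None}" using Wne by (auto simp: verts_N)
qed

text \<open>
  Since the edges of a self-avoiding path inside \<open>W\<close> are not loops, none of them disappears in the
  quotient.
\<close>

lemma wired_path:
  assumes "self_avoiding G u bs x" "path_verts G bs x \<subseteq> W"
  shows "self_avoiding N (Some u) bs (Some x)" "path_verts N bs (Some x) = Some ` path_verts G bs x"
proof -
  have t: "tail N b = Some (tail G b)" if "b \<in> set bs" for b
    using assms(2) that by (auto simp: tail_N path_verts_def)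
  show "path_verts N bs (Some x) = Some ` path_verts G bs x"
    unfolding path_verts_def using t by (auto simp: image_iff)
  have "walk N (Some u) bs (Some x)"
    using assms
  proof (induction bs arbitrary: u)
    case (Cons b bs)
    have h: "head G b \<in> path_verts G bs x"
      using Cons.prems(1) by (cases bs) (auto simp: self_avoiding_def path_verts_def out_arcs_def)
    then have hW: "head G b \<in> W" using Cons.prems(2) by (auto simp: path_verts_def)
    have u: "u = tail G b" "u \<in> W" "b \<in> out_arcs G u" using Cons.prems by (auto simp: self_avoiding_def out_arcs_def path_verts_def)
    have ne: "head G b \<noteq> u"
    proof
      assume "head G b = u"
      then have "u \<in> set (map (tail G) bs @ [x])" using h by (auto simp: path_verts_def)
      then show False using Cons.prems(1) u by (auto simp: self_avoiding_def)
    qed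
    have "self_avoiding G (head G b) bs x" using Cons.prems by (auto simp: self_avoiding_def)
    then have "walk N (Some (head G b)) bs (Some x)" using Cons.prems by (intro Cons.IH) (auto simp: path_verts_def)
    moreover have "head N b = Some (head G b)" using hW by (simp add: head_N)
    ultimately show ?case using u ne by (simp add: out_N)
  qed (simp add: self_avoiding_def)
  moreover have "map (tail N) bs = map Some (map (tail G) bs)" using t by simp
  ultimately show "self_avoiding N (Some u) bs (Some x)"
    using assms(1) by (auto simp: self_avoiding_def distinct_map comp_def inj_on_def)
qed

text \<open>
  Loops contribute nothing to a Laplacian, so the Laplacian of the quotient is that of \<open>G\<close>.
\<close>

lemma lap_N:
  assumes "x \<in> W"
  shows "(\<Sum>a\<in>out_arcs N (Some x). cond G (fst a) * (F (Some x) - F (head N a))) =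
     (\<Sum>a\<in>out_arcs G x. cond G (fst a) * (F (Some x) - F (wired_proj W (head G a)) :: real))"
  unfolding out_N[OF assms] by (rule sum.mono_neutral_cong_left) (auto simp: head_N)

lemma pi_N_le: "x \<in> W \<Longrightarrow> net_pi N {Some x} \<le> net_pi G {x}"
  unfolding net_pi_single cond_N out_N
  by (intro sum_mono2) (auto intro: less_imp_le cond_pos)

text \<open>
  \<open>thinning\<close> with about \<open>s \<pi> r\<close> excursions.
\<close>

lemma thinning_limit_form:
  assumes x: "x \<in> W" and s: "0 < s" "1 \<le> s * net_pi N {None}" and \<Gamma>: "finite \<Gamma>"
    "\<And>bs. bs \<in> \<Gamma> \<Longrightarrow> \<exists>u. self_avoiding G u bs x \<and> path_verts G bs x \<subseteq> W"
  shows "tree_prob N None (\<lambda>t. \<exists>bs\<in>\<Gamma>. follows N t bs) \<le> 2 * s * net_pi G {x} +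
    (\<Sum>bs\<in>\<Gamma>. tree_prob N None (\<lambda>t. follows N t bs) * exp (- s * capacity N None (Some ` path_verts G bs x)))"
proof -
  let ?p = "net_pi N {None}"
  define M where "M = nat \<lceil>s * ?p\<rceil>"
  have p: "0 < ?p" by (rule w.pi_pos) (simp add: verts_N)
  have M: "s * ?p \<le> real M" "real M \<le> 2 * s * ?p"
    using s(2) unfolding M_def by linarith+
  have path: "\<exists>u\<in>verts N. self_avoiding N u bs (Some x)" "None \<notin> path_verts N bs (Some x)" "path_verts N bs (Some x) = Some ` path_verts G bs x"
    "Some ` path_verts G bs x \<subseteq> verts N" if bs: "bs \<in> \<Gamma>" for bs
  proof -
    obtain u where u: "self_avoiding G u bs x" "path_verts G bs x \<subseteq> W" using \<Gamma>(2)[OF bs] by blast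
    then have "u \<in> path_verts G bs x" by (cases bs) (auto simp: self_avoiding_def path_verts_def out_arcs_def)
    then show "\<exists>u\<in>verts N. self_avoiding N u bs (Some x)" "None \<notin> path_verts N bs (Some x)" "path_verts N bs (Some x) = Some ` path_verts G bs x"
      "Some ` path_verts G bs x \<subseteq> verts N"
      using u wired_path[OF u] subsetD[OF u(2), of u] by (auto simp: verts_N)
  qed
  have v: "Some x \<in> verts N" "Some x \<noteq> None" using x by (auto simp: verts_N)
  have "tree_prob N None (\<lambda>t. \<exists>bs\<in>\<Gamma>. follows N t bs) \<le> real M * capacity N None {Some x} / ?p +
    (\<Sum>bs\<in>\<Gamma>. tree_prob N None (\<lambda>t. follows N t bs) * (1 - capacity N None (path_verts N bs (Some x)) / ?p) ^ M)"
    by (rule w.thinning[OF v \<Gamma>(1) path(1,2)])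
  also have "\<dots> \<le> 2 * s * net_pi G {x} +
    (\<Sum>bs\<in>\<Gamma>. tree_prob N None (\<lambda>t. follows N t bs) * exp (- s * capacity N None (Some ` path_verts G bs x)))"
  proof (intro add_mono sum_mono mult_left_mono w.tree_prob_nonneg)
    have "capacity N None {Some x} = escape N None {Some x} (Some x)" using v by (subst w.capacity_eq_escape) auto
    also have "\<dots> \<le> net_pi G {x}" using w.escape_le_pi[of "{Some x}" "Some x"] pi_N_le[OF x] v by simp
    finally have c: "capacity N None {Some x} \<le> net_pi G {x}" .
    have "real M * capacity N None {Some x} / ?p \<le> (2 * s * ?p) * net_pi G {x} / ?p"
      using M c w.capacity_le_pi[of "{Some x}"] v p s by (intro divide_right_mono mult_mono) auto
    then show "real M * capacity N None {Some x} / ?p \<le> 2 * s * net_pi G {x}" using p by simp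
  next
    fix bs assume bs: "bs \<in> \<Gamma>"
    let ?c = "capacity N None (Some ` path_verts G bs x)"
    have c: "0 \<le> ?c" "?c \<le> ?p" using w.capacity_le_pi[OF path(4)[OF bs]] by auto
    have "(1 - ?c / ?p) ^ M \<le> exp (- (?c / ?p)) ^ M"
      using c p exp_ge_add_one_self[of "- (?c / ?p)"] by (intro power_mono) auto
    also have "\<dots> = exp (- (real M * (?c / ?p)))" by (simp add: exp_of_nat_mult[symmetric])
    also have "\<dots> \<le> exp (- s * ?c)"
    proof -
      have "(s * ?p) * (?c / ?p) \<le> real M * (?c / ?p)" using M c p by (intro mult_right_mono) auto
      then show ?thesis using p by simp
    qed
    finally show "(1 - capacity N None (path_verts N bs (Some x)) / ?p) ^ M \<le> exp (- s * ?c)"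
      by (simp add: path(3)[OF bs])
  qed
  finally show ?thesis .
qed

end

section \<open>Cylinder events and the wired limit\<close>

text \<open>
  The indicator of a cylinder event as a polynomial in the indicators of single edges, from which both
  continuity and measurability are obvious.
\<close>

lemma cylinder_expand:
  assumes "cylinder D Q" "F \<subseteq> E"
  shows "(of_bool (Q F) :: real) = (\<Sum>S\<in>Pow (D \<inter> E). of_bool (Q S) * (\<Prod>e\<in>D \<inter> E. of_bool ((e \<in> F) = (e \<in> S))))"
proof -
  have fin: "finite (D \<inter> E)" using assms by (auto simp: cylinder_def)
  have "(\<Prod>e\<in>D \<inter> E. of_bool ((e \<in> F) = (e \<in> S))) = (if S = F \<inter> D then 1 else 0 :: real)" if S: "S \<in> Pow (D \<inter> E)" for S
  proof (cases "S = F \<inter> D")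
    case True then show ?thesis by (auto intro!: prod.neutral)
  next
    case False
    then obtain e where "e \<in> D \<inter> E" "(e \<in> F) \<noteq> (e \<in> S)" using S assms(2) by blast
    then have "(\<Prod>e\<in>D \<inter> E. of_bool ((e \<in> F) = (e \<in> S))) = (0::real)"
      by (intro prod_zero[OF fin] bexI[of _ e]) auto
    then show ?thesis using False by simp
  qed
  then have "(\<Sum>S\<in>Pow (D \<inter> E). of_bool (Q S) * (\<Prod>e\<in>D \<inter> E. of_bool ((e \<in> F) = (e \<in> S)))) =
     (\<Sum>S\<in>Pow (D \<inter> E). if S = F \<inter> D then of_bool (Q S) else 0 :: real)"
    by (intro sum.cong refl) simp
  also have "\<dots> = of_bool (Q (F \<inter> D))" using fin assms(2) by (subst sum.delta) (auto simp del: Pow_Int_eq)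
  also have "Q (F \<inter> D) \<longleftrightarrow> Q F" using assms(1) unfolding cylinder_def by blast
  finally show ?thesis by simp
qed

lemma cylinder_continuous:
  assumes "cylinder D Q"
  shows "continuous_map (config_topology E) euclideanreal (\<lambda>F. of_bool (Q F))"
proof -
  have top: "topspace (config_topology E) \<subseteq> Pow E"
    by (auto simp: config_topology_def topspace_pullback_topology)
  have coord: "continuous_map (config_topology E) euclideanreal (\<lambda>F. of_bool ((e \<in> F) = b))" if e: "e \<in> E" for e b
  proof -
    let ?P = "product_topology (\<lambda>_. discrete_topology (UNIV :: bool set)) E"
    have "continuous_map ?P euclideanreal ((\<lambda>x. of_bool (x = b)) \<circ> (\<lambda>h. h e))"
      by (rule continuous_map_compose[OF continuous_map_product_projection[OF e]]) simp
    then have "continuous_map (config_topology E) euclideanreal (((\<lambda>x. of_bool (x = b)) \<circ> (\<lambda>h. h e)) \<circ> (\<lambda>F. \<lambda>e\<in>E. e \<in> F))"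
      unfolding config_topology_def by (rule continuous_map_pullback)
    also have "(((\<lambda>x. of_bool (x = b)) \<circ> (\<lambda>h. h e)) \<circ> (\<lambda>F. \<lambda>e\<in>E. e \<in> F)) = (\<lambda>F. of_bool ((e \<in> F) = b) :: real)"
      using e by (auto simp: fun_eq_iff)
    finally show ?thesis .
  qed
  have fin: "finite (D \<inter> E)" using assms by (auto simp: cylinder_def)
  have "continuous_map (config_topology E) euclideanreal
     (\<lambda>F. \<Sum>S\<in>Pow (D \<inter> E). of_bool (Q S) * (\<Prod>e\<in>D \<inter> E. of_bool ((e \<in> F) = (e \<in> S))))"
    using fin by (intro continuous_map_sum continuous_map_real_mult continuous_map_prod coord) (auto simp del: Pow_Int_eq)
  then show ?thesis
  proof (rule continuous_map_eq)
    fix F assume "F \<in> topspace (config_topology E)"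
    then have "F \<subseteq> E" using top by auto
    from cylinder_expand[OF assms this]
    show "(\<Sum>S\<in>Pow (D \<inter> E). of_bool (Q S) * (\<Prod>e\<in>D \<inter> E. of_bool ((e \<in> F) = (e \<in> S)))) = (of_bool (Q F) :: real)" by (rule sym)
  qed
qed

lemma cylinder_sets:
  assumes "cylinder D Q"
  shows "{F \<in> Pow E. Q F} \<in> sets (config_space E)"
proof -
  let ?P = "PiM E (\<lambda>_. count_space (UNIV :: bool set))"
  have sp: "space (config_space E) = Pow E" by (simp add: config_space_def)
  have "(\<lambda>F. \<lambda>e\<in>E. e \<in> F) \<in> measurable (config_space E) ?P"
    unfolding config_space_def by (rule measurable_vimage_algebra1) (auto simp: space_PiM)
  then have "(\<lambda>F. (\<lambda>e\<in>E. e \<in> F) e) \<in> measurable (config_space E) (count_space UNIV)" if "e \<in> E" for e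
    by (rule measurable_compose[OF _ measurable_component_singleton[OF that]])
  then have [measurable]: "Measurable.pred (config_space E) (\<lambda>F. e \<in> F)" if "e \<in> E" for e
    using that by (simp add: restrict_def)
  have fin: "finite (D \<inter> E)" using assms by (auto simp: cylinder_def)
  have m: "(\<lambda>F. \<Sum>S\<in>Pow (D \<inter> E). of_bool (Q S) * (\<Prod>e\<in>D \<inter> E. of_bool ((e \<in> F) = (e \<in> S))) :: real) \<in> borel_measurable (config_space E)"
    by (intro borel_measurable_sum borel_measurable_times borel_measurable_prod) measurable
  have "{F \<in> Pow E. Q F} = {F \<in> space (config_space E). (\<Sum>S\<in>Pow (D \<inter> E). of_bool (Q S) * (\<Prod>e\<in>D \<inter> E. of_bool ((e \<in> F) = (e \<in> S)))) = (1::real)}"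
    using cylinder_expand[OF assms, of _ E, symmetric] unfolding sp by (auto simp del: sum_mult_of_bool_eq)
  also have "\<dots> \<in> sets (config_space E)" using m by measurable
  finally show ?thesis .
qed

text \<open>
  Both sides of \<open>e\<close> contain a self-avoiding path of prescribed length that ends at \<open>e\<close>. The two lengths
  may differ, as the estimates at the two endpoints need not be uniform.
\<close>

definition long_sides :: "('v, 'e) network \<Rightarrow> ('v \<Rightarrow> nat) \<Rightarrow> 'e \<Rightarrow> 'e set \<Rightarrow> bool" where
  "long_sides G n e F \<longleftrightarrow> e \<in> F \<and> (\<forall>x\<in>ends G e. \<exists>bs\<in>paths_to G (n x) x. fst ` set bs \<subseteq> F - {e})"

text \<open>
  A path in the tree that ends at \<open>v\<close> and avoids the exit arc of \<open>v\<close> can only run towards the root: by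
  induction from its end, the first edge is not the exit arc of the second vertex, hence that of the
  first.
\<close>

lemma (in fin_net) follows_of_edges:
  assumes t: "t \<in> forests G {r}" and p: "self_avoiding G u bs v" "r \<notin> path_verts G bs v"
    and e: "fst ` set bs \<subseteq> tree_edges G r t" "fst (t v) \<notin> fst ` set bs"
  shows "follows G t bs"
  using p e
proof (induction bs arbitrary: u)
  case Nil then show ?case by (simp add: follows_def)
next
  case (Cons b bs)
  have p': "self_avoiding G (head G b) bs v" using Cons.prems by (auto simp: self_avoiding_def)
  have IH: "follows G t bs"
    by (rule Cons.IH[OF p']) (use Cons.prems in \<open>auto simp: path_verts_def\<close>)
  have b: "b \<in> out_arcs G (tail G b)" "tail G b = u" using Cons.prems by (auto simp: self_avoiding_def out_arcs_def)
  have ne: "fst b \<noteq> fst (t (head G b))"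
  proof (cases bs)
    case Nil
    then have "head G b = v" using Cons.prems by (auto simp: self_avoiding_def)
    then show ?thesis using Cons.prems(4) by auto
  next
    case (Cons c cs)
    then have "tail G c = head G b" using p' by (auto simp: self_avoiding_def out_arcs_def)
    then have "t (head G b) = c" using IH Cons by (auto simp: follows_def)
    then show ?thesis using self_avoiding_distinct_edges[OF Cons.prems(1)] \<open>bs = c # cs\<close> by auto
  qed
  have "head G b \<in> path_verts G (b # bs) v" by (rule heads_path_verts[of G u]) (use Cons.prems in \<open>auto simp: self_avoiding_def\<close>)
  then have "tail G b \<in> verts G - {r} \<and> head G (t (tail G b)) = head G b \<and> fst b = fst (t (tail G b)) \<and> height G r t (head G b) < height G r t (tail G b)"
    using Cons.prems ne ends_fst[of G b] by (intro tree_parent_edge[OF t]) (auto simp: insert_commute)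
  then have "t (tail G b) = b" using b forest_out[OF t, of "tail G b"] arc_eqI by auto
  then show ?case using IH by (auto simp: follows_def)
qed

context wired_net
begin

text \<open>
  Every edge of the tree is the exit arc of one of its endpoints \<open>z\<close>. The long path on the side of \<open>z\<close>
  then lies in the past of \<open>z\<close>.
\<close>

lemma long_sides_follows:
  assumes t: "t \<in> forests N {None}" and W: "\<And>x. x \<in> ends G e \<Longrightarrow> ball_set G (n x) {x} \<subseteq> W"
    and L: "long_sides G n e (tree_edges N None t)"
  shows "\<exists>x\<in>ends G e. \<exists>bs\<in>paths_to G (n x) x. follows N t bs"
proof -
  have e: "e \<in> tree_edges N None t" using L by (simp add: long_sides_def)
  then obtain z where z: "z \<in> W" "e = fst (t (Some z))" by (auto simp: tree_edges_def verts_N)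
  have "t (Some z) \<in> out_arcs N (Some z)" using w.forest_out[OF t] z by (simp add: verts_N)
  then have "tail G (t (Some z)) = z" using out_N[OF z(1)] by (auto simp: out_arcs_def)
  then have ze: "z \<in> ends G e" using z(2) ends_fst[of G "t (Some z)"] by simp
  then obtain bs where bs: "bs \<in> paths_to G (n z) z" "fst ` set bs \<subseteq> tree_edges N None t - {e}"
    using L by (auto simp: long_sides_def)
  then obtain u where u: "self_avoiding G u bs z" by (auto simp: paths_to_def)
  have "path_verts G bs z \<subseteq> W" using paths_to_in_ball[OF bs(1)] W[OF ze] by blast
  note wp = wired_path[OF u this]
  have "follows N t bs"
    using wp bs(2) z by (intro w.follows_of_edges[OF t wp(1)]) auto
  then show ?thesis using ze bs by blast
qed

text \<open>
  The path from \<open>K\<close> to the root leaves \<open>K\<close>.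
\<close>

lemma tree_crosses:
  assumes t: "t \<in> forests N {None}" and K: "K \<subseteq> W" "K \<noteq> {}"
  shows "tree_edges N None t \<inter> edge_boundary G K \<noteq> {}"
proof -
  obtain x where x: "x \<in> K" using K by blast
  have "leads_to N {None} {None} t y \<Longrightarrow> y \<in> Some ` K \<Longrightarrow> \<exists>z\<in>K. head N (t (Some z)) \<notin> Some ` K" for y
    by (induction rule: leads_to.induct) auto
  from this[OF w.forest_leads_to[OF t, of "Some x"]] obtain z where z: "z \<in> K" "head N (t (Some z)) \<notin> Some ` K"
    using x K by (auto simp: verts_N)
  let ?a = "t (Some z)"
  have zW: "z \<in> W" using z K by auto
  have "?a \<in> out_arcs N (Some z)" using w.forest_out[OF t] zW by (simp add: verts_N)
  then have a: "?a \<in> out_arcs G z" using out_N[OF zW] by auto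
  have "head G ?a \<notin> K" using z(2) K by (auto simp: head_N)
  then have "fst ?a \<in> edge_boundary G K"
    using a z(1) ends_fst[of G ?a] by (auto simp: edge_boundary_def out_arcs_def oriented_edges_def mem_Times_iff)
  moreover have "fst ?a \<in> tree_edges N None t" using zW by (auto simp: tree_edges_def verts_N)
  ultimately show ?thesis by blast
qed

end

context inf_net
begin

lemma finite_edges_at: "finite S \<Longrightarrow> S \<subseteq> verts G \<Longrightarrow> finite {e \<in> edges G. ends G e \<inter> S \<noteq> {}}"
proof -
  assume "finite S" "S \<subseteq> verts G"
  then have "finite (\<Union>x\<in>S. {e \<in> edges G. x \<in> ends G e})" using loc_fin by (auto simp: locally_finite_def)
  then show ?thesis by (rule rev_finite_subset) auto
qed

lemma space_WSF: "is_WSF G \<mu> \<Longrightarrow> space \<mu> = Pow (edges G)"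
  by (auto simp: is_WSF_def config_space_def dest!: sets_eq_imp_space_eq)

text \<open>
  The indicator of a cylinder event is continuous, so bounds that hold for all large wired networks
  pass to the limit.
\<close>

lemma WSF_event_bound:
  assumes \<mu>: "is_WSF G \<mu>" and Q: "cylinder D Q" and W0: "finite W0" "W0 \<subseteq> verts G"
    and bd: "\<And>W. finite W \<Longrightarrow> W \<subseteq> verts G \<Longrightarrow> W \<noteq> {} \<Longrightarrow> W0 \<subseteq> W \<Longrightarrow>
       tree_prob (wired G W) None (\<lambda>t. Q (tree_edges (wired G W) None t)) \<le> b"
  shows "measure \<mu> {F \<in> space \<mu>. Q F} \<le> b"
proof -
  obtain H where H: "exhaustion G H" and lim: "\<And>f. continuous_map (config_topology (edges G)) euclideanreal f \<Longrightarrow>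
           (\<lambda>n. measure_pmf.expectation (UST (wired G (verts (H n)))) f) \<longlonglongrightarrow> (\<integral>F. f F \<partial>\<mu>)"
    using \<mu> by (auto simp: is_WSF_def)
  interpret prob_space \<mu> using \<mu> by (simp add: is_WSF_def)
  have Hf: "finite (verts (H n))" "verts (H n) \<noteq> {}" "verts (H n) \<subseteq> verts G" "verts (H n) \<subseteq> verts (H (Suc n))" for n
    using H by (auto simp: exhaustion_def net_connected_def subnetwork_def)
  have inc: "mono (\<lambda>n. verts (H n))" using Hf(4) by (intro mono_iff_le_Suc[THEN iffD2]) auto
  have "\<exists>n0. W0 \<subseteq> verts (H n0)"
    using W0
  proof (induction rule: finite_induct)
    case (insert x S)
    then obtain n0 where "S \<subseteq> verts (H n0)" by auto
    moreover have "x \<in> (\<Union>n. verts (H n))" using insert.prems H unfolding exhaustion_def by blast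
    then obtain n1 where "x \<in> verts (H n1)" by blast
    ultimately show ?case
      using monoD[OF inc, of n0 "max n0 n1"] monoD[OF inc, of n1 "max n0 n1"] by (intro exI[of _ "max n0 n1"]) auto
  qed auto
  then obtain n0 where n0: "W0 \<subseteq> verts (H n0)" by blast
  have E: "measure_pmf.expectation (UST (wired G (verts (H n)))) (\<lambda>F. of_bool (Q F)) \<le> b" if "n \<ge> n0" for n
  proof -
    interpret wn: wired_net G "verts (H n)" using Hf by unfold_locales auto
    have "measure_pmf.expectation (UST (wired G (verts (H n)))) (\<lambda>F. of_bool (Q F)) =
       tree_prob (wired G (verts (H n))) None (\<lambda>t. Q (tree_edges (wired G (verts (H n))) None t))"
      unfolding tree_prob_def by (rule wn.w.UST_expectation) (simp add: wn.verts_N)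
    also have "\<dots> \<le> b" using Hf n0 monoD[OF inc that] by (intro bd) auto
    finally show ?thesis .
  qed
  have "{F \<in> space \<mu>. Q F} \<in> sets \<mu>"
    using cylinder_sets[OF Q, of "edges G"] \<mu> space_WSF[OF \<mu>] by (simp add: is_WSF_def)
  then have "(\<integral>F. of_bool (Q F) \<partial>\<mu>) = measure \<mu> {F \<in> space \<mu>. Q F}"
    by (subst Bochner_Integration.integral_cong[OF refl, of _ _ "indicator {F \<in> space \<mu>. Q F}"]) auto
  moreover have "(\<lambda>n. measure_pmf.expectation (UST (wired G (verts (H n)))) (\<lambda>F. of_bool (Q F))) \<longlonglongrightarrow> (\<integral>F. (of_bool (Q F) :: real) \<partial>\<mu>)"
    by (rule lim[OF cylinder_continuous[OF Q]])
  ultimately show ?thesis using E by (intro LIMSEQ_le_const2[of _ "measure \<mu> {F \<in> space \<mu>. Q F}"]) auto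
qed

lemma countable_verts: "countable (verts G)"
proof -
  obtain x where x: "x \<in> verts G" using conn by (auto simp: net_connected_def)
  have "(\<Union>n. ball_set G n {x}) = verts G"
  proof (rule closed_set_is_everything[OF conn])
    show "(\<Union>n. ball_set G n {x}) \<subseteq> verts G" using ball_in[of "{x}"] x by auto
    show "(\<Union>n. ball_set G n {x}) \<noteq> {}" by (auto simp: ball_set_def intro!: exI[of _ 0])
    show "\<And>y a. y \<in> (\<Union>n. ball_set G n {x}) \<Longrightarrow> a \<in> out_arcs G y \<Longrightarrow> head G a \<in> (\<Union>n. ball_set G n {x})"
      using ball_step by blast
  qed
  moreover have "countable (\<Union>n. ball_set G n {x})"
    by (intro countable_UN) (auto intro: countable_finite finite_ball)
  ultimately show ?thesis by simp
qed

lemma countable_edges: "countable (edges G)"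
proof -
  have "edges G \<subseteq> (\<Union>x\<in>verts G. {e \<in> edges G. x \<in> ends G e})"
    using network by (auto simp: is_network_def ends_def)
  moreover have "countable (\<Union>x\<in>verts G. {e \<in> edges G. x \<in> ends G e})"
    using loc_fin by (intro countable_UN countable_verts) (auto simp: locally_finite_def intro: countable_finite)
  ultimately show ?thesis by (rule countable_subset)
qed

text \<open>
  All trees of the forest are infinite.
\<close>

lemma WSF_crosses:
  assumes \<mu>: "is_WSF G \<mu>"
  shows "AE F in \<mu>. \<forall>K. finite K \<and> K \<noteq> {} \<and> K \<subseteq> verts G \<longrightarrow> F \<inter> edge_boundary G K \<noteq> {}"
proof -
  interpret prob_space \<mu> using \<mu> by (simp add: is_WSF_def)
  have "countable {K. finite K \<and> K \<subseteq> verts G}" by (rule countable_Collect_finite_subset[OF countable_verts])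
  then have "countable {K. K \<noteq> {} \<and> K \<subseteq> verts G \<and> finite K}" by (rule countable_subset[rotated]) auto
  then have "AE F in \<mu>. \<forall>K\<in>{K. K \<noteq> {} \<and> K \<subseteq> verts G \<and> finite K}. F \<inter> edge_boundary G K \<noteq> {}"
  proof (subst AE_ball_countable, assumption, intro ballI)
    fix K assume "K \<in> {K. K \<noteq> {} \<and> K \<subseteq> verts G \<and> finite K}"
    then have K: "finite K" "K \<noteq> {}" "K \<subseteq> verts G" by auto
    let ?Q = "\<lambda>F. F \<inter> edge_boundary G K = {}"
    have "finite (edge_boundary G K)"
      by (rule finite_subset[OF _ finite_edges_at[OF K(1,3)]]) (auto simp: edge_boundary_def)
    then have cyl: "cylinder (edge_boundary G K) ?Q" by (auto simp: cylinder_def)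
    have "measure \<mu> {F \<in> space \<mu>. ?Q F} \<le> 0"
    proof (rule WSF_event_bound[OF \<mu> cyl K(1,3)])
      fix W assume W: "finite W" "W \<subseteq> verts G" "W \<noteq> {}" "K \<subseteq> W"
      interpret wn: wired_net G W using W by unfold_locales auto
      have "tree_prob (wired G W) None (\<lambda>t. ?Q (tree_edges (wired G W) None t)) \<le> tree_prob (wired G W) None (\<lambda>_. False)"
        by (rule wn.w.tree_prob_mono) (use wn.tree_crosses[OF _ W(4) K(2)] in auto)
      then show "tree_prob (wired G W) None (\<lambda>t. ?Q (tree_edges (wired G W) None t)) \<le> 0" by (simp add: tree_prob_def)
    qed
    moreover have "{F \<in> space \<mu>. ?Q F} \<in> sets \<mu>"
      using cylinder_sets[OF cyl, of "edges G"] \<mu> space_WSF[OF \<mu>] by (simp add: is_WSF_def)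
    ultimately have "{F \<in> space \<mu>. ?Q F} \<in> null_sets \<mu>"
      by (intro null_setsI) (auto simp: emeasure_eq_measure measure_le_0_iff)
    then show "AE F in \<mu>. F \<inter> edge_boundary G K \<noteq> {}"
      by (rule AE_I') auto
  qed
  then show ?thesis by (rule AE_mp) (auto intro!: AE_I2)
qed

text \<open>
  For each vertex, generation \<open>n\<close> of its past is empty with probability close to 1, in all large wired
  networks, if \<open>n\<close> is large.
\<close>

definition thin_pasts :: bool where
  "thin_pasts \<longleftrightarrow> (\<forall>x\<in>verts G. \<forall>\<epsilon>>0. \<exists>n W0. finite W0 \<and> W0 \<subseteq> verts G \<and>
     (\<forall>W. finite W \<longrightarrow> W \<subseteq> verts G \<longrightarrow> W0 \<subseteq> W \<longrightarrow> W \<noteq> {} \<longrightarrow>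
        tree_prob (wired G W) None (\<lambda>t. \<exists>bs\<in>paths_to G n x. follows (wired G W) t bs) \<le> \<epsilon>))"

lemma WSF_no_long_sides:
  assumes \<mu>: "is_WSF G \<mu>" and thin: thin_pasts
  shows "AE F in \<mu>. \<forall>e\<in>edges G. \<not> (\<forall>n. long_sides G n e F)"
proof (subst AE_ball_countable[OF countable_edges], intro ballI)
  interpret prob_space \<mu> using \<mu> by (simp add: is_WSF_def)
  fix e assume e: "e \<in> edges G"
  have eV: "ends G e \<subseteq> verts G" "finite (ends G e)" using e network by (auto simp: is_network_def ends_def)
  define D where "D n = insert e (\<Union>x\<in>ends G e. \<Union>bs\<in>paths_to G (n x) x. fst ` set bs)" for n
  have cyl: "cylinder (D n) (long_sides G n e)" for n
    unfolding cylinder_def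
  proof (intro conjI allI)
    show "finite (D n)" using eV finite_paths_to by (auto simp: D_def)
    fix F
    have eD: "e \<in> D n" by (simp add: D_def)
    have pD: "fst ` set bs \<subseteq> D n" if "x \<in> ends G e" "bs \<in> paths_to G (n x) x" for x bs
      using that unfolding D_def by blast
    have "(\<exists>bs\<in>paths_to G (n x) x. fst ` set bs \<subseteq> F - {e}) \<longleftrightarrow>
      (\<exists>bs\<in>paths_to G (n x) x. fst ` set bs \<subseteq> F \<inter> D n - {e})" if x: "x \<in> ends G e" for x
    proof (rule bex_cong[OF refl])
      fix bs assume "bs \<in> paths_to G (n x) x"
      from pD[OF x this] show "fst ` set bs \<subseteq> F - {e} \<longleftrightarrow> fst ` set bs \<subseteq> F \<inter> D n - {e}" by blast
    qed
    then show "long_sides G n e F \<longleftrightarrow> long_sides G n e (F \<inter> D n)"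
      unfolding long_sides_def using eD by blast
  qed
  have meas: "{F \<in> space \<mu>. long_sides G n e F} \<in> sets \<mu>" for n
    using cylinder_sets[OF cyl, of "edges G"] \<mu> space_WSF[OF \<mu>] by (simp add: is_WSF_def)
  have small: "\<exists>n. measure \<mu> {F \<in> space \<mu>. long_sides G n e F} \<le> \<epsilon>" if \<epsilon>: "0 < \<epsilon>" for \<epsilon>
  proof -
    define R where "R x n W0 \<longleftrightarrow> finite W0 \<and> W0 \<subseteq> verts G \<and>
     (\<forall>W. finite W \<longrightarrow> W \<subseteq> verts G \<longrightarrow> W0 \<subseteq> W \<longrightarrow> W \<noteq> {} \<longrightarrow>
        tree_prob (wired G W) None (\<lambda>t. \<exists>bs\<in>paths_to G n x. follows (wired G W) t bs) \<le> \<epsilon> / 2)" for x n W0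
    have "\<exists>n W0. R x n W0" if "x \<in> ends G e" for x
    proof -
      have "x \<in> verts G" "0 < \<epsilon> / 2" using eV \<epsilon> that by auto
      then show ?thesis using thin unfolding thin_pasts_def R_def by blast
    qed
    then obtain n W0 where R: "\<And>x. x \<in> ends G e \<Longrightarrow> R x (n x) (W0 x)" by metis
    have n: "\<And>x. x \<in> ends G e \<Longrightarrow> finite (W0 x) \<and> W0 x \<subseteq> verts G"
      "\<And>x W. x \<in> ends G e \<Longrightarrow> finite W \<Longrightarrow> W \<subseteq> verts G \<Longrightarrow> W0 x \<subseteq> W \<Longrightarrow> W \<noteq> {} \<Longrightarrow>
        tree_prob (wired G W) None (\<lambda>t. \<exists>bs\<in>paths_to G (n x) x. follows (wired G W) t bs) \<le> \<epsilon> / 2"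
      using R unfolding R_def by simp_all
    let ?W = "\<Union>x\<in>ends G e. W0 x \<union> ball_set G (n x) {x}"
    have "measure \<mu> {F \<in> space \<mu>. long_sides G n e F} \<le> \<epsilon>"
    proof (rule WSF_event_bound[OF \<mu> cyl])
      show "finite ?W" using n(1) eV finite_ball by auto
      have "W0 x \<union> ball_set G (n x) {x} \<subseteq> verts G" if "x \<in> ends G e" for x
        using n(1)[OF that] ball_in[of "{x}" "n x"] eV that by auto
      then show "?W \<subseteq> verts G" by (rule UN_least)
      fix W assume W: "finite W" "W \<subseteq> verts G" "W \<noteq> {}" "?W \<subseteq> W"
      interpret wn: wired_net G W using W(1,2,3) by unfold_locales
      have W4: "W0 x \<subseteq> W" "ball_set G (n x) {x} \<subseteq> W" if "x \<in> ends G e" for x using W(4) that by (simp_all add: UN_subset_iff)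
      let ?P = "\<lambda>x t. \<exists>bs\<in>paths_to G (n x) x. follows (wired G W) t bs"
      have "tree_prob (wired G W) None (\<lambda>t. long_sides G n e (tree_edges (wired G W) None t)) \<le>
         tree_prob (wired G W) None (\<lambda>t. ?P (src G e) t \<or> ?P (dst G e) t)"
      proof (rule wn.w.tree_prob_mono)
        fix t assume "t \<in> forests (wired G W) {None}" "long_sides G n e (tree_edges (wired G W) None t)"
        then have "\<exists>x\<in>ends G e. ?P x t" by (intro wn.long_sides_follows W4)
        then show "?P (src G e) t \<or> ?P (dst G e) t" by (auto simp: ends_def)
      qed
      also have "\<dots> \<le> tree_prob (wired G W) None (?P (src G e)) + tree_prob (wired G W) None (?P (dst G e))"
        by (rule wn.w.tree_prob_disj)
      also have "\<dots> \<le> \<epsilon> / 2 + \<epsilon> / 2"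
        by (intro add_mono n(2) W(1,2,3) W4) (simp_all add: ends_def)
      finally show "tree_prob (wired G W) None (\<lambda>t. long_sides G n e (tree_edges (wired G W) None t)) \<le> \<epsilon>" by simp
    qed
    then show ?thesis by blast
  qed
  show "AE F in \<mu>. \<not> (\<forall>n. long_sides G n e F)"
  proof -
    have "\<exists>n. measure \<mu> {F \<in> space \<mu>. long_sides G n e F} \<le> 1 / real (Suc k)" for k by (rule small) simp
    then obtain n where n: "\<And>k. measure \<mu> {F \<in> space \<mu>. long_sides G (n k) e F} \<le> 1 / real (Suc k)" by metis
    let ?A = "\<Inter>k. {F \<in> space \<mu>. long_sides G (n k) e F}"
    have A: "?A \<in> sets \<mu>" using meas by (intro sets.countable_INT) auto
    have "measure \<mu> ?A \<le> 1 / real (Suc k)" for k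
      using order_trans[OF finite_measure_mono[OF _ meas] n[of k], of ?A] by auto
    then have "measure \<mu> ?A \<le> 0"
      using LIMSEQ_le_const[OF LIMSEQ_inverse_real_of_nat, of "measure \<mu> ?A"] by (auto simp: inverse_eq_divide)
    then have "?A \<in> null_sets \<mu>" using A by (intro null_setsI) (auto simp: emeasure_eq_measure measure_le_0_iff)
    then show ?thesis by (rule AE_I') auto
  qed
qed

end

section \<open>From thin pasts to a single end\<close>

lemma walk_rev:
  assumes "walk G x bs y"
  shows "walk G y (map rev_arc (rev bs)) x"
  using assms
proof (induction bs arbitrary: x)
  case (Cons b bs)
  then have "walk G y (map rev_arc (rev bs)) (head G b)" "rev_arc b \<in> out_arcs G (head G b)" "head G (rev_arc b) = x"
    by (auto simp: out_arcs_def)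
  then show ?case by (auto simp: walk_append)
qed simp

lemma path_verts_heads: "walk G x bs y \<Longrightarrow> insert x (head G ` set bs) = path_verts G bs y"
proof (induction bs arbitrary: x)
  case (Cons b bs)
  then have "insert (head G b) (head G ` set bs) = path_verts G bs y" "x = tail G b" by (auto simp: out_arcs_def)
  then show ?case by (auto simp: path_verts_def)
qed (simp add: path_verts_def)

lemma card_path_verts: "self_avoiding G x bs y \<Longrightarrow> card (path_verts G bs y) = Suc (length bs)"
  using distinct_card[of "map (tail G) bs @ [y]"] by (auto simp: self_avoiding_def path_verts_def)

text \<open>
  In this form self-avoidance is visibly invariant under reversal.
\<close>

lemma self_avoiding_iff_card: "self_avoiding G x bs y \<longleftrightarrow> walk G x bs y \<and> card (path_verts G bs y) = Suc (length bs)"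
proof -
  have "set (map (tail G) bs @ [y]) = path_verts G bs y" by (auto simp: path_verts_def)
  moreover have "length (map (tail G) bs @ [y]) = Suc (length bs)" by simp
  ultimately show ?thesis unfolding self_avoiding_def by (metis card_distinct distinct_card)
qed

lemma path_verts_rev:
  assumes "walk G x bs y"
  shows "path_verts G (map rev_arc (rev bs)) x = path_verts G bs y"
  using path_verts_heads[OF assms] by (auto simp: path_verts_def image_image)

lemma self_avoiding_rev: "self_avoiding G x bs y \<Longrightarrow> self_avoiding G y (map rev_arc (rev bs)) x"
  by (auto simp: self_avoiding_iff_card walk_rev path_verts_rev)

lemma self_avoiding_prefix: "self_avoiding G x (bs @ cs) y \<Longrightarrow> \<exists>z. self_avoiding G x bs z"
proof -
  assume p: "self_avoiding G x (bs @ cs) y"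
  then obtain z where z: "walk G x bs z" "walk G z cs y" by (auto simp: self_avoiding_def walk_append)
  have "z \<in> path_verts G cs y" using z(2) by (cases cs) (auto simp: path_verts_def out_arcs_def)
  then have "z \<in> set (map (tail G) cs @ [y])" by (auto simp: path_verts_def)
  then show ?thesis using p z by (auto simp: self_avoiding_def intro!: exI[of _ z])
qed

lemma self_avoiding_suffix: "self_avoiding G x (bs @ cs) y \<Longrightarrow> \<exists>z. walk G x bs z \<and> self_avoiding G z cs y"
  by (auto simp: self_avoiding_def walk_append)

context inf_net
begin

lemma far_vertex: "infinite S \<Longrightarrow> \<exists>y\<in>S. y \<notin> ball_set G n {x}"
  using finite_ball[of "{x}" n] by (meson finite.emptyI finite_insert finite_subset subsetI)

text \<open>
  Koenig's lemma. Self-avoiding paths are extended one arc at a time while keeping arbitrarily long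
  self-avoiding continuations.
\<close>

lemma ray_exists: "\<exists>p. p \<in> rays G"
proof -
  obtain x where x: "x \<in> verts G" using conn by (auto simp: net_connected_def)
  define S where "S bs \<longleftrightarrow> (\<exists>y. self_avoiding G x bs y)" for bs
  (* Unbounded continuations, rather than infinitely many, pass to one of the finitely many extensions. *)
  define P where "P bs \<longleftrightarrow> (\<forall>n. \<exists>cs. n \<le> length cs \<and> S (bs @ cs))" for bs
  have P0: "P []"
    unfolding P_def
  proof
    fix n
    obtain y where y: "y \<in> verts G" "y \<notin> ball_set G n {x}" using far_vertex[OF inf_verts] by blast
    then have "(y, x) \<in> (adjacency G)\<^sup>*" using conn x by (auto simp: net_connected_def)
    then obtain ws where "walk G y ws x" using walk_of_rtrancl[of y x G] by blast
    then obtain bs where bs: "self_avoiding G y bs x" using walk_shorten[of G y ws x] by blast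
    have "n \<le> length bs"
      using walk_in_ball[of y bs x] bs y(2) subsetD[OF ball_mono[of "length bs" n "{x}"]] unfolding self_avoiding_def by (meson nat_le_linear)
    then show "\<exists>cs. n \<le> length cs \<and> S ([] @ cs)"
      using self_avoiding_rev[OF bs] by (intro exI[of _ "map rev_arc (rev bs)"]) (auto simp: S_def)
  qed
  have step: "\<exists>a. P (bs @ [a])" if P: "P bs" for bs
  proof (rule ccontr)
    assume "\<not> (\<exists>a. P (bs @ [a]))"
    then have "\<forall>a. \<exists>n. \<forall>cs. n \<le> length cs \<longrightarrow> \<not> S ((bs @ [a]) @ cs)" by (auto simp: P_def)
    then obtain n where n: "\<And>a cs. n a \<le> length cs \<Longrightarrow> \<not> S ((bs @ [a]) @ cs)" by metis
    obtain ds where "S (bs @ ds)" using P by (auto simp: P_def)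
    then obtain z where z: "self_avoiding G x bs z" unfolding S_def using self_avoiding_prefix by metis
    define m where "m = Suc (Max (n ` out_arcs G z))"
    obtain cs where cs: "m \<le> length cs" "S (bs @ cs)" using P by (auto simp: P_def)
    then obtain a cs' where a: "cs = a # cs'" by (cases cs) (auto simp: m_def)
    have "walk G x bs z' \<Longrightarrow> z' = z" for z' using z unfolding self_avoiding_def
    proof -
      have "walk G u bs z \<Longrightarrow> walk G u bs z' \<Longrightarrow> z' = z" for u
        by (induction bs arbitrary: u) auto
      then show "walk G x bs z' \<Longrightarrow> walk G x bs z \<and> distinct (map (tail G) bs @ [z]) \<Longrightarrow> z' = z" by blast
    qed
    then have "a \<in> out_arcs G z" using cs(2) a by (auto simp: S_def self_avoiding_def walk_append)
    then have "n a \<le> Max (n ` out_arcs G z)" by simp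
    then have "n a \<le> length cs'" using cs(1) a by (simp add: m_def)
    then show False using n[of a cs'] cs(2) a by simp
  qed
  define f where "f = rec_nat [] (\<lambda>_ bs. bs @ [SOME a. P (bs @ [a])])"
  define c where "c n = (SOME a. P (f n @ [a]))" for n
  have f: "f 0 = []" "\<And>n. f (Suc n) = f n @ [c n]" by (simp_all add: f_def c_def)
  have Pf: "P (f n)" for n
    by (induction n) (auto simp: f P0 c_def intro: someI_ex[OF step])
  have lf: "length (f n) = n" for n by (induction n) (auto simp: f)
  have pre: "\<exists>cs. f n = f m @ cs" if "m \<le> n" for m n using that
    by (induction n) (auto simp: f le_Suc_eq)
  have Sf: "S (f n)" for n
  proof -
    obtain cs where "S (f n @ cs)" using Pf by (auto simp: P_def)
    then show ?thesis unfolding S_def using self_avoiding_prefix by metis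
  qed
  have arc: "c n \<in> oriented_edges G \<and> tail G (c (Suc n)) = head G (c n)" for n
  proof -
    have "S (f n @ [c n, c (Suc n)])" using Sf[of "Suc (Suc n)"] by (simp add: f)
    then show ?thesis by (auto simp: S_def self_avoiding_def walk_append out_arcs_def)
  qed
  have inj: "tail G (c i) \<noteq> tail G (c j)" if "i < j" for i j
  proof -
    from pre[OF Suc_leI[OF that]] obtain cs where "f j = f (Suc i) @ cs" by blast
    then have "S (f i @ [c i] @ cs @ [c j])" using Sf[of "Suc j"] by (simp add: f)
    then show ?thesis by (auto simp: S_def self_avoiding_def)
  qed
  have "(\<lambda>n. tail G (c n), \<lambda>n. fst (c n)) \<in> rays G"
    unfolding rays_def mem_Collect_eq prod.case
  proof (intro conjI allI)
    have "i = j" if "tail G (c i) = tail G (c j)" for i j using inj[of i j] inj[of j i] that by (metis linorder_neqE_nat)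
    then show "inj (\<lambda>n. tail G (c n))" by (simp add: inj_def)
    show "range (\<lambda>n. tail G (c n)) \<subseteq> verts G" using arc tail_in by blast
    show "range (\<lambda>n. fst (c n)) \<subseteq> edges G" using arc unfolding oriented_edges_def mem_Times_iff by blast
    show "ends G (fst (c n)) = {tail G (c n), tail G (c (Suc n))}" for n using arc[of n] by (simp add: ends_fst)
  qed
  then show ?thesis by blast
qed

lemma long_path_of_infinite:
  assumes F: "F \<subseteq> edges G" and x: "x \<in> verts G" and inf: "infinite {y. (x, y) \<in> (adjacency (G\<lparr>edges := F\<rparr>))\<^sup>*}"
  shows "\<exists>bs\<in>paths_to G n x. fst ` set bs \<subseteq> F"
proof -
  let ?F = "G\<lparr>edges := F\<rparr>"
  obtain y where y: "(x, y) \<in> (adjacency ?F)\<^sup>*" "y \<notin> ball_set G n {x}" using far_vertex[OF inf] by blast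
  have "(y, x) \<in> (adjacency ?F)\<^sup>*" using y(1) by (rule adjacency_rtrancl_sym)
  then obtain ws where "walk ?F y ws x" using walk_of_rtrancl[of y x ?F] by blast
  then obtain bs where bs: "self_avoiding ?F y bs x" using walk_shorten[of ?F y ws x] by blast
  have w: "walk ?F u cs z \<Longrightarrow> walk G u cs z \<and> fst ` set cs \<subseteq> F" for u cs z
    using F by (induction cs arbitrary: u) (auto simp: out_arcs_def oriented_edges_def tail_def head_def)
  have "tail ?F = tail G" by (simp add: tail_def fun_eq_iff)
  then have bsG: "self_avoiding G y bs x" "fst ` set bs \<subseteq> F" using bs w[of y bs x] by (simp_all add: self_avoiding_def)
  have l: "n \<le> length bs"
    using walk_in_ball[of y bs x] bsG y(2) subsetD[OF ball_mono[of "length bs" n "{x}"]] unfolding self_avoiding_def by (meson nat_le_linear)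
  define cs where "cs = drop (length bs - n) bs"
  have "bs = take (length bs - n) bs @ cs" by (simp add: cs_def)
  then obtain z where z: "self_avoiding G z cs x" using bsG(1) self_avoiding_suffix by metis
  have "z \<in> verts G"
  proof (cases cs)
    case Nil then show ?thesis using z x by (simp add: self_avoiding_def)
  next
    case (Cons a as)
    then have "a \<in> out_arcs G z" using z by (simp add: self_avoiding_def)
    then show ?thesis using tail_in[of a] by (simp add: out_arcs_def)
  qed
  moreover have "length cs = n" using l by (simp add: cs_def)
  moreover have "fst ` set cs \<subseteq> F" using bsG(2) set_drop_subset[of _ bs] by (auto simp: cs_def)
  ultimately show ?thesis using z by (auto simp: paths_to_def)
qed

lemma ray_walk:
  assumes F: "\<And>i. i < n \<Longrightarrow> q i \<in> F" and e: "\<And>i. ends G (q i) = {p i, p (Suc i)}"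
  shows "(p 0, p n) \<in> (adjacency (G\<lparr>edges := F\<rparr>))\<^sup>*"
  using F
proof (induction n)
  case (Suc n)
  then have "(p n, p (Suc n)) \<in> adjacency (G\<lparr>edges := F\<rparr>)"
    using e[of n] by (auto simp: adjacency_def ends_def intro!: bexI[of _ "q n"])
  then show ?case using Suc by (auto intro: rtrancl_into_rtrancl)
qed simp

text \<open>
  If the second ray misses infinitely many edges of the first, it misses one, \<open>e\<close>, that is also off a
  fixed path between the two rays. Then the whole second ray lies on one side of \<open>e\<close>, and the rest of
  the first ray on the other side; so \<open>e\<close> has two infinite sides.
\<close>

lemma rays_almost_contained:
  assumes F: "F \<subseteq> edges G" and nl: "\<And>e. e \<in> F \<Longrightarrow> \<exists>n. \<not> long_sides G n e F"
    and r: "inj p" "range p \<subseteq> verts G" "range q \<subseteq> F" "\<And>i. ends G (q i) = {p i, p (Suc i)}"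
    and s: "inj p'" "range q' \<subseteq> F" "\<And>i. ends G (q' i) = {p' i, p' (Suc i)}"
    and c: "(p' 0, p 0) \<in> (adjacency (G\<lparr>edges := F\<rparr>))\<^sup>*"
  shows "finite (range q - range q')"
proof (rule ccontr)
  assume inf: "infinite (range q - range q')"
  let ?F = "G\<lparr>edges := F\<rparr>"
  obtain bs where bs: "walk ?F (p' 0) bs (p 0)" using walk_of_rtrancl[OF c] by blast
  have "finite (fst ` set bs)" by simp
  then obtain e where e: "e \<in> range q - range q'" "e \<notin> fst ` set bs"
    using inf by (meson finite_subset subsetI)
  then obtain i where i: "e = q i" by auto
  let ?E = "G\<lparr>edges := F - {e}\<rparr>"
  have qj: "q j \<noteq> e" if "j \<noteq> i" for j
  proof
    assume "q j = e"
    then have "{p j, p (Suc j)} = {p i, p (Suc i)}" using r(4) i by metis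
    then show False using r(1) that by (auto simp: doubleton_eq_iff inj_eq)
  qed
  have A: "(p 0, p i) \<in> (adjacency ?E)\<^sup>*" by (rule ray_walk[of _ q]) (use r qj in auto)
  have B: "(p (Suc i), p (Suc (i + n))) \<in> (adjacency ?E)\<^sup>*" for n
    using ray_walk[of n "\<lambda>j. q (Suc i + j)" "F - {e}" "\<lambda>j. p (Suc i + j)"] r qj by (auto simp: image_subset_iff)
  have C: "(p' 0, p' n) \<in> (adjacency ?E)\<^sup>*" for n
    by (rule ray_walk[of _ q']) (use s e(1) in \<open>auto simp: image_subset_iff\<close>, metis rangeI)
  have "walk ?F u cs z \<Longrightarrow> e \<notin> fst ` set cs \<Longrightarrow> walk ?E u cs z" for u cs z
    by (induction cs arbitrary: u) (auto simp: out_arcs_def oriented_edges_def tail_def head_def)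
  then have D: "(p' 0, p 0) \<in> (adjacency ?E)\<^sup>*" using bs e by (intro rtrancl_of_walk[of _ _ bs]) auto
  have "(p i, p' n) \<in> (adjacency ?E)\<^sup>*" for n
    using adjacency_rtrancl_sym[OF A] adjacency_rtrancl_sym[OF D] C[of n] by (meson rtrancl_trans)
  then have "range p' \<subseteq> {y. (p i, y) \<in> (adjacency ?E)\<^sup>*}" by auto
  then have I1: "infinite {y. (p i, y) \<in> (adjacency ?E)\<^sup>*}"
    using range_inj_infinite[OF s(1)] finite_subset by blast
  have "range (\<lambda>n. p (Suc (i + n))) \<subseteq> {y. (p (Suc i), y) \<in> (adjacency ?E)\<^sup>*}" using B by auto
  moreover have "infinite (range (\<lambda>n. p (Suc (i + n))))"
    by (rule range_inj_infinite, rule injI, drule injD[OF r(1)]) simp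
  ultimately have I2: "infinite {y. (p (Suc i), y) \<in> (adjacency ?E)\<^sup>*}" using finite_subset by blast
  have "\<exists>bs\<in>paths_to G (n x) x. fst ` set bs \<subseteq> F - {e}" if "x \<in> ends G e" for n x
    using that i r I1 I2 F by (intro long_path_of_infinite) auto
  then have "long_sides G n e F" for n using e i r by (auto simp: long_sides_def)
  moreover have "e \<in> F" using i r by auto
  ultimately show False using nl by blast
qed

text \<open>
  The components are infinite, so they contain rays, and any two rays of a component have finite
  symmetric difference by \<open>rays_almost_contained\<close> applied twice.
\<close>

lemma one_end:
  assumes F: "F \<subseteq> edges G" and nl: "\<And>e. e \<in> F \<Longrightarrow> \<exists>n. \<not> long_sides G n e F"
    and cr: "\<And>K. finite K \<Longrightarrow> K \<noteq> {} \<Longrightarrow> K \<subseteq> verts G \<Longrightarrow> F \<inter> edge_boundary G K \<noteq> {}"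
    and T: "T \<in> net_components (G\<lparr>edges := F\<rparr>)"
  shows "card (tree_ends T) = 1"
proof -
  let ?F = "G\<lparr>edges := F\<rparr>"
  obtain x where x: "x \<in> verts G" and Teq: "T = induced ?F {y \<in> verts G. (x, y) \<in> (adjacency ?F)\<^sup>*}"
    using T by (auto simp: net_components_def)
  define C where "C = {y \<in> verts G. (x, y) \<in> (adjacency ?F)\<^sup>*}"
  have T': "verts T = C" "edges T = {e \<in> F. ends G e \<subseteq> C}" "src T = src G" "dst T = dst G" "cond T = cond G"
    by (simp_all add: Teq C_def induced_def ends_def)
  have eT: "ends T = ends G" by (simp add: ends_def T' fun_eq_iff)
  have xC: "x \<in> C" using x by (simp add: C_def)
  have closed: "ends G e \<subseteq> C" if e: "e \<in> F" "y \<in> ends G e" "y \<in> C" for e y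
  proof
    fix z assume z: "z \<in> ends G e"
    show "z \<in> C"
    proof (cases "z = y")
      case False
      then have "ends G e = {y, z}" using z e by (auto simp: ends_def)
      then have "(y, z) \<in> adjacency ?F" using e(1) by (auto simp: adjacency_def ends_def)
      moreover have "z \<in> verts G" using z e(1) F network by (auto simp: ends_def is_network_def)
      ultimately show ?thesis using e(3) by (auto simp: C_def intro: rtrancl_into_rtrancl)
    qed (use e in simp)
  qed
  have infC: "infinite C"
  proof
    assume "finite C"
    then obtain e where "e \<in> F" "e \<in> edge_boundary G C" using cr[of C] xC by (auto simp: C_def)
    then show False using closed by (fastforce simp: edge_boundary_def)
  qed
  have conT: "net_connected T"
  proof -
    have sub: "(x, y) \<in> (adjacency T)\<^sup>*" if "(x, y) \<in> (adjacency ?F)\<^sup>*" for y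
      using that
    proof induction
      case (step y z)
      then obtain e where e: "e \<in> F" "ends G e = {y, z}" by (auto simp: adjacency_def ends_def)
      have "y \<in> verts G" using e F network by (auto simp: ends_def is_network_def doubleton_eq_iff)
      then have "y \<in> C" using step by (simp add: C_def)
      then have "e \<in> edges T" using closed[OF e(1), of y] e by (auto simp: T')
      then have "(y, z) \<in> adjacency T" using e by (auto simp: adjacency_def eT)
      then show ?case using step by (auto intro: rtrancl_into_rtrancl)
    qed simp
    show ?thesis unfolding net_connected_def T'
      using sub xC adjacency_rtrancl_sym[of x _ T] by (auto simp: C_def intro: rtrancl_trans)
  qed
  interpret T: inf_net T
  proof
    show "is_network T" using network F by (auto simp: is_network_def T' ends_def)
    show "infinite (verts T)" using infC by (simp add: T')
    show "net_connected T" by (rule conT)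
    show "locally_finite T"
      unfolding locally_finite_def
    proof
      fix y assume "y \<in> verts T"
      then have "finite {e \<in> edges G. y \<in> ends G e}" using loc_fin by (auto simp: T' C_def locally_finite_def)
      then show "finite {e \<in> edges T. y \<in> ends T e}" by (rule rev_finite_subset) (use F in \<open>auto simp: T' eT\<close>)
    qed
  qed
  have "rays T \<noteq> {}" using T.ray_exists by auto
  moreover have eq: "finite (sym_diff (range (snd r)) (range (snd s)))" if rs: "r \<in> rays T" "s \<in> rays T" for r s
  proof -
    have ray: "inj (fst r) \<and> range (fst r) \<subseteq> C \<and> range (snd r) \<subseteq> F \<and> (\<forall>i. ends G (snd r i) = {fst r i, fst r (Suc i)})"
      if "r \<in> rays T" for r
      using that by (auto simp: rays_def T' eT)
    have cc: "(y, z) \<in> (adjacency ?F)\<^sup>*" if "y \<in> C" "z \<in> C" for y z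
      using that adjacency_rtrancl_sym[of x y ?F] by (auto simp: C_def intro: rtrancl_trans)
    have "finite (range (snd r) - range (snd s))" if "r \<in> rays T" "s \<in> rays T" for r s
      using ray[OF that(1)] ray[OF that(2)] cc[of "fst s 0" "fst r 0"]
      by (intro rays_almost_contained[OF F nl, of "fst r" _ "fst s"]) (auto simp: C_def)
    then show ?thesis using rs by auto
  qed
  ultimately have "tree_ends T = {rays T}"
    unfolding tree_ends_def quotient_def by auto
  then show ?thesis by simp
qed

theorem one_end_of_thin_pasts:
  assumes "is_WSF G \<mu>" thin_pasts
  shows "AE F in \<mu>. \<forall>T\<in>net_components (G\<lparr>edges := F\<rparr>). card (tree_ends T) = 1"
  using WSF_crosses[OF assms(1)] WSF_no_long_sides[OF assms] AE_space
proof eventually_elim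
  case (elim F)
  then have "F \<subseteq> edges G" using space_WSF[OF assms(1)] by simp
  then show ?case using elim by (intro ballI one_end[of F]) auto
qed

end

section \<open>Isoperimetry and capacity\<close>

lemma path_cond_rev [simp]: "path_cond G (map rev_arc (rev bs)) = path_cond G bs"
  by (simp add: path_cond_def o_def rev_map[symmetric] prod_list.rev)

text \<open>
  A path in the direction of the exit arcs is determined by its start and its length.
\<close>

lemma follows_unique:
  "walk G x bs y \<Longrightarrow> walk G x bs' y' \<Longrightarrow> length bs = length bs' \<Longrightarrow> follows G t bs \<Longrightarrow> follows G t bs' \<Longrightarrow> bs = bs'"
proof (induction bs arbitrary: x bs')
  case (Cons b bs)
  then obtain c cs where c: "bs' = c # cs" by (cases bs') auto
  have "b = c" using Cons.prems c by (auto simp: follows_def out_arcs_def)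
  moreover have "bs = cs"
    by (rule Cons.IH[of "head G b"]) (use Cons.prems c \<open>b = c\<close> in \<open>auto simp: follows_def\<close>)
  ultimately show ?case using c by simp
qed simp

lemma self_avoiding_at_vertex:
  assumes "self_avoiding G u bs x" "y \<in> path_verts G bs x"
  shows "\<exists>ds cs. bs = ds @ cs \<and> self_avoiding G y cs x"
proof (cases "y = x")
  case True
  then show ?thesis by (intro exI[of _ bs] exI[of _ "[]"]) (simp add: self_avoiding_def)
next
  case False
  then obtain b where "b \<in> set bs" "tail G b = y" using assms(2) by (auto simp: path_verts_def)
  then obtain ds es where b: "bs = ds @ b # es" by (auto simp: in_set_conv_decomp)
  then obtain z where z: "self_avoiding G z (b # es) x" using self_avoiding_suffix[of G u ds "b # es" x] assms(1) by blast
  then have "z = y" using \<open>tail G b = y\<close> by (auto simp: self_avoiding_def out_arcs_def)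
  then show ?thesis using b z by blast
qed

context wired_net
begin

text \<open>
  The probability of hitting \<open>A\<close> before leaving \<open>W\<close>, as a function on all of \<open>G\<close>.
\<close>

definition potential :: "'v set \<Rightarrow> 'v \<Rightarrow> real" where
  "potential A z = forest_hit N (insert None (Some ` A)) (Some ` A) (wired_proj W z)"

lemma potential_props:
  assumes A: "A \<subseteq> W"
  shows "0 \<le> potential A z" "potential A z \<le> 1" "z \<in> A \<Longrightarrow> potential A z = 1" "z \<notin> W \<Longrightarrow> potential A z = 0"
proof -
  have sub: "insert None (Some ` A) \<subseteq> verts N" using A by (auto simp: verts_N)
  show "0 \<le> potential A z" by (simp add: potential_def w.forest_hit_nonneg)
  show "potential A z \<le> 1" unfolding potential_def using sub by (intro w.forest_hit_le_1) auto
  show "z \<in> A \<Longrightarrow> potential A z = 1" using A sub by (auto simp: potential_def w.forest_hit_root)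
  show "z \<notin> W \<Longrightarrow> potential A z = 0" using sub by (auto simp: potential_def w.forest_hit_root wired_proj_def)
qed

lemma potential_lap:
  assumes A: "A \<subseteq> W" and x: "x \<in> W"
  shows "(\<Sum>a\<in>out_arcs G x. cond G (fst a) * (potential A x - potential A (head G a))) = (if x \<in> A then escape N None (Some ` A) (Some x) else 0)"
proof -
  let ?H = "forest_hit N (insert None (Some ` A)) (Some ` A)"
  have sub: "insert None (Some ` A) \<subseteq> verts N" using A by (auto simp: verts_N)
  have "(\<Sum>a\<in>out_arcs G x. cond G (fst a) * (potential A x - potential A (head G a))) =
     (\<Sum>a\<in>out_arcs N (Some x). cond G (fst a) * (?H (Some x) - ?H (head N a)))"
    using x by (subst lap_N) (auto simp: potential_def)
  also have "\<dots> = (if x \<in> A then escape N None (Some ` A) (Some x) else 0)"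
  proof (cases "x \<in> A")
    case True
    then have "?H (Some x) = 1" using sub by (subst w.forest_hit_root) auto
    moreover have "escape N None (Some ` A) (Some x) = (\<Sum>a\<in>out_arcs N (Some x). cond N (fst a) * (1 - ?H (head N a)))"
      using sub by (intro w.escape_eq) auto
    ultimately show ?thesis using True by simp
  next
    case False
    then show ?thesis using w.forest_hit_harmonic[of "Some x" "insert None (Some ` A)" "Some ` A"] sub x by (auto simp: verts_N)
  qed
  finally show ?thesis .
qed

lemma capacity_sum_escape: "A \<subseteq> W \<Longrightarrow> capacity N None (Some ` A) = (\<Sum>x\<in>A. escape N None (Some ` A) (Some x))"
  by (subst w.capacity_eq_escape) (auto simp: verts_N sum.reindex)

lemma sum_arcs_at_W:
  fixes f :: "'v \<Rightarrow> 'v \<Rightarrow> real"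
  assumes "\<And>y z. y \<notin> W \<Longrightarrow> f y z = 0"
  shows "(\<Sum>x\<in>W. \<Sum>a\<in>out_arcs G x. cond G (fst a) * f x (head G a)) =
    (\<Sum>e | e \<in> edges G \<and> ends G e \<inter> W \<noteq> {}. cond G e * (f (src G e) (dst G e) + f (dst G e) (src G e)))"
proof -
  let ?E = "{e \<in> edges G. ends G e \<inter> W \<noteq> {}}"
  have finE: "finite ?E" by (rule finite_edges_at[OF finW Wsub])
  have "(\<Sum>x\<in>W. \<Sum>a\<in>out_arcs G x. cond G (fst a) * f x (head G a)) =
     (\<Sum>x\<in>W. \<Sum>a\<in>out_arcs G x. cond G (fst a) * f (tail G a) (head G a))"
    by (intro sum.cong refl) (simp add: out_arcs_def)
  also have "\<dots> = (\<Sum>a\<in>(\<Union>x\<in>W. out_arcs G x). cond G (fst a) * f (tail G a) (head G a))"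
    using finW fin_out by (intro sum.UNION_disjoint[symmetric] ballI impI) (assumption, assumption, auto simp: out_arcs_def)
  also have "\<dots> = (\<Sum>a\<in>?E \<times> UNIV. cond G (fst a) * f (tail G a) (head G a))"
    using finE assms
    by (intro sum.mono_neutral_left) (auto simp: out_arcs_def oriented_edges_def tail_def ends_def split: if_splits)
  also have "\<dots> = (\<Sum>e\<in>?E. \<Sum>b\<in>UNIV. cond G e * f (tail G (e, b)) (head G (e, b)))"
    by (simp add: sum.cartesian_product case_prod_beta)
  also have "\<dots> = (\<Sum>e\<in>?E. cond G e * (f (src G e) (dst G e) + f (dst G e) (src G e)))"
    by (intro sum.cong refl) (simp add: UNIV_bool tail_def head_def distrib_left add.commute)
  finally show ?thesis by simp
qed

text \<open>
  The capacity is the Dirichlet energy of the potential, by summation by parts.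
\<close>

lemma capacity_energy:
  assumes A: "A \<subseteq> W"
  shows "capacity N None (Some ` A) = (\<Sum>e | e \<in> edges G \<and> ends G e \<inter> W \<noteq> {}. cond G e * (potential A (src G e) - potential A (dst G e))\<^sup>2)"
proof -
  have "capacity N None (Some ` A) = (\<Sum>x\<in>A. potential A x * (\<Sum>a\<in>out_arcs G x. cond G (fst a) * (potential A x - potential A (head G a))))"
    unfolding capacity_sum_escape[OF A]
  proof (rule sum.cong[OF refl])
    fix x assume x: "x \<in> A"
    then have "x \<in> W" using A by auto
    then show "escape N None (Some ` A) (Some x) = potential A x * (\<Sum>a\<in>out_arcs G x. cond G (fst a) * (potential A x - potential A (head G a)))"
      unfolding potential_lap[OF A \<open>x \<in> W\<close>] using x potential_props(3)[OF A x] by simp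
  qed
  also have "\<dots> = (\<Sum>x\<in>W. potential A x * (\<Sum>a\<in>out_arcs G x. cond G (fst a) * (potential A x - potential A (head G a))))"
    using A finW by (intro sum.mono_neutral_left) (auto simp: potential_lap)
  also have "\<dots> = (\<Sum>x\<in>W. \<Sum>a\<in>out_arcs G x. cond G (fst a) * (potential A x * (potential A x - potential A (head G a))))"
    by (simp add: sum_distrib_left mult.left_commute)
  also have "\<dots> = (\<Sum>e | e \<in> edges G \<and> ends G e \<inter> W \<noteq> {}. cond G e * (potential A (src G e) * (potential A (src G e) - potential A (dst G e)) + potential A (dst G e) * (potential A (dst G e) - potential A (src G e))))"
    by (rule sum_arcs_at_W[where f = "\<lambda>y z. potential A y * (potential A y - potential A z)"]) (use potential_props(4)[OF A] in auto)
  finally show ?thesis by (simp add: power2_eq_square algebra_simps)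
qed

end

context inf_net
begin

lemma net_pi_sum: "finite K \<Longrightarrow> net_pi G K = (\<Sum>x\<in>K. net_pi G {x})"
proof -
  assume K: "finite K"
  have "{a. a \<in> oriented_edges G \<and> tail G a \<in> K} = (\<Union>x\<in>K. out_arcs G x)" by (auto simp: out_arcs_def)
  then have "net_pi G K = (\<Sum>a\<in>(\<Union>x\<in>K. out_arcs G x). cond G (fst a))" by (simp add: net_pi_def)
  also have "\<dots> = (\<Sum>x\<in>K. \<Sum>a\<in>out_arcs G x. cond G (fst a))"
    using K fin_out by (intro sum.UNION_disjoint ballI impI) (assumption, assumption, auto simp: out_arcs_def)
  finally show ?thesis by (simp add: net_pi_single)
qed

text \<open>
  The boundary of a set is the disjoint union of the boundaries of its components.
\<close>

lemma iso_disconnected: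
  assumes con: "\<And>K. finite K \<Longrightarrow> K \<subseteq> verts G \<Longrightarrow> net_connected (induced G K) \<Longrightarrow> h * net_pi G K \<le> (\<Sum>e\<in>edge_boundary G K. cond G e)"
    and K: "finite K" "K \<subseteq> verts G"
  shows "h * net_pi G K \<le> (\<Sum>e\<in>edge_boundary G K. cond G e)"
  using K
proof (induction "card K" arbitrary: K rule: less_induct)
  case less
  show ?case
  proof (cases "K = {}")
    case True then show ?thesis by (simp add: net_pi_def edge_boundary_def)
  next
    case False
    then obtain x where x: "x \<in> K" by blast
    let ?K = "induced G K"
    define C where "C = {y \<in> K. (x, y) \<in> (adjacency ?K)\<^sup>*}"
    have CK: "x \<in> C" "C \<subseteq> K" "finite C" using x less.prems by (auto simp: C_def intro: finite_subset)
    have noedge: "ends G e \<subseteq> C" if e: "e \<in> edges G" "ends G e \<subseteq> K" "ends G e \<inter> C \<noteq> {}" for e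
    proof
      fix z assume z: "z \<in> ends G e"
      obtain y where y: "y \<in> ends G e" "y \<in> C" using e by blast
      show "z \<in> C"
      proof (cases "z = y")
        case False
        then have "ends G e = {y, z}" using z y by (auto simp: ends_def)
        then have "(y, z) \<in> adjacency ?K" using e by (auto simp: adjacency_def induced_def ends_def)
        then show ?thesis using y z e by (auto simp: C_def intro: rtrancl_into_rtrancl)
      qed (use y in simp)
    qed
    have "net_connected (induced G C)"
    proof -
      have sub: "(x, y) \<in> (adjacency (induced G C))\<^sup>*" if "(x, y) \<in> (adjacency ?K)\<^sup>*" for y
        using that
      proof induction
        case (step y z)
        then obtain e where e: "e \<in> edges G" "ends G e \<subseteq> K" "ends G e = {y, z}" by (auto simp: adjacency_def induced_def ends_def)
        then have "y \<in> C" using step by (auto simp: C_def)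
        then have "ends G e \<subseteq> C" using noedge[OF e(1,2)] e by auto
        then have "(y, z) \<in> adjacency (induced G C)" using e by (auto simp: adjacency_def induced_def ends_def)
        then show ?case using step by (auto intro: rtrancl_into_rtrancl)
      qed simp
      have "verts (induced G C) = C" by (simp add: induced_def)
      then show ?thesis unfolding net_connected_def
        using sub CK adjacency_rtrancl_sym[of x _ "induced G C"] by (auto simp: C_def intro: rtrancl_trans)
    qed
    then have 1: "h * net_pi G C \<le> (\<Sum>e\<in>edge_boundary G C. cond G e)"
      using CK less.prems by (intro con) auto
    have 2: "h * net_pi G (K - C) \<le> (\<Sum>e\<in>edge_boundary G (K - C). cond G e)"
      using CK less.prems by (intro less.hyps psubset_card_mono) auto
    have fin: "finite (edge_boundary G S)" if "S \<subseteq> K" for S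
      by (rule finite_subset[OF _ finite_edges_at[OF less.prems]]) (use that in \<open>auto simp: edge_boundary_def\<close>)
    have disj: "edge_boundary G C \<inter> edge_boundary G (K - C) = {}"
    proof -
      have False if e: "e \<in> edge_boundary G C" "e \<in> edge_boundary G (K - C)" for e
      proof -
        have "ends G e \<subseteq> K" using e CK(2) by (fastforce simp: edge_boundary_def ends_def)
        then show False using noedge[of e] e by (auto simp: edge_boundary_def)
      qed
      then show ?thesis by blast
    qed
    have un: "edge_boundary G C \<union> edge_boundary G (K - C) = edge_boundary G K"
    proof
      show "edge_boundary G C \<union> edge_boundary G (K - C) \<subseteq> edge_boundary G K"
      proof
        fix e assume e: "e \<in> edge_boundary G C \<union> edge_boundary G (K - C)"
        have "\<not> ends G e \<subseteq> K" using e noedge[of e] by (auto simp: edge_boundary_def)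
        then show "e \<in> edge_boundary G K" using e CK by (auto simp: edge_boundary_def)
      qed
      show "edge_boundary G K \<subseteq> edge_boundary G C \<union> edge_boundary G (K - C)"
        using CK by (auto simp: edge_boundary_def)
    qed
    have "net_pi G K = net_pi G C + net_pi G (K - C)"
      using CK less.prems sum.subset_diff[of C K "\<lambda>x. net_pi G {x}"] net_pi_sum[of K] net_pi_sum[of C] net_pi_sum[of "K - C"] by simp
    then have "h * net_pi G K \<le> (\<Sum>e\<in>edge_boundary G C. cond G e) + (\<Sum>e\<in>edge_boundary G (K - C). cond G e)"
      using 1 2 by (simp add: distrib_left)
    also have "\<dots> = (\<Sum>e\<in>edge_boundary G K. cond G e)"
      unfolding un[symmetric] using fin CK disj by (intro sum.union_disjoint[symmetric]) auto
    finally show ?thesis .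
  qed
qed

text \<open>
  Peel off the smallest positive value of \<open>f\<close> on its support, to which the isoperimetric inequality
  applies.
\<close>

lemma coarea:
  assumes iso: "\<And>K. finite K \<Longrightarrow> K \<subseteq> verts G \<Longrightarrow> h * net_pi G K \<le> (\<Sum>e\<in>edge_boundary G K. cond G e)"
    and W: "finite W" "W \<subseteq> verts G" and f: "\<And>x. 0 \<le> f x" "\<And>x. x \<notin> W \<Longrightarrow> f x = 0"
  shows "h * (\<Sum>x\<in>W. net_pi G {x} * f x) \<le> (\<Sum>e | e \<in> edges G \<and> ends G e \<inter> W \<noteq> {}. cond G e * \<bar>f (src G e) - f (dst G e)\<bar>)"
  using f
proof (induction "card {x \<in> W. 0 < f x}" arbitrary: f rule: less_induct)
  case less
  let ?E = "{e \<in> edges G. ends G e \<inter> W \<noteq> {}}"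
  define K where "K = {x \<in> W. 0 < f x}"
  have Kf: "finite K" "K \<subseteq> verts G" "K \<subseteq> W" using W by (auto simp: K_def)
  have cp: "e \<in> edges G \<Longrightarrow> 0 < cond G e" for e using network by (auto simp: is_network_def)
  have finE: "finite ?E" by (rule finite_edges_at[OF W])
  have offK: "f x = 0" if "x \<notin> K" for x using less.prems[of x] that by (cases "x \<in> W") (auto simp: K_def)
  show ?case
  proof (cases "K = {}")
    case True
    then have "f x = 0" for x using offK by simp
    then show ?thesis by simp
  next
    case False
    (* The smallest positive value; subtracting it on \<open>K\<close> shrinks the support. *)
    define m where "m = Min (f ` K)"
    have "m \<in> f ` K" unfolding m_def using Kf False by (intro Min_in) auto
    then obtain z where z: "z \<in> K" "f z = m" by blast
    have m: "0 < m" using z by (auto simp: K_def)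
    have mle: "m \<le> f x" if "x \<in> K" for x using that Kf by (simp add: m_def)
    define g where "g x = (if x \<in> K then f x - m else 0)" for x
    have "{x \<in> W. 0 < g x} \<subseteq> K - {z}" using z by (auto simp: g_def split: if_splits)
    then have "card {x \<in> W. 0 < g x} < card K"
      using z Kf by (metis Diff_subset card_Diff1_less card_mono finite_Diff le_less_trans)
    then have "card {x \<in> W. 0 < g x} < card {x \<in> W. 0 < f x}" by (simp add: K_def)
    then have IH: "h * (\<Sum>x\<in>W. net_pi G {x} * g x) \<le> (\<Sum>e\<in>?E. cond G e * \<bar>g (src G e) - g (dst G e)\<bar>)"
      by (rule less.hyps) (use mle Kf in \<open>auto simp: g_def\<close>)
    have fg: "f x = m * of_bool (x \<in> K) + g x" for x by (simp add: g_def offK)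
    have g0: "0 \<le> g x" "x \<notin> K \<Longrightarrow> g x = 0" for x using mle by (auto simp: g_def)
    have "\<bar>f x - f y\<bar> = m * of_bool ((x \<in> K) \<noteq> (y \<in> K)) + \<bar>g x - g y\<bar>" for x y
      unfolding fg using g0[of x] g0[of y] m by (cases "x \<in> K"; cases "y \<in> K") auto
    then have "(\<Sum>e\<in>?E. cond G e * \<bar>f (src G e) - f (dst G e)\<bar>) =
       (\<Sum>e\<in>?E. m * (cond G e * of_bool ((src G e \<in> K) \<noteq> (dst G e \<in> K))) + cond G e * \<bar>g (src G e) - g (dst G e)\<bar>)"
      by (intro sum.cong refl) (simp add: algebra_simps)
    also have "\<dots> = m * (\<Sum>e\<in>?E. cond G e * of_bool ((src G e \<in> K) \<noteq> (dst G e \<in> K))) + (\<Sum>e\<in>?E. cond G e * \<bar>g (src G e) - g (dst G e)\<bar>)"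
      unfolding sum.distrib sum_distrib_left[symmetric] ..
    also have "(\<Sum>e\<in>?E. cond G e * of_bool ((src G e \<in> K) \<noteq> (dst G e \<in> K))) = (\<Sum>e\<in>edge_boundary G K. cond G e)"
      using finE Kf by (intro sum.mono_neutral_cong_right) (auto simp: edge_boundary_def ends_def)
    finally have E: "(\<Sum>e\<in>?E. cond G e * \<bar>f (src G e) - f (dst G e)\<bar>) =
       m * (\<Sum>e\<in>edge_boundary G K. cond G e) + (\<Sum>e\<in>?E. cond G e * \<bar>g (src G e) - g (dst G e)\<bar>)" .
    have "(\<Sum>x\<in>W. net_pi G {x} * f x) = (\<Sum>x\<in>W. m * (net_pi G {x} * of_bool (x \<in> K)) + net_pi G {x} * g x)"
      by (intro sum.cong refl) (simp only: fg, simp only: algebra_simps)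
    also have "\<dots> = m * (\<Sum>x\<in>W. net_pi G {x} * of_bool (x \<in> K)) + (\<Sum>x\<in>W. net_pi G {x} * g x)"
      unfolding sum.distrib sum_distrib_left[symmetric] ..
    also have "(\<Sum>x\<in>W. net_pi G {x} * of_bool (x \<in> K)) = net_pi G K"
      unfolding net_pi_sum[OF Kf(1)] using W Kf by (intro sum.mono_neutral_cong_right) auto
    finally have "h * (\<Sum>x\<in>W. net_pi G {x} * f x) = m * (h * net_pi G K) + h * (\<Sum>x\<in>W. net_pi G {x} * g x)"
      by (simp only: algebra_simps)
    also have "\<dots> \<le> m * (\<Sum>e\<in>edge_boundary G K. cond G e) + (\<Sum>e\<in>?E. cond G e * \<bar>g (src G e) - g (dst G e)\<bar>)"
      using iso[OF Kf(1,2)] m IH by (intro add_mono mult_left_mono) auto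
    finally show ?thesis unfolding E .
  qed
qed

end

text \<open>
  The co-area inequality for the square of the potential \<open>f\<close>, and
  \<open>|a\<^sup>2 - b\<^sup>2| \<le> (a - b)\<^sup>2 / h + h (a\<^sup>2 + b\<^sup>2) / 2\<close>, give \<open>h S \<le> energy / h + h S / 2\<close> for \<open>S = \<Sum>x. \<pi> x (f x)\<^sup>2\<close>.
\<close>

lemma (in wired_net) cheeger:
  assumes iso: "\<And>K. finite K \<Longrightarrow> K \<subseteq> verts G \<Longrightarrow> h * net_pi G K \<le> (\<Sum>e\<in>edge_boundary G K. cond G e)"
    and h: "0 < h" and A: "A \<subseteq> W"
  shows "h\<^sup>2 / 2 * net_pi G A \<le> capacity N None (Some ` A)"
proof -
  let ?E = "{e \<in> edges G. ends G e \<inter> W \<noteq> {}}"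
  let ?c = "capacity N None (Some ` A)"
  let ?f = "\<lambda>x. (potential A x)\<^sup>2"
  define S where "S = (\<Sum>x\<in>W. net_pi G {x} * ?f x)"
  have cp: "e \<in> edges G \<Longrightarrow> 0 < cond G e" for e using network by (auto simp: is_network_def)
  have pi: "x \<in> W \<Longrightarrow> 0 < net_pi G {x}" for x using pi_pos Wsub by auto
  have sq: "\<bar>a\<^sup>2 - b\<^sup>2\<bar> \<le> (1 / h) * (a - b)\<^sup>2 + (h / 2) * (a\<^sup>2 + b\<^sup>2)" for a b :: real
  proof -
    have "0 \<le> (\<bar>a - b\<bar> - (h / 2) * \<bar>a + b\<bar>)\<^sup>2" by simp
    also have "\<dots> = (a - b)\<^sup>2 - h * \<bar>a\<^sup>2 - b\<^sup>2\<bar> + (h\<^sup>2 / 4) * (a + b)\<^sup>2"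
    proof -
      have "\<bar>a - b\<bar> * \<bar>a + b\<bar> = \<bar>a\<^sup>2 - b\<^sup>2\<bar>" unfolding abs_mult[symmetric] by (simp add: power2_eq_square algebra_simps)
      moreover have "(\<bar>a - b\<bar> - (h / 2) * \<bar>a + b\<bar>)\<^sup>2 = \<bar>a - b\<bar>\<^sup>2 - h * (\<bar>a - b\<bar> * \<bar>a + b\<bar>) + (h\<^sup>2 / 4) * \<bar>a + b\<bar>\<^sup>2"
        by (simp add: power2_eq_square algebra_simps)
      ultimately show ?thesis by simp
    qed
    finally have "h * \<bar>a\<^sup>2 - b\<^sup>2\<bar> \<le> (a - b)\<^sup>2 + (h\<^sup>2 / 4) * (a + b)\<^sup>2" by simp
    also have "(a + b)\<^sup>2 \<le> 2 * (a\<^sup>2 + b\<^sup>2)"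
      using zero_le_power2[of "a - b"] by (simp add: power2_eq_square algebra_simps)
    then have "(h\<^sup>2 / 4) * (a + b)\<^sup>2 \<le> (h\<^sup>2 / 4) * (2 * (a\<^sup>2 + b\<^sup>2))" by (rule mult_left_mono) simp
    finally have "h * \<bar>a\<^sup>2 - b\<^sup>2\<bar> \<le> h * ((1 / h) * (a - b)\<^sup>2 + (h / 2) * (a\<^sup>2 + b\<^sup>2))"
      using h by (simp add: power2_eq_square algebra_simps)
    then show ?thesis using h by (simp only: mult_le_cancel_left_pos)
  qed
  have "h * S \<le> (\<Sum>e\<in>?E. cond G e * \<bar>?f (src G e) - ?f (dst G e)\<bar>)"
    unfolding S_def by (rule coarea[OF iso finW Wsub]) (use potential_props[OF A] in auto)
  also have "\<dots> \<le> (\<Sum>e\<in>?E. (1 / h) * (cond G e * (potential A (src G e) - potential A (dst G e))\<^sup>2) + (h / 2) * (cond G e * (?f (src G e) + ?f (dst G e))))"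
  proof (rule sum_mono)
    fix e assume "e \<in> ?E"
    then have "0 \<le> cond G e" using cp[of e] by simp
    from mult_left_mono[OF sq this]
    show "cond G e * \<bar>?f (src G e) - ?f (dst G e)\<bar> \<le> (1 / h) * (cond G e * (potential A (src G e) - potential A (dst G e))\<^sup>2) + (h / 2) * (cond G e * (?f (src G e) + ?f (dst G e)))"
      by (simp only: distrib_left mult.left_commute)
  qed
  also have "\<dots> = (1 / h) * ?c + (h / 2) * (\<Sum>e\<in>?E. cond G e * (?f (src G e) + ?f (dst G e)))"
    unfolding capacity_energy[OF A] sum.distrib sum_distrib_left[symmetric] by simp
  also have "(\<Sum>e\<in>?E. cond G e * (?f (src G e) + ?f (dst G e))) = S"
    using sum_arcs_at_W[where f = "\<lambda>y z. ?f y"] potential_props(4)[OF A]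
    by (simp add: S_def net_pi_single sum_distrib_right)
  finally have "h * (h / 2 * S) \<le> h * ((1 / h) * ?c)" using h by (intro mult_left_mono) (auto simp: algebra_simps)
  then have "h\<^sup>2 / 2 * S \<le> ?c" using h by (simp add: power2_eq_square)
  moreover have "net_pi G A \<le> S"
  proof -
    have "net_pi G A = (\<Sum>x\<in>A. net_pi G {x} * ?f x)"
      using A finW by (subst net_pi_sum) (auto intro: finite_subset simp: potential_props)
    also have "\<dots> \<le> S" unfolding S_def using A finW less_imp_le[OF pi] by (intro sum_mono2) auto
    finally show ?thesis .
  qed
  then have "h\<^sup>2 / 2 * net_pi G A \<le> h\<^sup>2 / 2 * S" by (rule mult_left_mono) simp
  ultimately show ?thesis by linarith
qed

section \<open>Non-amenable networks\<close>

context wired_net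
begin

text \<open>
  The events are disjoint, see \<open>follows_unique\<close>.
\<close>

lemma sum_paths_from_le_1:
  assumes \<Gamma>: "finite \<Gamma>" and w: "\<And>bs. bs \<in> \<Gamma> \<Longrightarrow> \<exists>y. walk N x bs y" and l: "\<And>bs. bs \<in> \<Gamma> \<Longrightarrow> length bs = n"
  shows "(\<Sum>bs\<in>\<Gamma>. tree_prob N None (\<lambda>t. follows N t bs)) \<le> 1"
proof (rule w.tree_prob_sum_disjoint[OF \<Gamma>])
  fix t assume "t \<in> forests N {None}"
  have "bs = cs" if "bs \<in> \<Gamma>" "cs \<in> \<Gamma>" "follows N t bs" "follows N t cs" for bs cs
    using w[OF that(1)] w[OF that(2)] l[OF that(1)] l[OF that(2)] follows_unique[of N x bs _ cs _ t] that by auto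
  then show "card {bs \<in> \<Gamma>. follows N t bs} \<le> 1"
    using \<Gamma> by (subst card_le_Suc0_iff_eq[unfolded One_nat_def[symmetric]]) auto
qed

lemma path_prob_reverse:
  assumes p: "self_avoiding G y bs x" "path_verts G bs x \<subseteq> W"
  shows "tree_prob N None (\<lambda>t. follows N t bs) * escape N None (Some ` path_verts G bs x) (Some y) =
    tree_prob N None (\<lambda>t. follows N t (map rev_arc (rev bs))) * escape N None (Some ` path_verts G bs x) (Some x)"
proof -
  note wp = wired_path[OF p]
  let ?A = "Some ` path_verts G bs x"
  have y: "y \<in> path_verts G bs x" using p(1) by (cases bs) (auto simp: self_avoiding_def path_verts_def out_arcs_def)
  have x: "x \<in> path_verts G bs x" by (simp add: path_verts_def)
  have V: "Some y \<in> verts N" "Some x \<in> verts N" "None \<in> verts N" using x y p(2) by (auto simp: verts_N)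
  have "walk N (Some y) bs (Some x)" using wp by (simp add: self_avoiding_def)
  note r = path_verts_rev[OF this]
  have 1: "tree_prob N None (\<lambda>t. follows N t bs) = path_cond N bs * forest_sum N (insert None ?A) / forest_sum N {None} * escape N None ?A (Some x)"
    using w.tree_prob_path[OF wp(1)] wp(2) V by auto
  have 2: "tree_prob N None (\<lambda>t. follows N t (map rev_arc (rev bs))) = path_cond N bs * forest_sum N (insert None ?A) / forest_sum N {None} * escape N None ?A (Some y)"
    using w.tree_prob_path[OF self_avoiding_rev[OF wp(1)]] r wp(2) V by auto
  show ?thesis unfolding 1 2 by simp
qed

text \<open>
  The expected number of paths into \<open>x\<close> of length \<open>n\<close> whose initial vertex has escape conductance at
  least \<open>\<eta>\<close>: after reversal they start at \<open>x\<close>, where the escape conductance is at most \<open>\<pi> x\<close>.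
\<close>

lemma sum_good_paths:
  assumes x: "x \<in> W" and \<eta>: "0 < \<eta>" and \<Gamma>: "finite \<Gamma>" "\<And>bs. bs \<in> \<Gamma> \<Longrightarrow> length bs = n"
    "\<And>bs. bs \<in> \<Gamma> \<Longrightarrow> \<exists>y. self_avoiding G y bs x \<and> path_verts G bs x \<subseteq> W \<and> \<eta> \<le> escape N None (Some ` path_verts G bs x) (Some y)"
  shows "(\<Sum>bs\<in>\<Gamma>. tree_prob N None (\<lambda>t. follows N t bs)) \<le> net_pi G {x} / \<eta>"
proof -
  let ?r = "\<lambda>bs. map rev_arc (rev bs)"
  have pt: "\<eta> * tree_prob N None (\<lambda>t. follows N t bs) \<le> net_pi G {x} * tree_prob N None (\<lambda>t. follows N t (?r bs))" if bs: "bs \<in> \<Gamma>" for bs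
  proof -
    obtain y where y: "self_avoiding G y bs x" "path_verts G bs x \<subseteq> W" "\<eta> \<le> escape N None (Some ` path_verts G bs x) (Some y)" using \<Gamma>(3)[OF bs] by blast
    have "\<eta> * tree_prob N None (\<lambda>t. follows N t bs) \<le> tree_prob N None (\<lambda>t. follows N t bs) * escape N None (Some ` path_verts G bs x) (Some y)"
      using mult_left_mono[OF y(3) w.tree_prob_nonneg] by (simp add: mult.commute)
    also have "\<dots> = tree_prob N None (\<lambda>t. follows N t (?r bs)) * escape N None (Some ` path_verts G bs x) (Some x)"
      by (rule path_prob_reverse[OF y(1,2)])
    also have "\<dots> \<le> tree_prob N None (\<lambda>t. follows N t (?r bs)) * net_pi G {x}"
    proof (rule mult_left_mono[OF _ w.tree_prob_nonneg])
      have "escape N None (Some ` path_verts G bs x) (Some x) \<le> net_pi N {Some x}"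
        using y(2) by (intro w.escape_le_pi) (auto simp: verts_N)
      then show "escape N None (Some ` path_verts G bs x) (Some x) \<le> net_pi G {x}" using pi_N_le[OF x] by simp
    qed
    finally show ?thesis by (simp add: mult.commute)
  qed
  have "\<eta> * (\<Sum>bs\<in>\<Gamma>. tree_prob N None (\<lambda>t. follows N t bs)) \<le> net_pi G {x} * (\<Sum>bs\<in>\<Gamma>. tree_prob N None (\<lambda>t. follows N t (?r bs)))"
    unfolding sum_distrib_left by (rule sum_mono) (rule pt)
  also have "(\<Sum>bs\<in>\<Gamma>. tree_prob N None (\<lambda>t. follows N t (?r bs))) = (\<Sum>cs\<in>?r ` \<Gamma>. tree_prob N None (\<lambda>t. follows N t cs))"
  proof -
    have "inj ?r"
    proof (rule injI)
      fix bs cs assume "?r bs = ?r cs"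
      then have "map rev_arc (?r bs) = map rev_arc (?r cs)" by simp
      then have "rev bs = rev cs" by (simp add: o_def)
      then show "bs = cs" by simp
    qed
    then show ?thesis by (subst sum.reindex) (auto intro: inj_on_subset)
  qed
  also have "net_pi G {x} * \<dots> \<le> net_pi G {x} * 1"
  proof (rule mult_left_mono)
    show "(\<Sum>cs\<in>?r ` \<Gamma>. tree_prob N None (\<lambda>t. follows N t cs)) \<le> 1"
    proof (rule sum_paths_from_le_1)
      fix cs assume "cs \<in> ?r ` \<Gamma>"
      then obtain bs where bs: "bs \<in> \<Gamma>" "cs = ?r bs" by blast
      then obtain y where "self_avoiding G y bs x" "path_verts G bs x \<subseteq> W" using \<Gamma>(3) by blast
      from wired_path(1)[OF this] have "walk N (Some y) bs (Some x)" by (simp add: self_avoiding_def)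
      from walk_rev[OF this] show "\<exists>y. walk N (Some x) cs y" unfolding bs(2) by blast
      show "length cs = n" using bs \<Gamma>(2) by simp
    qed (use \<Gamma> in simp)
    show "0 \<le> net_pi G {x}" using pi_pos[of x] x Wsub by auto
  qed
  finally show ?thesis using \<eta> by (simp add: pos_le_divide_eq mult.commute)
qed

end

context inf_net
begin

lemma large_finite_superset:
  assumes "finite S" "S \<subseteq> verts G"
  shows "\<exists>W. finite W \<and> S \<subseteq> W \<and> W \<subseteq> verts G \<and> n \<le> card W"
proof -
  obtain T where T: "T \<subseteq> verts G" "finite T" "card T = n" using inf_verts infinite_arbitrarily_large by metis
  then have "n \<le> card (S \<union> T)" using assms card_mono[of "S \<union> T" T] by auto
  then show ?thesis using T assms by (intro exI[of _ "S \<union> T"]) auto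
qed

text \<open>
  On a path into \<open>x\<close> with more than \<open>n\<close> vertices, the escape conductances at its vertices add up to the
  capacity, at least \<open>\<kappa>\<close> per vertex. The vertices near \<open>x\<close> contribute a bounded amount, so if the path is
  long, then some vertex at distance at least \<open>n\<close> along it contributes \<open>\<kappa> / 2\<close> even with respect to the
  part of the path between itself and \<open>x\<close>. The expected number of such parts that survive the
  excursions is a geometric series starting at \<open>n\<close>.
\<close>

theorem thin_pasts_of_linear_capacity:
  assumes \<kappa>: "0 < \<kappa>"
    and cap: "\<And>W A. finite W \<Longrightarrow> W \<subseteq> verts G \<Longrightarrow> W \<noteq> {} \<Longrightarrow> A \<subseteq> W \<Longrightarrow> \<kappa> * real (card A) \<le> capacity (wired G W) None (Some ` A)"
  shows thin_pasts
  unfolding thin_pasts_def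
proof (intro ballI allI impI)
  fix x \<epsilon> assume x: "x \<in> verts G" and \<epsilon>: "0 < (\<epsilon>::real)"
  have p: "0 < net_pi G {x}" by (rule pi_pos[OF x])
  (* Half of \<open>\<epsilon>\<close> pays for the event that the excursions hit \<open>x\<close>, the other half for the surviving paths. *)
  define s where "s = \<epsilon> / (4 * net_pi G {x})"
  have s: "0 < s" "2 * s * net_pi G {x} = \<epsilon> / 2" using p \<epsilon> by (auto simp: s_def)
  define \<eta> where "\<eta> = \<kappa> / 2"
  (* The factor in the survival probability for each vertex of a path. *)
  define \<rho> where "\<rho> = exp (- s * \<kappa>)"
  have \<rho>: "0 < \<rho>" "\<rho> < 1" using s \<kappa> by (auto simp: \<rho>_def)
  have "(\<lambda>n. (net_pi G {x} / \<eta>) * (\<rho> ^ n / (1 - \<rho>))) \<longlonglongrightarrow> (net_pi G {x} / \<eta>) * (0 / (1 - \<rho>))"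
    using \<rho> by (intro tendsto_intros LIMSEQ_power_zero) auto
  then have "eventually (\<lambda>n. (net_pi G {x} / \<eta>) * (\<rho> ^ n / (1 - \<rho>)) < \<epsilon> / 2) sequentially"
    using \<epsilon> by (intro order_tendstoD(2)[of _ "(net_pi G {x} / \<eta>) * (0 / (1 - \<rho>))"]) auto
  then obtain n where n: "(net_pi G {x} / \<eta>) * (\<rho> ^ n / (1 - \<rho>)) < \<epsilon> / 2" by (auto simp: eventually_sequentially)
  define B where "B = (\<Sum>y\<in>ball_set G n {x}. net_pi G {y})"
  obtain m where m: "B / \<eta> < real m" using reals_Archimedean2 by blast
  (* So long that the vertices within distance \<open>n\<close> of \<open>x\<close> cannot account for half of the capacity. *)
  define M where "M = max m n"
  have M: "n \<le> M" "B < \<eta> * (real M + 1)"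
  proof -
    have "B < \<eta> * real m" using m \<kappa> by (simp add: \<eta>_def pos_divide_less_eq mult.commute)
    also have "\<dots> \<le> \<eta> * (real M + 1)" using \<kappa> by (intro mult_left_mono) (auto simp: M_def \<eta>_def)
    finally show "B < \<eta> * (real M + 1)" .
  qed (simp add: M_def)
  obtain k where k: "1 / (s * \<kappa>) < real k" using reals_Archimedean2 by blast
  obtain W0 where W0: "finite W0" "ball_set G M {x} \<subseteq> W0" "W0 \<subseteq> verts G" "k \<le> card W0"
    using large_finite_superset[of "ball_set G M {x}" k] finite_ball[of "{x}"] ball_in[of "{x}"] x by auto
  have main: "tree_prob (wired G W) None (\<lambda>t. \<exists>bs\<in>paths_to G M x. follows (wired G W) t bs) \<le> \<epsilon>"
    if W: "finite W" "W \<subseteq> verts G" "W0 \<subseteq> W" "W \<noteq> {}" for W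
  proof -
    interpret wired_net G W using W by unfold_locales
    have bW: "ball_set G M {x} \<subseteq> W" using W0 W by auto
    have xW: "x \<in> W" using bW ball_mono[of 0 M "{x}"] by (auto simp: ball_set_def)
    (* Paths that are easy to leave at their initial vertex. *)
    define good where "good bs \<longleftrightarrow> (\<exists>y. self_avoiding G y bs x \<and> \<eta> \<le> escape N None (Some ` path_verts G bs x) (Some y))" for bs
    define \<Gamma> where "\<Gamma> = (\<Union>j\<in>{n..M}. {bs \<in> paths_to G j x. good bs})"
    have fin\<Gamma>: "finite \<Gamma>" using finite_paths_to by (auto simp: \<Gamma>_def)
    have inW: "path_verts G bs x \<subseteq> W" if "bs \<in> paths_to G j x" "j \<le> M" for bs j
      using paths_to_in_ball[OF that(1)] ball_mono[OF that(2), of "{x}"] bW by blast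
    have "1 \<le> s * net_pi N {None}"
    proof -
      have sk: "0 < s * \<kappa>" using s \<kappa> by simp
      have "1 \<le> (s * \<kappa>) * real k" using k sk by (simp add: pos_divide_less_eq mult.commute)
      also have "\<dots> \<le> (s * \<kappa>) * real (card W0)" using W0(4) sk by (intro mult_left_mono) auto
      also have "\<dots> \<le> (s * \<kappa>) * real (card W)" using sk card_mono[OF W(1,3)] by (intro mult_left_mono) auto
      also have "\<dots> = s * (\<kappa> * real (card W))" by (simp only: mult.assoc)
      also have "\<dots> \<le> s * capacity N None (Some ` W)" using cap[OF W(1,2,4) order_refl] s by (intro mult_left_mono) auto
      also have "\<dots> \<le> s * net_pi N {None}" using w.capacity_le_pi[of "Some ` W"] s by (intro mult_left_mono) (auto simp: verts_N)
      finally show ?thesis .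
    qed
    then have "tree_prob N None (\<lambda>t. \<exists>bs\<in>\<Gamma>. follows N t bs) \<le> 2 * s * net_pi G {x} +
      (\<Sum>bs\<in>\<Gamma>. tree_prob N None (\<lambda>t. follows N t bs) * exp (- s * capacity N None (Some ` path_verts G bs x)))"
    proof (intro thinning_limit_form xW s(1) fin\<Gamma>)
      fix bs assume "bs \<in> \<Gamma>"
      then obtain j where j: "j \<le> M" "bs \<in> paths_to G j x" by (auto simp: \<Gamma>_def)
      then show "\<exists>u. self_avoiding G u bs x \<and> path_verts G bs x \<subseteq> W" using inW[OF j(2,1)] by (auto simp: paths_to_def)
    qed
    also have "(\<Sum>bs\<in>\<Gamma>. tree_prob N None (\<lambda>t. follows N t bs) * exp (- s * capacity N None (Some ` path_verts G bs x))) \<le> \<epsilon> / 2"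
    proof -
      have "(\<Sum>bs\<in>\<Gamma>. tree_prob N None (\<lambda>t. follows N t bs) * exp (- s * capacity N None (Some ` path_verts G bs x))) =
        (\<Sum>j\<in>{n..M}. \<Sum>bs\<in>{bs \<in> paths_to G j x. good bs}. tree_prob N None (\<lambda>t. follows N t bs) * exp (- s * capacity N None (Some ` path_verts G bs x)))"
        unfolding \<Gamma>_def
      proof (intro sum.UNION_disjoint ballI impI)
        show "finite {bs \<in> paths_to G j x. good bs}" for j using finite_paths_to[of j x] by simp
      qed (auto simp: paths_to_def)
      also have "\<dots> \<le> (\<Sum>j\<in>{n..M}. (net_pi G {x} / \<eta>) * \<rho> ^ j)"
      proof (rule sum_mono)
        fix j assume j: "j \<in> {n..M}"
        have "tree_prob N None (\<lambda>t. follows N t bs) * exp (- s * capacity N None (Some ` path_verts G bs x)) \<le>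
            tree_prob N None (\<lambda>t. follows N t bs) * \<rho> ^ j" if bs: "bs \<in> paths_to G j x" for bs
        proof (rule mult_left_mono[OF _ w.tree_prob_nonneg])
          have "card (path_verts G bs x) = Suc j" using bs card_path_verts by (auto simp: paths_to_def)
          then have "\<kappa> * real j \<le> capacity N None (Some ` path_verts G bs x)"
            using cap[OF W(1,2,4) inW[OF bs]] j \<kappa> by (auto simp: algebra_simps)
          then have "exp (- s * capacity N None (Some ` path_verts G bs x)) \<le> exp (real j * (- s * \<kappa>))"
          proof -
            assume "\<kappa> * real j \<le> capacity N None (Some ` path_verts G bs x)"
            then have "s * (\<kappa> * real j) \<le> s * capacity N None (Some ` path_verts G bs x)" using s by (intro mult_left_mono) auto
            then show ?thesis unfolding exp_le_cancel_iff by (simp add: mult.left_commute mult.commute)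
          qed
          then show "exp (- s * capacity N None (Some ` path_verts G bs x)) \<le> \<rho> ^ j"
            unfolding \<rho>_def exp_of_nat_mult .
        qed
        then have "(\<Sum>bs\<in>{bs \<in> paths_to G j x. good bs}. tree_prob N None (\<lambda>t. follows N t bs) * exp (- s * capacity N None (Some ` path_verts G bs x)))
          \<le> (\<Sum>bs\<in>{bs \<in> paths_to G j x. good bs}. tree_prob N None (\<lambda>t. follows N t bs)) * \<rho> ^ j"
          unfolding sum_distrib_right by (intro sum_mono) auto
        also have "\<dots> \<le> (net_pi G {x} / \<eta>) * \<rho> ^ j"
        proof (intro mult_right_mono sum_good_paths[OF xW, where n = j])
          show "0 < \<eta>" using \<kappa> by (simp add: \<eta>_def)
          show "finite {bs \<in> paths_to G j x. good bs}" using finite_paths_to by simp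
          show "\<And>bs. bs \<in> {bs \<in> paths_to G j x. good bs} \<Longrightarrow> length bs = j" by (simp add: paths_to_def)
          show "\<exists>y. self_avoiding G y bs x \<and> path_verts G bs x \<subseteq> W \<and> \<eta> \<le> escape N None (Some ` path_verts G bs x) (Some y)"
            if "bs \<in> {bs \<in> paths_to G j x. good bs}" for bs
            using that inW[of bs j] j by (auto simp: good_def)
        qed (use \<rho> in auto)
        finally show "(\<Sum>bs\<in>{bs \<in> paths_to G j x. good bs}. tree_prob N None (\<lambda>t. follows N t bs) * exp (- s * capacity N None (Some ` path_verts G bs x)))
          \<le> (net_pi G {x} / \<eta>) * \<rho> ^ j" .
      qed
      also have "\<dots> = (net_pi G {x} / \<eta>) * (\<Sum>j\<in>{n..M}. \<rho> ^ j)" by (simp add: sum_distrib_left)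
      also have "(\<Sum>j\<in>{n..M}. \<rho> ^ j) \<le> \<rho> ^ n / (1 - \<rho>)"
        using \<rho> M(1) by (subst sum_gp) (auto simp: divide_right_mono)
      then have "(net_pi G {x} / \<eta>) * (\<Sum>j\<in>{n..M}. \<rho> ^ j) \<le> (net_pi G {x} / \<eta>) * (\<rho> ^ n / (1 - \<rho>))"
        using p \<kappa> by (intro mult_left_mono) (auto simp: \<eta>_def)
      finally show ?thesis using n by linarith
    qed
    finally have "tree_prob N None (\<lambda>t. \<exists>bs\<in>\<Gamma>. follows N t bs) \<le> \<epsilon>" using s(2) by linarith
    moreover have "tree_prob N None (\<lambda>t. \<exists>bs\<in>paths_to G M x. follows N t bs) \<le> tree_prob N None (\<lambda>t. \<exists>bs\<in>\<Gamma>. follows N t bs)"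
    proof (rule w.tree_prob_mono)
      fix t assume "\<exists>bs\<in>paths_to G M x. follows N t bs"
      then obtain bs where bs: "bs \<in> paths_to G M x" "follows N t bs" by blast
      then obtain u where u: "self_avoiding G u bs x" "u \<in> verts G" "length bs = M" by (auto simp: paths_to_def)
      have A: "path_verts G bs x \<subseteq> W" by (rule inW[OF bs(1)]) simp
      have "\<exists>cs\<in>\<Gamma>. \<exists>ds. bs = ds @ cs"
      proof (rule ccontr)
        assume none: "\<not> (\<exists>cs\<in>\<Gamma>. \<exists>ds. bs = ds @ cs)"
        have each: "escape N None (Some ` path_verts G bs x) (Some y) \<le> (if y \<in> ball_set G n {x} then net_pi G {y} else 0) + \<eta>" if y: "y \<in> path_verts G bs x" for y
        proof -
          obtain ds cs where cs: "bs = ds @ cs" "self_avoiding G y cs x" using self_avoiding_at_vertex[OF u(1) y] by blast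
          have le: "escape N None (Some ` path_verts G bs x) (Some y) \<le> escape N None (Some ` path_verts G cs x) (Some y)"
            using cs A by (intro w.escape_mono) (auto simp: path_verts_def verts_N)
          have yW: "y \<in> W" using A y by auto
          have e: "escape N None (Some ` path_verts G bs x) (Some y) \<le> net_pi G {y}"
            using order_trans[OF w.escape_le_pi[of "Some ` path_verts G bs x" "Some y"] pi_N_le[OF yW]] A unfolding verts_N by blast
          show ?thesis
          proof (cases "length cs < n")
            case True
            then have "y \<in> ball_set G n {x}"
              using walk_in_ball[of y cs x] cs(2) ball_mono[of "length cs" n "{x}"] by (auto simp: self_avoiding_def)
            then show ?thesis using e \<kappa> by (simp add: \<eta>_def)
          next
            case False
            have "cs \<in> paths_to G (length cs) x" using cs(2) yW Wsub by (auto simp: paths_to_def)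
            moreover have "length cs \<in> {n..M}" using False u(3) cs(1) by auto
            ultimately have "\<not> good cs" using none cs(1) unfolding \<Gamma>_def by blast
            then have "escape N None (Some ` path_verts G cs x) (Some y) < \<eta>" using cs(2) unfolding good_def by (meson not_le)
            moreover have "0 \<le> net_pi G {y}" using pi_pos[of y] yW Wsub by auto
            ultimately show ?thesis using le by auto
          qed
        qed
        have finA: "finite (path_verts G bs x)" by (simp add: path_verts_def)
        have "\<kappa> * (real M + 1) \<le> capacity N None (Some ` path_verts G bs x)"
          using cap[OF W(1,2,4) A] card_path_verts[OF u(1)] u(3) by (simp add: add.commute)
        also have "\<dots> \<le> (\<Sum>y\<in>path_verts G bs x. (if y \<in> ball_set G n {x} then net_pi G {y} else 0) + \<eta>)"
          unfolding capacity_sum_escape[OF A] by (rule sum_mono) (rule each)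
        also have "\<dots> = (\<Sum>y\<in>path_verts G bs x \<inter> ball_set G n {x}. net_pi G {y}) + \<eta> * (real M + 1)"
          using finA card_path_verts[OF u(1)] u(3) by (simp add: sum.distrib sum.inter_restrict mult.commute add.commute)
        also have "(\<Sum>y\<in>path_verts G bs x \<inter> ball_set G n {x}. net_pi G {y}) \<le> B"
          unfolding B_def using finite_ball[of "{x}" n] ball_in[of "{x}" n] x
          by (intro sum_mono2) (auto intro!: less_imp_le[OF pi_pos])
        finally have "\<kappa> * (real M + 1) < 2 * \<eta> * (real M + 1)" using M(2) by linarith
        then show False by (simp add: \<eta>_def)
      qed
      then obtain cs ds where "cs \<in> \<Gamma>" "bs = ds @ cs" by blast
      then show "\<exists>bs\<in>\<Gamma>. follows N t bs" using bs(2) by (auto simp: follows_def)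
    qed
    ultimately show ?thesis by linarith
  qed
  show "\<exists>n W0. finite W0 \<and> W0 \<subseteq> verts G \<and>
     (\<forall>W. finite W \<longrightarrow> W \<subseteq> verts G \<longrightarrow> W0 \<subseteq> W \<longrightarrow> W \<noteq> {} \<longrightarrow>
        tree_prob (wired G W) None (\<lambda>t. \<exists>bs\<in>paths_to G n x. follows (wired G W) t bs) \<le> \<epsilon>)"
    using W0 main by blast
qed

lemma non_amenable_iso:
  assumes "non_amenable G"
  shows "\<exists>h>0. \<forall>K. finite K \<longrightarrow> K \<subseteq> verts G \<longrightarrow> h * net_pi G K \<le> (\<Sum>e\<in>edge_boundary G K. cond G e)"
proof -
  obtain h where h: "0 < ereal h" "ereal h < (INF t\<in>{0<..}. kappa G t / ereal t)"
    using assms ereal_dense2[of 0] unfolding non_amenable_def by blast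
  have "h * net_pi G K \<le> (\<Sum>e\<in>edge_boundary G K. cond G e)"
    if K: "finite K" "K \<subseteq> verts G" "net_connected (induced G K)" for K
  proof -
    have "K \<noteq> {}" using K(3) by (auto simp: net_connected_def induced_def)
    then have t: "0 < net_pi G K"
      unfolding net_pi_sum[OF K(1)] using K pi_pos by (intro sum_pos) auto
    have "ereal h \<le> kappa G (net_pi G K) / ereal (net_pi G K)"
      using h(2) t by (meson INF_lower greaterThan_iff less_imp_le order_less_le_trans)
    also have "kappa G (net_pi G K) \<le> ereal (\<Sum>e\<in>edge_boundary G K. cond G e)"
      unfolding kappa_def by (rule Inf_lower) (use K in blast)
    then have "kappa G (net_pi G K) / ereal (net_pi G K) \<le> ereal (\<Sum>e\<in>edge_boundary G K. cond G e) / ereal (net_pi G K)"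
      using t by (intro ereal_divide_right_mono) auto
    finally have "h \<le> (\<Sum>e\<in>edge_boundary G K. cond G e) / net_pi G K" using t by simp
    then show ?thesis using t by (simp add: pos_le_divide_eq)
  qed
  then have "\<forall>K. finite K \<longrightarrow> K \<subseteq> verts G \<longrightarrow> h * net_pi G K \<le> (\<Sum>e\<in>edge_boundary G K. cond G e)"
    using iso_disconnected by blast
  then show ?thesis using h(1) by auto
qed

theorem thin_pasts_non_amenable:
  assumes "non_amenable G" and p: "0 < p" "\<And>x. x \<in> verts G \<Longrightarrow> p \<le> net_pi G {x}"
  shows thin_pasts
proof -
  obtain h where h: "0 < h" "\<And>K. finite K \<Longrightarrow> K \<subseteq> verts G \<Longrightarrow> h * net_pi G K \<le> (\<Sum>e\<in>edge_boundary G K. cond G e)"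
    using non_amenable_iso[OF assms(1)] by blast
  show ?thesis
  proof (rule thin_pasts_of_linear_capacity)
    show "0 < h\<^sup>2 / 2 * p" using h p by simp
    fix W A assume W: "finite W" "W \<subseteq> verts G" "W \<noteq> {}" "A \<subseteq> W"
    interpret wired_net G W using W by unfold_locales
    have fA: "finite A" using W finite_subset by blast
    have "p * real (card A) \<le> net_pi G A"
      using sum_mono[of A "\<lambda>_. p" "\<lambda>x. net_pi G {x}"] p W by (simp add: net_pi_sum[OF fA] mult.commute subset_iff)
    then have "h\<^sup>2 / 2 * (p * real (card A)) \<le> h\<^sup>2 / 2 * net_pi G A" by (intro mult_left_mono) auto
    also have "\<dots> \<le> capacity N None (Some ` A)" by (rule cheeger[OF h(2) h(1) W(4)])
    finally show "h\<^sup>2 / 2 * p * real (card A) \<le> capacity N None (Some ` A)" by (simp add: mult.assoc)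
  qed
qed

end

section \<open>Automorphisms and the random walk\<close>

text \<open>
  An automorphism may reverse the stored orientation of an edge.
\<close>

definition arc_map :: "('v, 'e) network \<Rightarrow> ('v \<Rightarrow> 'v) \<Rightarrow> ('e \<Rightarrow> 'e) \<Rightarrow> 'e \<times> bool \<Rightarrow> 'e \<times> bool" where
  "arc_map G \<phi> \<psi> a = (\<psi> (fst a), snd a \<longleftrightarrow> src G (\<psi> (fst a)) = \<phi> (src G (fst a)))"

definition avg :: "('v, 'e) network \<Rightarrow> ('v \<Rightarrow> real) \<Rightarrow> 'v \<Rightarrow> real" where
  "avg G f x = (\<Sum>a\<in>out_arcs G x. cond G (fst a) * f (head G a)) / net_pi G {x}"

text \<open>
  The \<open>n\<close>-step transition probabilities of the network random walk.
\<close>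

primrec step_prob :: "('v, 'e) network \<Rightarrow> nat \<Rightarrow> 'v \<Rightarrow> 'v \<Rightarrow> real" where
  "step_prob G 0 x y = of_bool (x = y)"
| "step_prob G (Suc n) x y = avg G (\<lambda>z. step_prob G n z y) x"

text \<open>
  The probability that the walk from \<open>z\<close> enters \<open>B\<close> within \<open>k\<close> steps, and through \<open>Q\<close>.
\<close>

primrec hit_within :: "('v, 'e) network \<Rightarrow> 'v set \<Rightarrow> 'v set \<Rightarrow> nat \<Rightarrow> 'v \<Rightarrow> real" where
  "hit_within G Q B 0 z = of_bool (z \<in> Q)"
| "hit_within G Q B (Suc k) z = (if z \<in> B then of_bool (z \<in> Q) else avg G (hit_within G Q B k) z)"

definition hit_ever :: "('v, 'e) network \<Rightarrow> 'v set \<Rightarrow> 'v set \<Rightarrow> 'v \<Rightarrow> real" where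
  "hit_ever G Q B z = lim (\<lambda>k. hit_within G Q B k z)"

context inf_net
begin

lemma arc_map:
  assumes "automorphism G \<phi> \<psi>" "a \<in> oriented_edges G"
  shows "arc_map G \<phi> \<psi> a \<in> oriented_edges G" "tail G (arc_map G \<phi> \<psi> a) = \<phi> (tail G a)"
    "head G (arc_map G \<phi> \<psi> a) = \<phi> (head G a)" "cond G (fst (arc_map G \<phi> \<psi> a)) = cond G (fst a)"
proof -
  let ?e = "fst a"
  have e: "?e \<in> edges G" using assms(2) by (auto simp: oriented_edges_def)
  have en: "{src G (\<psi> ?e), dst G (\<psi> ?e)} = {\<phi> (src G ?e), \<phi> (dst G ?e)}" "cond G (\<psi> ?e) = cond G ?e"
    using assms(1) e by (auto simp: automorphism_def ends_def)
  have "\<psi> ?e \<in> edges G" using assms(1) e by (auto simp: automorphism_def bij_betw_def)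
  then show "arc_map G \<phi> \<psi> a \<in> oriented_edges G" by (simp add: arc_map_def oriented_edges_def)
  show "tail G (arc_map G \<phi> \<psi> a) = \<phi> (tail G a)" "head G (arc_map G \<phi> \<psi> a) = \<phi> (head G a)"
    using en(1) by (auto simp: arc_map_def tail_def head_def doubleton_eq_iff)
  show "cond G (fst (arc_map G \<phi> \<psi> a)) = cond G (fst a)" using en(2) by (simp add: arc_map_def)
qed

lemma arc_map_inj: "automorphism G \<phi> \<psi> \<Longrightarrow> inj_on (arc_map G \<phi> \<psi>) (oriented_edges G)"
proof (rule inj_onI)
  fix a b assume A: "automorphism G \<phi> \<psi>" and ab: "a \<in> oriented_edges G" "b \<in> oriented_edges G" "arc_map G \<phi> \<psi> a = arc_map G \<phi> \<psi> b"
  then have "\<psi> (fst a) = \<psi> (fst b)" by (simp add: arc_map_def)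
  then have f: "fst a = fst b" using A ab by (auto simp: automorphism_def bij_betw_def inj_on_def oriented_edges_def mem_Times_iff)
  then have "snd a = snd b" using ab(3) by (auto simp: arc_map_def)
  then show "a = b" using f by (simp add: prod_eq_iff)
qed

lemma aut_verts:
  assumes "automorphism G \<phi> \<psi>"
  shows "x \<in> verts G \<Longrightarrow> \<phi> x \<in> verts G" "inj_on \<phi> (verts G)"
  using assms by (auto simp: automorphism_def bij_betw_def)

lemma out_arcs_aut:
  assumes A: "automorphism G \<phi> \<psi>" and x: "x \<in> verts G"
  shows "out_arcs G (\<phi> x) = arc_map G \<phi> \<psi> ` out_arcs G x"
proof
  show "arc_map G \<phi> \<psi> ` out_arcs G x \<subseteq> out_arcs G (\<phi> x)"
    using arc_map[OF A] by (auto simp: out_arcs_def)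
  show "out_arcs G (\<phi> x) \<subseteq> arc_map G \<phi> \<psi> ` out_arcs G x"
  proof
    fix b assume b: "b \<in> out_arcs G (\<phi> x)"
    then have "fst b \<in> edges G" by (rule out_arcsD(3))
    then have "fst b \<in> \<psi> ` edges G" using A by (simp add: automorphism_def bij_betw_def)
    then obtain e where e: "e \<in> edges G" "fst b = \<psi> e" by blast
    define a where "a = (e, snd b \<longleftrightarrow> src G (\<psi> e) = \<phi> (src G e))"
    have ab: "arc_map G \<phi> \<psi> a = b" using e by (auto simp: a_def arc_map_def prod_eq_iff)
    have a: "a \<in> oriented_edges G" using e by (simp add: a_def oriented_edges_def)
    have "\<phi> (tail G a) = \<phi> x" using arc_map(2)[OF A a] ab b by (simp add: out_arcs_def)
    then have "tail G a = x" using aut_verts(2)[OF A] tail_in[OF a] x by (auto dest: inj_onD)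
    then show "b \<in> arc_map G \<phi> \<psi> ` out_arcs G x" using ab a by (auto simp: out_arcs_def)
  qed
qed

text \<open>
  All local quantities are built from sums over the arcs at a vertex, so this gives their invariance.
\<close>

lemma sum_out_aut:
  assumes A: "automorphism G \<phi> \<psi>" and x: "x \<in> verts G" and f: "\<And>y. y \<in> verts G \<Longrightarrow> g (\<phi> y) = f y"
  shows "(\<Sum>a\<in>out_arcs G (\<phi> x). cond G (fst a) * g (head G a)) = (\<Sum>a\<in>out_arcs G x. cond G (fst a) * f (head G a) :: real)"
proof -
  have "inj_on (arc_map G \<phi> \<psi>) (out_arcs G x)" by (rule inj_on_subset[OF arc_map_inj[OF A]]) (auto simp: out_arcs_def)
  then have "(\<Sum>a\<in>out_arcs G (\<phi> x). cond G (fst a) * g (head G a)) =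
     (\<Sum>a\<in>out_arcs G x. cond G (fst (arc_map G \<phi> \<psi> a)) * g (head G (arc_map G \<phi> \<psi> a)))"
    unfolding out_arcs_aut[OF A x] by (subst sum.reindex) auto
  also have "\<dots> = (\<Sum>a\<in>out_arcs G x. cond G (fst a) * f (head G a))"
  proof (rule sum.cong[OF refl])
    fix a assume a: "a \<in> out_arcs G x"
    then show "cond G (fst (arc_map G \<phi> \<psi> a)) * g (head G (arc_map G \<phi> \<psi> a)) = cond G (fst a) * f (head G a)"
      using arc_map(3,4)[OF A out_arcsD(2)[OF a]] f[OF head_in[OF a]] by simp
  qed
  finally show ?thesis .
qed

lemma pi_aut: "automorphism G \<phi> \<psi> \<Longrightarrow> x \<in> verts G \<Longrightarrow> net_pi G {\<phi> x} = net_pi G {x}"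
  using sum_out_aut[of \<phi> \<psi> x "\<lambda>_. 1" "\<lambda>_. 1"] by (simp add: net_pi_single)

lemma avg_aut:
  assumes "automorphism G \<phi> \<psi>" "x \<in> verts G" "\<And>y. y \<in> verts G \<Longrightarrow> g (\<phi> y) = f y"
  shows "avg G g (\<phi> x) = avg G f x"
  unfolding avg_def pi_aut[OF assms(1,2)] using sum_out_aut[of \<phi> \<psi> x g f, OF assms] by simp

lemma step_prob_aut:
  assumes A: "automorphism G \<phi> \<psi>" and "x \<in> verts G" "y \<in> verts G"
  shows "step_prob G n (\<phi> x) (\<phi> y) = step_prob G n x y"
  using assms(2)
proof (induction n arbitrary: x)
  case 0
  then show ?case using aut_verts(2)[OF A] assms(3) by (auto dest: inj_onD)
next
  case (Suc n)
  then show ?case by (auto intro!: avg_aut[OF A])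
qed

lemma hit_within_aut:
  assumes A: "automorphism G \<phi> \<psi>" and "x \<in> verts G" "B \<subseteq> verts G" "Q \<subseteq> verts G"
  shows "hit_within G (\<phi> ` Q) (\<phi> ` B) k (\<phi> x) = hit_within G Q B k x"
proof -
  have mem: "\<phi> x \<in> \<phi> ` S \<longleftrightarrow> x \<in> S" if "x \<in> verts G" "S \<subseteq> verts G" for x S
    using inj_on_image_mem_iff[OF aut_verts(2)[OF A]] that by blast
  show ?thesis using assms(2)
  proof (induction k arbitrary: x)
    case 0 then show ?case using mem assms by simp
  next
    case (Suc k)
    then have "avg G (hit_within G (\<phi> ` Q) (\<phi> ` B) k) (\<phi> x) = avg G (hit_within G Q B k) x"
      by (intro avg_aut[OF A]) auto
    then show ?case using mem Suc.prems assms by simp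
  qed
qed

lemma ball_aut:
  assumes A: "automorphism G \<phi> \<psi>" and S: "S \<subseteq> verts G"
  shows "ball_set G n (\<phi> ` S) = \<phi> ` ball_set G n S"
proof (induction n)
  case (Suc n)
  have V: "ball_set G n S \<subseteq> verts G" by (rule ball_in[OF S])
  have "head G ` out_arcs G (\<phi> x) = \<phi> ` (head G ` out_arcs G x)" if "x \<in> ball_set G n S" for x
  proof -
    have "x \<in> verts G" using V that by blast
    then have "head G ` out_arcs G (\<phi> x) = (\<lambda>a. head G (arc_map G \<phi> \<psi> a)) ` out_arcs G x"
      by (simp only: out_arcs_aut[OF A] image_image)
    also have "\<dots> = (\<lambda>a. \<phi> (head G a)) ` out_arcs G x"
      by (rule image_cong[OF refl arc_map(3)[OF A out_arcsD(2)]])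
    finally show ?thesis by (simp only: image_image)
  qed
  then show ?case using Suc by (auto simp: ball_set_def nbh_def)
qed (simp add: ball_set_def)

lemma aut_id: "automorphism G id id"
  by (auto simp: automorphism_def)

lemma orbit_reps:
  assumes "quasi_transitive G"
  shows "\<exists>R. finite R \<and> R \<subseteq> verts G \<and> R \<noteq> {} \<and> (\<forall>x\<in>verts G. \<exists>z\<in>R. \<exists>\<phi> \<psi>. automorphism G \<phi> \<psi> \<and> \<phi> z = x)"
proof -
  define orb where "orb x = {\<phi> x | \<phi>. \<exists>\<psi>. automorphism G \<phi> \<psi>}" for x
  have "finite (orb ` verts G)" using assms unfolding quasi_transitive_def orb_def .
  from finite_subset_image[OF this subset_refl]
  obtain R where R: "R \<subseteq> verts G" "finite R" "orb ` verts G = orb ` R" by blast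
  have reps: "\<exists>z\<in>R. \<exists>\<phi> \<psi>. automorphism G \<phi> \<psi> \<and> \<phi> z = x" if x: "x \<in> verts G" for x
  proof -
    have "orb x \<in> orb ` R" using x unfolding R(3)[symmetric] by blast
    then obtain z where z: "z \<in> R" "orb x = orb z" by blast
    have "id x \<in> orb x" unfolding orb_def using aut_id by blast
    then have "x \<in> orb z" using z(2) by (simp only: id_apply)
    then obtain \<phi> \<psi> where "x = \<phi> z" "automorphism G \<phi> \<psi>" unfolding orb_def mem_Collect_eq by (elim exE conjE)
    then show ?thesis using z(1) by (intro bexI[of _ z] exI conjI) (assumption, simp, assumption)
  qed
  have "R \<noteq> {}"
  proof -
    obtain x where "x \<in> verts G" using conn by (auto simp: net_connected_def)
    then have "orb x \<in> orb ` R" unfolding R(3)[symmetric] by blast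
    then show ?thesis by blast
  qed
  then show ?thesis by (intro exI[of _ R] conjI ballI R(1,2) reps)
qed

lemma avg_mono: "x \<in> verts G \<Longrightarrow> (\<And>y. y \<in> verts G \<Longrightarrow> f y \<le> g y) \<Longrightarrow> avg G f x \<le> avg G g x"
  unfolding avg_def using pi_pos[of x] less_imp_le[OF cond_pos] head_in
  by (intro divide_right_mono sum_mono mult_left_mono) auto

lemma avg_const: "x \<in> verts G \<Longrightarrow> avg G (\<lambda>_. c) x = c"
  using pi_pos[of x] by (simp add: avg_def sum_distrib_right[symmetric] net_pi_single)

lemma avg_sum: "avg G (\<lambda>y. \<Sum>i\<in>I. f i y) x = (\<Sum>i\<in>I. avg G (f i) x)"
  unfolding avg_def sum_distrib_left sum_divide_distrib[symmetric] by (subst sum.swap) simp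

lemma avg_cmult: "avg G (\<lambda>y. f y * c) x = avg G f x * c"
  unfolding avg_def by (simp add: sum_distrib_right mult.assoc)

lemma avg_add: "avg G (\<lambda>y. f y + g y) x = avg G f x + avg G g x"
  unfolding avg_def by (simp add: distrib_left sum.distrib add_divide_distrib)

lemma step_prob_nonneg: "x \<in> verts G \<Longrightarrow> 0 \<le> step_prob G n x y"
proof (induction n arbitrary: x)
  case (Suc n)
  then show ?case using avg_mono[of x "\<lambda>_. 0" "\<lambda>z. step_prob G n z y"] avg_const[of x 0] by simp
qed simp

lemma ball_add: "ball_set G m (ball_set G n S) = ball_set G (m + n) S"
  by (simp add: ball_set_def funpow_add)

lemma ball_mono2: "S \<subseteq> T \<Longrightarrow> ball_set G n S \<subseteq> ball_set G n T"
  by (induction n) (auto simp: ball_set_def nbh_def)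

lemma ball_head: "a \<in> out_arcs G x \<Longrightarrow> ball_set G n {head G a} \<subseteq> ball_set G (Suc n) {x}"
  using ball_mono2[of "{head G a}" "ball_set G 1 {x}" n] ball_add[of n 1 "{x}"] ball_step[of x 0 "{x}" a]
  by (simp add: ball_set_def)

lemma step_prob_far: "z \<notin> ball_set G n {x} \<Longrightarrow> step_prob G n x z = 0"
proof (induction n arbitrary: x)
  case 0 then show ?case by (auto simp: ball_set_def)
next
  case (Suc n)
  then have "step_prob G n (head G a) z = 0" if "a \<in> out_arcs G x" for a using ball_head[OF that, of n] by (intro Suc.IH) auto
  then show ?case by (simp add: avg_def)
qed

lemma step_prob_add:
  assumes "finite S" "ball_set G m {x} \<subseteq> S"
  shows "step_prob G (m + n) x y = (\<Sum>z\<in>S. step_prob G m x z * step_prob G n z y)"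
  using assms
proof (induction m arbitrary: x)
  case 0
  then have "x \<in> S" by (simp add: ball_set_def)
  then show ?case using 0 by (simp add: of_bool_def if_distrib[of "\<lambda>u. u * _"] cong: if_cong)
next
  case (Suc m)
  have "step_prob G (m + n) (head G a) y = (\<Sum>z\<in>S. step_prob G m (head G a) z * step_prob G n z y)" if "a \<in> out_arcs G x" for a
    using Suc ball_head[OF that, of m] by (intro Suc.IH) auto
  then have "step_prob G (Suc m + n) x y = avg G (\<lambda>u. \<Sum>z\<in>S. step_prob G m u z * step_prob G n z y) x"
    by (simp add: avg_def)
  then show ?case by (simp add: avg_sum avg_cmult)
qed

lemma step_prob_1_sym:
  assumes "x \<in> verts G" "y \<in> verts G"
  shows "net_pi G {x} * step_prob G 1 x y = net_pi G {y} * step_prob G 1 y x"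
proof -
  have eq: "net_pi G {x} * step_prob G 1 x y = (\<Sum>a\<in>{a\<in>out_arcs G x. head G a = y}. cond G (fst a))" if "x \<in> verts G" for x y
  proof -
    have "net_pi G {x} * step_prob G 1 x y = (\<Sum>a\<in>out_arcs G x. if head G a = y then cond G (fst a) else 0)"
      using pi_pos[OF that] by (simp add: avg_def of_bool_def if_distrib cong: if_cong)
    then show ?thesis by (simp add: sum.inter_filter)
  qed
  have "(\<Sum>a\<in>{a\<in>out_arcs G x. head G a = y}. cond G (fst a)) = (\<Sum>a\<in>{a\<in>out_arcs G y. head G a = x}. cond G (fst a))"
    by (rule sum.reindex_bij_witness[where i = rev_arc and j = rev_arc]) (auto simp: out_arcs_def)
  then show ?thesis unfolding eq[OF assms(1)] eq[OF assms(2)] .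
qed

text \<open>
  Reversibility.
\<close>

lemma step_prob_sym:
  assumes "x \<in> verts G" "y \<in> verts G"
  shows "net_pi G {x} * step_prob G n x y = net_pi G {y} * step_prob G n y x"
  using assms
proof (induction n arbitrary: x y)
  case 0 then show ?case by auto
next
  case (Suc n)
  define S where "S = ball_set G n {x} \<union> ball_set G 1 {y}"
  have S: "finite S" "S \<subseteq> verts G" using finite_ball ball_in Suc.prems by (auto simp: S_def)
  have "net_pi G {x} * step_prob G (Suc n) x y = net_pi G {x} * step_prob G (n + 1) x y" by simp
  also have "\<dots> = (\<Sum>z\<in>S. (net_pi G {x} * step_prob G n x z) * step_prob G 1 z y)"
    using S by (subst step_prob_add[of S]) (auto simp: S_def sum_distrib_left mult.assoc)
  also have "\<dots> = (\<Sum>z\<in>S. (net_pi G {z} * step_prob G 1 z y) * step_prob G n z x)"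
    using S Suc.IH[OF Suc.prems(1)] by (intro sum.cong refl) (auto simp: mult.commute mult.left_commute)
  also have "\<dots> = (\<Sum>z\<in>S. net_pi G {y} * (step_prob G 1 y z * step_prob G n z x))"
    using S step_prob_1_sym[OF _ Suc.prems(2)] by (intro sum.cong refl) (auto simp: mult.assoc)
  also have "\<dots> = net_pi G {y} * step_prob G (1 + n) y x"
    using S by (subst step_prob_add[of S]) (auto simp: S_def sum_distrib_left)
  finally show ?case by simp
qed

lemma hit_within_bounds: "z \<in> verts G \<Longrightarrow> 0 \<le> hit_within G Q B k z \<and> hit_within G Q B k z \<le> 1"
proof (induction k arbitrary: z)
  case (Suc k)
  then show ?case
    using avg_mono[of z "\<lambda>_. 0" "hit_within G Q B k"] avg_mono[of z "hit_within G Q B k" "\<lambda>_. 1"] by (auto simp: avg_const)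
qed simp

lemma hit_within_Suc_mono: "z \<in> verts G \<Longrightarrow> Q \<subseteq> B \<Longrightarrow> hit_within G Q B k z \<le> hit_within G Q B (Suc k) z"
proof (induction k arbitrary: z)
  case 0
  have "0 \<le> avg G (hit_within G Q B 0) z" using avg_mono[of z "\<lambda>_. 0" "hit_within G Q B 0"] 0 by (simp add: avg_const)
  then show ?case using 0 by auto
next
  case (Suc k)
  then show ?case using avg_mono[of z "hit_within G Q B k" "hit_within G Q B (Suc k)"] by auto
qed

lemma hit_within_antimono_B:
  assumes "z \<in> verts G" "B \<subseteq> B'" "Q \<subseteq> B"
  shows "hit_within G Q B' k z \<le> hit_within G Q B k z"
  using assms(1)
proof (induction k arbitrary: z)
  case (Suc k)
  then have "avg G (hit_within G Q B' k) z \<le> avg G (hit_within G Q B k) z" by (intro avg_mono) auto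
  moreover have "0 \<le> avg G (hit_within G Q B k) z"
    using avg_mono[of z "\<lambda>_. 0" "hit_within G Q B k"] hit_within_bounds Suc.prems by (auto simp: avg_const)
  ultimately show ?case using assms by auto
qed simp

lemma hit_ever_lim: "z \<in> verts G \<Longrightarrow> Q \<subseteq> B \<Longrightarrow> (\<lambda>k. hit_within G Q B k z) \<longlonglongrightarrow> hit_ever G Q B z"
proof -
  assume z: "z \<in> verts G" "Q \<subseteq> B"
  have "incseq (\<lambda>k. hit_within G Q B k z)" using hit_within_Suc_mono[OF z] by (intro incseq_SucI)
  moreover have "Bseq (\<lambda>k. hit_within G Q B k z)" using hit_within_bounds[OF z(1)] by (intro BseqI'[of _ 1]) auto
  ultimately have "convergent (\<lambda>k. hit_within G Q B k z)" by (rule Bseq_monoseq_convergent[rotated, OF incseq_imp_monoseq])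
  then show ?thesis by (simp add: hit_ever_def convergent_LIMSEQ_iff)
qed

lemma hit_ever_ge: "z \<in> verts G \<Longrightarrow> Q \<subseteq> B \<Longrightarrow> hit_within G Q B k z \<le> hit_ever G Q B z"
  using incseq_le[OF incseq_SucI hit_ever_lim] hit_within_Suc_mono by blast

lemma hit_ever_bounds: "z \<in> verts G \<Longrightarrow> Q \<subseteq> B \<Longrightarrow> 0 \<le> hit_ever G Q B z \<and> hit_ever G Q B z \<le> 1"
  using hit_ever_ge[of z Q B 0] hit_within_bounds[of z Q B] LIMSEQ_le_const2[OF hit_ever_lim, of z Q B 1]
  by (metis hit_within_bounds order_trans)

lemma avg_lim:
  assumes "\<And>y. y \<in> verts G \<Longrightarrow> (\<lambda>k. f k y) \<longlonglongrightarrow> g y"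
  shows "(\<lambda>k. avg G (f k) x) \<longlonglongrightarrow> avg G g x"
proof (cases "x \<in> verts G")
  case True
  then show ?thesis unfolding avg_def using pi_pos[OF True]
    by (intro tendsto_divide tendsto_sum tendsto_mult tendsto_const assms head_in) auto
next
  case False
  then have "out_arcs G x = {}" using tail_in by (auto simp: out_arcs_def)
  then show ?thesis by (simp add: avg_def)
qed

lemma hit_ever_eq:
  assumes "z \<in> verts G" "Q \<subseteq> B"
  shows "hit_ever G Q B z = (if z \<in> B then of_bool (z \<in> Q) else avg G (hit_ever G Q B) z)"
proof (rule LIMSEQ_unique)
  show "(\<lambda>k. hit_within G Q B (Suc k) z) \<longlonglongrightarrow> hit_ever G Q B z" by (rule LIMSEQ_Suc[OF hit_ever_lim[OF assms]])
  have "(\<lambda>k. avg G (hit_within G Q B k) z) \<longlonglongrightarrow> avg G (hit_ever G Q B) z" using assms(2) by (intro avg_lim hit_ever_lim)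
  then show "(\<lambda>k. hit_within G Q B (Suc k) z) \<longlonglongrightarrow> (if z \<in> B then of_bool (z \<in> Q) else avg G (hit_ever G Q B) z)" by simp
qed

lemma hit_ever_aut:
  assumes A: "automorphism G \<phi> \<psi>" and "x \<in> verts G" "B \<subseteq> verts G" "Q \<subseteq> B"
  shows "hit_ever G (\<phi> ` Q) (\<phi> ` B) (\<phi> x) = hit_ever G Q B x"
  unfolding hit_ever_def using hit_within_aut[OF A assms(2,3)] assms by simp

lemma hit_ever_antimono_B:
  assumes "z \<in> verts G" "B \<subseteq> B'" "Q \<subseteq> B"
  shows "hit_ever G Q B' z \<le> hit_ever G Q B z"
  by (rule LIMSEQ_le[OF hit_ever_lim hit_ever_lim]) (use assms hit_within_antimono_B in auto)

lemma avg_trans_prob: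
  "x \<in> verts G \<Longrightarrow> avg G f x = (\<Sum>z\<in>head G ` out_arcs G x. trans_prob G x z * f z)"
proof -
  assume x: "x \<in> verts G"
  have "(\<Sum>a\<in>out_arcs G x. cond G (fst a) * f (head G a)) = (\<Sum>z\<in>head G ` out_arcs G x. \<Sum>a\<in>{a \<in> out_arcs G x. head G a = z}. cond G (fst a) * f (head G a))"
    by (rule sum.image_gen) simp
  also have "\<dots> = (\<Sum>z\<in>head G ` out_arcs G x. (\<Sum>a\<in>{a \<in> out_arcs G x. head G a = z}. cond G (fst a)) * f z)"
    by (intro sum.cong refl) (auto simp: sum_distrib_right intro!: sum.cong)
  also have "\<dots> / net_pi G {x} = (\<Sum>z\<in>head G ` out_arcs G x. trans_prob G x z * f z)"
    unfolding sum_divide_distrib[of _ "head G ` out_arcs G x"]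
    by (intro sum.cong refl) (simp add: trans_prob_def out_arcs_def)
  finally show ?thesis unfolding avg_def .
qed

text \<open>
  The law of the walk gives each event described by finitely many coordinates at least the probability
  computed by the recursion for \<open>hit_within\<close>, because the corresponding cylinders are disjoint.
\<close>

lemma transient_return_prob:
  assumes tr: "transient G" and x: "x \<in> verts G"
  shows "avg G (hit_ever G {x} {x}) x < 1"
proof -
  obtain M where M: "walk_law G x M" and lt: "measure M {\<omega> \<in> space M. \<exists>n\<ge>1. \<omega> n = x} < 1"
    using tr x by (auto simp: transient_def)
  interpret prob_space M using M by (simp add: walk_law_def)
  have sets: "sets M = sets (PiM (UNIV :: nat set) (\<lambda>_. count_space (verts G)))"
    and law: "\<And>y n. (\<forall>i. y i \<in> verts G) \<Longrightarrow> measure M {\<omega> \<in> space M. \<forall>i\<le>n. \<omega> i = y i} =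
          (if y 0 = x then \<Prod>i<n. trans_prob G (y i) (y (Suc i)) else 0)"
    using M by (auto simp: walk_law_def)
  have "(\<lambda>\<omega>. \<omega> i) \<in> measurable M (count_space (verts G))" for i
    using measurable_component_singleton[of i UNIV "\<lambda>_. count_space (verts G)"] unfolding measurable_cong_sets[OF sets refl] by simp
  then have [measurable]: "Measurable.pred M (\<lambda>\<omega>. \<omega> i = c)" for i c
    by (rule measurable_compose) simp
  define w where "w y n = (\<Prod>i<n. trans_prob G (y i) (y (Suc i)))" for y :: "nat \<Rightarrow> 'v" and n
  (* The walk starts with \<open>y 0, ..., y j\<close> and is at \<open>x\<close> at some time between \<open>j\<close> and \<open>j + k\<close>. *)
  define ev where "ev y j k = {\<omega> \<in> space M. (\<forall>i\<le>j. \<omega> i = y i) \<and> (\<exists>n. j \<le> n \<and> n \<le> j + k \<and> \<omega> n = x)}" for y j k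
  have ev_sets [measurable]: "ev y j k \<in> sets M" for y j k unfolding ev_def by measurable
  have split: "(\<Sum>z\<in>head G ` out_arcs G v. measure M (ev (y(Suc j := z)) (Suc j) k)) \<le> measure M S"
    if "S \<in> sets M" "\<And>z. z \<in> head G ` out_arcs G v \<Longrightarrow> ev (y(Suc j := z)) (Suc j) k \<subseteq> S" for y j k v S
  proof -
    have "disjoint_family_on (\<lambda>z. ev (y(Suc j := z)) (Suc j) k) (head G ` out_arcs G v)"
    proof (unfold disjoint_family_on_def, intro ballI impI)
      fix z z' :: 'v assume ne: "z \<noteq> z'"
      have "\<omega> (Suc j) = z''" if "\<omega> \<in> ev (y(Suc j := z'')) (Suc j) k" for \<omega> z''
      proof -
        have "\<forall>i\<le>Suc j. \<omega> i = (y(Suc j := z'')) i" using that by (simp add: ev_def)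
        then have "\<omega> (Suc j) = (y(Suc j := z'')) (Suc j)" by blast
        then show ?thesis by simp
      qed
      then show "ev (y(Suc j := z)) (Suc j) k \<inter> ev (y(Suc j := z')) (Suc j) k = {}" using ne by blast
    qed
    then have "(\<Sum>z\<in>head G ` out_arcs G v. measure M (ev (y(Suc j := z)) (Suc j) k)) = measure M (\<Union>z\<in>head G ` out_arcs G v. ev (y(Suc j := z)) (Suc j) k)"
      by (intro finite_measure_finite_Union[symmetric]) auto
    also have "\<dots> \<le> measure M S" using that by (intro finite_measure_mono) auto
    finally show ?thesis .
  qed
  have w_upd: "w (y(Suc j := z)) (Suc j) = w y j * trans_prob G (y j) z" for y j z
    by (simp add: w_def)
  have tp: "0 \<le> trans_prob G u z" if "u \<in> verts G" for u z
    unfolding trans_prob_def using pi_pos[OF that] network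
    by (intro divide_nonneg_nonneg sum_nonneg) (auto simp: is_network_def oriented_edges_def intro: less_imp_le)
  have low: "w y j * hit_within G {x} {x} k (y j) \<le> measure M (ev y j k)" if y: "\<forall>i. y i \<in> verts G" "y 0 = x" for y j k
    using y
  proof (induction k arbitrary: y j)
    case 0
    show ?case
    proof (cases "y j = x")
      case True
      have eq: "ev y j 0 = {\<omega> \<in> space M. \<forall>i\<le>j. \<omega> i = y i}" unfolding ev_def using True by auto
      show ?thesis unfolding eq law[OF 0(1)] using 0(2) True by (simp add: w_def)
    qed simp
  next
    case (Suc k)
    show ?case
    proof (cases "y j = x")
      case True
      have eq: "ev y j (Suc k) = {\<omega> \<in> space M. \<forall>i\<le>j. \<omega> i = y i}" unfolding ev_def using True by auto
      show ?thesis unfolding eq law[OF Suc.prems(1)] using Suc.prems(2) True by (simp add: w_def)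
    next
      case False
      have v: "y j \<in> verts G" using Suc.prems by simp
      have "w y j * hit_within G {x} {x} (Suc k) (y j) = (\<Sum>z\<in>head G ` out_arcs G (y j). w (y(Suc j := z)) (Suc j) * hit_within G {x} {x} k ((y(Suc j := z)) (Suc j)))"
        unfolding w_upd using False by (simp add: avg_trans_prob[OF v] sum_distrib_left mult.assoc)
      also have "\<dots> \<le> (\<Sum>z\<in>head G ` out_arcs G (y j). measure M (ev (y(Suc j := z)) (Suc j) k))"
        using Suc.prems head_in by (intro sum_mono Suc.IH) auto
      also have "\<dots> \<le> measure M (ev y j (Suc k))"
      proof (rule split)
        fix z
        show "ev (y(Suc j := z)) (Suc j) k \<subseteq> ev y j (Suc k)"
        proof
          fix \<omega> assume "\<omega> \<in> ev (y(Suc j := z)) (Suc j) k"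
          then have 1: "\<omega> \<in> space M" "\<And>i. i \<le> Suc j \<Longrightarrow> \<omega> i = (y(Suc j := z)) i" "\<exists>n. Suc j \<le> n \<and> n \<le> Suc j + k \<and> \<omega> n = x"
            by (auto simp: ev_def)
          have "\<omega> i = y i" if "i \<le> j" for i using 1(2)[of i] that by simp
          moreover have "\<exists>n. j \<le> n \<and> n \<le> j + Suc k \<and> \<omega> n = x" using 1(3) by (metis Suc_leD add_Suc add_Suc_right)
          ultimately show "\<omega> \<in> ev y j (Suc k)" using 1(1) by (auto simp: ev_def)
        qed
      qed auto
      finally show ?thesis .
    qed
  qed
  let ?E = "{\<omega> \<in> space M. \<exists>n\<ge>1. \<omega> n = x}"
  have "avg G (hit_within G {x} {x} k) x \<le> measure M ?E" for k
  proof -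
    let ?y = "\<lambda>z. (\<lambda>_. x)(Suc 0 := z)"
    have "avg G (hit_within G {x} {x} k) x = (\<Sum>z\<in>head G ` out_arcs G x. w (?y z) (Suc 0) * hit_within G {x} {x} k (?y z (Suc 0)))"
      unfolding w_upd by (simp add: avg_trans_prob[OF x] w_def)
    also have "\<dots> \<le> (\<Sum>z\<in>head G ` out_arcs G x. measure M (ev (?y z) (Suc 0) k))"
      using x head_in by (intro sum_mono low) auto
    also have "\<dots> \<le> measure M ?E" by (rule split) (measurable, auto simp: ev_def)
    finally show ?thesis .
  qed
  moreover have "(\<lambda>k. avg G (hit_within G {x} {x} k) x) \<longlonglongrightarrow> avg G (hit_ever G {x} {x}) x" by (intro avg_lim hit_ever_lim) auto
  ultimately have "avg G (hit_ever G {x} {x}) x \<le> measure M ?E" by (intro LIMSEQ_le_const2) auto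
  then show ?thesis using lt by simp
qed

text \<open>
  The expected number of visits to \<open>x\<close> from any starting point is at most the probability of ever
  reaching \<open>x\<close> times the number from \<open>x\<close> itself.
\<close>

lemma green_bound:
  assumes tr: "transient G" and x: "x \<in> verts G"
  shows "(\<Sum>n<N. step_prob G n x x) \<le> 1 / (1 - avg G (hit_ever G {x} {x}) x)"
proof -
  let ?\<rho> = "avg G (hit_ever G {x} {x}) x"
  have \<rho>: "?\<rho> < 1" by (rule transient_return_prob[OF assms])
  define g where "g N y = (\<Sum>n<N. step_prob G n y x)" for N y
  have g_Suc: "g (Suc N) y = of_bool (y = x) + avg G (g N) y" for N y
    unfolding g_def by (subst sum.lessThan_Suc_shift) (simp add: avg_sum)
  have g0: "0 \<le> g N y" if "y \<in> verts G" for N y unfolding g_def by (intro sum_nonneg step_prob_nonneg that)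
  have gm: "g N y \<le> g (Suc N) y" if "y \<in> verts G" for N y unfolding g_def using step_prob_nonneg[OF that] by simp
  have hit: "g N y \<le> hit_within G {x} {x} N y * g N x" if "y \<in> verts G" for N y
    using that
  proof (induction N arbitrary: y)
    case 0 then show ?case by (simp add: g_def)
  next
    case (Suc N)
    show ?case
    proof (cases "y = x")
      case False
      have "g (Suc N) y = avg G (g N) y" using False by (simp add: g_Suc)
      also have "\<dots> \<le> avg G (\<lambda>z. hit_within G {x} {x} N z * g N x) y" using Suc by (intro avg_mono) auto
      also have "\<dots> = hit_within G {x} {x} (Suc N) y * g N x" using False by (simp add: avg_cmult)
      also have "\<dots> \<le> hit_within G {x} {x} (Suc N) y * g (Suc N) x"
        by (rule mult_left_mono[OF gm[OF x] conjunct1[OF hit_within_bounds[OF Suc.prems]]])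
      finally show ?thesis .
    qed simp
  qed
  have "g N x * (1 - ?\<rho>) \<le> 1"
  proof -
    have "g N x \<le> g (Suc N) x" by (rule gm[OF x])
    also have "\<dots> = 1 + avg G (g N) x" by (simp add: g_Suc)
    also have "avg G (g N) x \<le> avg G (\<lambda>y. hit_ever G {x} {x} y * g N x) x"
    proof (rule avg_mono[OF x])
      fix y assume y: "y \<in> verts G"
      have "g N y \<le> hit_within G {x} {x} N y * g N x" by (rule hit[OF y])
      also have "\<dots> \<le> hit_ever G {x} {x} y * g N x" using hit_ever_ge[OF y, of "{x}" "{x}" N] g0[OF x] by (intro mult_right_mono) auto
      finally show "g N y \<le> hit_ever G {x} {x} y * g N x" .
    qed
    also have "\<dots> = ?\<rho> * g N x" by (rule avg_cmult)
    finally show ?thesis by (simp add: algebra_simps)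
  qed
  then show ?thesis using \<rho> by (simp add: g_def pos_le_divide_eq)
qed

end

section \<open>Capacity in transient quasi-transitive networks\<close>

locale qt_net = inf_net G for G :: "('v, 'e) network" +
  assumes tr: "transient G" and qt: "quasi_transitive G"
begin

definition reps :: "'v set" where
  "reps = (SOME R. finite R \<and> R \<subseteq> verts G \<and> R \<noteq> {} \<and> (\<forall>x\<in>verts G. \<exists>z\<in>R. \<exists>\<phi> \<psi>. automorphism G \<phi> \<psi> \<and> \<phi> z = x))"

lemma reps: "finite reps" "reps \<subseteq> verts G" "reps \<noteq> {}"
  "x \<in> verts G \<Longrightarrow> \<exists>z\<in>reps. \<exists>\<phi> \<psi>. automorphism G \<phi> \<psi> \<and> \<phi> z = x"
  using someI_ex[OF orbit_reps[OF qt]] unfolding reps_def[symmetric] by blast+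

text \<open>
  An invariant function takes only its values at the orbit representatives.
\<close>

lemma invariant_bounded:
  fixes f :: "'v \<Rightarrow> real"
  assumes "\<And>\<phi> \<psi> x. automorphism G \<phi> \<psi> \<Longrightarrow> x \<in> verts G \<Longrightarrow> f (\<phi> x) = f x" "x \<in> verts G"
  shows "f x \<in> f ` reps"
proof -
  obtain z \<phi> \<psi> where z: "z \<in> reps" "automorphism G \<phi> \<psi>" "\<phi> z = x" using reps(4)[OF assms(2)] by blast
  have "f (\<phi> z) = f z" using reps(2) z by (intro assms(1)) auto
  then show ?thesis using z by auto
qed

lemma pi_bounds: "\<exists>p q. 0 < p \<and> (\<forall>x\<in>verts G. p \<le> net_pi G {x} \<and> net_pi G {x} \<le> q)"
proof -
  let ?P = "(\<lambda>x. net_pi G {x}) ` reps"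
  have fin: "finite ?P" "?P \<noteq> {}" using reps by auto
  have "net_pi G {x} \<in> ?P" if "x \<in> verts G" for x
    by (rule invariant_bounded[of "\<lambda>x. net_pi G {x}"]) (use that pi_aut in auto)
  then have "\<forall>x\<in>verts G. Min ?P \<le> net_pi G {x} \<and> net_pi G {x} \<le> Max ?P" using fin by auto
  moreover have "Min ?P \<in> ?P" using fin by (rule Min_in)
  then have "0 < Min ?P" using pi_pos reps(2) by auto
  ultimately show ?thesis by blast
qed

lemma ball_bound: "\<exists>b. \<forall>x\<in>verts G. card (ball_set G n {x}) \<le> b"
proof -
  let ?f = "\<lambda>x. real (card (ball_set G n {x}))"
  have inv: "?f (\<phi> x) = ?f x" if A: "automorphism G \<phi> \<psi>" "x \<in> verts G" for \<phi> \<psi> x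
  proof -
    have "ball_set G n {\<phi> x} = \<phi> ` ball_set G n {x}" using ball_aut[OF A(1), of "{x}" n] A(2) by simp
    then show ?thesis using ball_in[of "{x}" n] A by (simp add: card_image inj_on_subset[OF aut_verts(2)[OF A(1)]])
  qed
  have "?f x \<le> Max (?f ` reps)" if "x \<in> verts G" for x
  proof (rule Max_ge)
    show "?f x \<in> ?f ` reps" by (rule invariant_bounded[of ?f]) (use inv that in auto)
  qed (use reps in auto)
  note le = this
  obtain b where b: "Max (?f ` reps) \<le> real b" using real_arch_simple by blast
  have "card (ball_set G n {x}) \<le> b" if "x \<in> verts G" for x
    using order_trans[OF le[OF that] b] by simp
  then show ?thesis by blast
qed

text \<open>
  A bound for \<open>step_prob G m x y / \<pi> y\<close> that is uniform in \<open>x\<close> and \<open>y\<close>. Odd times are rounded down, because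
  only even return probabilities dominate the off-diagonal ones.
\<close>

definition decay :: "nat \<Rightarrow> real" where
  "decay m = (\<Sum>z\<in>reps. step_prob G (2 * (m div 2)) z z / net_pi G {z})"

lemma decay_even:
  assumes "x \<in> verts G"
  shows "step_prob G (2 * n) x x / net_pi G {x} \<le> decay (2 * n)"
proof -
  let ?f = "\<lambda>x. step_prob G (2 * n) x x / net_pi G {x}"
  have "?f x \<in> ?f ` reps" by (rule invariant_bounded[of ?f]) (use assms step_prob_aut pi_aut in auto)
  then obtain z where z: "z \<in> reps" "?f x = ?f z" by auto
  have "?f z \<le> (\<Sum>z\<in>reps. ?f z)"
    using z reps pi_pos step_prob_nonneg by (intro member_le_sum) (auto intro!: divide_nonneg_nonneg intro: less_imp_le)
  then show ?thesis using z by (simp add: decay_def)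
qed

lemma decay_nonneg: "0 \<le> decay m"
  unfolding decay_def using reps pi_pos step_prob_nonneg by (intro sum_nonneg divide_nonneg_nonneg) (auto intro: less_imp_le)

text \<open>
  Split the walk in the middle, reverse the second half, and use \<open>2 a b \<le> a\<^sup>2 + b\<^sup>2\<close>.
\<close>

lemma step_prob_even_bound:
  assumes x: "x \<in> verts G" and y: "y \<in> verts G"
  shows "step_prob G (2 * n) x y \<le> net_pi G {y} * decay (2 * n)"
proof -
  define S where "S = ball_set G n {x} \<union> ball_set G n {y}"
  have S: "finite S" "S \<subseteq> verts G" using finite_ball ball_in x y by (auto simp: S_def)
  have px: "0 < net_pi G {x}" "0 < net_pi G {y}" using pi_pos x y by auto
  have diag: "step_prob G (2 * n) u u / net_pi G {u} = (\<Sum>z\<in>S. (step_prob G n u z)\<^sup>2 / net_pi G {z})"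
    if u: "u \<in> verts G" "ball_set G n {u} \<subseteq> S" for u
  proof -
    have "step_prob G (2 * n) u u = (\<Sum>z\<in>S. step_prob G n u z * step_prob G n z u)"
      using step_prob_add[OF S(1) u(2), of n u] by (simp add: mult_2)
    also have "\<dots> = (\<Sum>z\<in>S. net_pi G {u} * ((step_prob G n u z)\<^sup>2 / net_pi G {z}))"
    proof (rule sum.cong[OF refl])
      fix z assume "z \<in> S"
      then have z: "z \<in> verts G" "0 < net_pi G {z}" using S pi_pos by auto
      have "step_prob G n z u = net_pi G {u} * step_prob G n u z / net_pi G {z}"
        using step_prob_sym[OF u(1) z(1), of n] z(2) by (simp add: field_simps)
      then show "step_prob G n u z * step_prob G n z u = net_pi G {u} * ((step_prob G n u z)\<^sup>2 / net_pi G {z})"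
        by (simp add: power2_eq_square)
    qed
    finally have "step_prob G (2 * n) u u = net_pi G {u} * (\<Sum>z\<in>S. (step_prob G n u z)\<^sup>2 / net_pi G {z})"
      unfolding sum_distrib_left .
    then show ?thesis using pi_pos[OF u(1)] by simp
  qed
  have "step_prob G (2 * n) x y = (\<Sum>z\<in>S. step_prob G n x z * step_prob G n z y)"
    using step_prob_add[OF S(1), of n x n y] by (simp add: mult_2 S_def)
  also have "\<dots> \<le> (\<Sum>z\<in>S. net_pi G {y} / 2 * ((step_prob G n x z)\<^sup>2 / net_pi G {z} + (step_prob G n y z)\<^sup>2 / net_pi G {z}))"
  proof (rule sum_mono)
    fix z assume "z \<in> S"
    then have z: "z \<in> verts G" "0 < net_pi G {z}" using S pi_pos by auto
    have e: "step_prob G n z y = net_pi G {y} * step_prob G n y z / net_pi G {z}"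
      using step_prob_sym[OF y z(1), of n] z(2) by (simp add: field_simps)
    have "step_prob G n x z * step_prob G n y z \<le> ((step_prob G n x z)\<^sup>2 + (step_prob G n y z)\<^sup>2) / 2"
      using sum_squares_bound[of "step_prob G n x z" "step_prob G n y z"] by simp
    then have "net_pi G {y} / net_pi G {z} * (step_prob G n x z * step_prob G n y z) \<le> net_pi G {y} / net_pi G {z} * (((step_prob G n x z)\<^sup>2 + (step_prob G n y z)\<^sup>2) / 2)"
      using px z by (intro mult_left_mono) auto
    then show "step_prob G n x z * step_prob G n z y \<le> net_pi G {y} / 2 * ((step_prob G n x z)\<^sup>2 / net_pi G {z} + (step_prob G n y z)\<^sup>2 / net_pi G {z})"
      unfolding e by (simp add: algebra_simps add_divide_distrib)
  qed
  also have "\<dots> = net_pi G {y} / 2 * (step_prob G (2 * n) x x / net_pi G {x} + step_prob G (2 * n) y y / net_pi G {y})"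
  proof -
    have "step_prob G (2 * n) x x / net_pi G {x} = (\<Sum>z\<in>S. (step_prob G n x z)\<^sup>2 / net_pi G {z})" by (rule diag[OF x]) (simp add: S_def)
    moreover have "step_prob G (2 * n) y y / net_pi G {y} = (\<Sum>z\<in>S. (step_prob G n y z)\<^sup>2 / net_pi G {z})" by (rule diag[OF y]) (simp add: S_def)
    ultimately show ?thesis unfolding sum_distrib_left[symmetric] sum.distrib by simp
  qed
  also have "\<dots> \<le> net_pi G {y} / 2 * (decay (2 * n) + decay (2 * n))"
    using px decay_even[OF x] decay_even[OF y] by (intro mult_left_mono add_mono) auto
  finally show ?thesis by simp
qed

lemma step_prob_bound:
  assumes x: "x \<in> verts G" and y: "y \<in> verts G"
  shows "step_prob G m x y \<le> net_pi G {y} * decay m"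
proof (cases "even m")
  case True
  then obtain n where "m = 2 * n" by (elim evenE)
  then show ?thesis using step_prob_even_bound[OF assms] by simp
next
  case False
  then obtain n where n: "m = Suc (2 * n)" by (auto elim: oddE)
  have "step_prob G m x y = avg G (\<lambda>z. step_prob G (2 * n) z y) x" by (simp add: n)
  also have "\<dots> \<le> avg G (\<lambda>_. net_pi G {y} * decay (2 * n)) x" by (rule avg_mono[OF x step_prob_even_bound[OF _ y]])
  also have "\<dots> = net_pi G {y} * decay m" by (simp add: avg_const[OF x] decay_def n)
  finally show ?thesis .
qed

lemma summable_decay: "summable decay"
proof -
  have "summable (\<lambda>n. step_prob G n z z)" if z: "z \<in> verts G" for z
    by (rule bounded_imp_summable[OF step_prob_nonneg[OF z], of _ _ "1 / (1 - avg G (hit_ever G {z} {z}) z)"])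
      (use green_bound[OF tr z, of "Suc _"] in \<open>auto simp: lessThan_Suc_atMost\<close>)
  then have s: "summable (\<lambda>n. step_prob G (2 * n) z z / net_pi G {z})" if "z \<in> verts G" for z
  proof -
    assume *: "\<And>z. z \<in> verts G \<Longrightarrow> summable (\<lambda>n. step_prob G n z z)"
    have "summable (\<lambda>n. step_prob G (2 * n) z z)"
    proof (rule bounded_imp_summable[OF step_prob_nonneg[OF that], of "\<lambda>n. 2 * n" _ "suminf (\<lambda>n. step_prob G n z z)"])
      fix n
      have "(\<Sum>k\<le>n. step_prob G (2 * k) z z) = (\<Sum>j\<in>(\<lambda>k. 2 * k) ` {..n}. step_prob G j z z)"
        by (subst sum.reindex) (auto simp: inj_on_def)
      also have "\<dots> \<le> suminf (\<lambda>n. step_prob G n z z)"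
        using *[OF that] step_prob_nonneg[OF that] by (intro sum_le_suminf) auto
      finally show "(\<Sum>k\<le>n. step_prob G (2 * k) z z) \<le> suminf (\<lambda>n. step_prob G n z z)" .
    qed
    then show ?thesis by (rule summable_divide)
  qed
  define E where "E n = (\<Sum>z\<in>reps. step_prob G (2 * n) z z / net_pi G {z})" for n
  have sE: "summable E" unfolding E_def using reps(2) s by (intro summable_sum) auto
  have E0: "0 \<le> E n" for n using decay_nonneg[of "2 * n"] by (simp add: decay_def E_def)
  have d: "decay m = E (m div 2)" for m by (simp add: decay_def E_def)
  show ?thesis
  proof (rule bounded_imp_summable[of _ "2 * suminf E"])
    fix n
    have "(\<Sum>k\<le>n. decay k) \<le> (\<Sum>k<2 * Suc n. decay k)"
      using decay_nonneg by (intro sum_mono2) auto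
    also have "\<dots> = 2 * (\<Sum>k<Suc n. E k)"
      by (induction n) (simp_all add: d)
    also have "\<dots> \<le> 2 * suminf E" using sum_le_suminf[OF sE, of "{..<Suc n}"] E0 by simp
    finally show "(\<Sum>k\<le>n. decay k) \<le> 2 * suminf E" .
  qed (rule decay_nonneg)
qed

text \<open>
  Points that are far apart see each other only at late times, which carry little of the summable
  \<open>decay\<close>.
\<close>

lemma green_decay:
  assumes "0 < \<delta>"
  shows "\<exists>R. \<forall>N. \<forall>x\<in>verts G. \<forall>y\<in>verts G. (\<forall>m<R. step_prob G m x y = 0) \<longrightarrow> (\<Sum>m<N. step_prob G m x y) \<le> \<delta>"
proof -
  obtain p q where q: "\<And>x. x \<in> verts G \<Longrightarrow> net_pi G {x} \<le> q" using pi_bounds by blast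
  have q0: "0 \<le> q"
  proof -
    obtain x where "x \<in> verts G" using conn by (auto simp: net_connected_def)
    then show ?thesis using q[of x] pi_pos[of x] by linarith
  qed
  have "(\<lambda>R. q * (suminf decay - (\<Sum>m<R. decay m))) \<longlonglongrightarrow> q * (suminf decay - suminf decay)"
    by (intro tendsto_intros summable_LIMSEQ summable_decay)
  then have "eventually (\<lambda>R. q * (suminf decay - (\<Sum>m<R. decay m)) < \<delta>) sequentially"
    using assms by (intro order_tendstoD(2)[of _ "q * (suminf decay - suminf decay)"]) auto
  then obtain R where R: "q * (suminf decay - (\<Sum>m<R. decay m)) < \<delta>" by (auto simp: eventually_sequentially)
  have "(\<Sum>m<N. step_prob G m x y) \<le> \<delta>" if x: "x \<in> verts G" "y \<in> verts G" "\<forall>m<R. step_prob G m x y = 0" for N x y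
  proof -
    have "(\<Sum>m<N. step_prob G m x y) \<le> (\<Sum>m<N. if m < R then 0 else q * decay m)"
    proof (rule sum_mono)
      fix m
      have "step_prob G m x y \<le> net_pi G {y} * decay m" by (rule step_prob_bound[OF x(1,2)])
      also have "\<dots> \<le> q * decay m" using q[OF x(2)] decay_nonneg by (intro mult_right_mono)
      finally show "step_prob G m x y \<le> (if m < R then 0 else q * decay m)" using x(3) by auto
    qed
    also have "\<dots> = (\<Sum>m\<in>{..<N} - {..<R}. q * decay m)"
      by (intro sum.mono_neutral_cong_right) auto
    also have "\<dots> = q * ((\<Sum>m\<in>({..<N} - {..<R}) \<union> {..<R}. decay m) - (\<Sum>m<R. decay m))"
      by (subst sum.union_disjoint) (auto simp: sum_distrib_left)
    also have "\<dots> \<le> q * (suminf decay - (\<Sum>m<R. decay m))"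
      using q0 sum_le_suminf[OF summable_decay, of "({..<N} - {..<R}) \<union> {..<R}"] decay_nonneg by (intro mult_left_mono) auto
    finally show ?thesis using R by linarith
  qed
  then show ?thesis by blast
qed

text \<open>
  Choose points greedily, each time discarding a ball.
\<close>

lemma separated_subset:
  assumes "\<forall>x\<in>verts G. card (ball_set G R {x}) \<le> b" "finite A" "A \<subseteq> verts G" "m * b \<le> card A"
  shows "\<exists>S\<subseteq>A. card S = m \<and> (\<forall>x\<in>S. \<forall>y\<in>S. x \<noteq> y \<longrightarrow> (\<forall>k<R. step_prob G k x y = 0))"
  using assms(2-)
proof (induction m arbitrary: A)
  case 0 then show ?case by (intro exI[of _ "{}"]) auto
next
  case (Suc m)
  show ?case
  proof (cases "A = {}")
    case True
    obtain z where z: "z \<in> verts G" using conn by (auto simp: net_connected_def)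
    have "z \<in> ball_set G R {z}" using ball_mono[of 0 R "{z}"] by (auto simp: ball_set_def)
    then have "0 < card (ball_set G R {z})" using finite_ball[of "{z}" R] by (auto simp: card_gt_0_iff)
    then have "0 < b" using assms(1) z by fastforce
    then show ?thesis using Suc.prems True by simp
  next
    case False
    then obtain x where x: "x \<in> A" by blast
    let ?B = "A - ball_set G R {x}"
    have "card A \<le> card ?B + card (ball_set G R {x})"
      using card_mono[of "?B \<union> ball_set G R {x}" A] Suc.prems finite_ball[of "{x}" R] card_Un_le[of ?B "ball_set G R {x}"] by fastforce
    moreover have "card (ball_set G R {x}) \<le> b" using assms(1) x Suc.prems by auto
    ultimately have "m * b \<le> card ?B" using Suc.prems(3) by simp
    then obtain S where S: "S \<subseteq> ?B" "card S = m" "\<forall>x\<in>S. \<forall>y\<in>S. x \<noteq> y \<longrightarrow> (\<forall>k<R. step_prob G k x y = 0)"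
      using Suc.IH[of ?B] Suc.prems by auto
    have xS: "step_prob G k x y = 0 \<and> step_prob G k y x = 0" if "y \<in> S" "k < R" for y k
    proof -
      have y: "y \<in> verts G" "x \<in> verts G" "y \<notin> ball_set G k {x}"
        using that S(1) x Suc.prems ball_mono[of k R "{x}"] by auto
      then have "step_prob G k x y = 0" by (intro step_prob_far)
      then show ?thesis using step_prob_sym[OF y(2,1), of k] pi_pos[OF y(1)] by simp
    qed
    have "finite S" "x \<notin> S" using S(1) Suc.prems ball_mono[of 0 R "{x}"] by (auto intro: finite_subset simp: ball_set_def)
    then have "card (insert x S) = Suc m" using S(2) by simp
    then show ?thesis using S xS x by (intro exI[of _ "insert x S"]) auto
  qed
qed

text \<open>
  The potential satisfies \<open>f \<le> avg f + escape / \<pi>\<close> on \<open>A\<close> and \<open>f \<le> avg f\<close> elsewhere. Iterating this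
  \<open>N\<close> times is the last-exit decomposition, as an inequality.
\<close>

lemma potential_bound:
  assumes W: "finite W" "W \<subseteq> verts G" "W \<noteq> {}" and A: "A \<subseteq> W" and x: "x \<in> verts G"
  shows "wired_net.potential G W A x \<le> (\<Sum>y\<in>A. (\<Sum>n<N. step_prob G n x y) * (escape (wired G W) None (Some ` A) (Some y) / net_pi G {y})) + (\<Sum>z\<in>W. step_prob G N x z)"
proof -
  interpret wired_net G W using W by unfold_locales
  have fA: "finite A" using A W finite_subset by blast
  let ?e = "\<lambda>y. escape (wired G W) None (Some ` A) (Some y) / net_pi G {y}"
  let ?U = "\<lambda>N x. (\<Sum>y\<in>A. (\<Sum>n<N. step_prob G n x y) * ?e y) + (\<Sum>z\<in>W. step_prob G N x z)"
  have step: "potential A x \<le> avg G (potential A) x + (if x \<in> A then ?e x else 0)" if x: "x \<in> verts G" for x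
  proof (cases "x \<in> W")
    case True
    have "net_pi G {x} * potential A x - (\<Sum>a\<in>out_arcs G x. cond G (fst a) * potential A (head G a)) = (if x \<in> A then escape (wired G W) None (Some ` A) (Some x) else 0)"
      using potential_lap[OF A True] by (simp add: right_diff_distrib sum_subtractf net_pi_single sum_distrib_right)
    then have "potential A x = avg G (potential A) x + (if x \<in> A then ?e x else 0)"
      using pi_pos[OF x] by (auto simp: avg_def field_simps)
    then show ?thesis by simp
  next
    case False
    then have "potential A x = 0" "x \<notin> A" using potential_props(4)[OF A] A by auto
    then show ?thesis using avg_mono[OF x, of "\<lambda>_. 0" "potential A"] potential_props(1)[OF A] by (simp add: avg_const[OF x])
  qed
  have "potential A x \<le> ?U N x" using x
  proof (induction N arbitrary: x)
    case 0
    have "potential A x \<le> (\<Sum>z\<in>W. of_bool (x = z))"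
      using potential_props(2,4)[OF A, of x] finW by (cases "x \<in> W") (auto simp: of_bool_def)
    then show ?case by simp
  next
    case (Suc N)
    have "potential A x \<le> avg G (potential A) x + (if x \<in> A then ?e x else 0)" by (rule step[OF Suc.prems])
    also have "avg G (potential A) x \<le> avg G (?U N) x" by (rule avg_mono[OF Suc.prems Suc.IH])
    also have "avg G (?U N) x = (\<Sum>y\<in>A. (\<Sum>n<N. step_prob G (Suc n) x y) * ?e y) + (\<Sum>z\<in>W. step_prob G (Suc N) x z)"
      by (simp only: avg_add avg_sum avg_cmult step_prob.simps)
    also have "(\<Sum>y\<in>A. (\<Sum>n<N. step_prob G (Suc n) x y) * ?e y) + (\<Sum>z\<in>W. step_prob G (Suc N) x z) + (if x \<in> A then ?e x else 0) = ?U (Suc N) x"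
    proof -
      have "(\<Sum>y\<in>A. (\<Sum>n<Suc N. step_prob G n x y) * ?e y) = (\<Sum>y\<in>A. (if x = y then ?e y else 0) + (\<Sum>n<N. step_prob G (Suc n) x y) * ?e y)"
      proof (rule sum.cong[OF refl])
        fix y
        have "(\<Sum>n<Suc N. step_prob G n x y) = of_bool (x = y) + (\<Sum>n<N. step_prob G (Suc n) x y)"
          by (subst sum.lessThan_Suc_shift) (simp del: step_prob.simps(2))
        then show "(\<Sum>n<Suc N. step_prob G n x y) * ?e y = (if x = y then ?e y else 0) + (\<Sum>n<N. step_prob G (Suc n) x y) * ?e y"
          by (simp only: distrib_right) (simp del: step_prob.simps(2))
      qed
      also have "\<dots> = (if x \<in> A then ?e x else 0) + (\<Sum>y\<in>A. (\<Sum>n<N. step_prob G (Suc n) x y) * ?e y)"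
        using fA by (simp add: sum.distrib del: step_prob.simps(2))
      finally show ?thesis by (simp del: step_prob.simps(2))
    qed
    finally show ?case by simp
  qed
  then show ?thesis .
qed

text \<open>
  A large set contains \<open>m\<close> points whose mutual Green's functions are at most \<open>1 / m\<close>. The potential of
  these points is 1 at each of them. Summing the last-exit bound over them gives
  \<open>m \<le> (T + 1) cap / p\<close>, where \<open>T\<close> bounds Green's function on the diagonal and \<open>p\<close> bounds \<open>\<pi>\<close> below.
\<close>

theorem capacity_unbounded:
  "\<exists>n. \<forall>W A. finite W \<longrightarrow> W \<subseteq> verts G \<longrightarrow> W \<noteq> {} \<longrightarrow> A \<subseteq> W \<longrightarrow> n \<le> card A \<longrightarrow> K \<le> capacity (wired G W) None (Some ` A)"
proof -
  obtain p q where pq: "0 < p" "\<And>x. x \<in> verts G \<Longrightarrow> p \<le> net_pi G {x}" "\<And>x. x \<in> verts G \<Longrightarrow> net_pi G {x} \<le> q" using pi_bounds by blast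
  define T where "T = q * suminf decay"
  have q0: "0 \<le> q"
  proof -
    obtain x where "x \<in> verts G" using conn by (auto simp: net_connected_def)
    then show ?thesis using pq(3)[of x] pi_pos[of x] by linarith
  qed
  have T0: "0 \<le> T" unfolding T_def using q0 decay_nonneg summable_decay by (intro mult_nonneg_nonneg suminf_nonneg) auto
  have T: "(\<Sum>n<N. step_prob G n x x) \<le> T" if x: "x \<in> verts G" for N x
  proof -
    have "step_prob G n x x \<le> q * decay n" for n
      using step_prob_bound[OF x x, of n] pq(3)[OF x] decay_nonneg[of n] mult_right_mono[of "net_pi G {x}" q "decay n"] by linarith
    then have "(\<Sum>n<N. step_prob G n x x) \<le> q * (\<Sum>n<N. decay n)" unfolding sum_distrib_left by (rule sum_mono)
    also have "\<dots> \<le> T" unfolding T_def using q0 sum_le_suminf[OF summable_decay, of "{..<N}"] decay_nonneg by (intro mult_left_mono) auto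
    finally show ?thesis .
  qed
  obtain m where m: "K * (T + 1) / p \<le> real m" "1 \<le> m"
  proof -
    obtain m where "K * (T + 1) / p < real m" using reals_Archimedean2 by blast
    then show ?thesis using that[of "Suc m"] by auto
  qed
  obtain R where R: "\<And>N x y. x \<in> verts G \<Longrightarrow> y \<in> verts G \<Longrightarrow> \<forall>m<R. step_prob G m x y = 0 \<Longrightarrow> (\<Sum>m<N. step_prob G m x y) \<le> 1 / real m"
  proof -
    have "0 < 1 / real m" using m(2) by simp
    from green_decay[OF this] show thesis using that by blast
  qed
  obtain b where b: "\<forall>x\<in>verts G. card (ball_set G R {x}) \<le> b" using ball_bound by blast
  have "K \<le> capacity (wired G W) None (Some ` A)"
    if W: "finite W" "W \<subseteq> verts G" "W \<noteq> {}" and A: "A \<subseteq> W" "m * b \<le> card A" for W A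
  proof -
    interpret wired_net G W using W by unfold_locales
    have finA: "finite A" by (rule finite_subset[OF A(1) W(1)])
    have AV: "A \<subseteq> verts G" using A(1) W(2) by (rule order_trans)
    from separated_subset[OF b finA AV A(2)]
    obtain S where S: "S \<subseteq> A" "card S = m" and sep: "\<forall>x\<in>S. \<forall>y\<in>S. x \<noteq> y \<longrightarrow> (\<forall>k<R. step_prob G k x y = 0)"
      by (elim exE conjE)
    have SW: "S \<subseteq> W" "S \<subseteq> verts G" "finite S"
      using order_trans[OF S(1) A(1)] order_trans[OF S(1) AV] finite_subset[OF S(1) finA] by auto
    let ?e = "\<lambda>y. escape N None (Some ` S) (Some y)"
    have e0: "0 \<le> ?e y" for y by (rule w.escape_nonneg)
    have col: "(\<Sum>x\<in>S. \<Sum>n<M. step_prob G n x y) \<le> T + 1" if y: "y \<in> S" for y M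
    proof -
      have "(\<Sum>x\<in>S. \<Sum>n<M. step_prob G n x y) = (\<Sum>n<M. step_prob G n y y) + (\<Sum>x\<in>S - {y}. \<Sum>n<M. step_prob G n x y)"
        using y SW by (simp add: sum.remove)
      also have "(\<Sum>x\<in>S - {y}. \<Sum>n<M. step_prob G n x y) \<le> (\<Sum>x\<in>S - {y}. 1 / real m)"
      proof (rule sum_mono)
        fix x assume x: "x \<in> S - {y}"
        then have "\<forall>k<R. step_prob G k x y = 0" using sep y by simp
        then show "(\<Sum>n<M. step_prob G n x y) \<le> 1 / real m" using x y SW(2) by (intro R) auto
      qed
      also have "(\<Sum>x\<in>S - {y}. 1 / real m) \<le> 1" using S(2) m(2) SW y by (simp add: card_Diff_singleton divide_simps)
      finally show ?thesis using T[of y M] y SW by auto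
    qed
    have bound: "real m \<le> (T + 1) / p * capacity N None (Some ` S) + (\<Sum>x\<in>S. \<Sum>z\<in>W. step_prob G M x z)" for M
    proof -
      have "real m = (\<Sum>x\<in>S. potential S x)" using S(2) potential_props(3)[OF SW(1)] by simp
      also have "\<dots> \<le> (\<Sum>x\<in>S. (\<Sum>y\<in>S. (\<Sum>n<M. step_prob G n x y) * (?e y / net_pi G {y})) + (\<Sum>z\<in>W. step_prob G M x z))"
        using SW W by (intro sum_mono potential_bound) auto
      also have "\<dots> = (\<Sum>y\<in>S. (\<Sum>x\<in>S. \<Sum>n<M. step_prob G n x y) * (?e y / net_pi G {y})) + (\<Sum>x\<in>S. \<Sum>z\<in>W. step_prob G M x z)"
      proof -
        have "(\<Sum>x\<in>S. \<Sum>y\<in>S. (\<Sum>n<M. step_prob G n x y) * (?e y / net_pi G {y})) = (\<Sum>y\<in>S. (\<Sum>x\<in>S. \<Sum>n<M. step_prob G n x y) * (?e y / net_pi G {y}))"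
          unfolding sum_distrib_right[of _ S] by (rule sum.swap)
        then show ?thesis unfolding sum.distrib by simp
      qed
      also have "(\<Sum>y\<in>S. (\<Sum>x\<in>S. \<Sum>n<M. step_prob G n x y) * (?e y / net_pi G {y})) \<le> (\<Sum>y\<in>S. (T + 1) * (?e y / p))"
      proof (intro sum_mono mult_mono col)
        fix y assume "y \<in> S"
        then have y: "p \<le> net_pi G {y}" "0 < net_pi G {y}" using pq(2) pi_pos SW by auto
        show "?e y / net_pi G {y} \<le> ?e y / p" using y pq(1) e0 by (intro divide_left_mono) auto
        show "0 \<le> ?e y / net_pi G {y}" using y e0 by auto
      qed (use T0 in auto)
      also have "(\<Sum>y\<in>S. (T + 1) * (?e y / p)) = (T + 1) / p * capacity N None (Some ` S)"
        unfolding capacity_sum_escape[OF SW(1)] by (simp add: sum_distrib_left sum_divide_distrib)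
      finally show ?thesis by simp
    qed
    have "(\<lambda>M. step_prob G M x z) \<longlonglongrightarrow> 0" if "x \<in> S" "z \<in> W" for x z
    proof (rule tendsto_sandwich[where f = "\<lambda>_. 0"])
      have "(\<lambda>M. net_pi G {z} * decay M) \<longlonglongrightarrow> net_pi G {z} * 0"
        by (intro tendsto_intros summable_LIMSEQ_zero summable_decay)
      then show "(\<lambda>M. net_pi G {z} * decay M) \<longlonglongrightarrow> 0" by simp
      have xz: "x \<in> verts G" "z \<in> verts G" using that SW(2) W(2) by auto
      show "eventually (\<lambda>M. 0 \<le> step_prob G M x z) sequentially" using step_prob_nonneg[OF xz(1)] by simp
      show "eventually (\<lambda>M. step_prob G M x z \<le> net_pi G {z} * decay M) sequentially" using step_prob_bound[OF xz] by simp
    qed simp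
    then have "(\<lambda>M. (T + 1) / p * capacity N None (Some ` S) + (\<Sum>x\<in>S. \<Sum>z\<in>W. step_prob G M x z)) \<longlonglongrightarrow> (T + 1) / p * capacity N None (Some ` S) + (\<Sum>x\<in>S. \<Sum>z\<in>W. 0)"
      by (intro tendsto_intros)
    then have "real m \<le> (T + 1) / p * capacity N None (Some ` S) + (\<Sum>x\<in>S. \<Sum>z\<in>W. 0)"
      using bound by (intro LIMSEQ_le_const) auto
    then have "K * (T + 1) / p \<le> (T + 1) / p * capacity N None (Some ` S)" using m(1) by simp
    then have "K * (T + 1) \<le> (T + 1) * capacity N None (Some ` S)" using pq(1) by (simp add: divide_right_mono pos_divide_le_eq)
    then have "K \<le> capacity N None (Some ` S)" using T0 by (simp add: mult.commute[of K])
    also have "\<dots> \<le> capacity N None (Some ` A)"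
      using S(1) A W by (intro w.capacity_mono) (auto simp: verts_N)
    finally show ?thesis .
  qed
  then show ?thesis by blast
qed

end

section \<open>Paths into a vertex in the limit of large wired networks\<close>

lemma path_cond_N: "path_cond (wired G W) bs = path_cond G bs"
  by (simp add: path_cond_def wired_def)

lemma walk_end_unique: "walk G u bs x \<Longrightarrow> bs \<noteq> [] \<Longrightarrow> x = head G (last bs)"
  by (induction bs arbitrary: u) (auto split: if_splits)

text \<open>
  The effective conductance between \<open>z\<close> and \<open>B\<close> together with infinity.
\<close>

definition eff_cond :: "('v, 'e) network \<Rightarrow> 'v set \<Rightarrow> 'v \<Rightarrow> real" where
  "eff_cond G B z = (\<Sum>a\<in>out_arcs G z. cond G (fst a) * (1 - hit_ever G {z} (insert z B) (head G a)))"

text \<open>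
  \<open>escape\<close> with the root at infinity.
\<close>

definition escape_inf :: "('v, 'e) network \<Rightarrow> 'v set \<Rightarrow> 'v \<Rightarrow> real" where
  "escape_inf G A y = (\<Sum>a\<in>out_arcs G y. cond G (fst a) * (1 - hit_ever G A A (head G a)))"

text \<open>
  The limit of the ratio of \<open>forest_sum\<close> with the additional roots \<open>zs\<close> to \<open>forest_sum\<close> without them: each
  new root divides it by an effective conductance.
\<close>

primrec forest_sum_ratio :: "('v, 'e) network \<Rightarrow> 'v set \<Rightarrow> 'v list \<Rightarrow> real" where
  "forest_sum_ratio G B [] = 1"
| "forest_sum_ratio G B (z # zs) = forest_sum_ratio G (insert z B) zs / eff_cond G B z"

text \<open>
  The limit, over large wired networks, of the probability that the tree follows the path \<open>bs\<close> to \<open>x\<close>. It is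
  expressed by hitting probabilities of the walk on \<open>G\<close>, so that its invariance is evident.
\<close>

definition path_prob_inf :: "('v, 'e) network \<Rightarrow> ('e \<times> bool) list \<Rightarrow> 'v \<Rightarrow> real" where
  "path_prob_inf G bs x = path_cond G bs * forest_sum_ratio G {} (map (tail G) bs @ [x]) * escape_inf G (path_verts G bs x) x"

context wired_net
begin

abbreviation "hW Q B z \<equiv> forest_hit N (insert None (Some ` B)) (Some ` Q) (wired_proj W z)"

lemma hW_avg:
  assumes "B \<subseteq> W" "Q \<subseteq> B" "z \<in> W" "z \<notin> B"
  shows "hW Q B z = avg G (hW Q B) z"
proof -
  let ?H = "forest_hit N (insert None (Some ` B)) (Some ` Q)"
  have "(\<Sum>a\<in>out_arcs N (Some z). cond N (fst a) * (?H (Some z) - ?H (head N a))) = 0"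
    by (rule w.forest_hit_harmonic) (use assms in \<open>auto simp: verts_N\<close>)
  then have "(\<Sum>a\<in>out_arcs G z. cond G (fst a) * (?H (Some z) - ?H (wired_proj W (head G a)))) = 0"
    using lap_N[OF assms(3), of ?H] by simp
  then have "net_pi G {z} * ?H (Some z) = (\<Sum>a\<in>out_arcs G z. cond G (fst a) * hW Q B (head G a))"
    by (simp add: right_diff_distrib sum_subtractf net_pi_single sum_distrib_right)
  moreover have "0 < net_pi G {z}" using pi_pos Wsub assms by auto
  ultimately show ?thesis using assms(3) by (simp add: avg_def field_simps)
qed

lemma hW_root: "B \<subseteq> W \<Longrightarrow> z \<in> B \<Longrightarrow> hW Q B z = of_bool (z \<in> Q)"
  by (subst w.forest_hit_root) (auto simp: verts_N)

lemma hW_bounds: "B \<subseteq> W \<Longrightarrow> 0 \<le> hW Q B z \<and> hW Q B z \<le> 1"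
proof
  assume "B \<subseteq> W"
  then have sub: "insert None (Some ` B) \<subseteq> verts N" by (auto simp: verts_N)
  show "hW Q B z \<le> 1" by (rule w.forest_hit_le_1[OF _ sub]) simp
qed (rule w.forest_hit_nonneg)

text \<open>
  Up to the first \<open>k\<close> steps the walk does not notice the boundary of \<open>W\<close>.
\<close>

lemma hit_within_le_hW:
  assumes "B \<subseteq> W" "Q \<subseteq> B" "ball_set G k {z} \<subseteq> W"
  shows "hit_within G Q B k z \<le> hW Q B z"
  using assms(3)
proof (induction k arbitrary: z)
  case 0
  then show ?case using hW_root[OF assms(1), of z Q] hW_bounds[OF assms(1), of Q z] assms(2) by (auto simp: of_bool_def)
next
  case (Suc k)
  have zW: "z \<in> W" using Suc.prems ball_mono[of 0 "Suc k" "{z}"] by (auto simp: ball_set_def)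
  show ?case
  proof (cases "z \<in> B")
    case True then show ?thesis using hW_root[OF assms(1)] by simp
  next
    case False
    have "avg G (hit_within G Q B k) z \<le> avg G (hW Q B) z"
      unfolding avg_def
    proof (intro divide_right_mono sum_mono mult_left_mono)
      fix a assume a: "a \<in> out_arcs G z"
      show "hit_within G Q B k (head G a) \<le> hW Q B (head G a)" using Suc.prems ball_head[OF a, of k] by (intro Suc.IH) auto
      show "0 \<le> cond G (fst a)" using cond_pos[OF a] by simp
    qed (use pi_pos[of z] zW Wsub in auto)
    then show ?thesis using hW_avg[OF assms(1,2) zW False] False by simp
  qed
qed

text \<open>
  Maximum principle: \<open>hit_ever\<close> is harmonic off \<open>B\<close> and nonnegative where the other function is 0.
\<close>

lemma hW_le_hit_ever:
  assumes B: "B \<subseteq> W" "Q \<subseteq> B" and z: "z \<in> verts G"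
  shows "hW Q B z \<le> hit_ever G Q B z"
proof (cases "z \<in> W")
  case False
  then have "hW Q B z = 0" using w.forest_hit_root[of None "insert None (Some ` B)" "Some ` Q"] B by (auto simp: wired_proj_def verts_N)
  then show ?thesis using hit_ever_bounds[OF z B(2)] by simp
next
  case True
  let ?H = "forest_hit N (insert None (Some ` B)) (Some ` Q)"
  define g where "g w = (case w of None \<Rightarrow> 0 | Some y \<Rightarrow> hit_ever G Q B y)" for w
  have g_le: "g (wired_proj W y) \<le> hit_ever G Q B y" if "y \<in> verts G" for y
    using hit_ever_bounds[OF that B(2)] by (auto simp: g_def wired_proj_def)
  have sub: "insert None (Some ` B) \<subseteq> verts N" using B by (auto simp: verts_N)
  have "?H (Some z) - g (Some z) \<le> 0"
  proof (rule w.max_principle[where R = "insert None (Some ` B)"])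
    fix w assume w: "w \<in> verts N" "w \<notin> insert None (Some ` B)"
    then obtain y where y: "w = Some y" "y \<in> W" "y \<notin> B" by (auto simp: verts_N)
    have yV: "y \<in> verts G" using y Wsub by auto
    have "(\<Sum>b\<in>out_arcs N w. cond N (fst b) * (?H w - g w - (?H (head N b) - g (head N b)))) =
       (\<Sum>b\<in>out_arcs N w. cond N (fst b) * (?H w - ?H (head N b))) - (\<Sum>b\<in>out_arcs N (Some y). cond G (fst b) * (g (Some y) - g (head N b)))"
      unfolding sum_subtractf[symmetric] y(1) cond_N by (intro sum.cong refl) (simp add: algebra_simps)
    also have "(\<Sum>b\<in>out_arcs N w. cond N (fst b) * (?H w - ?H (head N b))) = 0"
      by (rule w.forest_hit_harmonic) (use w B sub in auto)
    also have "(\<Sum>b\<in>out_arcs N (Some y). cond G (fst b) * (g (Some y) - g (head N b))) =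
      (\<Sum>b\<in>out_arcs G y. cond G (fst b) * (g (Some y) - g (wired_proj W (head G b))))"
      by (rule lap_N[OF y(2)])
    also have "\<dots> \<ge> (\<Sum>b\<in>out_arcs G y. cond G (fst b) * (hit_ever G Q B y - hit_ever G Q B (head G b)))"
      using g_le head_in less_imp_le[OF cond_pos] by (intro sum_mono mult_left_mono) (auto simp: g_def)
    moreover have "(\<Sum>b\<in>out_arcs G y. cond G (fst b) * (hit_ever G Q B y - hit_ever G Q B (head G b))) = 0"
      using hit_ever_eq[OF yV B(2)] y(3) pi_pos[OF yV]
      by (simp add: right_diff_distrib sum_subtractf avg_def net_pi_single sum_distrib_right[symmetric] field_simps)
    ultimately show "(\<Sum>b\<in>out_arcs N w. cond N (fst b) * (?H w - g w - (?H (head N b) - g (head N b)))) \<le> 0" by linarith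
  next
    fix w assume w: "w \<in> insert None (Some ` B)"
    then show "?H w - g w \<le> 0"
    proof
      assume "w = None"
      then show ?thesis using sub by (subst w.forest_hit_root) (auto simp: g_def)
    next
      assume "w \<in> Some ` B"
      then obtain y where y: "w = Some y" "y \<in> B" by blast
      then have "y \<in> verts G" using B Wsub by auto
      then have "hit_ever G Q B y = of_bool (y \<in> Q)" using hit_ever_eq[OF _ B(2)] y by simp
      then show ?thesis using sub y by (subst w.forest_hit_root) (auto simp: g_def)
    qed
  qed (use sub True in \<open>auto simp: verts_N\<close>)
  then show ?thesis using True by (simp add: g_def)
qed

lemma forest_sum_ratio:
  assumes "insert z B \<subseteq> W" "z \<notin> B"
  shows "forest_sum N (insert None (Some ` B)) = forest_sum N (insert None (Some ` insert z B)) *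
     (\<Sum>a\<in>out_arcs G z. cond G (fst a) * (1 - hW {z} (insert z B) (head G a)))"
proof -
  let ?R = "insert None (Some ` B)" and ?R' = "insert None (Some ` insert z B)"
  have R': "insert (Some z) ?R = ?R'" by auto
  have sub: "?R' \<subseteq> verts N" using assms by (auto simp: verts_N)
  have "forest_sum N ?R = forest_sum N ?R' * (\<Sum>a\<in>out_arcs N (Some z). cond N (fst a) * forest_hit N ?R' ?R (head N a))"
    using w.forest_sum_split[of "Some z" ?R] assms sub unfolding R' by auto
  also have "(\<Sum>a\<in>out_arcs N (Some z). cond N (fst a) * forest_hit N ?R' ?R (head N a)) =
     (\<Sum>a\<in>out_arcs N (Some z). cond G (fst a) * (forest_hit N ?R' {Some z} (Some z) - forest_hit N ?R' {Some z} (head N a)))"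
  proof (intro sum.cong refl)
    fix a assume a: "a \<in> out_arcs N (Some z)"
    have "?R' - {Some z} = ?R" using assms by auto
    then have "forest_hit N ?R' ?R (head N a) = 1 - forest_hit N ?R' {Some z} (head N a)"
      using w.forest_hit_compl[of ?R' "{Some z}" "head N a"] sub w.head_in[OF a] by auto
    moreover have "forest_hit N ?R' {Some z} (Some z) = 1" using sub by (subst w.forest_hit_root) auto
    ultimately show "cond N (fst a) * forest_hit N ?R' ?R (head N a) = cond G (fst a) * (forest_hit N ?R' {Some z} (Some z) - forest_hit N ?R' {Some z} (head N a))"
      by simp
  qed
  also have "\<dots> = (\<Sum>a\<in>out_arcs G z. cond G (fst a) * (forest_hit N ?R' {Some z} (Some z) - forest_hit N ?R' {Some z} (wired_proj W (head G a))))"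
    using assms by (intro lap_N) auto
  also have "forest_hit N ?R' {Some z} (Some z) = 1" using sub by (subst w.forest_hit_root) auto
  finally show ?thesis by simp
qed

text \<open>
  In a tree, every vertex starts only one path of length \<open>n\<close> towards the root, and if that path ends in
  \<open>K\<close>, the vertex has distance at most \<open>n\<close> from \<open>K\<close>.
\<close>

lemma mass_bound:
  assumes K: "finite K" "K \<subseteq> verts G" "ball_set G n K \<subseteq> W" and n: "0 < n"
  shows "(\<Sum>x\<in>K. \<Sum>bs\<in>paths_to G n x. tree_prob N None (\<lambda>t. follows N t bs)) \<le> real (card (ball_set G n K))"
proof -
  let ?P = "\<lambda>bs. tree_prob N None (\<lambda>t. follows N t bs)"
  define \<Gamma> where "\<Gamma> = (\<Union>x\<in>K. paths_to G n x)"
  have fin: "finite \<Gamma>" using K finite_paths_to by (auto simp: \<Gamma>_def)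
  let ?s = "\<lambda>bs. tail G (hd bs)"
  have info: "\<exists>y. walk N (Some (?s bs)) bs y" "?s bs \<in> ball_set G n K" "length bs = n" if "bs \<in> \<Gamma>" for bs
  proof -
    obtain x u where x: "x \<in> K" "self_avoiding G u bs x" "length bs = n" "bs \<in> paths_to G n x" using \<open>bs \<in> \<Gamma>\<close> by (auto simp: \<Gamma>_def paths_to_def)
    have u: "?s bs = u" using x(2,3) n by (cases bs) (auto simp: self_avoiding_def out_arcs_def)
    have b: "ball_set G n {x} \<subseteq> ball_set G n K" using x by (intro ball_mono2) auto
    have ps: "path_verts G bs x \<subseteq> ball_set G n {x}" by (rule paths_to_in_ball[OF x(4)])
    then have "path_verts G bs x \<subseteq> W" using b K(3) by blast
    from wired_path(1)[OF x(2) this] show "\<exists>y. walk N (Some (?s bs)) bs y" unfolding u by (auto simp: self_avoiding_def)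
    have "u \<in> path_verts G bs x" using x(2,3) n by (cases bs) (auto simp: self_avoiding_def path_verts_def out_arcs_def)
    then show "?s bs \<in> ball_set G n K" using ps b unfolding u by blast
    show "length bs = n" by (rule x)
  qed
  have "(\<Sum>x\<in>K. \<Sum>bs\<in>paths_to G n x. ?P bs) = (\<Sum>bs\<in>\<Gamma>. ?P bs)"
    unfolding \<Gamma>_def
  proof (intro sum.UNION_disjoint[symmetric] ballI impI finite_paths_to K)
    fix x y :: 'v assume "x \<noteq> y"
    show "paths_to G n x \<inter> paths_to G n y = {}"
    proof (rule ccontr)
      assume "paths_to G n x \<inter> paths_to G n y \<noteq> {}"
      then obtain bs u v where "self_avoiding G u bs x" "self_avoiding G v bs y" "length bs = n" by (auto simp: paths_to_def)
      then have "x = head G (last bs)" "y = head G (last bs)" using n walk_end_unique[of G u bs x] walk_end_unique[of G v bs y] by (auto simp: self_avoiding_def)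
      then show False using \<open>x \<noteq> y\<close> by simp
    qed
  qed
  also have "\<dots> = (\<Sum>u\<in>?s ` \<Gamma>. \<Sum>bs\<in>{bs\<in>\<Gamma>. ?s bs = u}. ?P bs)" by (rule sum.image_gen[OF fin])
  also have "\<dots> \<le> (\<Sum>u\<in>?s ` \<Gamma>. 1)"
  proof (rule sum_mono)
    fix u
    show "(\<Sum>bs\<in>{bs\<in>\<Gamma>. ?s bs = u}. ?P bs) \<le> 1"
      by (rule sum_paths_from_le_1[where x = "Some u" and n = n]) (use fin info in auto)
  qed
  also have "\<dots> = real (card (?s ` \<Gamma>))" by simp
  also have "\<dots> \<le> real (card (ball_set G n K))"
    using info(2) finite_ball[OF K(1)] by (intro of_nat_mono card_mono) auto
  finally show ?thesis .
qed

end

context inf_net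
begin

abbreviation "FW \<equiv> finite_subsets_at_top (verts G)"

lemma eventually_FW:
  assumes "finite W0" "W0 \<subseteq> verts G" "\<And>W. finite W \<Longrightarrow> W \<subseteq> verts G \<Longrightarrow> W \<noteq> {} \<Longrightarrow> W0 \<subseteq> W \<Longrightarrow> P W"
  shows "eventually P FW"
proof -
  obtain x where x: "x \<in> verts G" using conn by (auto simp: net_connected_def)
  show ?thesis
    unfolding eventually_finite_subsets_at_top
    by (intro exI[of _ "insert x W0"]) (use assms x in auto)
qed

lemma forest_hit_limit:
  assumes B: "finite B" "B \<subseteq> verts G" "Q \<subseteq> B" and z: "z \<in> verts G"
  shows "((\<lambda>W. forest_hit (wired G W) (insert None (Some ` B)) (Some ` Q) (wired_proj W z)) \<longlongrightarrow> hit_ever G Q B z) FW"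
proof (rule order_tendstoI)
  fix a assume "a < hit_ever G Q B z"
  then have "eventually (\<lambda>k. a < hit_within G Q B k z) sequentially" by (rule order_tendstoD(1)[OF hit_ever_lim[OF z B(3)]])
  then obtain k where k: "a < hit_within G Q B k z" by (auto simp: eventually_sequentially)
  show "eventually (\<lambda>W. a < forest_hit (wired G W) (insert None (Some ` B)) (Some ` Q) (wired_proj W z)) FW"
  proof (rule eventually_FW[of "B \<union> ball_set G k {z}"])
    fix W assume W: "finite W" "W \<subseteq> verts G" "W \<noteq> {}" "B \<union> ball_set G k {z} \<subseteq> W"
    interpret wired_net G W using W by unfold_locales
    have "hit_within G Q B k z \<le> hW Q B z" using W B by (intro hit_within_le_hW) auto
    then show "a < hW Q B z" using k by simp
  qed (use B z finite_ball ball_in[of "{z}"] in auto)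
next
  fix a assume a: "hit_ever G Q B z < a"
  show "eventually (\<lambda>W. forest_hit (wired G W) (insert None (Some ` B)) (Some ` Q) (wired_proj W z) < a) FW"
  proof (rule eventually_FW[of B])
    fix W assume W: "finite W" "W \<subseteq> verts G" "W \<noteq> {}" "B \<subseteq> W"
    interpret wired_net G W using W by unfold_locales
    show "hW Q B z < a" using hW_le_hit_ever[OF W(4) B(3) z] a by simp
  qed (use B in auto)
qed

lemma eff_cond_pos:
  assumes "transient G" and B: "B \<subseteq> verts G" "z \<in> verts G"
  shows "0 < eff_cond G B z"
proof -
  have "0 < net_pi G {z} * (1 - avg G (hit_ever G {z} {z}) z)"
    using pi_pos[OF B(2)] transient_return_prob[OF assms(1) B(2)] by simp
  also have "\<dots> = (\<Sum>a\<in>out_arcs G z. cond G (fst a) * (1 - hit_ever G {z} {z} (head G a)))"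
    using pi_pos[OF B(2)] by (simp add: avg_def right_diff_distrib sum_subtractf net_pi_single)
  also have "\<dots> \<le> eff_cond G B z"
    unfolding eff_cond_def using hit_ever_antimono_B[of _ "{z}" "insert z B" "{z}"] head_in less_imp_le[OF cond_pos]
    by (intro sum_mono mult_left_mono) auto
  finally show ?thesis .
qed

lemma forest_sum_ratio_limit:
  assumes tr: "transient G" and B: "finite B" "B \<subseteq> verts G" and zs: "set zs \<subseteq> verts G" "distinct zs" "set zs \<inter> B = {}"
  shows "((\<lambda>W. forest_sum (wired G W) (insert None (Some ` (set zs \<union> B))) / forest_sum (wired G W) (insert None (Some ` B))) \<longlongrightarrow> forest_sum_ratio G B zs) FW"
  using B zs
proof (induction zs arbitrary: B)
  case Nil
  have "eventually (\<lambda>W. forest_sum (wired G W) (insert None (Some ` B)) / forest_sum (wired G W) (insert None (Some ` B)) = 1) FW"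
  proof (rule eventually_FW[of B])
    fix W assume W: "finite W" "W \<subseteq> verts G" "W \<noteq> {}" "B \<subseteq> W"
    interpret wired_net G W using W by unfold_locales
    have "0 < forest_sum N (insert None (Some ` B))" using W(4) by (intro w.forest_sum_pos) (auto simp: verts_N)
    then show "forest_sum N (insert None (Some ` B)) / forest_sum N (insert None (Some ` B)) = 1" by simp
  qed (use Nil in auto)
  then show ?case by (auto intro: tendsto_eventually)
next
  case (Cons z zs)
  let ?B = "insert z B"
  let ?f = "\<lambda>S W. forest_sum (wired G W) (insert None (Some ` S))"
  have IH: "((\<lambda>W. ?f (set zs \<union> ?B) W / ?f ?B W) \<longlongrightarrow> forest_sum_ratio G ?B zs) FW"
    using Cons.prems by (intro Cons.IH) auto
  have "((\<lambda>W. \<Sum>a\<in>out_arcs G z. cond G (fst a) * (1 - forest_hit (wired G W) (insert None (Some ` ?B)) (Some ` {z}) (wired_proj W (head G a)))) \<longlongrightarrow> eff_cond G B z) FW"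
    unfolding eff_cond_def using Cons.prems by (intro tendsto_intros forest_hit_limit head_in) auto
  then have D: "((\<lambda>W. 1 / (\<Sum>a\<in>out_arcs G z. cond G (fst a) * (1 - forest_hit (wired G W) (insert None (Some ` ?B)) (Some ` {z}) (wired_proj W (head G a))))) \<longlongrightarrow> 1 / eff_cond G B z) FW"
    using eff_cond_pos[OF tr, of B z] Cons.prems by (intro tendsto_intros) auto
  have "((\<lambda>W. ?f (set zs \<union> ?B) W / ?f ?B W * (1 / (\<Sum>a\<in>out_arcs G z. cond G (fst a) * (1 - forest_hit (wired G W) (insert None (Some ` ?B)) (Some ` {z}) (wired_proj W (head G a)))))) \<longlongrightarrow> forest_sum_ratio G ?B zs * (1 / eff_cond G B z)) FW"
    by (rule tendsto_mult[OF IH D])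
  moreover have "eventually (\<lambda>W. ?f (set zs \<union> ?B) W / ?f ?B W * (1 / (\<Sum>a\<in>out_arcs G z. cond G (fst a) * (1 - forest_hit (wired G W) (insert None (Some ` ?B)) (Some ` {z}) (wired_proj W (head G a)))))
      = ?f (set (z # zs) \<union> B) W / ?f B W) FW"
  proof (rule eventually_FW[of ?B])
    fix W assume W: "finite W" "W \<subseteq> verts G" "W \<noteq> {}" "?B \<subseteq> W"
    interpret wired_net G W using W by unfold_locales
    have "0 < ?f ?B W" using W(4) by (intro w.forest_sum_pos) (auto simp: verts_N)
    moreover have "z \<notin> B" using Cons.prems by auto
    note forest_sum_ratio[OF W(4) this]
    moreover have "set zs \<union> ?B = set (z # zs) \<union> B" by auto
    ultimately show "?f (set zs \<union> ?B) W / ?f ?B W * (1 / (\<Sum>a\<in>out_arcs G z. cond G (fst a) * (1 - forest_hit N (insert None (Some ` ?B)) (Some ` {z}) (wired_proj W (head G a)))))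
      = ?f (set (z # zs) \<union> B) W / ?f B W" by simp
  qed (use Cons.prems in auto)
  ultimately show ?case by (auto elim: Lim_transform_eventually)
qed

text \<open>
  By \<open>tree_prob_path\<close> the probability is a product of quantities that converge.
\<close>

lemma path_prob_limit:
  assumes tr: "transient G" and p: "self_avoiding G u bs x" "u \<in> verts G"
  shows "((\<lambda>W. tree_prob (wired G W) None (\<lambda>t. follows (wired G W) t bs)) \<longlongrightarrow> path_prob_inf G bs x) FW"
proof -
  let ?A = "path_verts G bs x"
  have A: "finite ?A" "?A \<subseteq> verts G" "x \<in> ?A"
  proof -
    have "x \<in> verts G" using p walk_in_verts by (auto simp: self_avoiding_def)
    then show "?A \<subseteq> verts G" using p walk_tails_in_ball[of u bs x] ball_in[of "{x}" "length bs"] by (auto simp: self_avoiding_def)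
  qed (auto simp: path_verts_def)
  have set: "set (map (tail G) bs @ [x]) = ?A" by (auto simp: path_verts_def)
  have Z: "((\<lambda>W. forest_sum (wired G W) (insert None (Some ` (set (map (tail G) bs @ [x]) \<union> {}))) / forest_sum (wired G W) (insert None (Some ` {}))) \<longlongrightarrow> forest_sum_ratio G {} (map (tail G) bs @ [x])) FW"
    using p A set by (intro forest_sum_ratio_limit[OF tr]) (auto simp: self_avoiding_def)
  have E: "((\<lambda>W. \<Sum>a\<in>out_arcs G x. cond G (fst a) * (1 - forest_hit (wired G W) (insert None (Some ` ?A)) (Some ` ?A) (wired_proj W (head G a)))) \<longlongrightarrow> escape_inf G ?A x) FW"
    unfolding escape_inf_def using A by (intro tendsto_intros forest_hit_limit head_in) auto
  have "((\<lambda>W. path_cond G bs * (forest_sum (wired G W) (insert None (Some ` (set (map (tail G) bs @ [x]) \<union> {}))) / forest_sum (wired G W) (insert None (Some ` {}))) *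
     (\<Sum>a\<in>out_arcs G x. cond G (fst a) * (1 - forest_hit (wired G W) (insert None (Some ` ?A)) (Some ` ?A) (wired_proj W (head G a))))) \<longlongrightarrow> path_prob_inf G bs x) FW"
    unfolding path_prob_inf_def by (intro tendsto_mult tendsto_const Z E)
  moreover have "eventually (\<lambda>W. path_cond G bs * (forest_sum (wired G W) (insert None (Some ` (set (map (tail G) bs @ [x]) \<union> {}))) / forest_sum (wired G W) (insert None (Some ` {}))) *
     (\<Sum>a\<in>out_arcs G x. cond G (fst a) * (1 - forest_hit (wired G W) (insert None (Some ` ?A)) (Some ` ?A) (wired_proj W (head G a))))
     = tree_prob (wired G W) None (\<lambda>t. follows (wired G W) t bs)) FW"
  proof (rule eventually_FW[OF A(1,2)])
    fix W assume W: "finite W" "W \<subseteq> verts G" "W \<noteq> {}" "?A \<subseteq> W"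
    interpret wired_net G W using W by unfold_locales
    note wp = wired_path[OF p(1) W(4)]
    have u: "u \<in> W" using p(1) W(4) by (cases bs) (auto simp: self_avoiding_def path_verts_def out_arcs_def)
    have xW: "x \<in> W" using A(3) W(4) by auto
    have e: "(\<Sum>a\<in>out_arcs G x. cond G (fst a) * (1 - forest_hit N (insert None (Some ` ?A)) (Some ` ?A) (wired_proj W (head G a)))) = escape N None (Some ` ?A) (Some x)"
      using potential_lap[OF W(4) xW] A(3) potential_props(3)[OF W(4) A(3)] by (simp add: potential_def)
    have "tree_prob N None (\<lambda>t. follows N t bs) = path_cond N bs * forest_sum N (insert None (path_verts N bs (Some x))) / forest_sum N {None} * escape N None (path_verts N bs (Some x)) (Some x)"
      using wp u by (intro w.tree_prob_path[OF wp(1)]) (auto simp: verts_N)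
    then show "path_cond G bs * (forest_sum N (insert None (Some ` (set (map (tail G) bs @ [x]) \<union> {}))) / forest_sum N (insert None (Some ` {}))) *
     (\<Sum>a\<in>out_arcs G x. cond G (fst a) * (1 - forest_hit N (insert None (Some ` ?A)) (Some ` ?A) (wired_proj W (head G a))))
     = tree_prob N None (\<lambda>t. follows N t bs)"
      unfolding e wp(2) set path_cond_N by simp
  qed
  ultimately show ?thesis by (rule Lim_transform_eventually)
qed

lemma FW_not_bot: "FW \<noteq> bot"
  by (rule finite_subsets_at_top_neq_bot)

lemma path_prob_inf_nonneg:
  assumes tr: "transient G" and p: "self_avoiding G u bs x" "u \<in> verts G"
  shows "0 \<le> path_prob_inf G bs x"
proof (rule tendsto_lowerbound[OF path_prob_limit[OF assms] _ FW_not_bot])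
  show "eventually (\<lambda>W. 0 \<le> tree_prob (wired G W) None (\<lambda>t. follows (wired G W) t bs)) FW"
  proof (rule eventually_FW[of "{}"])
    fix W assume W: "finite W" "W \<subseteq> verts G" "W \<noteq> {}"
    interpret wired_net G W using W by unfold_locales
    show "0 \<le> tree_prob N None (\<lambda>t. follows N t bs)" by (rule w.tree_prob_nonneg)
  qed auto
qed

section \<open>Mass transport and amenable quasi-transitive networks\<close>

lemma eff_cond_aut:
  assumes A: "automorphism G \<phi> \<psi>" and "z \<in> verts G" "B \<subseteq> verts G"
  shows "eff_cond G (\<phi> ` B) (\<phi> z) = eff_cond G B z"
  unfolding eff_cond_def
  by (rule sum_out_aut[OF A assms(2)]) (use hit_ever_aut[OF A, of _ "insert z B" "{z}"] assms in auto)

lemma escape_inf_aut: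
  assumes A: "automorphism G \<phi> \<psi>" and "z \<in> verts G" "B \<subseteq> verts G"
  shows "escape_inf G (\<phi> ` B) (\<phi> z) = escape_inf G B z"
  unfolding escape_inf_def
  by (rule sum_out_aut[OF A assms(2)]) (use hit_ever_aut[OF A, of _ B B] assms in auto)

lemma forest_sum_ratio_aut:
  assumes A: "automorphism G \<phi> \<psi>" and "set zs \<subseteq> verts G" "B \<subseteq> verts G"
  shows "forest_sum_ratio G (\<phi> ` B) (map \<phi> zs) = forest_sum_ratio G B zs"
  using assms(2,3)
proof (induction zs arbitrary: B)
  case (Cons z zs)
  then have "forest_sum_ratio G (\<phi> ` insert z B) (map \<phi> zs) = forest_sum_ratio G (insert z B) zs" by (intro Cons.IH) auto
  then show ?case using eff_cond_aut[OF A, of z B] Cons.prems by simp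
qed simp

lemma path_aut:
  assumes A: "automorphism G \<phi> \<psi>" and p: "self_avoiding G u bs x" "u \<in> verts G"
  shows "self_avoiding G (\<phi> u) (map (arc_map G \<phi> \<psi>) bs) (\<phi> x)"
    "path_prob_inf G (map (arc_map G \<phi> \<psi>) bs) (\<phi> x) = path_prob_inf G bs x"
proof -
  let ?f = "arc_map G \<phi> \<psi>"
  have x: "x \<in> verts G" using p walk_in_verts by (auto simp: self_avoiding_def)
  have or: "a \<in> oriented_edges G" if "a \<in> set bs" for a
  proof -
    have "walk G v cs y \<Longrightarrow> a \<in> set cs \<Longrightarrow> a \<in> oriented_edges G" for v cs y
      by (induction cs arbitrary: v) (auto simp: out_arcs_def)
    then show ?thesis using p that by (auto simp: self_avoiding_def)
  qed
  have tl: "map (tail G) (map ?f bs) = map \<phi> (map (tail G) bs)" using arc_map(2)[OF A or] by simp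
  have S: "set (map (tail G) bs @ [x]) \<subseteq> verts G" using x tail_in or by auto
  have ps: "path_verts G (map ?f bs) (\<phi> x) = \<phi> ` path_verts G bs x" "path_verts G bs x \<subseteq> verts G"
    using arc_map(2)[OF A or] S by (auto simp: path_verts_def image_image)
  have "walk G (\<phi> u) (map ?f bs) (\<phi> x)"
  proof -
    have "walk G v cs y \<Longrightarrow> v \<in> verts G \<Longrightarrow> walk G (\<phi> v) (map ?f cs) (\<phi> y)" for v cs y
    proof (induction cs arbitrary: v)
      case (Cons c cs)
      then have c: "c \<in> out_arcs G v" "head G c \<in> verts G" using head_in[of c v] by simp_all
      have "?f c \<in> out_arcs G (\<phi> v)" using out_arcs_aut[OF A Cons.prems(2)] c by auto
      moreover have "head G (?f c) = \<phi> (head G c)" by (rule arc_map(3)[OF A out_arcsD(2)[OF c(1)]])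
      ultimately show ?case using Cons.IH[of "head G c"] Cons.prems c by simp
    qed simp
    then show ?thesis using p by (auto simp: self_avoiding_def)
  qed
  moreover have "distinct (map (tail G) (map ?f bs) @ [\<phi> x])"
  proof -
    have "map (tail G) (map ?f bs) @ [\<phi> x] = map \<phi> (map (tail G) bs @ [x])" unfolding tl by simp
    moreover have "distinct (map \<phi> (map (tail G) bs @ [x]))"
      unfolding distinct_map using p inj_on_subset[OF aut_verts(2)[OF A] S] by (simp add: self_avoiding_def)
    ultimately show ?thesis by (simp only:)
  qed
  ultimately show "self_avoiding G (\<phi> u) (map ?f bs) (\<phi> x)" by (simp add: self_avoiding_def)
  have "path_cond G (map ?f bs) = path_cond G bs"
    unfolding path_cond_def using arc_map(4)[OF A or] by (simp add: o_def cong: map_cong)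
  moreover have "forest_sum_ratio G {} (map (tail G) (map ?f bs) @ [\<phi> x]) = forest_sum_ratio G {} (map (tail G) bs @ [x])"
    using forest_sum_ratio_aut[OF A S, of "{}"] unfolding tl by simp
  ultimately show "path_prob_inf G (map ?f bs) (\<phi> x) = path_prob_inf G bs x"
    unfolding path_prob_inf_def ps(1) escape_inf_aut[OF A x ps(2)] by simp
qed

text \<open>
  The expected number of vertices in generation \<open>n\<close> of the past of \<open>x\<close>, in the limit of large wired
  networks.
\<close>

definition past_mass :: "nat \<Rightarrow> 'v \<Rightarrow> real" where
  "past_mass n x = (\<Sum>bs\<in>paths_to G n x. path_prob_inf G bs x)"

text \<open>
  An automorphism maps the paths into \<open>x\<close> injectively to paths into \<open>\<phi> x\<close>. The
  inverse automorphism would give equality.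
\<close>

lemma past_mass_aut:
  assumes tr: "transient G" and A: "automorphism G \<phi> \<psi>"
  shows "past_mass n x \<le> past_mass n (\<phi> x)"
proof -
  let ?f = "map (arc_map G \<phi> \<psi>)"
  have im: "?f ` paths_to G n x \<subseteq> paths_to G n (\<phi> x)"
    using path_aut(1)[OF A] aut_verts(1)[OF A] by (fastforce simp: paths_to_def)
  have inj: "inj_on ?f (paths_to G n x)"
  proof (rule inj_onI)
    fix bs cs assume bc: "bs \<in> paths_to G n x" "cs \<in> paths_to G n x" "?f bs = ?f cs"
    have w: "walk G v ds y \<Longrightarrow> set ds \<subseteq> oriented_edges G" for v ds y
      by (induction ds arbitrary: v) (auto simp: out_arcs_def)
    have wo: "set ds \<subseteq> oriented_edges G" if "ds \<in> paths_to G n x" for ds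
      using that w unfolding paths_to_def self_avoiding_def by blast
    have "set bs \<subseteq> oriented_edges G" "set cs \<subseteq> oriented_edges G" using wo[OF bc(1)] wo[OF bc(2)] .
    then have "inj_on (arc_map G \<phi> \<psi>) (set bs \<union> set cs)" by (intro inj_on_subset[OF arc_map_inj[OF A]]) auto
    then show "bs = cs" using bc(3) by (metis map_injective inj_on_map_eq_map)
  qed
  have "past_mass n x = (\<Sum>bs\<in>paths_to G n x. path_prob_inf G (?f bs) (\<phi> x))"
    unfolding past_mass_def
  proof (intro sum.cong refl)
    fix bs assume "bs \<in> paths_to G n x"
    then obtain u where "self_avoiding G u bs x" "u \<in> verts G" by (auto simp: paths_to_def)
    then show "path_prob_inf G bs x = path_prob_inf G (?f bs) (\<phi> x)" using path_aut(2)[OF A] by simp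
  qed
  also have "\<dots> = (\<Sum>bs\<in>?f ` paths_to G n x. path_prob_inf G bs (\<phi> x))" by (simp add: sum.reindex[OF inj])
  also have "\<dots> \<le> past_mass n (\<phi> x)"
    unfolding past_mass_def using im finite_paths_to path_prob_inf_nonneg[OF tr] by (intro sum_mono2) (auto simp: paths_to_def)
  finally show ?thesis .
qed

lemma past_mass_limit:
  assumes tr: "transient G"
  shows "((\<lambda>W. \<Sum>bs\<in>paths_to G n x. tree_prob (wired G W) None (\<lambda>t. follows (wired G W) t bs)) \<longlongrightarrow> past_mass n x) FW"
  unfolding past_mass_def
proof (rule tendsto_sum)
  fix bs assume "bs \<in> paths_to G n x"
  then obtain u where "self_avoiding G u bs x" "u \<in> verts G" by (auto simp: paths_to_def)
  then show "((\<lambda>W. tree_prob (wired G W) None (\<lambda>t. follows (wired G W) t bs)) \<longlongrightarrow> path_prob_inf G bs x) FW"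
    by (rule path_prob_limit[OF tr])
qed

lemma past_mass_nonneg: "transient G \<Longrightarrow> 0 \<le> past_mass n x"
  unfolding past_mass_def using path_prob_inf_nonneg by (intro sum_nonneg) (auto simp: paths_to_def)

lemma past_mass_sum:
  assumes tr: "transient G" and K: "finite K" "K \<subseteq> verts G" and n: "0 < n"
  shows "(\<Sum>x\<in>K. past_mass n x) \<le> real (card (ball_set G n K))"
proof (rule tendsto_upperbound[OF _ _ FW_not_bot])
  show "((\<lambda>W. \<Sum>x\<in>K. \<Sum>bs\<in>paths_to G n x. tree_prob (wired G W) None (\<lambda>t. follows (wired G W) t bs)) \<longlongrightarrow> (\<Sum>x\<in>K. past_mass n x)) FW"
    by (intro tendsto_sum past_mass_limit tr)
  show "eventually (\<lambda>W. (\<Sum>x\<in>K. \<Sum>bs\<in>paths_to G n x. tree_prob (wired G W) None (\<lambda>t. follows (wired G W) t bs)) \<le> real (card (ball_set G n K))) FW"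
  proof (rule eventually_FW[of "ball_set G n K"])
    fix W assume W: "finite W" "W \<subseteq> verts G" "W \<noteq> {}" "ball_set G n K \<subseteq> W"
    interpret wired_net G W using W by unfold_locales
    show "(\<Sum>x\<in>K. \<Sum>bs\<in>paths_to G n x. tree_prob N None (\<lambda>t. follows N t bs)) \<le> real (card (ball_set G n K))"
      by (rule mass_bound[OF K W(4) n])
  qed (use finite_ball[OF K(1)] ball_in[OF K(2)] in auto)
qed

lemma amenable_small_boundary:
  assumes "\<not> non_amenable G" "0 < \<delta>"
  shows "\<exists>K. finite K \<and> K \<subseteq> verts G \<and> K \<noteq> {} \<and> (\<Sum>e\<in>edge_boundary G K. cond G e) \<le> \<delta> * net_pi G K"
proof -
  have "(INF t\<in>{0<..}. kappa G t / ereal t) < ereal \<delta>"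
    using assms unfolding non_amenable_def by (metis ereal_less(2) not_le order_le_less_trans)
  then obtain t where t: "0 < t" "kappa G t / ereal t < ereal \<delta>" by (auto simp: INF_less_iff)
  have "kappa G t < ereal (\<delta> * t)"
  proof -
    have "kappa G t / ereal t * ereal t < ereal \<delta> * ereal t" using t by (intro ereal_mult_strict_right_mono) auto
    moreover have "kappa G t / ereal t * ereal t = kappa G t" using t(1) by (cases "kappa G t") auto
    ultimately show ?thesis by simp
  qed
  then obtain K where K: "K \<subseteq> verts G" "finite K" "net_connected (induced G K)" "t \<le> net_pi G K" "(\<Sum>e\<in>edge_boundary G K. cond G e) < \<delta> * t"
    unfolding kappa_def Inf_less_iff by auto
  have "K \<noteq> {}" using K(3) by (auto simp: net_connected_def induced_def)
  moreover have "\<delta> * t \<le> \<delta> * net_pi G K" using K(4) assms(2) by simp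
  ultimately show ?thesis using K by (intro exI[of _ K]) auto
qed

text \<open>
  On the way from \<open>K\<close> to \<open>y\<close> the boundary of \<open>K\<close> is crossed.
\<close>

lemma ball_outside: "y \<in> ball_set G n K \<Longrightarrow> y \<notin> K \<Longrightarrow> \<exists>e\<in>edge_boundary G K. \<exists>w\<in>ends G e. y \<in> ball_set G n {w}"
proof (induction n arbitrary: y)
  case 0 then show ?case by (simp add: ball_set_def)
next
  case (Suc n)
  show ?case
  proof (cases "y \<in> ball_set G n K")
    case True
    then show ?thesis using Suc ball_Suc_mono by blast
  next
    case False
    then obtain z a where z: "z \<in> ball_set G n K" "a \<in> out_arcs G z" "head G a = y"
      using Suc.prems(1) by (auto simp: ball_set_def nbh_def)
    show ?thesis
    proof (cases "z \<in> K")
      case True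
      then have "fst a \<in> edge_boundary G K" "y \<in> ends G (fst a)"
        using z Suc.prems(2) ends_fst[of G a] out_arcsD(3)[OF z(2)] by (auto simp: edge_boundary_def out_arcs_def)
      moreover have "y \<in> ball_set G (Suc n) {y}" using ball_mono[of 0 "Suc n" "{y}"] by (auto simp: ball_set_def)
      ultimately show ?thesis by blast
    next
      case zK: False
      then show ?thesis using Suc.IH[OF z(1) zK] ball_step[OF _ z(2)] z(3) by blast
    qed
  qed
qed

end

context qt_net
begin

lemma cond_lower: "\<exists>c>0. \<forall>e\<in>edges G. c \<le> cond G e"
proof -
  let ?C = "\<Union>z\<in>reps. (\<lambda>a. cond G (fst a)) ` out_arcs G z"
  have fin: "finite ?C" using reps by auto
  have mem: "cond G e \<in> ?C" if e: "e \<in> edges G" for e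
  proof -
    let ?a = "(e, True)"
    have a: "?a \<in> out_arcs G (src G e)" using e by (simp add: out_arcs_def oriented_edges_def tail_def)
    have "src G e \<in> verts G" using e network by (auto simp: is_network_def)
    then obtain z \<phi> \<psi> where z: "z \<in> reps" "automorphism G \<phi> \<psi>" "\<phi> z = src G e" using reps(4) by blast
    then have "out_arcs G (src G e) = arc_map G \<phi> \<psi> ` out_arcs G z" using out_arcs_aut[OF z(2), of z] reps(2) by auto
    then obtain b where b: "b \<in> out_arcs G z" "?a = arc_map G \<phi> \<psi> b" using a by blast
    have "cond G e = cond G (fst b)" using arc_map(4)[OF z(2) out_arcsD(2)[OF b(1)]] b(2) by (metis fst_conv)
    then show ?thesis using z b by auto
  qed
  show ?thesis
  proof (cases "?C = {}")
    case True
    then have "edges G = {}" using mem by blast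
    then show ?thesis by (intro exI[of _ 1]) simp
  next
    case False
    have "Min ?C \<in> ?C" by (rule Min_in[OF fin False])
    then have "0 < Min ?C" using cond_pos by auto
    then show ?thesis using mem fin by (intro exI[of _ "Min ?C"]) auto
  qed
qed

text \<open>
  Conductances are bounded below and \<open>\<pi>\<close> is bounded above, so \<open>K\<close> with small relative boundary also has
  few boundary edges per vertex; each of them accounts for boundedly many vertices near \<open>K\<close>.
\<close>

lemma folner:
  assumes na: "\<not> non_amenable G"
  shows "\<exists>K. finite K \<and> K \<subseteq> verts G \<and> K \<noteq> {} \<and> card (ball_set G n K) \<le> 2 * card K"
proof -
  obtain c where c: "0 < c" "\<And>e. e \<in> edges G \<Longrightarrow> c \<le> cond G e" using cond_lower by blast
  obtain p q where q: "0 < p" "\<And>x. x \<in> verts G \<Longrightarrow> p \<le> net_pi G {x} \<and> net_pi G {x} \<le> q" using pi_bounds by blast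
  obtain b where b: "\<And>x. x \<in> verts G \<Longrightarrow> card (ball_set G n {x}) \<le> b" using ball_bound by blast
  have q0: "0 < q"
  proof -
    obtain x where "x \<in> verts G" using conn by (auto simp: net_connected_def)
    then show ?thesis using q(1) q(2)[of x] by linarith
  qed
  (* Chosen so that the \<open>n\<close>-balls at the ends of the boundary edges contain at most \<open>card K\<close> vertices. *)
  define \<delta> where "\<delta> = c / (2 * q * (real b + 1))"
  have \<delta>: "0 < \<delta>" using c q0 by (auto simp: \<delta>_def intro!: divide_pos_pos mult_pos_pos)
  obtain K where K: "finite K" "K \<subseteq> verts G" "K \<noteq> {}" "(\<Sum>e\<in>edge_boundary G K. cond G e) \<le> \<delta> * net_pi G K"
    using amenable_small_boundary[OF na \<delta>] by blast
  let ?D = "edge_boundary G K"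
  have fD: "finite ?D" by (rule finite_subset[OF _ finite_edges_at[OF K(1,2)]]) (auto simp: edge_boundary_def)
  have "c * real (card ?D) \<le> (\<Sum>e\<in>?D. cond G e)"
    using sum_mono[of ?D "\<lambda>_. c" "cond G"] c(2) by (auto simp: edge_boundary_def mult.commute)
  also have "\<dots> \<le> \<delta> * net_pi G K" by (rule K(4))
  also have "net_pi G K \<le> q * real (card K)"
    using sum_mono[of K "\<lambda>x. net_pi G {x}" "\<lambda>_. q"] q(2) K(2) by (auto simp: net_pi_sum[OF K(1)] mult.commute)
  then have "\<delta> * net_pi G K \<le> \<delta> * (q * real (card K))" using \<delta> by (intro mult_left_mono) auto
  also have "\<delta> * (q * real (card K)) = c * (real (card K) / (2 * (real b + 1)))" 
  proof -
    have "q * (real b + 1) \<noteq> 0" using q0 by (simp add: add_nonneg_eq_0_iff)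
    then show ?thesis using q0 by (simp add: \<delta>_def)
  qed
  finally have "real (card ?D) \<le> real (card K) / (2 * (real b + 1))"
    by (simp only: mult_le_cancel_left_pos[OF c(1)])
  then have D: "real (card ?D) * (2 * (real b + 1)) \<le> real (card K)" by (simp add: pos_le_divide_eq)
  have "ball_set G n K \<subseteq> K \<union> (\<Union>e\<in>?D. \<Union>w\<in>ends G e. ball_set G n {w})" using ball_outside by blast
  moreover have eV: "ends G e \<subseteq> verts G" "finite (ends G e)" "card (ends G e) \<le> 2" if "e \<in> ?D" for e
    using that network card_insert_le_m1[of 2 "{dst G e}" "src G e"] by (auto simp: edge_boundary_def is_network_def ends_def card_insert_if)
  ultimately have "card (ball_set G n K) \<le> card K + card (\<Union>e\<in>?D. \<Union>w\<in>ends G e. ball_set G n {w})"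
    using K(1) fD finite_ball by (intro order_trans[OF card_mono card_Un_le]) auto
  also have "card (\<Union>e\<in>?D. \<Union>w\<in>ends G e. ball_set G n {w}) \<le> (\<Sum>e\<in>?D. card (\<Union>w\<in>ends G e. ball_set G n {w}))"
    by (rule card_UN_le[OF fD])
  also have "\<dots> \<le> (\<Sum>e\<in>?D. 2 * b)"
  proof (rule sum_mono)
    fix e assume e: "e \<in> ?D"
    have "card (\<Union>w\<in>ends G e. ball_set G n {w}) \<le> (\<Sum>w\<in>ends G e. card (ball_set G n {w}))" by (rule card_UN_le[OF eV(2)[OF e]])
    also have "\<dots> \<le> (\<Sum>w\<in>ends G e. b)" using eV(1)[OF e] b by (intro sum_mono) auto
    also have "\<dots> \<le> 2 * b" using eV(3)[OF e] by simp
    finally show "card (\<Union>w\<in>ends G e. ball_set G n {w}) \<le> 2 * b" .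
  qed
  finally have "card (ball_set G n K) \<le> card K + card ?D * (2 * b)" by simp
  then have "real (card (ball_set G n K)) \<le> real (card K + card ?D * (2 * b))" by (simp only: of_nat_le_iff)
  also have "\<dots> = real (card K) + real (card ?D) * (2 * real b)" by simp
  also have "real (card ?D) * (2 * real b) \<le> real (card ?D) * (2 * (real b + 1))" by (intro mult_left_mono) auto
  finally have "real (card (ball_set G n K)) \<le> 2 * real (card K)" using D by linarith
  then have "card (ball_set G n K) \<le> 2 * card K" by linarith
  then show ?thesis using K by blast
qed

text \<open>
  Each point of \<open>K\<close> is within distance \<open>D\<close> of an image of \<open>v\<close>, so that the images of \<open>v\<close> near \<open>K\<close> make up
  a fixed proportion of \<open>K\<close>. The total mass received near \<open>K\<close> is at most the number of vertices that can
  send it, at most \<open>2 |K|\<close>.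
\<close>

lemma past_mass_bounded:
  assumes na: "\<not> non_amenable G" and v: "v \<in> verts G"
  shows "\<exists>C. \<forall>n>0. past_mass n v \<le> C"
proof -
  have "\<exists>D. v \<in> ball_set G D {z}" if z: "z \<in> verts G" for z
  proof -
    have "(v, z) \<in> (adjacency G)\<^sup>*" using conn v z by (auto simp: net_connected_def)
    from walk_of_rtrancl[OF this] obtain bs where "walk G v bs z" by blast
    from walk_in_ball[OF this] show ?thesis by blast
  qed
  then obtain d where d: "\<And>z. z \<in> verts G \<Longrightarrow> v \<in> ball_set G (d z) {z}" by metis
  define D where "D = Max (d ` reps)"
  have vD: "v \<in> ball_set G D {z}" if "z \<in> reps" for z
    using d[of z] reps(1,2) that ball_mono[of "d z" D "{z}"] by (auto simp: D_def)
  obtain b where b: "\<And>x. x \<in> verts G \<Longrightarrow> card (ball_set G D {x}) \<le> b" using ball_bound by blast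
  have "past_mass n v \<le> 2 * real b" if n: "0 < n" for n
  proof -
    obtain K where K: "finite K" "K \<subseteq> verts G" "K \<noteq> {}" "card (ball_set G (n + D) K) \<le> 2 * card K"
      using folner[OF na] by blast
    let ?K = "ball_set G D K"
    have fK: "finite ?K" "?K \<subseteq> verts G" using finite_ball[OF K(1)] ball_in[OF K(2)] by auto
    (* In particular the images of \<open>v\<close> that are near \<open>K\<close>, see \<open>past_mass_aut\<close>. *)
    define V where "V = {y \<in> ?K. past_mass n v \<le> past_mass n y}"
    have fV: "finite V" "V \<subseteq> ?K" using fK by (auto simp: V_def)
    have "K \<subseteq> (\<Union>y\<in>V. ball_set G D {y})"
    proof
      fix x assume x: "x \<in> K"
      then obtain z \<phi> \<psi> where z: "z \<in> reps" "automorphism G \<phi> \<psi>" "\<phi> z = x" using reps(4) K(2) by blast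
      have "\<phi> v \<in> \<phi> ` ball_set G D {z}" using vD[OF z(1)] by blast
      then have y: "\<phi> v \<in> ball_set G D {x}" using ball_aut[OF z(2), of "{z}" D] reps(2) z by auto
      then have "\<phi> v \<in> V" using past_mass_aut[OF tr z(2)] ball_mono2[of "{x}" K D] x by (auto simp: V_def)
      moreover have "x \<in> ball_set G D {\<phi> v}"
      proof (rule ccontr)
        have sym: "y \<in> ball_set G k {x} \<Longrightarrow> x \<in> ball_set G k {y}" for k x y
        proof (induction k arbitrary: y)
          case 0 then show ?case by (auto simp: ball_set_def)
        next
          case (Suc k)
          then consider "y \<in> ball_set G k {x}" | w a where "w \<in> ball_set G k {x}" "a \<in> out_arcs G w" "head G a = y"
            by (auto simp: ball_set_def nbh_def)
          then show ?case
          proof cases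
            case 1 then show ?thesis using Suc.IH ball_Suc_mono by blast
          next
            case 2
            then have "rev_arc a \<in> out_arcs G y" "head G (rev_arc a) = w" by (auto simp: out_arcs_def)
            then have "ball_set G k {w} \<subseteq> ball_set G (Suc k) {y}" using ball_head by metis
            then show ?thesis using Suc.IH[OF 2(1)] by blast
          qed
        qed
        assume "x \<notin> ball_set G D {\<phi> v}" then show False using sym[OF y] by blast
      qed
      ultimately show "x \<in> (\<Union>y\<in>V. ball_set G D {y})" by blast
    qed
    then have "card K \<le> card (\<Union>y\<in>V. ball_set G D {y})" using fV finite_ball by (intro card_mono) auto
    also have "\<dots> \<le> (\<Sum>y\<in>V. card (ball_set G D {y}))" by (rule card_UN_le[OF fV(1)])
    also have "\<dots> \<le> (\<Sum>y\<in>V. b)" using fV fK b by (intro sum_mono) auto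
    also have "\<dots> = card V * b" by simp
    finally have cK: "real (card K) \<le> real (card V) * real b" unfolding of_nat_mult[symmetric] of_nat_le_iff .
    have "0 < card K" using K by (simp add: card_gt_0_iff)
    then have V0: "0 < real (card V)" using cK by (cases "card V") auto
    have "real (card V) * past_mass n v = (\<Sum>y\<in>V. past_mass n v)" by simp
    also have "\<dots> \<le> (\<Sum>y\<in>V. past_mass n y)" by (rule sum_mono) (simp add: V_def)
    also have "\<dots> \<le> (\<Sum>y\<in>?K. past_mass n y)" using fK fV past_mass_nonneg[OF tr] by (intro sum_mono2) auto
    also have "\<dots> \<le> real (card (ball_set G n ?K))" by (rule past_mass_sum[OF tr fK n])
    also have "\<dots> \<le> 2 * real (card K)" using K(4) unfolding ball_add by linarith
    also have "\<dots> \<le> real (card V) * (2 * real b)" using cK by simp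
    finally show ?thesis using V0 by (simp only: mult_le_cancel_left_pos)
  qed
  then show ?thesis by blast
qed

text \<open>
  The number of paths into \<open>x\<close> of length \<open>n\<close> stays bounded, while their capacities tend to infinity.
\<close>

theorem thin_pasts_amenable:
  assumes na: "\<not> non_amenable G"
  shows thin_pasts
  unfolding thin_pasts_def
proof (intro ballI allI impI)
  fix x \<epsilon> assume x: "x \<in> verts G" and \<epsilon>: "0 < (\<epsilon>::real)"
  have p: "0 < net_pi G {x}" by (rule pi_pos[OF x])
  define s where "s = \<epsilon> / (4 * net_pi G {x})"
  have s: "0 < s" "2 * s * net_pi G {x} = \<epsilon> / 2" using p \<epsilon> by (auto simp: s_def)
  obtain C where C: "\<And>n. 0 < n \<Longrightarrow> past_mass n x \<le> C" using past_mass_bounded[OF na x] by blast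
  have C0: "0 \<le> C" using C[of 1] past_mass_nonneg[OF tr, of 1 x] by simp
  have "((\<lambda>k. (C + 1) * exp (- s * k)) \<longlongrightarrow> (C + 1) * 0) at_top"
    by (intro tendsto_mult_left filterlim_compose[OF exp_at_bot] filterlim_tendsto_neg_mult_at_bot[OF tendsto_const] filterlim_ident)
      (use s(1) in auto)
  then have "eventually (\<lambda>k. (C + 1) * exp (- s * k) < \<epsilon> / 2) at_top"
    using \<epsilon> by (intro order_tendstoD(2)[of _ "(C + 1) * 0"]) auto
  moreover have "eventually (\<lambda>k. 1 / s \<le> k) at_top" by (rule eventually_ge_at_top)
  ultimately obtain k where k: "(C + 1) * exp (- s * k) < \<epsilon> / 2" "1 / s \<le> k"
    using eventually_conj eventually_happens by (metis (no_types, lifting) trivial_limit_at_top_linorder)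
  obtain m where m: "\<And>W A. finite W \<Longrightarrow> W \<subseteq> verts G \<Longrightarrow> W \<noteq> {} \<Longrightarrow> A \<subseteq> W \<Longrightarrow> m \<le> card A \<Longrightarrow> k \<le> capacity (wired G W) None (Some ` A)"
    using capacity_unbounded by blast
  define n where "n = Suc m"
  have n: "0 < n" "m \<le> n" by (auto simp: n_def)
  have "eventually (\<lambda>W. (\<Sum>bs\<in>paths_to G n x. tree_prob (wired G W) None (\<lambda>t. follows (wired G W) t bs)) < C + 1) FW"
    by (rule order_tendstoD(2)[OF past_mass_limit[OF tr]]) (use C[OF n(1)] in simp)
  then obtain W1 where W1: "finite W1" "W1 \<subseteq> verts G" "\<And>W. finite W \<Longrightarrow> W1 \<subseteq> W \<Longrightarrow> W \<subseteq> verts G \<Longrightarrow>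
      (\<Sum>bs\<in>paths_to G n x. tree_prob (wired G W) None (\<lambda>t. follows (wired G W) t bs)) < C + 1"
    unfolding eventually_finite_subsets_at_top by auto
  obtain W0 where W0: "finite W0" "W1 \<union> ball_set G n {x} \<subseteq> W0" "W0 \<subseteq> verts G" "m \<le> card W0"
    using large_finite_superset[of "W1 \<union> ball_set G n {x}" m] W1 finite_ball[of "{x}"] ball_in[of "{x}"] x by auto
  have main: "tree_prob (wired G W) None (\<lambda>t. \<exists>bs\<in>paths_to G n x. follows (wired G W) t bs) \<le> \<epsilon>"
    if W: "finite W" "W \<subseteq> verts G" "W0 \<subseteq> W" "W \<noteq> {}" for W
  proof -
    interpret wired_net G W using W by unfold_locales
    have bW: "ball_set G n {x} \<subseteq> W" using W0 W by auto
    have xW: "x \<in> W" using bW ball_mono[of 0 n "{x}"] by (auto simp: ball_set_def)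
    have inW: "path_verts G bs x \<subseteq> W" if "bs \<in> paths_to G n x" for bs using paths_to_in_ball[OF that] bW by blast
    have "m \<le> card W" using W0(4) card_mono[OF W(1,3)] by simp
    then have "k \<le> capacity N None (Some ` W)" using W by (intro m) auto
    also have "\<dots> \<le> net_pi N {None}" by (rule w.capacity_le_pi) (auto simp: verts_N)
    finally have "1 / s \<le> net_pi N {None}" using k(2) by simp
    then have "1 \<le> s * net_pi N {None}" using s(1) by (simp add: pos_divide_le_eq mult.commute)
    then have "tree_prob N None (\<lambda>t. \<exists>bs\<in>paths_to G n x. follows N t bs) \<le> 2 * s * net_pi G {x} +
      (\<Sum>bs\<in>paths_to G n x. tree_prob N None (\<lambda>t. follows N t bs) * exp (- s * capacity N None (Some ` path_verts G bs x)))"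
      using inW by (intro thinning_limit_form xW s(1) finite_paths_to) (auto simp: paths_to_def)
    also have "(\<Sum>bs\<in>paths_to G n x. tree_prob N None (\<lambda>t. follows N t bs) * exp (- s * capacity N None (Some ` path_verts G bs x)))
       \<le> (\<Sum>bs\<in>paths_to G n x. tree_prob N None (\<lambda>t. follows N t bs) * exp (- s * k))"
    proof (intro sum_mono mult_left_mono w.tree_prob_nonneg)
      fix bs assume bs: "bs \<in> paths_to G n x"
      then have "card (path_verts G bs x) = Suc n" using card_path_verts by (auto simp: paths_to_def)
      then have "k \<le> capacity N None (Some ` path_verts G bs x)" using W inW[OF bs] n by (intro m) auto
      then show "exp (- s * capacity N None (Some ` path_verts G bs x)) \<le> exp (- s * k)" using s(1) by simp
    qed
    also have "\<dots> = (\<Sum>bs\<in>paths_to G n x. tree_prob N None (\<lambda>t. follows N t bs)) * exp (- s * k)"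
      by (simp add: sum_distrib_right)
    also have "\<dots> \<le> (C + 1) * exp (- s * k)"
      using W1(3)[of W] W W0 by (intro mult_right_mono) (auto intro: less_imp_le)
    finally show ?thesis using k(1) s(2) by linarith
  qed
  show "\<exists>n W0. finite W0 \<and> W0 \<subseteq> verts G \<and>
     (\<forall>W. finite W \<longrightarrow> W \<subseteq> verts G \<longrightarrow> W0 \<subseteq> W \<longrightarrow> W \<noteq> {} \<longrightarrow>
        tree_prob (wired G W) None (\<lambda>t. \<exists>bs\<in>paths_to G n x. follows (wired G W) t bs) \<le> \<epsilon>)"
    using W0 main by blast
qed

theorem thin_pasts_qt: thin_pasts
proof (cases "non_amenable G")
  case True
  obtain p q where "0 < p" "\<And>x. x \<in> verts G \<Longrightarrow> p \<le> net_pi G {x} \<and> net_pi G {x} \<le> q" using pi_bounds by blast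
  then show ?thesis using thin_pasts_non_amenable[OF True, of p] by auto
qed (rule thin_pasts_amenable)

end

section \<open>One end\<close>

theorem theorem7p4:
  fixes G :: "('v, 'e) network" and \<mu> :: "'e set measure"
  assumes "is_network G" and "infinite (verts G)" and "net_connected G" and "locally_finite G"
    and "(transient G \<and> quasi_transitive G) \<or>
         (non_amenable G \<and> 0 < (INF x\<in>verts G. net_pi G {x}))"
    and "is_WSF G \<mu>"
  shows "AE F in \<mu>. \<forall>T\<in>net_components (G\<lparr>edges := F\<rparr>). card (tree_ends T) = 1"
proof -
  interpret inf_net G using assms(1-4) by unfold_locales
  have thin_pasts
    using assms(5)
  proof
    assume A: "transient G \<and> quasi_transitive G"
    interpret qt_net G using A by unfold_locales auto
    show thin_pasts by (rule thin_pasts_qt)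
  next
    assume A: "non_amenable G \<and> 0 < (INF x\<in>verts G. net_pi G {x})"
    have "bdd_below ((\<lambda>x. net_pi G {x}) ` verts G)"
      by (rule bdd_belowI[of _ 0]) (auto intro: less_imp_le[OF pi_pos])
    then have "(INF x\<in>verts G. net_pi G {x}) \<le> net_pi G {x}" if "x \<in> verts G" for x
      using that by (rule cINF_lower)
    then show thin_pasts using A by (intro thin_pasts_non_amenable[of "INF x\<in>verts G. net_pi G {x}"]) auto
  qed
  then show ?thesis by (rule one_end_of_thin_pasts[OF assms(6)])
qed

end
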